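(* Let $p\in(2,\infty)$, $s>\frac{2}{p}$, $\delta:=\min\left(s-\frac{2}{p},\frac{1}{p}\right)>0$ and $\alpha\in\left(0,\frac{\delta}{2+\delta}\right]$. There is a constant $C$ such that for every function $F\in\mathrm{BMO}(\mathbb{R}^2)\cap W^{s,p}(\mathbb{R}^2)$ the following hold. (i) For every unit vector $v\in\mathbb{R}^2$, $$\|H_v(F)\|_{\mathrm{BMO}(\mathbb{R}^2)}\le C\,\|F\|_{\mathrm{BMO}(\mathbb{R}^2)}^{\alpha^2}\,\|F\|_{W^{s,p}(\mathbb{R}^2)}^{1-\alpha^2}.$$ (ii) For every $\Omega\in L^1(\mathbb{S}^1)$ with $\int_{\mathbb{S}^1}\Omega(v)\,dv=0$, $$\|T_\Omega(F)\|_{\mathrm{BMO}(\mathbb{R}^2)}\le C\,\|\Omega\|_{L^1(\mathbb{S}^1)}\,\|F\|_{\mathrm{BMO}(\mathbb{R}^2)}^{\alpha^2}\,\|F\|_{W^{s,p}(\mathbb{R}^2)}^{1-\alpha^2}.$$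
   Context: For a unit vector $v\in\mathbb{R}^2$, the directional Hilbert transform is $H_v(F)(x,y)=\mathrm{p.v.}\int_{-\infty}^{\infty}F((x,y)-tv)\,\frac{dt}{t}$. For $\Omega\in L^1(\mathbb{S}^1)$ with vanishing integral, the rough homogeneous singular integral operator is $T_\Omega(F)(x,y)=\mathrm{p.v.}\int_{\mathbb{R}^2}F((x,y)-u)\,\Omega\big(\tfrac{u}{|u|}\big)\,\frac{du}{|u|^2}$. $\mathrm{BMO}(\mathbb{R}^2)$ denotes the biparameter (Chang–Fefferman, product) BMO space, defined as follows. Let $\mathbb{D}=\mathbb{D}^0=\{2^k[j,j+1): j,k\in\mathbb{Z}\}$. For $\delta_0\in\mathbb{R}$ let $\mathbb{D}^{\delta_0}=\{\delta_I+I: I\in\mathbb{D}\}$, where $\delta_I=\delta_0$ if $|I|\le 1$, $\delta_I=\delta_0+\frac13(|I|-1)$ if $|I|=2^k$ with $k>0$ even, and $\delta_I=\delta_0+\frac13(2|I|-1)$ if $|I|=2^k$ with $k>0$ odd. For an interval $I=[a,b)$ the Haar wavelet is $h_I=|I|^{-1/2}\big(\mathbf{1}_{[a,\frac{a+b}{2})}-\mathbf{1}_{[\frac{a+b}{2},b)}\big)$. For $a,b\in\{0,\delta_0\}$ and $F\in L^2_{loc}(\mathbb{R}^2)$, $$\|F\|_{\mathrm{BMO}^{a,b}(\mathbb{R}^2)}=\sup_{U}\Big(\frac{1}{|U|}\sum_{\substack{I\in\mathbb{D}^a,\ J\in\mathbb{D}^b\\ I\times J\subset U}}|\langle F,h_I\otimes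 h_J\rangle|^2\Big)^{1/2},$$ the supremum being over all (nonempty) open sets $U\subset\mathbb{R}^2$ of finite measure. A parameter $\delta_0\in(0,1/2)$ is fixed once and for all such that the product BMO space is the intersection of the four dyadic spaces: $\mathrm{BMO}(\mathbb{R}^2)=\bigcap_{a,b\in\{0,\delta_0\}}\mathrm{BMO}^{a,b}(\mathbb{R}^2)$, with $\|F\|_{\mathrm{BMO}(\mathbb{R}^2)}=\sup_{a,b\in\{0,\delta_0\}}\|F\|_{\mathrm{BMO}^{a,b}(\mathbb{R}^2)}$; this is taken as the definition. (It is a pseudo-norm.) $W^{s,p}(\mathbb{R}^2)$ is the usual $L^p$-based (possibly fractional) Sobolev space of order $s$, e.g. with norm $\|(1-\Delta)^{s/2}F\|_{L^p}$. *)

theory Defs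
  imports "HOL-Analysis.Analysis"
begin

section \<open>Lebesgue and Sobolev spaces on the plane\<close>

definition Lp_space :: "real \<Rightarrow> (real \<times> real \<Rightarrow> complex) set" where
  "Lp_space p = {F. F \<in> borel_measurable lebesgue \<and>
                    integrable lebesgue (\<lambda>z. norm (F z) powr p)}"

definition Lp_norm :: "real \<Rightarrow> (real \<times> real \<Rightarrow> complex) \<Rightarrow> real" where
  "Lp_norm p F = (LINT z|lebesgue. norm (F z) powr p) powr (1 / p)"

definition L2_loc :: "(real \<times> real \<Rightarrow> complex) set" where
  "L2_loc = {F. F \<in> borel_measurable lebesgue \<and>
                (\<forall>K. compact K \<longrightarrow> set_integrable lebesgue K (\<lambda>z. (norm (F z))\<^sup>2))}"

fun iterated_deriv ::
    "(real \<times> real) list \<Rightarrow> (real \<times> real \<Rightarrow> complex) \<Rightarrow> real \<times> real \<Rightarrow> complex" where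
  "iterated_deriv [] f = f"
| "iterated_deriv (d # ds) f = (\<lambda>z. frechet_derivative (iterated_deriv ds f) (at z) d)"

definition schwartz :: "(real \<times> real \<Rightarrow> complex) \<Rightarrow> bool" where
  "schwartz f \<longleftrightarrow> (\<forall>ds. set ds \<subseteq> Basis \<longrightarrow>
     (\<forall>z. iterated_deriv ds f differentiable at z) \<and>
     (\<forall>k::nat. bounded (range (\<lambda>z. (1 + norm z) ^ k *\<^sub>R iterated_deriv ds f z))))"

definition fourier :: "(real \<times> real \<Rightarrow> complex) \<Rightarrow> real \<times> real \<Rightarrow> complex" where
  "fourier f \<xi> = (LINT z|lebesgue. exp (- 2 * pi * \<i> * of_real (z \<bullet> \<xi>)) * f z)"

text \<open>
  With this normalisation of the Fourier transform, \<open>(1 - \<Delta>)\<^sup>s\<^sup>/\<^sup>2\<close> is the multiplier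
  \<open>(1 + 4 \<pi>\<^sup>2 \<bar>\<xi>\<bar>\<^sup>2)\<^sup>s\<^sup>/\<^sup>2\<close>. The following relation says that \<open>(1 - \<Delta>)\<^sup>s\<^sup>/\<^sup>2 F = G\<close> as tempered
  distributions: the Fourier transform of \<open>G\<close> is the multiplier times that of \<open>F\<close>, the Fourier
  transform of a tempered distribution being defined by duality.
\<close>

definition bessel_derivative ::
    "real \<Rightarrow> (real \<times> real \<Rightarrow> complex) \<Rightarrow> (real \<times> real \<Rightarrow> complex) \<Rightarrow> bool" where
  "bessel_derivative s F G \<longleftrightarrow> (\<forall>\<phi>. schwartz \<phi> \<longrightarrow>
     (LINT z|lebesgue. F z *
        fourier (\<lambda>\<xi>. of_real ((1 + 4 * pi\<^sup>2 * (norm \<xi>)\<^sup>2) powr (s / 2)) * \<phi> \<xi>) z) =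
     (LINT z|lebesgue. G z * fourier \<phi> z))"

definition sobolev_space :: "real \<Rightarrow> real \<Rightarrow> (real \<times> real \<Rightarrow> complex) set" where
  "sobolev_space s p = {F \<in> Lp_space p. \<exists>G \<in> Lp_space p. bessel_derivative s F G}"

text \<open>The choice below is immaterial: \<open>G\<close> is unique up to null sets.\<close>

definition sobolev_norm :: "real \<Rightarrow> real \<Rightarrow> (real \<times> real \<Rightarrow> complex) \<Rightarrow> real" where
  "sobolev_norm s p F = Lp_norm p (SOME G. G \<in> Lp_space p \<and> bessel_derivative s F G)"


section \<open>Product BMO\<close>

definition dyadic_intervals :: "real set set" where
  "dyadic_intervals =
     {{2 powi k * of_int j ..< 2 powi k * (of_int j + 1)} | k j. True}"

definition grid_shift :: "real \<Rightarrow> real set \<Rightarrow> real" where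
  "grid_shift d I =
     (let l = measure lebesgue I in
      if l \<le> 1 then d
      else if \<exists>k::nat. even k \<and> l = 2 ^ k then d + (l - 1) / 3
      else d + (2 * l - 1) / 3)"

text \<open>
  The grid with parameter \<open>0\<close> is the standard one; the shifts are applied for \<open>d \<noteq> 0\<close> only
  (the formula for \<open>grid_shift\<close> would move the long intervals even for \<open>d = 0\<close>).
\<close>

definition dyadic_grid :: "real \<Rightarrow> real set set" where
  "dyadic_grid d =
     (if d = 0 then dyadic_intervals
      else (\<lambda>I. (+) (grid_shift d I) ` I) ` dyadic_intervals)"

definition haar :: "real set \<Rightarrow> real \<Rightarrow> real" where
  "haar I x =
     (let a = Inf I; b = Sup I in
      measure lebesgue I powr (- 1 / 2) *
      (indicator {a ..< (a + b) / 2} x - indicator {(a + b) / 2 ..< b} x))"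

definition haar_coeff :: "(real \<times> real \<Rightarrow> complex) \<Rightarrow> real set \<Rightarrow> real set \<Rightarrow> complex" where
  "haar_coeff F I J = (LINT z|lebesgue. F z * of_real (haar I (fst z) * haar J (snd z)))"

definition ennreal_sqrt :: "ennreal \<Rightarrow> ennreal" where
  "ennreal_sqrt x = (if x = \<infinity> then \<infinity> else ennreal (sqrt (enn2real x)))"

definition dyadic_bmo_norm :: "real \<Rightarrow> real \<Rightarrow> (real \<times> real \<Rightarrow> complex) \<Rightarrow> ennreal" where
  "dyadic_bmo_norm a b F =
     (SUP U \<in> {U. open U \<and> U \<noteq> {} \<and> emeasure lebesgue U < \<infinity>}.
        ennreal_sqrt
          ((\<Sum>\<^sub>\<infinity>(I, J) \<in> {(I, J). I \<in> dyadic_grid a \<and> J \<in> dyadic_grid b \<and> I \<times> J \<subseteq> U}.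
              ennreal ((norm (haar_coeff F I J))\<^sup>2)) / emeasure lebesgue U))"

definition dyadic_bmo :: "real \<Rightarrow> real \<Rightarrow> (real \<times> real \<Rightarrow> complex) set" where
  "dyadic_bmo a b = {F \<in> L2_loc. dyadic_bmo_norm a b F < \<infinity>}"

definition bmo :: "real \<Rightarrow> (real \<times> real \<Rightarrow> complex) set" where
  "bmo d = (\<Inter>a \<in> {0, d}. \<Inter>b \<in> {0, d}. dyadic_bmo a b)"

definition bmo_norm :: "real \<Rightarrow> (real \<times> real \<Rightarrow> complex) \<Rightarrow> real" where
  "bmo_norm d F = enn2real (SUP (a, b) \<in> {0, d} \<times> {0, d}. dyadic_bmo_norm a b F)"


section \<open>Principal values and singular integrals\<close>

definition pv_exists :: "('a::euclidean_space \<Rightarrow> complex) \<Rightarrow> bool" where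
  "pv_exists f \<longleftrightarrow>
     (\<forall>\<epsilon>>0. set_integrable lebesgue {u. \<epsilon> < norm u} f) \<and>
     (\<exists>l. ((\<lambda>\<epsilon>. LINT u:{u. \<epsilon> < norm u}|lebesgue. f u) \<longlongrightarrow> l) (at_right 0))"

definition pv_integral :: "('a::euclidean_space \<Rightarrow> complex) \<Rightarrow> complex" where
  "pv_integral f = Lim (at_right 0) (\<lambda>\<epsilon>. LINT u:{u. \<epsilon> < norm u}|lebesgue. f u)"

definition hilbert_integrand ::
    "real \<times> real \<Rightarrow> (real \<times> real \<Rightarrow> complex) \<Rightarrow> real \<times> real \<Rightarrow> real \<Rightarrow> complex" where
  "hilbert_integrand v F z t = F (z - t *\<^sub>R v) / of_real t"

definition hilbert ::
    "real \<times> real \<Rightarrow> (real \<times> real \<Rightarrow> complex) \<Rightarrow> real \<times> real \<Rightarrow> complex" where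
  "hilbert v F z = pv_integral (hilbert_integrand v F z)"

definition rough_integrand ::
    "(real \<times> real \<Rightarrow> complex) \<Rightarrow> (real \<times> real \<Rightarrow> complex) \<Rightarrow> real \<times> real \<Rightarrow> real \<times> real \<Rightarrow> complex"
  where
  "rough_integrand \<Omega> F z u = F (z - u) * \<Omega> (u /\<^sub>R norm u) / of_real ((norm u)\<^sup>2)"

definition rough_operator ::
    "(real \<times> real \<Rightarrow> complex) \<Rightarrow> (real \<times> real \<Rightarrow> complex) \<Rightarrow> real \<times> real \<Rightarrow> complex" where
  "rough_operator \<Omega> F z = pv_integral (rough_integrand \<Omega> F z)"

text \<open>
  Functions on the unit circle are represented by functions on the plane of which only the values
  on the circle are used; the circle carries arc length, through its unit speed parametrisation.
\<close>

definition circle_L1 :: "(real \<times> real \<Rightarrow> complex) set" where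
  "circle_L1 = {\<Omega>. set_integrable lebesgue {0..2 * pi} (\<lambda>\<theta>. \<Omega> (cos \<theta>, sin \<theta>))}"

definition circle_integral :: "(real \<times> real \<Rightarrow> complex) \<Rightarrow> complex" where
  "circle_integral \<Omega> = (LINT \<theta>:{0..2 * pi}|lebesgue. \<Omega> (cos \<theta>, sin \<theta>))"

definition circle_L1_norm :: "(real \<times> real \<Rightarrow> complex) \<Rightarrow> real" where
  "circle_L1_norm \<Omega> = (LINT \<theta>:{0..2 * pi}|lebesgue. norm (\<Omega> (cos \<theta>, sin \<theta>)))"

end

theory Submission
  imports Defs "HOL-Probability.Probability"
begin

text \<open>
  The Bessel potential representation and Gaussian subordination show that \<open>F\<close>, divided by its Sobolev
  norm, is almost everywhere equal to a bounded Hoelder continuous function \<open>g\<close> with \<open>p\<close>-integrable power.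
  The Haar coefficients over single rectangles bound the second differences of the dyadic averages of \<open>g\<close>.
  Telescoping in both variables from scale \<open>2\<^sup>-\<^sup>k\<close> to scale \<open>2\<^sup>2\<^sup>k\<close>, where the averages over the long
  rectangles are small by \<open>p\<close>-integrability and \<open>g\<close> is close to its averages over the small squares, bounds
  \<open>sup \<bar>g\<bar>\<close> by a power of the product BMO norm.

  Conversely the product BMO norm is at most the sup norm, by Bessel's inequality. So it suffices to bound the
  singular integrals of \<open>g\<close> uniformly by \<open>sqrt (sup \<bar>g\<bar>)\<close>. Both are superpositions of integrals over rays,
  which are controlled near the origin by Hoelder continuity and far away because a Hoelder continuous
  function that is \<open>p\<close>-integrable on the plane is uniformly \<open>(p + 1 / \<kappa>)\<close>-integrable on lines.
\<close>

section \<open>Haar functions and the upper bound for the product BMO norm\<close>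

text \<open>A Haar coefficient over a rectangle sees only a mixed second difference of averages, so
  a small product BMO norm says nothing about a single average. After telescoping in both variables,
  three averages over rectangles with a long side remain besides the small square. The mixed ones
  have sides \<open>2^-k\<close> and \<open>2^(2k)\<close>, hence area \<open>2^k\<close>; a far
  scale of only \<open>2^k\<close> would leave them at area 1, without any gain. The telescoped sum
  has \<open>9 k^2\<close> terms, each of the size \<open>e\<close> of the normalised coefficients,
  against errors exponentially small in \<open>k\<close>. Taking \<open>k\<close> of order
  \<open>e^(-1/4)\<close> makes everything of size \<open>sqrt e\<close>. Near the origin of a ray
  the second square root is a geometric mean of a sup bound and a Hoelder bound; far away it comes
  from Young's inequality. \<open>F\<close> is divided by \<open>2 N\<close> for any
  \<open>N\<close> strictly above its Sobolev norm, with all constants independent of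
  \<open>F\<close>; the final limit also covers vanishing norms. Since \<open>F\<close> equals its
  continuous version only almost everywhere, each operator needs its own argument that null sets do
  no harm.\<close>

lemma
  fixes f g :: "real \<Rightarrow> 'a::{real_normed_field, banach, second_countable_topology}"
  assumes f: "integrable lborel f" and g: "integrable lborel g"
  shows integrable_lborel_prod: "integrable lborel (\<lambda>z::real \<times> real. f (fst z) * g (snd z))"
    and integral_lborel_prod: "(LINT z|lborel. f (fst z) * g (snd z)) =
      (LINT x|lborel. f x) * (LINT y|lborel. g y)"
proof -
  have [measurable]: "f \<in> borel_measurable borel" "g \<in> borel_measurable borel"
    using f g by (auto dest: borel_measurable_integrable)
  have "integrable (lborel \<Otimes>\<^sub>M lborel) (\<lambda>z::real \<times> real. f (fst z) * g (snd z))"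
  proof (rule lborel_pair.Fubini_integrable)
    show "integrable lborel (\<lambda>x. LINT y|lborel. norm (f (fst (x, y)) * g (snd (x, y))))"
      using f g by (simp add: norm_mult)
  qed (use g in auto)
  then show I: "integrable lborel (\<lambda>z::real \<times> real. f (fst z) * g (snd z))"
    by (simp add: lborel_prod)
  have "(LINT z|lborel. f (fst z) * g (snd z)) =
      (LINT x|lborel. LINT y|lborel. f (fst (x, y)) * g (snd (x, y)))"
    using lborel_pair.integral_fst'[of "\<lambda>z. f (fst z) * g (snd z)"] I by (simp add: lborel_prod)
  then show "(LINT z|lborel. f (fst z) * g (snd z)) =
      (LINT x|lborel. f x) * (LINT y|lborel. g y)" by simp
qed

lemma haar_Ico:
  fixes a l :: real
  assumes "0 < l"
  shows "haar {a..<a + l} x =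
    l powr (- 1 / 2) * (indicator {a..<a + l / 2} x - indicator {a + l / 2..<a + l} x)"
proof -
  have "(a + (a + l)) / 2 = a + l / 2" by (simp add: field_simps)
  moreover have "Inf {a..<a + l} = a" "Sup {a..<a + l} = a + l" "measure lebesgue {a..<a + l} = l"
    using assms by simp_all
  ultimately show ?thesis unfolding haar_def Let_def by presburger
qed

lemma haar_Ico_borel: "0 < l \<Longrightarrow> haar {a..<a + l::real} \<in> borel_measurable borel"
  by (simp add: haar_Ico cong: measurable_cong)

lemma haar_Ico_outside: "0 < l \<Longrightarrow> x \<notin> {a..<a + l::real} \<Longrightarrow> haar {a..<a + l} x = 0"
  by (auto simp: haar_Ico indicator_def field_simps)

lemma haar_Ico_sq:
  "0 < l \<Longrightarrow> haar {a..<a + l::real} x * haar {a..<a + l} x = indicator {a..<a + l} x / l"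
  by (auto simp: haar_Ico indicator_def field_simps powr_add[symmetric] powr_minus)

lemma abs_haar_Ico: "0 < l \<Longrightarrow> \<bar>haar {a..<a + l::real} x\<bar> = l powr (- 1 / 2) * indicator {a..<a + l} x"
  by (auto simp: haar_Ico indicator_def field_simps)

lemma integrable_haar_Ico: "0 < l \<Longrightarrow> integrable lborel (haar {a..<a + l::real})"
  by (simp add: haar_Ico cong: Bochner_Integration.integrable_cong)

lemma integral_haar_Ico: "0 < l \<Longrightarrow> (LINT x|lborel. haar {a..<a + l::real} x) = 0"
  by (subst haar_Ico) auto

lemma integral_haar_Ico_sq: "0 < l \<Longrightarrow> (LINT x|lborel. haar {a..<a + l::real} x * haar {a..<a + l} x) = 1"
  by (simp add: haar_Ico_sq)

text \<open>The shift of a grid depends only on the length of the interval, hence on the generation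
  \<open>k\<close>; the function \<sigma> records it. This covers the standard and the shifted grid
  at once.\<close>

definition grid_Ico :: "(int \<Rightarrow> real) \<Rightarrow> int \<Rightarrow> int \<Rightarrow> real set" where
  "grid_Ico \<sigma> k j = {\<sigma> k + 2 powi k * of_int j ..< \<sigma> k + 2 powi k * of_int j + 2 powi k}"

text \<open>The endpoints of generation \<open>k + 1\<close> are among those of generation
  \<open>k\<close>. Orthogonality of the Haar functions rests on this property of the
  shifts.\<close>

definition nested_shift :: "(int \<Rightarrow> real) \<Rightarrow> bool" where
  "nested_shift \<sigma> \<longleftrightarrow> (\<forall>k. \<exists>i::int. \<sigma> (k + 1) = \<sigma> k + 2 powi k * of_int i)"

lemma powi_add_nat: "(2::real) powi (k + int n) = 2 powi k * 2 ^ n"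
  by (simp add: power_int_add)

lemma nested_shift_lattice:
  assumes "nested_shift \<sigma>" "k \<le> n"
  shows "\<exists>i'::int. \<sigma> n + 2 powi n * of_int i = \<sigma> k + 2 powi k * of_int i'"
  using \<open>k \<le> n\<close>
proof (induction n arbitrary: i rule: int_ge_induct)
  case base
  show ?case by blast
next
  case (step n)
  obtain j where j: "\<sigma> (n + 1) = \<sigma> n + 2 powi n * of_int j"
    using assms(1) by (auto simp: nested_shift_def)
  have "\<sigma> (n + 1) + 2 powi (n + 1) * of_int i = \<sigma> n + 2 powi n * of_int (j + 2 * i)"
    unfolding j using powi_add_nat[of n 1] by (simp add: algebra_simps)
  then show ?case using step.IH[of "j + 2 * i"] by presburger
qed

text \<open>Since \<open>i\<close> is at most \<open>j\<close> or at least \<open>j + 1\<close>, a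
  lattice point never separates two points of an interval of the same generation. It is applied to
  the three points where the Haar function of a longer interval can jump.\<close>

lemma grid_Ico_dichotomy:
  assumes "e = \<sigma> k + 2 powi k * of_int i"
  shows "(\<forall>x\<in>grid_Ico \<sigma> k j. e \<le> x) \<or> (\<forall>x\<in>grid_Ico \<sigma> k j. x < e)"
proof (cases "i \<le> j")
  case True
  then have "2 powi k * real_of_int i \<le> 2 powi k * of_int j" by (simp add: mult_left_mono)
  then have "\<forall>x\<in>grid_Ico \<sigma> k j. e \<le> x" unfolding assms grid_Ico_def
    by (meson atLeastLessThan_iff add_left_mono order_trans)
  then show ?thesis by blast
next
  case False
  then have "real_of_int (j + 1) \<le> of_int i" by linarith
  then have "2 powi k * real_of_int (j + 1) \<le> 2 powi k * of_int i" by (simp add: mult_left_mono)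
  then show ?thesis using assms by (auto simp: grid_Ico_def algebra_simps)
qed

text \<open>A Haar function jumps only at the ends and at the midpoint of its interval. All three
  lie on the endpoint lattice of generation \<open>n - 1\<close>, hence on that of generation
  \<open>k\<close>.\<close>

lemma haar_const_on_smaller:
  assumes "nested_shift \<sigma>" "k < n"
  shows "\<exists>c. \<forall>x\<in>grid_Ico \<sigma> k j. haar (grid_Ico \<sigma> n m) x = c"
proof -
  define a where "a = \<sigma> n + 2 powi n * of_int m"
  obtain j' where j': "\<sigma> n = \<sigma> (n - 1) + 2 powi (n - 1) * of_int j'"
    using assms(1) unfolding nested_shift_def by (metis diff_add_cancel)
  have p: "2 powi n = 2 * (2::real) powi (n - 1)"
    using powi_add_nat[of "n - 1" 1] by simp
  have "\<exists>i. a = \<sigma> k + 2 powi k * of_int i"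
    unfolding a_def using assms nested_shift_lattice by simp
  moreover have "\<exists>i. a + 2 powi n = \<sigma> k + 2 powi k * of_int i"
    using assms nested_shift_lattice[of \<sigma> k n "m + 1"] unfolding a_def by (simp add: algebra_simps)
  \<comment> \<open>The midpoint belongs to the lattice of generation \<open>n - 1\<close> but not
    to that of generation \<open>n\<close>; here the strict inequality \<open>k < n\<close>
    enters.\<close>
  moreover have "\<exists>i. a + 2 powi n / 2 = \<sigma> k + 2 powi k * of_int i"
  proof -
    have "a + 2 powi n / 2 = \<sigma> (n - 1) + 2 powi (n - 1) * of_int (j' + 2 * m + 1)"
      unfolding a_def j' p by (simp add: algebra_simps)
    moreover have "k \<le> n - 1" using assms by simp
    ultimately show ?thesis using nested_shift_lattice[OF assms(1)] by metis
  qed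
  ultimately have D: "\<forall>e\<in>{a, a + 2 powi n / 2, a + 2 powi n}.
      (\<forall>x\<in>grid_Ico \<sigma> k j. e \<le> x) \<or> (\<forall>x\<in>grid_Ico \<sigma> k j. x < e)"
    using grid_Ico_dichotomy by blast
  have H: "haar (grid_Ico \<sigma> n m) x = ((2::real) powi n) powr (- 1 / 2) *
      (indicator {a..<a + 2 powi n / 2} x - indicator {a + 2 powi n / 2..<a + 2 powi n} x)" for x
    unfolding grid_Ico_def a_def[symmetric] by (rule haar_Ico) simp
  define x0 where "x0 = \<sigma> k + 2 powi k * of_int j"
  have x0: "x0 \<in> grid_Ico \<sigma> k j" by (simp add: grid_Ico_def x0_def)
  have "haar (grid_Ico \<sigma> n m) x = haar (grid_Ico \<sigma> n m) x0" if x: "x \<in> grid_Ico \<sigma> k j" for x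
  proof -
    have "e \<le> x \<longleftrightarrow> e \<le> x0" if "e \<in> {a, a + 2 powi n / 2, a + 2 powi n}" for e
      using D that x x0 by (meson not_le)
    then have "a \<le> x \<longleftrightarrow> a \<le> x0" "a + 2 powi n / 2 \<le> x \<longleftrightarrow> a + 2 powi n / 2 \<le> x0"
      "a + 2 powi n \<le> x \<longleftrightarrow> a + 2 powi n \<le> x0" by auto
    then have "indicator {a..<a + 2 powi n / 2} x = (indicator {a..<a + 2 powi n / 2} x0 :: real)"
      "indicator {a + 2 powi n / 2..<a + 2 powi n} x
         = (indicator {a + 2 powi n / 2..<a + 2 powi n} x0 :: real)"
      unfolding indicator_def by auto
    then show ?thesis unfolding H by simp
  qed
  then show ?thesis by blast
qed

definition grid_of :: "(int \<Rightarrow> real) \<Rightarrow> real set set" where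
  "grid_of \<sigma> = {grid_Ico \<sigma> k j | k j. True}"

lemma grid_ofE:
  assumes "I \<in> grid_of \<sigma>"
  obtains a l where "0 < l" "I = {a..<a + l}"
proof -
  obtain k j where "I = grid_Ico \<sigma> k j" using assms unfolding grid_of_def by blast
  then show ?thesis
    using that[of "2 powi k" "\<sigma> k + 2 powi k * of_int j"] by (simp add: grid_Ico_def)
qed

lemma haar_grid_borel: "I \<in> grid_of \<sigma> \<Longrightarrow> haar I \<in> borel_measurable borel"
  by (elim grid_ofE) (simp add: haar_Ico_borel)

lemma haar_grid_outside: "I \<in> grid_of \<sigma> \<Longrightarrow> x \<notin> I \<Longrightarrow> haar I x = 0"
  using haar_Ico_outside by (elim grid_ofE) blast

lemma integral_haar_grid: "I \<in> grid_of \<sigma> \<Longrightarrow> (LINT x|lborel. haar I x) = 0"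
  using integral_haar_Ico by (elim grid_ofE) blast

lemma grid_Ico_in_grid_of [simp]: "grid_Ico \<sigma> k j \<in> grid_of \<sigma>"
  by (auto simp: grid_of_def)

text \<open>The function of the longer interval is constant on the support of the other one, whose
  integral vanishes.\<close>

lemma haar_orthogonal_lt:
  assumes "nested_shift \<sigma>" "k < n"
  shows "(LINT x|lborel. haar (grid_Ico \<sigma> k j) x * haar (grid_Ico \<sigma> n m) x) = 0"
proof -
  obtain c where c: "\<And>x. x \<in> grid_Ico \<sigma> k j \<Longrightarrow> haar (grid_Ico \<sigma> n m) x = c"
    using haar_const_on_smaller[OF assms, of j m] by meson
  have eq: "haar (grid_Ico \<sigma> k j) x * haar (grid_Ico \<sigma> n m) x = haar (grid_Ico \<sigma> k j) x * c" for x
    by (cases "x \<in> grid_Ico \<sigma> k j") (simp_all add: c haar_grid_outside[OF grid_Ico_in_grid_of])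
  have "(LINT x|lborel. haar (grid_Ico \<sigma> k j) x * c) = 0"
    by (simp add: integral_haar_grid[OF grid_Ico_in_grid_of])
  then show ?thesis by (simp only: eq)
qed

lemma haar_orthogonal:
  assumes "nested_shift \<sigma>" "I \<in> grid_of \<sigma>" "J \<in> grid_of \<sigma>" "I \<noteq> J"
  shows "(LINT x|lborel. haar I x * haar J x) = 0"
proof -
  obtain k j n m where I: "I = grid_Ico \<sigma> k j" and J: "J = grid_Ico \<sigma> n m"
    using assms unfolding grid_of_def by blast
  consider "k < n" | "n < k" | "k = n" by linarith
  then show ?thesis
  proof cases
    case 1
    then show ?thesis using haar_orthogonal_lt assms(1) I J by simp
  next
    case 2
    then show ?thesis using haar_orthogonal_lt[OF assms(1) 2, of m j] I J by (simp add: mult.commute)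
  next
    case 3
    \<comment> \<open>Distinct intervals of one generation are disjoint, so the product vanishes
      pointwise.\<close>
    have "haar I x * haar J x = 0" for x
    proof (rule ccontr)
      assume "haar I x * haar J x \<noteq> 0"
      then have xI: "x \<in> I" and xJ: "x \<in> J"
        using haar_grid_outside assms by (metis mult_not_zero)+
      have "j \<le> m"
      proof (rule ccontr)
        assume "\<not> j \<le> m"
        then have "real_of_int (m + 1) \<le> of_int j" by linarith
        then have "2 powi k * real_of_int (m + 1) \<le> 2 powi k * of_int j" by (simp add: mult_left_mono)
        then show False using xI xJ I J 3 by (auto simp: grid_Ico_def algebra_simps)
      qed
      moreover have "m \<le> j"
      proof (rule ccontr)
        assume "\<not> m \<le> j"
        then have "real_of_int (j + 1) \<le> of_int m" by linarith
        then have "2 powi k * real_of_int (j + 1) \<le> 2 powi k * of_int m" by (simp add: mult_left_mono)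
        then show False using xI xJ I J 3 by (auto simp: grid_Ico_def algebra_simps)
      qed
      ultimately show False using assms(4) I J 3 by simp
    qed
    then show ?thesis by (simp only: integral_zero)
  qed
qed

text \<open>For \<open>d \<noteq> 0\<close> the shift grows by exactly \<open>2^k\<close> from an
  even generation \<open>k \<ge> 0\<close> to the next and does not change otherwise. Both
  increments are multiples of \<open>2^k\<close>, so the grid is nested.\<close>

lemma dyadic_grid_shift:
  "\<exists>\<sigma>. nested_shift \<sigma> \<and> dyadic_grid d = grid_of \<sigma>"
proof (cases "d = 0")
  case True
  have "dyadic_grid d = grid_of (\<lambda>_. 0)"
    using True unfolding dyadic_grid_def dyadic_intervals_def grid_of_def grid_Ico_def
    by (simp add: algebra_simps)
  moreover have "nested_shift (\<lambda>_. 0)" unfolding nested_shift_def by (auto intro!: exI[of _ 0])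
  ultimately show ?thesis by blast
next
  case False
  define \<sigma> :: "int \<Rightarrow> real" where
    "\<sigma> k = (if k \<le> 0 then d else if even k then d + (2 powi k - 1) / 3 else d + (2 * 2 powi k - 1) / 3)" for k
  have "nested_shift \<sigma>"
    unfolding nested_shift_def
  proof
    fix k :: int
    have p: "2 powi (k + 1) = 2 * (2::real) powi k" using powi_add_nat[of k 1] by simp
    consider "k < 0" | "k = 0" | "k > 0" "even k" | "k > 0" "odd k" by linarith
    then show "\<exists>i::int. \<sigma> (k + 1) = \<sigma> k + 2 powi k * of_int i"
    proof cases
      case 1 then show ?thesis by (intro exI[of _ 0]) (simp add: \<sigma>_def)
    next
      case 2 then show ?thesis by (intro exI[of _ 1]) (simp add: \<sigma>_def)
    next
      case 3 then show ?thesis by (intro exI[of _ 1]) (simp add: \<sigma>_def p[unfolded add.commute[of k]] field_simps)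
    next
      case 4 then show ?thesis by (intro exI[of _ 0]) (simp add: \<sigma>_def p[unfolded add.commute[of k]] field_simps)
    qed
  qed
  moreover have gs: "grid_shift d {2 powi k * of_int j ..< 2 powi k * (of_int j + 1)} = \<sigma> k" for k j
  proof -
    have m: "measure lebesgue {2 powi k * real_of_int j ..< 2 powi k * (of_int j + 1)} = 2 powi k"
      by (simp add: algebra_simps)
    have le: "(2::real) powi k \<le> 1 \<longleftrightarrow> k \<le> 0"
    proof
      assume "k \<le> 0" then show "(2::real) powi k \<le> 1"
        using power_int_increasing[of k 0 "2::real"] by simp
    next
      assume "(2::real) powi k \<le> 1" then show "k \<le> 0"
        using power_int_strict_increasing[of 0 k "2::real"] by (cases "k \<le> 0") auto
    qed
    \<comment> \<open>\<open>grid_shift\<close> reads the parity off the length through a natural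
      exponent; injectivity of the powers of 2 identifies that exponent with the integer
      \<open>k\<close>.\<close>
    have ev: "(\<exists>n::nat. even n \<and> (2::real) powi k = 2 ^ n) \<longleftrightarrow> even k" if "k > 0"
    proof
      assume "\<exists>n::nat. even n \<and> (2::real) powi k = 2 ^ n"
      then obtain n where n: "even n" "(2::real) powi k = 2 ^ n" by blast
      have "(2::real) ^ nat k = 2 ^ n" using n that by (simp add: power_int_def)
      then have "nat k = n" by (simp add: power_inject_exp)
      then show "even k" using n that by (metis even_nat_iff less_imp_le)
    next
      assume "even k"
      then show "\<exists>n::nat. even n \<and> (2::real) powi k = 2 ^ n"
        using that by (intro exI[of _ "nat k"]) (auto simp: power_int_def even_nat_iff)
    qed
    show ?thesis
      unfolding grid_shift_def Let_def m \<sigma>_def using le ev by auto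
  qed
  have im: "(+) c ` {(2::real) powi k * of_int j ..< 2 powi k * (of_int j + 1)} =
      {c + 2 powi k * of_int j ..< c + 2 powi k * of_int j + 2 powi k}" for c k j
    by (simp add: algebra_simps)
  have "dyadic_grid d = grid_of \<sigma>"
  proof -
    have "dyadic_grid d = (\<lambda>I. (+) (grid_shift d I) ` I) `
        {{2 powi k * of_int j ..< 2 powi k * (of_int j + 1)} | k j. True}"
      using False unfolding dyadic_grid_def dyadic_intervals_def by simp
    also have "\<dots> = {(+) (grid_shift d {2 powi k * of_int j ..< 2 powi k * (of_int j + 1)}) `
        {2 powi k * of_int j ..< 2 powi k * (of_int j + 1)} | k j. True}"
      by blast
    finally show ?thesis unfolding grid_of_def grid_Ico_def gs im .
  qed
  ultimately show ?thesis by blast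
qed

lemma haar_sq_integral:
  assumes "nested_shift \<sigma>" "I \<in> grid_of \<sigma>" "J \<in> grid_of \<sigma>"
  shows "(LINT x|lborel. haar I x * haar J x) = (if I = J then 1 else 0)"
  using haar_orthogonal[OF assms] assms(2) integral_haar_Ico_sq by (auto elim!: grid_ofE)

lemma abs_haar_le:
  assumes "I \<in> grid_of \<sigma>"
  shows "\<exists>b\<ge>0. \<forall>x. \<bar>haar I x\<bar> \<le> b * indicator I x"
proof -
  obtain a l where al: "0 < l" "I = {a..<a + l}" using assms by (rule grid_ofE)
  show ?thesis by (rule exI[of _ "l powr (- 1 / 2)"]) (use al abs_haar_Ico in auto)
qed

lemma integrable_haar_mult:
  assumes "I \<in> grid_of \<sigma>" "J \<in> grid_of \<sigma>"
  shows "integrable lborel (\<lambda>x. haar I x * haar J x)"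
proof -
  obtain a l where al: "0 < l" "I = {a..<a + l}" using assms(1) by (rule grid_ofE)
  obtain b where b: "0 \<le> b" "\<And>x. \<bar>haar J x\<bar> \<le> b * indicator J x" using abs_haar_le[OF assms(2)] by meson
  have [measurable]: "haar I \<in> borel_measurable borel" "haar J \<in> borel_measurable borel"
    using assms haar_grid_borel by auto
  show ?thesis
  proof (rule Bochner_Integration.integrable_bound)
    show "integrable lborel (\<lambda>x. haar I x * b)"
      using integrable_haar_Ico al by auto
    have "\<bar>haar J x\<bar> \<le> b" for x using b(1) b(2)[of x] by (cases "x \<in> J") auto
    then show "AE x in lborel. norm (haar I x * haar J x) \<le> norm (haar I x * b)"
      using b(1) by (auto simp: abs_mult intro!: mult_left_mono)
  qed auto
qed

section \<open>Orthonormality of products of Haar functions and Bessel's inequality\<close>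

definition haar2 :: "real set \<times> real set \<Rightarrow> real \<times> real \<Rightarrow> real" where
  "haar2 R z = haar (fst R) (fst z) * haar (snd R) (snd z)"

context
  fixes \<sigma> \<tau> :: "int \<Rightarrow> real"
  assumes ns: "nested_shift \<sigma>" "nested_shift \<tau>"
begin

lemma haar2_borel [measurable]:
  assumes "R \<in> grid_of \<sigma> \<times> grid_of \<tau>"
  shows "haar2 R \<in> borel_measurable borel"
proof -
  have [measurable]: "haar (fst R) \<in> borel_measurable borel" "haar (snd R) \<in> borel_measurable borel"
    using assms haar_grid_borel by auto
  show ?thesis unfolding haar2_def[abs_def] borel_prod[symmetric] by measurable
qed

lemma haar2_bound:
  assumes "R \<in> grid_of \<sigma> \<times> grid_of \<tau>"
  shows "\<exists>b\<ge>0. \<forall>z. \<bar>haar2 R z\<bar> \<le> b * indicator (fst R \<times> snd R) z"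
proof -
  obtain b where b: "0 \<le> b" "\<And>x. \<bar>haar (fst R) x\<bar> \<le> b * indicator (fst R) x"
    using assms abs_haar_le by (metis mem_Times_iff)
  obtain c where c: "0 \<le> c" "\<And>x. \<bar>haar (snd R) x\<bar> \<le> c * indicator (snd R) x"
    using assms abs_haar_le by (metis mem_Times_iff)
  have "\<bar>haar2 R z\<bar> \<le> b * c * indicator (fst R \<times> snd R) z" for z
  proof -
    have "\<bar>haar2 R z\<bar> \<le> (b * indicator (fst R) (fst z)) * (c * indicator (snd R) (snd z))"
      unfolding haar2_def abs_mult using b c by (intro mult_mono) auto
    then show ?thesis
      by (auto simp: indicator_def mem_Times_iff split: if_splits)
  qed
  then show ?thesis using b c by (intro exI[of _ "b * c"]) auto
qed

lemma haar2_orthonormal: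
  assumes "R \<in> grid_of \<sigma> \<times> grid_of \<tau>" "R' \<in> grid_of \<sigma> \<times> grid_of \<tau>"
  shows "integrable lborel (\<lambda>z. haar2 R z * haar2 R' z)"
    and "(LINT z|lborel. haar2 R z * haar2 R' z) = (if R = R' then 1 else 0)"
proof -
  have eq: "haar2 R z * haar2 R' z = (haar (fst R) (fst z) * haar (fst R') (fst z)) *
      (haar (snd R) (snd z) * haar (snd R') (snd z))" for z
    by (simp add: haar2_def)
  have i: "integrable lborel (\<lambda>x. haar (fst R) x * haar (fst R') x)"
    "integrable lborel (\<lambda>x. haar (snd R) x * haar (snd R') x)"
    using assms integrable_haar_mult by (auto simp: mem_Times_iff)
  show "integrable lborel (\<lambda>z. haar2 R z * haar2 R' z)"
    unfolding eq by (rule integrable_lborel_prod[OF i])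
  show "(LINT z|lborel. haar2 R z * haar2 R' z) = (if R = R' then 1 else 0)"
    unfolding eq integral_lborel_prod[OF i] using assms ns
    by (auto simp: haar_sq_integral mem_Times_iff prod_eq_iff)
qed

text \<open>Pairing \<open>H\<close> with the finite Haar sum \<open>P\<close> whose coefficients are those of \<open>H\<close> yields the
  squared sum \<open>S\<close>, which is also the squared norm of \<open>P\<close>; so \<open>2 S \<le> B\<^sup>2 \<bar>U\<bar> + S\<close>.\<close>

lemma haar_coeff_bessel:
  fixes H :: "real \<times> real \<Rightarrow> complex"
  assumes H: "H \<in> borel_measurable lebesgue" "AE z in lebesgue. norm (H z) \<le> B"
    and U: "U \<in> sets lebesgue" "emeasure lebesgue U < \<infinity>"
    and T: "finite T" "\<And>R. R \<in> T \<Longrightarrow> R \<in> grid_of \<sigma> \<times> grid_of \<tau> \<and> fst R \<times> snd R \<subseteq> U"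
  shows "(\<Sum>R\<in>T. (norm (haar_coeff H (fst R) (snd R)))\<^sup>2) \<le> B\<^sup>2 * measure lebesgue U"
proof -
  define c where "c R = haar_coeff H (fst R) (snd R)" for R
  \<comment> \<open>\<open>haar_coeff\<close> involves no complex conjugation; conjugating the
    coefficients here makes the pairing of \<open>H\<close> with \<open>P\<close> equal to the real
    number \<open>S\<close>.\<close>
  define P where "P z = (\<Sum>R\<in>T. cnj (c R) * of_real (haar2 R z))" for z
  define S where "S = (\<Sum>R\<in>T. (norm (c R))\<^sup>2)"
  note [measurable] = H(1) U(1)
  have hm [measurable]: "haar2 R \<in> borel_measurable lebesgue" if "R \<in> T" for R
    using haar2_borel[of R] T(2)[OF that] by (auto intro: measurable_completion)
  have Pm [measurable]: "P \<in> borel_measurable lebesgue"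
    unfolding P_def[abs_def] by measurable
  have c_eq: "c R = (LINT z|lebesgue. H z * of_real (haar2 R z))" for R
    unfolding c_def haar_coeff_def haar2_def ..
  have Hint: "integrable lebesgue (\<lambda>z. H z * of_real (haar2 R z))" if "R \<in> T" for R
  proof -
    obtain b where b: "0 \<le> b" "\<And>z. \<bar>haar2 R z\<bar> \<le> b * indicator (fst R \<times> snd R) z"
      using haar2_bound[of R] T(2)[OF \<open>R \<in> T\<close>] by meson
    have [measurable]: "haar2 R \<in> borel_measurable lebesgue" using that by (rule hm)
    show ?thesis
    proof (rule Bochner_Integration.integrable_bound)
      show "integrable lebesgue (\<lambda>z. B * b * indicator U z :: real)"
        using U by (intro integrable_mult_right integrable_real_indicator) auto
      show "AE z in lebesgue. norm (H z * of_real (haar2 R z)) \<le> norm (B * b * indicator U z)"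
        using H(2)
      proof eventually_elim
        case (elim z)
        have "\<bar>haar2 R z\<bar> \<le> b * indicator U z"
        proof -
          have "indicator (fst R \<times> snd R) z \<le> (indicator U z :: real)"
            using T(2)[OF \<open>R \<in> T\<close>] by (intro indicator_leI) blast
          then have "b * indicator (fst R \<times> snd R) z \<le> b * indicator U z"
            using b(1) by (rule mult_left_mono)
          then show ?thesis using b(2)[of z] by linarith
        qed
        moreover have "0 \<le> B" using elim norm_ge_zero order_trans by blast
        ultimately have "norm (H z) * \<bar>haar2 R z\<bar> \<le> B * (b * indicator U z)"
          using elim by (intro mult_mono) auto
        then show ?case by (simp add: norm_mult)
      qed
    qed measurable
  qed
  have ortho: "integrable lebesgue (\<lambda>z. haar2 R z * haar2 R' z)"
    "(LINT z|lebesgue. haar2 R z * haar2 R' z) = (if R = R' then 1 else 0)"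
    if "R \<in> T" "R' \<in> T" for R R'
  proof -
    have [measurable]: "haar2 R \<in> borel_measurable borel" "haar2 R' \<in> borel_measurable borel"
      using T(2) that haar2_borel by auto
    show "integrable lebesgue (\<lambda>z. haar2 R z * haar2 R' z)"
      "(LINT z|lebesgue. haar2 R z * haar2 R' z) = (if R = R' then 1 else 0)"
      using haar2_orthonormal[of R R'] T(2) that by (auto simp: integrable_completion integral_completion)
  qed
  have HP: "integrable lebesgue (\<lambda>z. H z * P z)" "(LINT z|lebesgue. H z * P z) = of_real S"
  proof -
    have eq: "H z * P z = (\<Sum>R\<in>T. cnj (c R) * (H z * of_real (haar2 R z)))" for z
      by (simp add: P_def sum_distrib_left algebra_simps)
    show "integrable lebesgue (\<lambda>z. H z * P z)"
      unfolding eq using Hint by (intro Bochner_Integration.integrable_sum integrable_mult_right) auto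
    have "(LINT z|lebesgue. H z * P z) = (\<Sum>R\<in>T. cnj (c R) * c R)"
      unfolding eq c_eq using Hint by (subst Bochner_Integration.integral_sum) auto
    also have "\<dots> = of_real S" 
      unfolding S_def by (simp add: mult.commute complex_norm_square[symmetric] flip: of_real_power)
    finally show "(LINT z|lebesgue. H z * P z) = of_real S" .
  qed
  have PP: "integrable lebesgue (\<lambda>z. (norm (P z))\<^sup>2)" "(LINT z|lebesgue. (norm (P z))\<^sup>2) = S"
  proof -
    have eq: "(norm (P z))\<^sup>2 = (\<Sum>R\<in>T. \<Sum>R'\<in>T. Re (cnj (c R) * c R') * (haar2 R z * haar2 R' z))" for z
    proof -
      have "complex_of_real ((norm (P z))\<^sup>2) = P z * cnj (P z)"
        using complex_norm_square[of "P z"] by simp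
      also have "\<dots> = (\<Sum>R\<in>T. \<Sum>R'\<in>T. (cnj (c R) * c R') * of_real (haar2 R z * haar2 R' z))"
        unfolding P_def cnj_sum sum_product by (simp add: mult_ac)
      finally have "(norm (P z))\<^sup>2 = Re (\<Sum>R\<in>T. \<Sum>R'\<in>T. (cnj (c R) * c R') * of_real (haar2 R z * haar2 R' z))"
        by (metis Re_complex_of_real)
      then show ?thesis by (simp only: Re_sum Re_complex_of_real[symmetric] times_complex.sel complex_of_real_def complex.sel) simp
    qed
    show "integrable lebesgue (\<lambda>z. (norm (P z))\<^sup>2)"
      unfolding eq using ortho by (intro Bochner_Integration.integrable_sum integrable_mult_right) auto
    have inner: "(LINT z|lebesgue. (\<Sum>R'\<in>T. Re (cnj (c R) * c R') * (haar2 R z * haar2 R' z))) =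
        (\<Sum>R'\<in>T. Re (cnj (c R) * c R') * (if R = R' then 1 else 0))" if "R \<in> T" for R
    proof -
      have "(LINT z|lebesgue. (\<Sum>R'\<in>T. Re (cnj (c R) * c R') * (haar2 R z * haar2 R' z))) =
          (\<Sum>R'\<in>T. LINT z|lebesgue. Re (cnj (c R) * c R') * (haar2 R z * haar2 R' z))"
        by (intro Bochner_Integration.integral_sum integrable_mult_right ortho that)
      also have "\<dots> = (\<Sum>R'\<in>T. Re (cnj (c R) * c R') * (if R = R' then 1 else 0))"
        by (intro sum.cong refl) (simp only: integral_mult_right_zero ortho(2)[OF that])
      finally show ?thesis .
    qed
    have "(LINT z|lebesgue. (norm (P z))\<^sup>2) = (\<Sum>R\<in>T. LINT z|lebesgue.
        (\<Sum>R'\<in>T. Re (cnj (c R) * c R') * (haar2 R z * haar2 R' z)))"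
      unfolding eq by (intro Bochner_Integration.integral_sum Bochner_Integration.integrable_sum
          integrable_mult_right ortho)
    also have "\<dots> =
        (\<Sum>R\<in>T. \<Sum>R'\<in>T. Re (cnj (c R) * c R') * (if R = R' then 1 else 0))"
      by (intro sum.cong refl inner)
    also have "\<dots> = (\<Sum>R\<in>T. Re (cnj (c R) * c R))"
      using T(1) by (simp add: if_distrib[of "(*) _"] cong: if_cong)
    also have "\<dots> = S" unfolding S_def by (simp add: cmod_def power2_eq_square)
    finally show "(LINT z|lebesgue. (norm (P z))\<^sup>2) = S" .
  qed
  have PU: "P z = 0" if "z \<notin> U" for z
  proof -
    have "haar2 R z = 0" if "R \<in> T" for R
    proof -
      obtain b where b: "\<bar>haar2 R z\<bar> \<le> b * indicator (fst R \<times> snd R) z"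
        using haar2_bound[of R] T(2)[OF \<open>R \<in> T\<close>] by metis
      moreover have "z \<notin> fst R \<times> snd R" using T(2)[OF \<open>R \<in> T\<close>] \<open>z \<notin> U\<close> by blast
      ultimately show ?thesis by simp
    qed
    then show ?thesis by (simp add: P_def)
  qed
  have iU: "integrable lebesgue (\<lambda>z. B\<^sup>2 * indicator U z :: real)"
    using U by (intro integrable_mult_right integrable_real_indicator) auto
  have "S = norm (LINT z|lebesgue. H z * P z)"
    unfolding HP by (simp only: norm_of_real) (simp add: S_def sum_nonneg)
  also have "\<dots> \<le> (LINT z|lebesgue. norm (H z * P z))" by simp
  also have "\<dots> \<le> (LINT z|lebesgue. (B\<^sup>2 * indicator U z + (norm (P z))\<^sup>2) / 2)"
  proof (rule integral_mono_AE)
    \<comment> \<open>On \<open>U\<close> this is \<open>B * x \<le> (B^2 + x^2) / 2\<close> with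
      \<open>x = norm (P z)\<close>; outside \<open>U\<close> the sum \<open>P\<close>
      vanishes.\<close>
    show "AE z in lebesgue. norm (H z * P z) \<le> (B\<^sup>2 * indicator U z + (norm (P z))\<^sup>2) / 2"
      using H(2)
    proof eventually_elim
      case (elim z)
      show ?case
      proof (cases "z \<in> U")
        case True
        have "norm (H z) * norm (P z) \<le> B * norm (P z)" using elim by (simp add: mult_right_mono)
        moreover have "0 \<le> (B - norm (P z))\<^sup>2" by simp
        ultimately show ?thesis using True by (simp add: norm_mult power2_diff)
      qed (simp add: PU)
    qed
  qed (use HP PP iU in auto)
  also have "\<dots> = (B\<^sup>2 * measure lebesgue U + S) / 2"
    using PP iU U by simp
  finally show ?thesis unfolding S_def c_def by simp
qed

text \<open>An infinite sum of nonnegative terms is controlled by its finite partial sums, and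
  Bessel's inequality bounds these independently of the number of rectangles.\<close>

lemma dyadic_sum_le:
  fixes H :: "real \<times> real \<Rightarrow> complex"
  assumes H: "H \<in> borel_measurable lebesgue" "AE z in lebesgue. norm (H z) \<le> B"
    and U: "U \<in> sets lebesgue" "emeasure lebesgue U < \<infinity>"
  shows "(\<Sum>\<^sub>\<infinity>(I, J) \<in> {(I, J). I \<in> grid_of \<sigma> \<and> J \<in> grid_of \<tau> \<and> I \<times> J \<subseteq> U}.
              ennreal ((norm (haar_coeff H I J))\<^sup>2)) \<le> ennreal (B\<^sup>2) * emeasure lebesgue U"
proof (rule infsum_le_finite_sums)
  fix T assume T: "finite T" "T \<subseteq> {(I, J). I \<in> grid_of \<sigma> \<and> J \<in> grid_of \<tau> \<and> I \<times> J \<subseteq> U}"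
  have "(\<Sum>(I, J)\<in>T. ennreal ((norm (haar_coeff H I J))\<^sup>2)) =
      ennreal (\<Sum>R\<in>T. (norm (haar_coeff H (fst R) (snd R)))\<^sup>2)"
    by (subst sum_ennreal[symmetric]) (auto simp: case_prod_beta)
  also have "\<dots> \<le> ennreal (B\<^sup>2 * measure lebesgue U)"
    using haar_coeff_bessel[OF H U T(1)] T(2) by (intro ennreal_leI) force
  also have "\<dots> = ennreal (B\<^sup>2) * emeasure lebesgue U"
    using U by (simp add: ennreal_mult' emeasure_eq_ennreal_measure)
  finally show "(\<Sum>(I, J)\<in>T. ennreal ((norm (haar_coeff H I J))\<^sup>2)) \<le> ennreal (B\<^sup>2) * emeasure lebesgue U" .
qed (auto intro!: nonneg_summable_on_complete)

end

lemma ennreal_sqrt_le: "x \<le> ennreal (B\<^sup>2) \<Longrightarrow> 0 \<le> B \<Longrightarrow> ennreal_sqrt x \<le> ennreal B"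
proof -
  assume x: "x \<le> ennreal (B\<^sup>2)" "0 \<le> B"
  then have "x \<noteq> \<infinity>" by (auto simp: top_unique)
  moreover have "sqrt (enn2real x) \<le> B"
    using x enn2real_mono[OF x(1)] by (auto intro: real_le_lsqrt)
  ultimately show ?thesis by (simp add: ennreal_sqrt_def ennreal_leI)
qed

lemma dyadic_bmo_norm_le:
  fixes H :: "real \<times> real \<Rightarrow> complex"
  assumes H: "H \<in> borel_measurable lebesgue" "AE z in lebesgue. norm (H z) \<le> B" and B: "0 \<le> B"
  shows "dyadic_bmo_norm a b H \<le> ennreal B"
proof -
  obtain \<sigma> where s: "nested_shift \<sigma>" "dyadic_grid a = grid_of \<sigma>" using dyadic_grid_shift by blast
  obtain \<tau> where t: "nested_shift \<tau>" "dyadic_grid b = grid_of \<tau>" using dyadic_grid_shift by blast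
  show ?thesis unfolding dyadic_bmo_norm_def
  proof (rule SUP_least, rule ennreal_sqrt_le[OF _ B])
    fix U :: "(real \<times> real) set" assume "U \<in> {U. open U \<and> U \<noteq> {} \<and> emeasure lebesgue U < \<infinity>}"
    then have U: "open U" "U \<noteq> {}" "emeasure lebesgue U < \<infinity>" by auto
    then have Us: "U \<in> sets lebesgue" by auto
    \<comment> \<open>A nonempty open set has positive measure, so the measure cancels in the
      quotient.\<close>
    have pos: "emeasure lebesgue U \<noteq> 0"
      using U open_not_negligible[of U] by (auto simp: negligible_iff_emeasure0 Us)
    have "(\<Sum>\<^sub>\<infinity>(I, J) \<in> {(I, J). I \<in> dyadic_grid a \<and> J \<in> dyadic_grid b \<and> I \<times> J \<subseteq> U}.
              ennreal ((norm (haar_coeff H I J))\<^sup>2)) / emeasure lebesgue U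
        \<le> ennreal (B\<^sup>2) * emeasure lebesgue U / emeasure lebesgue U"
      unfolding s(2) t(2)
      by (intro divide_right_mono_ennreal dyadic_sum_le[OF s(1) t(1) H Us]) (use U in auto)
    also have "\<dots> = ennreal (B\<^sup>2)"
      using pos U by (simp add: ennreal_mult_divide_eq)
    finally show "(\<Sum>\<^sub>\<infinity>(I, J) \<in> {(I, J). I \<in> dyadic_grid a \<and> J \<in> dyadic_grid b \<and> I \<times> J \<subseteq> U}.
              ennreal ((norm (haar_coeff H I J))\<^sup>2)) / emeasure lebesgue U \<le> ennreal (B\<^sup>2)" .
  qed
qed

text \<open>The bound is assumed almost everywhere because the Hilbert transform of \<open>F\<close>
  is identified only up to a null set.\<close>

lemma bounded_in_bmo:
  fixes H :: "real \<times> real \<Rightarrow> complex"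
  assumes H: "H \<in> borel_measurable lebesgue" "AE z in lebesgue. norm (H z) \<le> B" and B: "0 \<le> B"
  shows "H \<in> bmo d" "bmo_norm d H \<le> B"
proof -
  have "H \<in> L2_loc" unfolding L2_loc_def
  proof (intro CollectI conjI H allI impI)
    fix K :: "(real \<times> real) set" assume K: "compact K"
    then have Km [measurable]: "K \<in> sets lebesgue" by (simp add: compact_imp_closed)
    have Kf: "emeasure lebesgue K < \<infinity>" using K fmeasurable_compact[of K] by (simp add: fmeasurable_def)
    note [measurable] = H(1)
    show "set_integrable lebesgue K (\<lambda>z. (norm (H z))\<^sup>2)" unfolding set_integrable_def
    proof (rule Bochner_Integration.integrable_bound)
      show "integrable lebesgue (\<lambda>z. B\<^sup>2 * indicator K z :: real)"
        using Kf by (intro integrable_mult_right integrable_real_indicator) auto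
      show "AE z in lebesgue. norm (indicator K z *\<^sub>R (norm (H z))\<^sup>2) \<le> norm (B\<^sup>2 * indicator K z)"
        using H(2) by eventually_elim (auto simp: indicator_def intro: power_mono)
    qed measurable
  qed
  moreover have "dyadic_bmo_norm a b H < \<infinity>" for a b
    using dyadic_bmo_norm_le[OF H B, of a b] by (simp add: order_le_less_trans)
  ultimately show "H \<in> bmo d" unfolding bmo_def dyadic_bmo_def by auto
  have "(SUP (a, b) \<in> {0, d} \<times> {0, d}. dyadic_bmo_norm a b H) \<le> ennreal B"
    using dyadic_bmo_norm_le[OF H B] by (auto intro!: SUP_least)
  then show "bmo_norm d H \<le> B"
    unfolding bmo_norm_def using enn2real_mono[of _ "ennreal B"] B by fastforce
qed

section \<open>Polar coordinates\<close>

lemma arctan_in_box_iff: "- (pi / 2) < x \<Longrightarrow> x < pi / 2 \<Longrightarrow> (l < tan x \<and> tan x < u) \<longleftrightarrow> (arctan l < x \<and> x < arctan u)"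
  by (metis arctan_less_iff arctan_tan)

lemma tan_borel [measurable]: "(tan :: real \<Rightarrow> real) \<in> borel_measurable borel"
  unfolding tan_def[abs_def] by measurable

text \<open>It suffices to compare boxes, and there the claim is the fundamental theorem of calculus
  for \<open>tan\<close> between \<open>arctan l\<close> and \<open>arctan u\<close>.\<close>

lemma lborel_eq_distr_tan:
  "lborel = distr (density lborel (\<lambda>x. ennreal (inverse ((cos x)\<^sup>2)) * indicator {- (pi / 2)<..<pi / 2} x)) borel (tan :: real \<Rightarrow> real)"
    (is "_ = distr ?D borel tan")
proof (rule lborel_eqI)
  fix l u :: real assume "\<And>b. b \<in> Basis \<Longrightarrow> l \<bullet> b \<le> u \<bullet> b"
  then have lu: "l \<le> u" by simp
  let ?a = "arctan l" and ?b = "arctan u"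
  have ab: "?a \<le> ?b" "- (pi / 2) < ?a" "?b < pi / 2" using lu arctan_lbound arctan_ubound by (auto simp: arctan_le_iff)
  have cpos: "cos x \<noteq> 0" if "?a \<le> x" "x \<le> ?b" for x
    using cos_gt_zero_pi[of x] ab that by simp
  have "emeasure (distr ?D borel tan) (box l u) = emeasure ?D (tan -` {l<..<u})"
    by (simp add: emeasure_distr box_real)
  also have "\<dots> = (\<integral>\<^sup>+x. ennreal (inverse ((cos x)\<^sup>2)) * indicator {?a..?b} x \<partial>lborel)"
  proof (subst emeasure_density)
    show "(\<integral>\<^sup>+x. ennreal (inverse ((cos x)\<^sup>2)) * indicator {- (pi / 2)<..<pi / 2} x * indicator (tan -` {l<..<u}) x \<partial>lborel)
      = (\<integral>\<^sup>+x. ennreal (inverse ((cos x)\<^sup>2)) * indicator {?a..?b} x \<partial>lborel)"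
    proof (rule nn_integral_cong_AE)
      have "AE x in lborel. x \<noteq> ?a" "AE x in lborel. x \<noteq> ?b" by (rule AE_lborel_singleton)+
      then show "AE x in lborel. ennreal (inverse ((cos x)\<^sup>2)) * indicator {- (pi / 2)<..<pi / 2} x * indicator (tan -` {l<..<u}) x
        = ennreal (inverse ((cos x)\<^sup>2)) * indicator {?a..?b} x"
      proof eventually_elim
        case (elim x)
        show ?case
        proof (cases "- (pi / 2) < x \<and> x < pi / 2")
          case True
          then have "x \<in> tan -` {l<..<u} \<longleftrightarrow> ?a < x \<and> x < ?b" using arctan_in_box_iff[of x l u] by auto
          then have "x \<in> tan -` {l<..<u} \<longleftrightarrow> x \<in> {?a..?b}" using elim by auto
          then show ?thesis using True by (simp add: indicator_def)
        next
          case False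
          then have "x \<notin> {?a..?b}" using ab by auto
          then show ?thesis using False by auto
        qed
      qed
    qed
  qed (auto intro!: measurable_sets[OF tan_borel, simplified])
  also have "\<dots> = ennreal (tan ?b - tan ?a)"
    using ab cpos by (intro nn_integral_FTC_Icc) (auto intro!: DERIV_tan DERIV_subset[OF DERIV_tan] simp: has_real_derivative_iff_has_vector_derivative[symmetric])
  finally show "emeasure (distr ?D borel tan) (box l u) = (\<Prod>b\<in>Basis. (u - l) \<bullet> b)"
    by (simp add: tan_arctan)
qed simp

lemma nn_integral_tan:
  assumes [measurable]: "h \<in> borel_measurable borel"
  shows "(\<integral>\<^sup>+x. h x \<partial>lborel) = (\<integral>\<^sup>+x. ennreal (inverse ((cos x)\<^sup>2)) * indicator {- (pi / 2)<..<pi / 2} x * h (tan x) \<partial>lborel)"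
  by (subst lborel_eq_distr_tan) (simp add: nn_integral_distr nn_integral_density)

lemma nn_integral_lborel_prod:
  fixes f :: "real \<times> real \<Rightarrow> ennreal"
  assumes [measurable]: "f \<in> borel_measurable borel"
  shows "(\<integral>\<^sup>+z. f z \<partial>lborel) = (\<integral>\<^sup>+x. \<integral>\<^sup>+y. f (x, y) \<partial>lborel \<partial>lborel)"
    and "(\<integral>\<^sup>+z. f z \<partial>lborel) = (\<integral>\<^sup>+y. \<integral>\<^sup>+x. f (x, y) \<partial>lborel \<partial>lborel)"
proof -
  have "f \<in> borel_measurable (lborel \<Otimes>\<^sub>M lborel)" using assms by (simp add: lborel_prod)
  then show "(\<integral>\<^sup>+z. f z \<partial>lborel) = (\<integral>\<^sup>+x. \<integral>\<^sup>+y. f (x, y) \<partial>lborel \<partial>lborel)"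
    "(\<integral>\<^sup>+z. f z \<partial>lborel) = (\<integral>\<^sup>+y. \<integral>\<^sup>+x. f (x, y) \<partial>lborel \<partial>lborel)"
    by (simp_all add: lborel.nn_integral_fst lborel_pair.nn_integral_snd flip: lborel_prod)
qed

text \<open>Three substitutions in one variable replace a planar change of variables:
  \<open>- y * \<tau>\<close> for the abscissa at height \<open>y\<close>, then \<open>tan x\<close>
  for \<tau>, then \<open>r * cos x\<close> for \<open>y\<close>. The factors \<open>y\<close>,
  \<open>1 / cos^2\<close> and \<open>cos\<close> combine to \<open>r\<close>.\<close>

lemma nn_integral_polar_half_plane:
  fixes f :: "real \<times> real \<Rightarrow> ennreal"
  assumes [measurable]: "f \<in> borel_measurable borel"
  shows "(\<integral>\<^sup>+z. indicator {0<..} (snd z) * f z \<partial>lborel) =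
    (\<integral>\<^sup>+\<theta>. indicator {0<..<pi} \<theta> * (\<integral>\<^sup>+r. indicator {0<..} r * ennreal r * f (r * cos \<theta>, r * sin \<theta>) \<partial>lborel) \<partial>lborel)"
proof -
  have [measurable]: "f \<in> borel_measurable (borel \<Otimes>\<^sub>M borel)" using assms by (simp add: borel_prod)
  let ?i = "indicator {0<..} :: real \<Rightarrow> ennreal"
  define h where "h \<tau> = (\<integral>\<^sup>+y. ?i y * ennreal y * f (- y * \<tau>, y) \<partial>lborel)" for \<tau>
  have [measurable]: "h \<in> borel_measurable borel" unfolding h_def[abs_def] by measurable
  have "(\<integral>\<^sup>+z. ?i (snd z) * f z \<partial>lborel) = (\<integral>\<^sup>+y. \<integral>\<^sup>+x. ?i y * f (x, y) \<partial>lborel \<partial>lborel)"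
    by (subst nn_integral_lborel_prod(2)) (auto simp flip: borel_prod)
  also have "\<dots> = (\<integral>\<^sup>+y. \<integral>\<^sup>+\<tau>. ?i y * ennreal y * f (- y * \<tau>, y) \<partial>lborel \<partial>lborel)"
  proof (rule nn_integral_cong)
    fix y :: real
    show "(\<integral>\<^sup>+x. ?i y * f (x, y) \<partial>lborel) = (\<integral>\<^sup>+\<tau>. ?i y * ennreal y * f (- y * \<tau>, y) \<partial>lborel)"
    proof (cases "y > 0")
      case True
      then show ?thesis
        by (subst nn_integral_real_affine[where c = "- y" and t = 0]) (auto simp: nn_integral_cmult)
    qed simp
  qed
  also have "\<dots> = (\<integral>\<^sup>+\<tau>. h \<tau> \<partial>lborel)"
    unfolding h_def by (rule lborel_pair.Fubini') measurable
  also have "\<dots> = (\<integral>\<^sup>+x. ennreal (inverse ((cos x)\<^sup>2)) * indicator {- (pi / 2)<..<pi / 2} x * h (tan x) \<partial>lborel)"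
    by (rule nn_integral_tan) measurable
  also have "\<dots> = (\<integral>\<^sup>+x. indicator {- (pi / 2)<..<pi / 2} x *
      (\<integral>\<^sup>+r. ?i r * ennreal r * f (- r * sin x, r * cos x) \<partial>lborel) \<partial>lborel)"
  proof (rule nn_integral_cong)
    fix x :: real
    show "ennreal (inverse ((cos x)\<^sup>2)) * indicator {- (pi / 2)<..<pi / 2} x * h (tan x) =
      indicator {- (pi / 2)<..<pi / 2} x * (\<integral>\<^sup>+r. ?i r * ennreal r * f (- r * sin x, r * cos x) \<partial>lborel)"
    proof (cases "x \<in> {- (pi / 2)<..<pi / 2}")
      case True
      then have c: "cos x > 0" using cos_gt_zero_pi by auto
      have "h (tan x) = ennreal (cos x) * (\<integral>\<^sup>+r. ?i (cos x * r) * ennreal (cos x * r) * f (- (cos x * r) * tan x, cos x * r) \<partial>lborel)"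
        unfolding h_def using c by (subst nn_integral_real_affine[where c = "cos x" and t = 0]) auto
      also have "\<dots> = ennreal (cos x) * (\<integral>\<^sup>+r. ennreal (cos x) * (?i r * ennreal r * f (- r * sin x, r * cos x)) \<partial>lborel)"
      proof (rule arg_cong2[where f = "(*)", OF refl nn_integral_cong])
        fix r :: real
        have *: "- (cos x * r) * tan x = - r * sin x" using c by (simp add: tan_def)
        have "?i (cos x * r) = ?i r" using c by (simp add: indicator_def zero_less_mult_iff)
        moreover have "ennreal (cos x * r) = ennreal (cos x) * ennreal r" using c by (simp add: ennreal_mult')
        ultimately show "?i (cos x * r) * ennreal (cos x * r) * f (- (cos x * r) * tan x, cos x * r) =
            ennreal (cos x) * (?i r * ennreal r * f (- r * sin x, r * cos x))"
          unfolding * by (simp add: mult_ac)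
      qed
      also have "\<dots> = ennreal ((cos x)\<^sup>2) * (\<integral>\<^sup>+r. ?i r * ennreal r * f (- r * sin x, r * cos x) \<partial>lborel)"
        using c by (subst nn_integral_cmult) (auto simp: power2_eq_square ennreal_mult' mult.assoc)
      finally have "ennreal (inverse ((cos x)\<^sup>2)) * h (tan x) =
          ennreal (inverse ((cos x)\<^sup>2) * (cos x)\<^sup>2) * (\<integral>\<^sup>+r. ?i r * ennreal r * f (- r * sin x, r * cos x) \<partial>lborel)"
        by (simp add: ennreal_mult' mult.assoc)
      then show ?thesis using c True by simp
    qed simp
  qed
  \<comment> \<open>The sign in \<open>- y * \<tau>\<close> makes
    \<open>(- r * sin x, r * cos x)\<close> the point with polar angle \<open>pi / 2 + x\<close>, so
    only a translation of the angle remains.\<close>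
  also have "\<dots> = (\<integral>\<^sup>+\<theta>. indicator {0<..<pi} \<theta> * (\<integral>\<^sup>+r. ?i r * ennreal r * f (r * cos \<theta>, r * sin \<theta>) \<partial>lborel) \<partial>lborel)"
  proof -
    have "(\<integral>\<^sup>+\<theta>. indicator {0<..<pi} \<theta> * (\<integral>\<^sup>+r. ?i r * ennreal r * f (r * cos \<theta>, r * sin \<theta>) \<partial>lborel) \<partial>lborel)
      = ennreal \<bar>1\<bar> * (\<integral>\<^sup>+x. indicator {0<..<pi} (pi / 2 + 1 * x) *
          (\<integral>\<^sup>+r. ?i r * ennreal r * f (r * cos (pi / 2 + 1 * x), r * sin (pi / 2 + 1 * x)) \<partial>lborel) \<partial>lborel)"
      by (rule nn_integral_real_affine) auto
    then show ?thesis
      by (auto simp: cos_add sin_add indicator_def intro!: nn_integral_cong)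
  qed
  finally show ?thesis .
qed

lemma nn_integral_reflect_plane:
  fixes f :: "real \<times> real \<Rightarrow> ennreal"
  assumes [measurable]: "f \<in> borel_measurable borel"
  shows "(\<integral>\<^sup>+z. f z \<partial>lborel) = (\<integral>\<^sup>+z. f (- z) \<partial>lborel)"
proof -
  have [measurable]: "f \<in> borel_measurable (borel \<Otimes>\<^sub>M borel)" using assms by (simp add: borel_prod)
  have fm [measurable]: "(\<lambda>z. f (- z)) \<in> borel_measurable borel"
    by (rule measurable_compose[OF _ assms]) simp
  have "(\<integral>\<^sup>+z. f z \<partial>lborel) = (\<integral>\<^sup>+x. \<integral>\<^sup>+y. f (x, y) \<partial>lborel \<partial>lborel)"
    by (rule nn_integral_lborel_prod(1)) measurable
  also have "\<dots> = (\<integral>\<^sup>+x. \<integral>\<^sup>+y. f (- x, y) \<partial>lborel \<partial>lborel)"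
    by (subst nn_integral_real_affine[where c = "- 1" and t = 0]) auto
  also have "\<dots> = (\<integral>\<^sup>+x. \<integral>\<^sup>+y. f (- x, - y) \<partial>lborel \<partial>lborel)"
  proof (rule nn_integral_cong)
    fix x :: real
    show "(\<integral>\<^sup>+y. f (- x, y) \<partial>lborel) = (\<integral>\<^sup>+y. f (- x, - y) \<partial>lborel)"
      by (subst nn_integral_real_affine[where c = "- 1" and t = 0]) auto
  qed
  also have "\<dots> = (\<integral>\<^sup>+z. f (- z) \<partial>lborel)"
    by (subst nn_integral_lborel_prod(1)[OF fm]) simp
  finally show ?thesis .
qed

text \<open>The lower half-plane is the reflection of the upper one in the origin, which adds
  \<open>pi\<close> to the angle; the axis between them is a null set.\<close>

lemma nn_integral_polar:
  fixes f :: "real \<times> real \<Rightarrow> ennreal"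
  assumes [measurable]: "f \<in> borel_measurable borel"
  shows "(\<integral>\<^sup>+z. f z \<partial>lborel) =
    (\<integral>\<^sup>+\<theta>. indicator {0..2 * pi} \<theta> * (\<integral>\<^sup>+r. indicator {0<..} r * ennreal r * f (r * cos \<theta>, r * sin \<theta>) \<partial>lborel) \<partial>lborel)"
proof -
  have [measurable]: "f \<in> borel_measurable (borel \<Otimes>\<^sub>M borel)" using assms by (simp add: borel_prod)
  let ?i = "indicator {0<..} :: real \<Rightarrow> ennreal"
  define k where "k \<theta> = (\<integral>\<^sup>+r. ?i r * ennreal r * f (r * cos \<theta>, r * sin \<theta>) \<partial>lborel)" for \<theta>
  have [measurable]: "k \<in> borel_measurable borel" unfolding k_def[abs_def] by measurable
  have fm [measurable]: "(\<lambda>z. f (- z)) \<in> borel_measurable borel"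
    by (rule measurable_compose[OF _ assms]) simp
  have im [measurable]: "(\<lambda>z::real \<times> real. ?i (snd z) * f z) \<in> borel_measurable borel"
    "(\<lambda>z::real \<times> real. ?i (- snd z) * f z) \<in> borel_measurable borel"
    unfolding borel_prod[symmetric] by measurable
  have "AE z::real \<times> real in lborel. snd z \<noteq> 0"
  proof (rule AE_I[where N = "{z. snd z = 0}"])
    have [measurable]: "{z::real \<times> real. snd z = 0} \<in> sets borel"
      by (intro borel_closed closed_Collect_eq continuous_intros)
    have "emeasure lborel {z::real \<times> real. snd z = 0} = (\<integral>\<^sup>+z. indicator {z::real \<times> real. snd z = 0} z \<partial>lborel)"
      by (subst nn_integral_indicator) auto
    also have "\<dots> = (\<integral>\<^sup>+(x::real). \<integral>\<^sup>+(y::real). indicator {0} y \<partial>lborel \<partial>lborel)"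
    proof -
      have eq: "indicator {z::real \<times> real. snd z = 0} (x, y) = (indicator {0} y :: ennreal)" for x y
        by (simp add: indicator_def)
      have "indicator {z::real \<times> real. snd z = 0} \<in> borel_measurable (borel :: (real \<times> real) measure)"
        by (rule borel_measurable_indicator) measurable
      from nn_integral_lborel_prod(1)[OF this] show ?thesis by (simp only: eq)
    qed
    also have "\<dots> = (\<integral>\<^sup>+(x::real). emeasure lborel {0::real} \<partial>lborel)"
      by (intro nn_integral_cong nn_integral_indicator) simp
    finally show "emeasure lborel {z::real \<times> real. snd z = 0} = 0" by simp
    show "{z::real \<times> real. snd z = 0} \<in> sets lborel" by measurable
  qed auto
  then have "(\<integral>\<^sup>+z. f z \<partial>lborel) = (\<integral>\<^sup>+z. ?i (snd z) * f z + ?i (- snd z) * f z \<partial>lborel)"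
    by (intro nn_integral_cong_AE) (auto elim!: eventually_mono simp: indicator_def)
  also have "\<dots> = (\<integral>\<^sup>+z. ?i (snd z) * f z \<partial>lborel) + (\<integral>\<^sup>+z. ?i (- snd z) * f z \<partial>lborel)"
    using im by (intro nn_integral_add) auto
  also have "(\<integral>\<^sup>+z. ?i (- snd z) * f z \<partial>lborel) = (\<integral>\<^sup>+z. ?i (snd z) * f (- z) \<partial>lborel)"
    by (subst nn_integral_reflect_plane) (use im in auto)
  also have "\<dots> = (\<integral>\<^sup>+\<theta>. indicator {0<..<pi} \<theta> * k (pi + 1 * \<theta>) \<partial>lborel)"
    by (subst nn_integral_polar_half_plane) (auto simp: k_def)
  also have "\<dots> = (\<integral>\<^sup>+\<theta>. indicator {pi<..<2 * pi} \<theta> * k \<theta> \<partial>lborel)"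
    by (subst (2) nn_integral_real_affine[where c = 1 and t = pi]) (auto simp: indicator_def intro!: nn_integral_cong)
  also have "(\<integral>\<^sup>+z. ?i (snd z) * f z \<partial>lborel) = (\<integral>\<^sup>+\<theta>. indicator {0<..<pi} \<theta> * k \<theta> \<partial>lborel)"
    by (subst nn_integral_polar_half_plane) (auto simp: k_def)
  also have "\<dots> + (\<integral>\<^sup>+\<theta>. indicator {pi<..<2 * pi} \<theta> * k \<theta> \<partial>lborel) =
      (\<integral>\<^sup>+\<theta>. indicator {0<..<pi} \<theta> * k \<theta> + indicator {pi<..<2 * pi} \<theta> * k \<theta> \<partial>lborel)"
    by (rule nn_integral_add[symmetric]) auto
  also have "\<dots> = (\<integral>\<^sup>+\<theta>. indicator {0..2 * pi} \<theta> * k \<theta> \<partial>lborel)"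
  proof (rule nn_integral_cong_AE)
    have "AE \<theta>::real in lborel. \<theta> \<noteq> 0" "AE \<theta>::real in lborel. \<theta> \<noteq> pi" "AE \<theta>::real in lborel. \<theta> \<noteq> 2 * pi"
      by (rule AE_lborel_singleton)+
    then show "AE \<theta> in lborel. indicator {0<..<pi} \<theta> * k \<theta> + indicator {pi<..<2 * pi} \<theta> * k \<theta> = indicator {0..2 * pi} \<theta> * k \<theta>"
      by eventually_elim (auto simp: indicator_def)
  qed
  finally show ?thesis unfolding k_def .
qed

definition polar_measure :: "(real \<times> real) measure" where
  "polar_measure = density (lborel \<Otimes>\<^sub>M lborel)
     (\<lambda>(\<theta>, r). indicator {0..2 * pi} \<theta> * (indicator {0<..} r * ennreal r))"

definition polar_map :: "real \<times> real \<Rightarrow> real \<times> real" where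
  "polar_map = (\<lambda>(\<theta>, r). (r * cos \<theta>, r * sin \<theta>))"

lemma polar_map_borel [measurable]: "polar_map \<in> borel_measurable (borel \<Otimes>\<^sub>M borel)"
  unfolding polar_map_def borel_prod[symmetric] by measurable

text \<open>As an equality of measures it transfers integrability and integrals of complex functions
  as well.\<close>

lemma lborel_eq_distr_polar: "lborel = distr polar_measure borel polar_map"
proof (rule measure_eqI)
  show "sets (lborel :: (real \<times> real) measure) = sets (distr polar_measure borel polar_map)" by simp
  fix A :: "(real \<times> real) set" assume "A \<in> sets lborel"
  then have [measurable]: "A \<in> sets borel" by simp
  have [measurable]: "polar_map \<in> polar_measure \<rightarrow>\<^sub>M borel"
    unfolding polar_measure_def by simp
  have [measurable]: "(\<lambda>z. indicator A (polar_map z) :: ennreal) \<in> borel_measurable (borel \<Otimes>\<^sub>M borel)"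
    by measurable
  have "emeasure lborel A = (\<integral>\<^sup>+z. indicator A z \<partial>lborel)" by simp
  also have "\<dots> = (\<integral>\<^sup>+\<theta>. \<integral>\<^sup>+r. indicator {0..2 * pi} \<theta> * (indicator {0<..} r * ennreal r) * indicator A (polar_map (\<theta>, r)) \<partial>lborel \<partial>lborel)"
    by (subst nn_integral_polar) (auto simp: polar_map_def nn_integral_cmult[symmetric] mult.assoc)
  also have "\<dots> = (\<integral>\<^sup>+z. indicator A (polar_map z) \<partial>polar_measure)"
    unfolding polar_measure_def
    by (subst nn_integral_density, (simp; fail), (simp; fail), subst lborel.nn_integral_fst[symmetric]) (auto simp: mult.assoc)
  also have "\<dots> = emeasure (distr polar_measure borel polar_map) A"
    by (subst nn_integral_indicator[symmetric], simp, subst nn_integral_distr) auto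
  finally show "emeasure lborel A = emeasure (distr polar_measure borel polar_map) A" .
qed

section \<open>The sup norm of a Hoelder function with small Haar coefficients\<close>

text \<open>What the Sobolev embedding gives for a function divided by its Sobolev norm.\<close>

definition tame :: "real \<Rightarrow> real \<Rightarrow> real \<Rightarrow> (real \<times> real \<Rightarrow> complex) \<Rightarrow> bool" where
  "tame A \<kappa> p g \<longleftrightarrow> (\<forall>z. norm (g z) \<le> A) \<and> (\<forall>z w. norm (g z - g w) \<le> A * norm (z - w) powr \<kappa>) \<and>
     (\<integral>\<^sup>+z. ennreal (norm (g z) powr p) \<partial>lborel) \<le> 1"

lemma tameD:
  assumes "tame A \<kappa> p g"
  shows "norm (g z) \<le> A" "norm (g z - g w) \<le> A * norm (z - w) powr \<kappa>"
    "(\<integral>\<^sup>+z. ennreal (norm (g z) powr p) \<partial>lborel) \<le> 1" "0 \<le> A"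
proof -
  show *: "norm (g z) \<le> A" for z
    using assms unfolding tame_def by blast
  show "norm (g z - g w) \<le> A * norm (z - w) powr \<kappa>" "(\<integral>\<^sup>+z. ennreal (norm (g z) powr p) \<partial>lborel) \<le> 1"
    using assms unfolding tame_def by blast+
  show "0 \<le> A" using *[of 0] norm_ge_zero order_trans by blast
qed

lemma tame_continuous:
  assumes "tame A \<kappa> p g" "0 < \<kappa>"
  shows "continuous_on UNIV g"
proof -
  have "isCont g z" for z
  proof -
    have "((\<lambda>w. norm (w - z)) \<longlongrightarrow> norm (z - z)) (at z)" by (intro tendsto_intros)
    then have "((\<lambda>w. norm (w - z) powr \<kappa>) \<longlongrightarrow> norm (z - z) powr \<kappa>) (at z)"
      using assms(2) by (intro tendsto_powr'[OF _ tendsto_const]) auto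
    then have lim: "((\<lambda>w. A * norm (w - z) powr \<kappa>) \<longlongrightarrow> 0) (at z)"
      by (simp add: tendsto_mult_right_zero)
    have "\<forall>\<^sub>F w in at z. norm (g w - g z) \<le> A * norm (w - z) powr \<kappa>"
      by (rule always_eventually) (use tameD(2)[OF assms(1)] in blast)
    then have "((\<lambda>w. g w - g z) \<longlongrightarrow> 0) (at z)"
      using lim by (rule Lim_null_comparison)
    then show ?thesis by (simp add: isCont_def LIM_zero_iff)
  qed
  then show ?thesis by (simp add: continuous_at_imp_continuous_on)
qed

lemma tame_borel:
  assumes "tame A \<kappa> p g" "0 < \<kappa>"
  shows "g \<in> borel_measurable borel"
  using tame_continuous[OF assms] by (rule borel_measurable_continuous_onI)

section \<open>Averages over dyadic rectangles and their telescoping\<close>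

definition dyadic_at :: "real \<Rightarrow> int \<Rightarrow> real set" where
  "dyadic_at x n = {2 powi n * of_int \<lfloor>x / 2 powi n\<rfloor> ..< 2 powi n * of_int \<lfloor>x / 2 powi n\<rfloor> + 2 powi n}"

text \<open>Integrating against it averages over the dyadic interval of generation \<open>n\<close>
  around \<open>x\<close>: the conditional expectation, with the point \<open>x\<close>
  frozen.\<close>

definition dyadic_kernel :: "real \<Rightarrow> int \<Rightarrow> real \<Rightarrow> real" where
  "dyadic_kernel x n t = indicator (dyadic_at x n) t / 2 powi n"

lemma dyadic_at_mem: "x \<in> dyadic_at x n"
proof -
  define L :: real where "L = 2 powi n"
  have L: "0 < L" by (simp add: L_def)
  have "of_int \<lfloor>x / L\<rfloor> \<le> x / L" "x / L < of_int \<lfloor>x / L\<rfloor> + 1" by linarith+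
  then have "of_int \<lfloor>x / L\<rfloor> * L \<le> x" "x < (of_int \<lfloor>x / L\<rfloor> + 1) * L"
    using L pos_le_divide_eq pos_divide_less_eq by blast+
  then show ?thesis by (simp add: dyadic_at_def algebra_simps flip: L_def)
qed

lemma dyadic_at_in: "dyadic_at x n \<in> dyadic_intervals"
proof -
  have "dyadic_at x n = {2 powi n * of_int \<lfloor>x / 2 powi n\<rfloor> ..< 2 powi n * (of_int \<lfloor>x / 2 powi n\<rfloor> + 1)}"
    by (simp add: dyadic_at_def algebra_simps)
  then show ?thesis unfolding dyadic_intervals_def by blast
qed

lemma dyadic_kernel_borel [measurable]: "dyadic_kernel x n \<in> borel_measurable borel"
  unfolding dyadic_kernel_def[abs_def] dyadic_at_def by measurable

lemma dyadic_kernel_integral: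
  "integrable lborel (dyadic_kernel x n)" "(LINT t|lborel. dyadic_kernel x n t) = 1"
  unfolding dyadic_kernel_def dyadic_at_def by auto

lemma dyadic_at_eq:
  assumes "2 powi n * of_int j \<le> x" "x < 2 powi n * of_int j + 2 powi n"
  shows "dyadic_at x n = {2 powi n * of_int j ..< 2 powi n * of_int j + 2 powi n}"
proof -
  have "\<lfloor>x / 2 powi n\<rfloor> = j"
    using assms by (intro floor_unique) (auto simp: field_simps)
  then show ?thesis by (simp add: dyadic_at_def)
qed

text \<open>Both sides are \<open>1 / 2 powi (n + 1)\<close> on the half of the larger interval that
  contains \<open>x\<close>, and minus that on the other half: the value of the Haar function at
  \<open>x\<close> supplies the right sign.\<close>

lemma dyadic_kernel_diff:
  "dyadic_kernel x n t - dyadic_kernel x (n + 1) t =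
     haar (dyadic_at x (n + 1)) x * haar (dyadic_at x (n + 1)) t"
proof -
  define L :: real where "L = 2 powi n"
  define j where "j = \<lfloor>x / 2 powi (n + 1)\<rfloor>"
  define a where "a = 2 * L * of_int j"
  have L: "L > 0" by (simp add: L_def)
  have p: "2 powi (n + 1) = 2 * L" using powi_add_nat[of n 1] by (simp add: L_def)
  have I1: "dyadic_at x (n + 1) = {a..<a + 2 * L}"
    by (simp add: dyadic_at_def p a_def j_def)
  then have x: "a \<le> x" "x < a + 2 * L" using dyadic_at_mem[of x "n + 1"] by auto
  have I0: "dyadic_at x n = (if x < a + L then {a..<a + L} else {a + L..<a + 2 * L})"
  proof (cases "x < a + L")
    case True
    then show ?thesis using dyadic_at_eq[of n "2 * j" x] x by (simp add: L_def a_def mult_ac)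
  next
    case False
    then show ?thesis using dyadic_at_eq[of n "2 * j + 1" x] x by (simp add: L_def a_def algebra_simps)
  qed
  have h: "haar {a..<a + 2 * L} s = (2 * L) powr (- 1 / 2) *
      (indicator {a..<a + L} s - indicator {a + L..<a + 2 * L} s)" for s
    using haar_Ico[of "2 * L" a s] L by simp
  have sq: "(2 * L) powr (- 1 / 2) * (2 * L) powr (- 1 / 2) = 1 / (2 * L)"
    using L by (simp add: powr_add[symmetric] powr_minus field_simps)
  have "haar {a..<a + 2 * L} x * haar {a..<a + 2 * L} t =
      (if x < a + L then 1 else - 1) * (indicator {a..<a + L} t - indicator {a + L..<a + 2 * L} t) / (2 * L)"
    unfolding h using x sq by (auto simp: indicator_def)
  also have "\<dots> = dyadic_kernel x n t - dyadic_kernel x (n + 1) t"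
    unfolding dyadic_kernel_def I0 I1 p L_def[symmetric] using L by (auto simp: indicator_def field_simps)
  finally show ?thesis unfolding I1 by simp
qed

lemma dyadic_kernel_telescope:
  "dyadic_kernel x n t - dyadic_kernel x (n + int k) t =
     (\<Sum>i<k. haar (dyadic_at x (n + int i + 1)) x * haar (dyadic_at x (n + int i + 1)) t)"
proof (induction k)
  case (Suc k)
  then show ?case using dyadic_kernel_diff[of x "n + int k" t] by (simp add: algebra_simps)
qed simp

lemma dyadic_at_grid: "dyadic_at x n \<in> grid_of (\<lambda>_. 0)"
  unfolding dyadic_at_def grid_of_def grid_Ico_def by auto

lemma abs_haar_dyadic_at: "\<bar>haar (dyadic_at x n) x\<bar> = (2 powi n) powr (- 1 / 2)"
  using abs_haar_Ico[of "2 powi n" _ x] dyadic_at_mem[of x n] by (simp add: dyadic_at_def)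

text \<open>For \<open>t > l\<close> the factor \<open>(t / l) powr (p - 1)\<close> is at least 1.
  With a well chosen \<open>l\<close> this replaces Hoelder's inequality for averages.\<close>

lemma le_young:
  fixes l p t :: real
  assumes "0 < l" "1 < p" "0 \<le> t"
  shows "t \<le> l + l powr (1 - p) * t powr p"
proof (cases "t \<le> l")
  case False
  then have t: "t > 0" using assms by simp
  have "t = t powr (1 - p) * t powr p" using t by (simp add: powr_add[symmetric])
  also have "\<dots> \<le> l powr (1 - p) * t powr p"
    using False assms by (intro mult_right_mono powr_mono2') auto
  finally show ?thesis using assms by simp
next
  case True
  moreover have "0 \<le> l powr (1 - p) * t powr p" by simp
  ultimately show ?thesis by linarith
qed

locale tame_fun =
  fixes A \<kappa> p :: real and g :: "real \<times> real \<Rightarrow> complex"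
  assumes tame: "tame A \<kappa> p g" and \<kappa>: "0 < \<kappa>" "\<kappa> \<le> 1" and p: "1 < p"
begin

lemma g_borel [measurable]: "g \<in> borel_measurable borel"
  using tame_borel[OF tame \<kappa>(1)] .

lemma pairing_integrable:
  assumes "integrable lborel \<phi>" "integrable lborel \<psi>"
  shows "integrable lborel (\<lambda>z. g z * of_real (\<phi> (fst z) * \<psi> (snd z)))"
proof (rule Bochner_Integration.integrable_bound)
  have i: "integrable lborel (\<lambda>z. \<phi> (fst z) * \<psi> (snd z))" by (rule integrable_lborel_prod[OF assms])
  then show "integrable lborel (\<lambda>z. A * (\<phi> (fst z) * \<psi> (snd z)))" by simp
  show "(\<lambda>z. g z * of_real (\<phi> (fst z) * \<psi> (snd z))) \<in> borel_measurable lborel"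
    using borel_measurable_integrable[OF i] by measurable
  show "AE z in lborel. norm (g z * of_real (\<phi> (fst z) * \<psi> (snd z))) \<le> norm (A * (\<phi> (fst z) * \<psi> (snd z)))"
    using tameD(1,4)[OF tame] by (auto simp: norm_mult abs_mult intro!: mult_right_mono)
qed

definition pairing :: "(real \<Rightarrow> real) \<Rightarrow> (real \<Rightarrow> real) \<Rightarrow> complex" where
  "pairing \<phi> \<psi> = (LINT z|lborel. g z * of_real (\<phi> (fst z) * \<psi> (snd z)))"

lemma pairing_diff:
  assumes "integrable lborel \<phi>" "integrable lborel \<phi>'" "integrable lborel \<psi>" "integrable lborel \<psi>'"
  shows "pairing (\<lambda>t. \<phi> t - \<phi>' t) (\<lambda>t. \<psi> t - \<psi>' t) = pairing \<phi> \<psi> - pairing \<phi> \<psi>' - pairing \<phi>' \<psi> + pairing \<phi>' \<psi>'"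
proof -
  have "g z * of_real ((\<phi> (fst z) - \<phi>' (fst z)) * (\<psi> (snd z) - \<psi>' (snd z))) =
    g z * of_real (\<phi> (fst z) * \<psi> (snd z)) - g z * of_real (\<phi> (fst z) * \<psi>' (snd z)) -
    g z * of_real (\<phi>' (fst z) * \<psi> (snd z)) + g z * of_real (\<phi>' (fst z) * \<psi>' (snd z))" for z
    by (simp add: algebra_simps)
  then show ?thesis
    unfolding pairing_def using pairing_integrable assms by simp
qed

lemma pairing_sum:
  assumes "\<And>i. i \<in> S \<Longrightarrow> integrable lborel (\<phi> i)" "\<And>j. j \<in> T \<Longrightarrow> integrable lborel (\<psi> j)"
  shows "pairing (\<lambda>t. \<Sum>i\<in>S. c i * \<phi> i t) (\<lambda>t. \<Sum>j\<in>T. d j * \<psi> j t) =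
    (\<Sum>i\<in>S. \<Sum>j\<in>T. of_real (c i * d j) * pairing (\<phi> i) (\<psi> j))"
proof -
  have eq: "g z * of_real ((\<Sum>i\<in>S. c i * \<phi> i (fst z)) * (\<Sum>j\<in>T. d j * \<psi> j (snd z))) =
    (\<Sum>i\<in>S. \<Sum>j\<in>T. of_real (c i * d j) * (g z * of_real (\<phi> i (fst z) * \<psi> j (snd z))))" for z
  proof -
    have "(\<Sum>i\<in>S. c i * \<phi> i (fst z)) * (\<Sum>j\<in>T. d j * \<psi> j (snd z)) =
        (\<Sum>i\<in>S. \<Sum>j\<in>T. (c i * d j) * (\<phi> i (fst z) * \<psi> j (snd z)))"
      unfolding sum_product by (simp add: mult_ac)
    then show ?thesis by (simp only: of_real_sum sum_distrib_left) (simp add: mult_ac)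
  qed
  have inner: "(LINT z|lborel. (\<Sum>j\<in>T. of_real (c i * d j) * (g z * of_real (\<phi> i (fst z) * \<psi> j (snd z))))) =
      (\<Sum>j\<in>T. of_real (c i * d j) * pairing (\<phi> i) (\<psi> j))" if "i \<in> S" for i
  proof -
    have I: "integrable lborel (\<lambda>z. g z * of_real (\<phi> i (fst z) * \<psi> j (snd z)))" if "j \<in> T" for j
      using assms \<open>i \<in> S\<close> that by (intro pairing_integrable)
    have "(LINT z|lborel. (\<Sum>j\<in>T. of_real (c i * d j) * (g z * of_real (\<phi> i (fst z) * \<psi> j (snd z))))) =
        (\<Sum>j\<in>T. LINT z|lborel. of_real (c i * d j) * (g z * of_real (\<phi> i (fst z) * \<psi> j (snd z))))"
      by (intro Bochner_Integration.integral_sum integrable_mult_right I)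
    then show ?thesis by (simp only: integral_mult_right_zero pairing_def)
  qed
  show ?thesis
    unfolding pairing_def[of "\<lambda>t. \<Sum>i\<in>S. c i * \<phi> i t"] eq
    by (subst Bochner_Integration.integral_sum,
        intro Bochner_Integration.integrable_sum integrable_mult_right pairing_integrable assms, assumption, assumption)
      (intro sum.cong refl inner)
qed

text \<open>A Hoelder estimate, up to the factor 2, for the average of \<open>g\<close> over a
  rectangle of area \<open>2 powi (n + m)\<close>; it uses that the \<open>p\<close>-integral of
  \<open>g\<close> is at most 1.\<close>

lemma pairing_kernel_le:
  "norm (pairing (dyadic_kernel x n) (dyadic_kernel y m)) \<le> 2 * (2 powi (n + m)) powr (- 1 / p)"
proof -
  define w where "w z = dyadic_kernel x n (fst z) * dyadic_kernel y m (snd z)" for z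
  define R :: real where "R = 2 powi (n + m)"
  have R: "R > 0" "R = 2 powi n * 2 powi m" by (simp_all add: R_def power_int_add)
  \<comment> \<open>This value makes the two terms of \<open>le_young\<close> equal:
    \<open>l powr (1 - p) / R = l\<close>.\<close>
  define l where "l = R powr (- 1 / p)"
  have l: "l > 0" using R by (simp add: l_def)
  have wi: "integrable lborel w" "(LINT z|lborel. w z) = 1"
    unfolding w_def
    by (intro integrable_lborel_prod dyadic_kernel_integral(1))
      (simp only: integral_lborel_prod[OF dyadic_kernel_integral(1) dyadic_kernel_integral(1)] dyadic_kernel_integral(2) mult_1)
  have w0: "0 \<le> w z" "w z \<le> 1 / R" for z
    by (auto simp: w_def dyadic_kernel_def R(2) indicator_def)
  have ip: "integrable lborel (\<lambda>z. norm (g z) powr p)"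
    using tameD(3)[OF tame] by (intro integrableI_bounded) (auto simp: le_less_trans)
  have lp: "(LINT z|lborel. norm (g z) powr p) \<le> 1"
    using tameD(3)[OF tame] by (subst integral_eq_nn_integral) (auto intro: enn2real_leI)
  have "norm (pairing (dyadic_kernel x n) (dyadic_kernel y m)) \<le> (LINT z|lborel. norm (g z * of_real (w z)))"
    unfolding pairing_def w_def by simp
  also have "\<dots> \<le> (LINT z|lborel. l * w z + l powr (1 - p) / R * norm (g z) powr p)"
  proof (rule integral_mono_AE)
    show "integrable lborel (\<lambda>z. norm (g z * of_real (w z)))"
      using pairing_integrable[OF dyadic_kernel_integral(1) dyadic_kernel_integral(1), THEN integrable_norm, of x n y m]
      by (simp add: w_def)
    show "AE z in lborel. norm (g z * of_real (w z)) \<le> l * w z + l powr (1 - p) / R * norm (g z) powr p"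
    proof (rule AE_I2)
      fix z
      have "norm (g z * of_real (w z)) = norm (g z) * w z" using w0 by (simp add: norm_mult)
      also have "\<dots> \<le> (l + l powr (1 - p) * norm (g z) powr p) * w z"
        using w0 le_young[OF l p] by (intro mult_right_mono) auto
      also have "\<dots> = l * w z + l powr (1 - p) * norm (g z) powr p * w z" by (simp add: algebra_simps)
      also have "l powr (1 - p) * norm (g z) powr p * w z \<le> l powr (1 - p) * norm (g z) powr p * (1 / R)"
        using w0 by (intro mult_left_mono) auto
      finally show "norm (g z * of_real (w z)) \<le> l * w z + l powr (1 - p) / R * norm (g z) powr p" by simp
    qed
  qed (use wi ip in auto)
  also have "\<dots> = l + l powr (1 - p) / R * (LINT z|lborel. norm (g z) powr p)"
    using wi ip by simp
  also have "\<dots> \<le> l + l powr (1 - p) / R * 1"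
    using lp R l by (intro add_left_mono mult_left_mono) auto
  also have "l powr (1 - p) / R = l"
  proof -
    have "- 1 / p * (1 - p) = - 1 / p + 1" using p by (simp add: field_simps)
    then have "l powr (1 - p) = R powr (- 1 / p + 1)" unfolding l_def powr_powr by simp
    then have "l powr (1 - p) = l * R" using R(1) by (simp only: powr_add l_def) simp
    then show ?thesis using R(1) by simp
  qed
  finally show ?thesis by (simp add: l_def R_def)
qed

text \<open>The kernel is a probability density on a square of side \<open>2^-k\<close> containing
  \<open>(x, y)\<close>, and within it the two coordinate distances add up to at most
  \<open>2 * 2^-k\<close>.\<close>

lemma pairing_kernel_close:
  assumes "n = - int k"
  shows "norm (g (x, y) - pairing (dyadic_kernel x n) (dyadic_kernel y n)) \<le> A * (2 * (1 / 2) ^ k) powr \<kappa>"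
proof -
  define w where "w z = dyadic_kernel x n (fst z) * dyadic_kernel y n (snd z)" for z
  define r :: real where "r = 2 * (1 / 2) ^ k"
  have pn: "2 powi n = (1 / 2 :: real) ^ k" by (simp add: assms power_int_minus power_one_over inverse_eq_divide)
  have wi: "integrable lborel w" "(LINT z|lborel. w z) = 1"
    unfolding w_def
    by (intro integrable_lborel_prod dyadic_kernel_integral(1))
      (simp only: integral_lborel_prod[OF dyadic_kernel_integral(1) dyadic_kernel_integral(1)] dyadic_kernel_integral(2) mult_1)
  have w0: "0 \<le> w z" for z by (simp add: w_def dyadic_kernel_def)
  have gi: "integrable lborel (\<lambda>z. g z * of_real (w z))"
    using pairing_integrable[OF dyadic_kernel_integral(1) dyadic_kernel_integral(1)] by (simp add: w_def)
  have "g (x, y) - pairing (dyadic_kernel x n) (dyadic_kernel y n) =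
      (LINT z|lborel. g (x, y) * of_real (w z) - g z * of_real (w z))"
    using wi gi unfolding pairing_def w_def[symmetric] by simp
  also have "norm \<dots> \<le> (LINT z|lborel. norm (g (x, y) * of_real (w z) - g z * of_real (w z)))" by simp
  also have "\<dots> \<le> (LINT z|lborel. A * r powr \<kappa> * w z)"
  proof (rule integral_mono_AE)
    show "AE z in lborel. norm (g (x, y) * of_real (w z) - g z * of_real (w z)) \<le> A * r powr \<kappa> * w z"
    proof (rule AE_I2)
      fix z
      have "norm (g (x, y) * of_real (w z) - g z * of_real (w z)) = norm (g (x, y) - g z) * w z"
        using w0[of z] by (simp add: norm_mult left_diff_distrib[symmetric])
      also have "\<dots> \<le> A * r powr \<kappa> * w z"
      proof (cases "w z = 0")
        case False
        then have "fst z \<in> dyadic_at x n" "snd z \<in> dyadic_at y n" by (auto simp: w_def dyadic_kernel_def indicator_def split: if_splits)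
        then have "\<bar>x - fst z\<bar> \<le> 2 powi n" "\<bar>y - snd z\<bar> \<le> 2 powi n"
          using dyadic_at_mem[of x n] dyadic_at_mem[of y n] by (auto simp: dyadic_at_def)
        moreover have "norm ((x, y) - z) \<le> \<bar>x - fst z\<bar> + \<bar>y - snd z\<bar>"
          using norm_Pair_le[of "x - fst z" "y - snd z"] by (cases z) simp
        ultimately have "norm ((x, y) - z) \<le> r" by (simp add: r_def pn)
        then have "A * norm ((x, y) - z) powr \<kappa> \<le> A * r powr \<kappa>"
          using tameD(4)[OF tame] \<kappa> by (intro mult_left_mono powr_mono2) auto
        then show ?thesis using tameD(2)[OF tame, of "(x, y)" z] w0[of z] by (intro mult_right_mono) auto
      qed simp
      finally show "norm (g (x, y) * of_real (w z) - g z * of_real (w z)) \<le> A * r powr \<kappa> * w z" .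
    qed
  qed (use wi gi in auto)
  also have "\<dots> = A * r powr \<kappa>" using wi by simp
  finally show ?thesis by (simp add: r_def)
qed

text \<open>The mixed difference of the four corner averages telescopes into \<open>3 * k\<close>
  times \<open>3 * k\<close> Haar terms. Each is at most \<open>e\<close>, since the values of the
  Haar functions at \<open>x\<close> and \<open>y\<close> cancel the square root of the area. The
  three averages with a long side contribute 2 each to the 6; the fourth is close to
  \<open>g z\<close>.\<close>

lemma norm_le_of_haar_coeffs:
  assumes e: "\<And>I J. I \<in> dyadic_intervals \<Longrightarrow> J \<in> dyadic_intervals \<Longrightarrow>
     norm (haar_coeff g I J) \<le> e * sqrt (measure lebesgue I * measure lebesgue J)"
  shows "norm (g z) \<le> 9 * (real k)\<^sup>2 * e + 6 * (2 ^ k) powr (- 1 / p) + A * (2 * (1 / 2) ^ k) powr \<kappa>"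
proof -
  obtain x y where z: "z = (x, y)" by force
  \<comment> \<open>\<open>?m\<close> equals \<open>2 * k\<close>, written as \<open>?n\<close> plus
    the number of telescoping steps.\<close>
  let ?n = "- int k" and ?m = "- int k + int (3 * k)"
  let ?I = "\<lambda>i. dyadic_at x (?n + int i + 1)" and ?J = "\<lambda>j. dyadic_at y (?n + int j + 1)"
  note ki = dyadic_kernel_integral(1)
  have hi: "integrable lborel (haar (dyadic_at x n))" for x n
    using integrable_haar_Ico[of "2 powi n"] by (simp add: dyadic_at_def)
  have coeff_le: "norm (of_real (haar (?I i) x * haar (?J j) y) * pairing (haar (?I i)) (haar (?J j))) \<le> e" for i j
  proof -
    let ?a = "2 powi (?n + int i + 1) :: real" and ?b = "2 powi (?n + int j + 1) :: real"
    have pos: "?a > 0" "?b > 0" by simp_all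
    have m: "measure lebesgue (?I i) = ?a" "measure lebesgue (?J j) = ?b" by (simp_all add: dyadic_at_def)
    have [measurable]: "haar (?I i) \<in> borel_measurable borel" "haar (?J j) \<in> borel_measurable borel"
      using dyadic_at_grid haar_grid_borel by blast+
    have hc: "haar_coeff g (?I i) (?J j) = pairing (haar (?I i)) (haar (?J j))"
      unfolding haar_coeff_def pairing_def
      by (subst integral_completion)
         (use borel_measurable_integrable[OF pairing_integrable[OF hi hi]] in auto)
    have E: "norm (haar_coeff g (?I i) (?J j)) \<le> e * sqrt (?a * ?b)"
      using e[OF dyadic_at_in dyadic_at_in, of x "?n + int i + 1" y "?n + int j + 1"] unfolding m .
    have "norm (of_real (haar (?I i) x * haar (?J j) y) * pairing (haar (?I i)) (haar (?J j))) \<le>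
        (?a powr (- 1 / 2) * ?b powr (- 1 / 2)) * (e * sqrt (?a * ?b))"
      unfolding norm_mult norm_of_real abs_mult abs_haar_dyadic_at hc[symmetric]
      by (intro mult_left_mono E) auto
    also have "\<dots> = e"
      using pos by (simp add: real_sqrt_mult powr_half_sqrt[symmetric] powr_minus field_simps)
    finally show ?thesis .
  qed
  have T: "pairing (\<lambda>t. dyadic_kernel x ?n t - dyadic_kernel x ?m t) (\<lambda>t. dyadic_kernel y ?n t - dyadic_kernel y ?m t)
     = (\<Sum>i<3 * k. \<Sum>j<3 * k. of_real (haar (?I i) x * haar (?J j) y) * pairing (haar (?I i)) (haar (?J j)))"
    unfolding dyadic_kernel_telescope by (rule pairing_sum) (rule hi)+
  have "norm (pairing (\<lambda>t. dyadic_kernel x ?n t - dyadic_kernel x ?m t) (\<lambda>t. dyadic_kernel y ?n t - dyadic_kernel y ?m t))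
     \<le> (\<Sum>i<3 * k. \<Sum>j<3 * k. e)"
    unfolding T by (intro sum_norm_le) (rule coeff_le)
  also have "\<dots> = 9 * (real k)\<^sup>2 * e" by (simp add: power2_eq_square)
  finally have S: "norm (pairing (dyadic_kernel x ?n) (dyadic_kernel y ?n) - pairing (dyadic_kernel x ?n) (dyadic_kernel y ?m)
      - pairing (dyadic_kernel x ?m) (dyadic_kernel y ?n) + pairing (dyadic_kernel x ?m) (dyadic_kernel y ?m)) \<le> 9 * (real k)\<^sup>2 * e"
    unfolding pairing_diff[OF ki ki ki ki] .
  have B: "norm (pairing (dyadic_kernel x a) (dyadic_kernel y b)) \<le> 2 * (2 ^ k) powr (- 1 / p)"
    if "a + b \<ge> int k" for a b
  proof -
    have "(2::real) ^ k \<le> 2 powi (a + b)"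
      using power_int_increasing[OF that, of "2::real"] by simp
    then have "(2 powi (a + b)) powr (- 1 / p) \<le> (2 ^ k :: real) powr (- 1 / p)"
      using p by (intro powr_mono2') auto
    then show ?thesis using pairing_kernel_le[of x a y b] by linarith
  qed
  have tri: "norm (a + b + (c + d - f)) \<le> norm a + norm b + (norm c + norm d + norm f)" for a b c d f :: complex
    using norm_triangle_ineq[of "a + b" "c + d - f"] norm_triangle_ineq[of a b]
      norm_triangle_ineq4[of "c + d" f] norm_triangle_ineq[of c d] by linarith
  have le: "norm z \<le> u + 6 * w + v" if "norm (z - a) \<le> v" "norm (a - b - c + d) \<le> u"
    "norm b \<le> 2 * w" "norm c \<le> 2 * w" "norm d \<le> 2 * w" for z a b c d :: complex and u v w
  proof -
    have "z = (z - a) + (a - b - c + d) + (b + c - d)" by simp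
    then have "norm z \<le> norm (z - a) + norm (a - b - c + d) + (norm b + norm c + norm d)"
      using tri[of "z - a" "a - b - c + d" b c d] by metis
    then show ?thesis using that by linarith
  qed
  \<comment> \<open>Exponents of the areas of the three rectangles with a long side. The first two
    are exactly \<open>k\<close>, which is what fixes the far scale.\<close>
  have nm: "int k \<le> ?n + ?m" "int k \<le> ?m + ?n" "int k \<le> ?m + ?m" by simp_all
  show ?thesis
    unfolding z by (rule le[OF pairing_kernel_close[OF refl] S B[OF nm(1)] B[OF nm(2)] B[OF nm(3)]])
qed

end

text \<open>Brings the exponential errors into the form \<open>1 / k^2\<close>, which the choice of
  \<open>k\<close> compares with \<open>sqrt e\<close>.\<close>

lemma exp_decay_square:
  assumes "0 < c" "1 \<le> k"
  shows "exp (- c * real k) \<le> 2 / (c\<^sup>2 * (real k)\<^sup>2)"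
proof -
  have pos: "0 \<le> c * real k" "0 < (c * real k)\<^sup>2" using assms by auto
  have "(c * real k)\<^sup>2 / 2 \<le> exp (c * real k)"
    using exp_lower_Taylor_quadratic[OF pos(1)] pos by linarith
  then have "exp (- (c * real k)) \<le> 2 / (c * real k)\<^sup>2"
    using assms by (simp add: exp_minus field_simps)
  then show ?thesis by (simp add: power_mult_distrib)
qed

lemma tame_sup_le:
  assumes "0 < \<kappa>" "\<kappa> \<le> 1" "1 < p"
  shows "\<exists>C\<ge>0. \<forall>g e. tame A \<kappa> p g \<longrightarrow> 0 < e \<longrightarrow> e \<le> 1 \<longrightarrow>
     (\<forall>I\<in>dyadic_intervals. \<forall>J\<in>dyadic_intervals.
        norm (haar_coeff g I J) \<le> e * sqrt (measure lebesgue I * measure lebesgue J)) \<longrightarrow>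
     (\<forall>z. norm (g z) \<le> C * sqrt e)"
proof -
  define c1 where "c1 = ln 2 / p"
  define c2 where "c2 = \<kappa> * ln 2"
  have c: "c1 > 0" "c2 > 0" using assms by (simp_all add: c1_def c2_def)
  \<comment> \<open>36 is \<open>9 * 4\<close>, the 4 being that of \<open>K1\<close>; the factor 2
    next to \<open>\<bar>A\<bar>\<close> bounds \<open>2 powr \<kappa>\<close>.\<close>
  define C where "C = 36 + 6 * (2 / c1\<^sup>2) + \<bar>A\<bar> * 2 * (2 / c2\<^sup>2)"
  show ?thesis
  proof (intro exI[of _ C] conjI allI impI)
    show "0 \<le> C" by (simp add: C_def)
    fix g :: "real \<times> real \<Rightarrow> complex" and e :: real and z
    assume t: "tame A \<kappa> p g" and e: "0 < e" "e \<le> 1"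
      and H: "\<forall>I\<in>dyadic_intervals. \<forall>J\<in>dyadic_intervals.
        norm (haar_coeff g I J) \<le> e * sqrt (measure lebesgue I * measure lebesgue J)"
    interpret tame_fun A \<kappa> p g using t assms by unfold_locales
    \<comment> \<open>For \<open>k\<close> comparable to \<open>q\<close>, both
      \<open>k^2 * e\<close> and \<open>1 / k^2\<close> are of size \<open>sqrt e\<close>.\<close>
    define q where "q = e powr (- 1 / 4)"
    have q: "q \<ge> 1" using e by (simp add: q_def ge_one_powr_ge_zero powr_minus_divide powr_le1 field_simps)
    define k where "k = nat \<lceil>q\<rceil>"
    \<comment> \<open>Rounding up at most doubles \<open>q\<close>, because \<open>e \<le> 1\<close>
      gives \<open>q \<ge> 1\<close>.\<close>
    have k: "1 \<le> k" "q \<le> real k" "real k \<le> 2 * q" using q by (auto simp: k_def) linarith+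
    have q2: "q\<^sup>2 * sqrt e = 1"
      unfolding q_def using e by (simp add: powr_half_sqrt[symmetric] power2_eq_square powr_add[symmetric])
    have s: "sqrt e > 0" "e = sqrt e * sqrt e" using e by auto
    have "(real k)\<^sup>2 * e \<le> (2 * q)\<^sup>2 * e" using k e by (intro mult_right_mono power_mono) auto
    also have "\<dots> = 4 * (q\<^sup>2 * sqrt e) * sqrt e" using s by (simp add: power_mult_distrib mult.assoc)
    finally have K1: "(real k)\<^sup>2 * e \<le> 4 * sqrt e" by (simp add: q2)
    have K2: "1 / (real k)\<^sup>2 \<le> sqrt e"
    proof -
      have "1 / (real k)\<^sup>2 \<le> 1 / q\<^sup>2" using k q by (intro divide_left_mono power_mono) auto
      also have "\<dots> = sqrt e" using q2 q by (simp add: field_simps)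
      finally show ?thesis .
    qed
    have "(2 ^ k :: real) powr (- 1 / p) = exp (- c1 * real k)"
      by (simp add: powr_def ln_realpow c1_def)
    also have "\<dots> \<le> 2 / c1\<^sup>2 * (1 / (real k)\<^sup>2)" using exp_decay_square[OF c(1) k(1)] by simp
    also have "\<dots> \<le> 2 / c1\<^sup>2 * sqrt e" using K2 by (intro mult_left_mono) auto
    finally have D1: "(2 ^ k :: real) powr (- 1 / p) \<le> 2 / c1\<^sup>2 * sqrt e" .
    have "(2 * (1 / 2) ^ k) powr \<kappa> = 2 powr \<kappa> * exp (- c2 * real k)"
    proof -
      have "(2 * (1 / 2) ^ k) powr \<kappa> = 2 powr \<kappa> * ((1 / 2) ^ k) powr \<kappa>" by (simp add: powr_mult)
      also have "((1 / 2 :: real) ^ k) powr \<kappa> = exp (\<kappa> * (real k * ln (1 / 2)))"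
        by (simp add: powr_def ln_realpow)
      also have "\<kappa> * (real k * ln (1 / 2)) = - c2 * real k" by (simp add: c2_def ln_div)
      finally show ?thesis .
    qed
    also have "\<dots> \<le> 2 * (2 / c2\<^sup>2 * (1 / (real k)\<^sup>2))"
      using exp_decay_square[OF c(2) k(1)] assms powr_mono[of \<kappa> 1 2] by (intro mult_mono) auto
    also have "\<dots> \<le> 2 * (2 / c2\<^sup>2 * sqrt e)" using K2 by (intro mult_left_mono) auto
    finally have D2: "(2 * (1 / 2) ^ k) powr \<kappa> \<le> 2 * (2 / c2\<^sup>2 * sqrt e)" .
    have "norm (g z) \<le> 9 * (real k)\<^sup>2 * e + 6 * (2 ^ k) powr (- 1 / p) + A * (2 * (1 / 2) ^ k) powr \<kappa>"
      using H by (intro norm_le_of_haar_coeffs) auto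
    also have "\<dots> \<le> 9 * (4 * sqrt e) + 6 * (2 / c1\<^sup>2 * sqrt e) + \<bar>A\<bar> * (2 * (2 / c2\<^sup>2 * sqrt e))"
    proof (intro add_mono)
      show "9 * (real k)\<^sup>2 * e \<le> 9 * (4 * sqrt e)"
        using mult_left_mono[OF K1, of 9] by (simp only: mult.assoc)
      show "6 * (2 ^ k) powr (- 1 / p) \<le> 6 * (2 / c1\<^sup>2 * sqrt e)"
        using D1 by (intro mult_left_mono) auto
      show "A * (2 * (1 / 2) ^ k) powr \<kappa> \<le> \<bar>A\<bar> * (2 * (2 / c2\<^sup>2 * sqrt e))"
        using D2 by (intro mult_mono) auto
    qed
    also have "\<dots> = C * sqrt e" by (simp add: C_def algebra_simps)
    finally show "norm (g z) \<le> C * sqrt e" .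
  qed
qed

section \<open>Haar coefficients bounded by the product BMO norm\<close>

lemma ennreal_sqrt_leD:
  assumes "ennreal_sqrt x \<le> ennreal B" "0 \<le> B"
  shows "x \<le> ennreal (B\<^sup>2)"
proof (cases "x = \<infinity>")
  case False
  then have "sqrt (enn2real x) \<le> B"
    using assms by (simp add: ennreal_sqrt_def)
  then have "enn2real x \<le> B\<^sup>2" using assms(2) by (simp add: sqrt_le_D)
  then have "ennreal (enn2real x) \<le> ennreal (B\<^sup>2)" by (rule ennreal_leI)
  then show ?thesis using False by (metis ennreal_enn2real less_top infinity_ennreal_def)
qed (use assms in \<open>simp add: ennreal_sqrt_def top_unique\<close>)

lemma bmo_norm_nonneg: "0 \<le> bmo_norm d F"
  by (simp add: bmo_norm_def)

text \<open>\<open>enn2real\<close> sends infinity to 0, so finiteness of the supremum has to be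
  checked first; it is a supremum of finitely many finite norms.\<close>

lemma dyadic_bmo_norm_le_bmo_norm:
  assumes "F \<in> bmo d"
  shows "dyadic_bmo_norm 0 0 F \<le> ennreal (bmo_norm d F)"
proof -
  let ?S = "SUP (a, b) \<in> {0, d} \<times> {0, d}. dyadic_bmo_norm a b F"
  have "dyadic_bmo_norm a b F < \<infinity>" if "a \<in> {0, d}" "b \<in> {0, d}" for a b
    using assms that unfolding bmo_def dyadic_bmo_def by blast
  then have "?S < \<infinity>"
    by (subst finite_Sup_less_iff) auto
  moreover have "dyadic_bmo_norm 0 0 F \<le> ?S"
    by (rule SUP_upper2[of "(0, 0)"]) auto
  ultimately show ?thesis by (simp add: bmo_norm_def)
qed

text \<open>The half-open rectangle is not an admissible open set. It is enclosed in open rectangles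
  \<open>U\<close> of area \<open>(l + t) * (m + t)\<close>, a single term of the sum is kept, and
  \<open>t\<close> tends to 0.\<close>

lemma haar_coeff_le_bmo_norm:
  assumes F: "F \<in> bmo d" and I: "I \<in> dyadic_intervals" and J: "J \<in> dyadic_intervals"
  shows "norm (haar_coeff F I J) \<le> bmo_norm d F * sqrt (measure lebesgue I * measure lebesgue J)"
proof -
  have dy: "\<exists>a l. 0 < l \<and> K = {a..<a + l}" if "K \<in> dyadic_intervals" for K :: "real set"
  proof -
    obtain k j where "K = {2 powi k * of_int j ..< 2 powi k * (of_int j + 1)}"
      using \<open>K \<in> dyadic_intervals\<close> unfolding dyadic_intervals_def by blast
    then have "K = {2 powi k * of_int j ..< 2 powi k * of_int j + 2 powi k}" by (simp add: algebra_simps)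
    then show ?thesis by (intro exI[of _ "2 powi k * of_int j"] exI[of _ "2 powi k"]) simp
  qed
  obtain a l where I': "0 < l" "I = {a..<a + l}" using dy[OF I] by blast
  obtain b m where J': "0 < m" "J = {b..<b + m}" using dy[OF J] by blast
  define N where "N = bmo_norm d F"
  define c where "c = norm (haar_coeff F I J)"
  have N: "0 \<le> N" by (simp add: N_def bmo_norm_nonneg)
  have bound: "c\<^sup>2 \<le> N\<^sup>2 * ((l + t) * (m + t))" if t: "0 < t" for t
  proof -
    define U where "U = box (a - t, b - t) (a + l, b + m)"
    have U_eq: "U = {a - t<..<a + l} \<times> {b - t<..<b + m}" unfolding U_def by (auto simp: mem_box Basis_prod_def)
    have pos: "0 < (l + t) * (m + t)" using t I' J' by simp
    have mU: "emeasure lebesgue U = ennreal ((l + t) * (m + t))"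
      unfolding U_def using t I' J'
      by (subst emeasure_completion) (auto simp: emeasure_lborel_box_eq Basis_prod_def prod.union_disjoint prod.reindex algebra_simps)
    have sub: "I \<times> J \<subseteq> U" unfolding U_eq using t I' J' by auto
    let ?R = "{(I, J). I \<in> dyadic_grid 0 \<and> J \<in> dyadic_grid 0 \<and> I \<times> J \<subseteq> U}"
    let ?T = "\<Sum>\<^sub>\<infinity>(I, J) \<in> ?R. ennreal ((norm (haar_coeff F I J))\<^sup>2)"
    have IJ: "(I, J) \<in> ?R" using I J sub by (simp add: dyadic_grid_def)
    have "infsum (\<lambda>(I, J). ennreal ((norm (haar_coeff F I J))\<^sup>2)) {(I, J)} \<le> ?T"
      using IJ by (intro infsum_mono_neutral) (auto intro!: nonneg_summable_on_complete)
    then have "ennreal (c\<^sup>2) \<le> ?T" by (simp add: c_def)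
    then have "ennreal (c\<^sup>2) / emeasure lebesgue U \<le> ?T / emeasure lebesgue U" by (rule divide_right_mono_ennreal)
    also have "\<dots> \<le> ennreal (N\<^sup>2)"
    proof (rule ennreal_sqrt_leD[OF _ N])
      have "ennreal_sqrt (?T / emeasure lebesgue U) \<le> dyadic_bmo_norm 0 0 F"
        unfolding dyadic_bmo_norm_def
      proof (rule SUP_upper)
        show "U \<in> {U. open U \<and> U \<noteq> {} \<and> emeasure lebesgue U < \<infinity>}"
          using sub I' J' mU by (auto simp: U_def open_box)
      qed
      then show "ennreal_sqrt (?T / emeasure lebesgue U) \<le> ennreal N"
        using dyadic_bmo_norm_le_bmo_norm[OF F] unfolding N_def by simp
    qed
    finally have "c\<^sup>2 / ((l + t) * (m + t)) \<le> N\<^sup>2"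
      using pos N by (simp add: mU divide_ennreal)
    then show ?thesis using pos by (simp add: field_simps)
  qed
  have "((\<lambda>t. N\<^sup>2 * ((l + t) * (m + t))) \<longlongrightarrow> N\<^sup>2 * ((l + 0) * (m + 0))) (at_right 0)"
    by (intro tendsto_intros)
  moreover have "\<forall>\<^sub>F t in at_right 0. c\<^sup>2 \<le> N\<^sup>2 * ((l + t) * (m + t))"
    using bound by (auto simp: eventually_at_right_field intro: exI[of _ 1])
  ultimately have cN: "c\<^sup>2 \<le> N\<^sup>2 * (l * m)"
    using tendsto_lowerbound by fastforce
  have sq: "(N * sqrt (l * m))\<^sup>2 = N\<^sup>2 * (l * m)"
    using I'(1) J'(1) by (simp add: power_mult_distrib)
  have "c \<le> N * sqrt (l * m)"
  proof (rule power2_le_imp_le)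
    show "c\<^sup>2 \<le> (N * sqrt (l * m))\<^sup>2" unfolding sq by (rule cN)
    show "0 \<le> N * sqrt (l * m)" using N I'(1) J'(1) by (intro mult_nonneg_nonneg real_sqrt_ge_zero) simp_all
  qed
  moreover have "measure lebesgue I = l" "measure lebesgue J = m" using I' J' by simp_all
  ultimately show ?thesis by (simp add: c_def N_def)
qed

section \<open>Integrals of a Hoelder function along lines and rays\<close>

lemma norm_Pair_snd: "norm (0::real, s::real) = \<bar>s\<bar>" by simp

context tame_fun
begin

text \<open>Where \<open>g\<close> has modulus \<open>a\<close>, it keeps modulus
  \<open>a / 2\<close> on a segment of length proportional to \<open>a powr (1 / \<kappa>)\<close>.
  The integral of the \<open>p\<close>-th power over this segment is therefore of order
  \<open>a powr (p + 1 / \<kappa>)\<close>.\<close>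

definition line_exp :: real where "line_exp = p + 1 / \<kappa>"

definition line_const :: real where "line_const = (2 * (A + 1)) powr (1 / \<kappa>) * 2 powr p"

lemma powr_le_vertical_integral:
  "ennreal (norm (g w) powr line_exp) \<le>
     ennreal line_const * (\<integral>\<^sup>+s. ennreal (norm (g (w + (0, s))) powr p) \<partial>lborel)"
proof (cases "g w = 0")
  case False
  define a where "a = norm (g w)"
  have a: "0 < a" using False by (simp add: a_def)
  \<comment> \<open>\<open>A\<close> may be 0 and \<rho> divides by this number.\<close>
  define B where "B = A + 1"
  have B: "0 < B" "A \<le> B" using tameD(4)[OF tame] by (auto simp: B_def)
  \<comment> \<open>Chosen so that \<open>B * \<rho> powr \<kappa>\<close> is
    \<open>a / 2\<close>.\<close>
  define \<rho> where "\<rho> = (a / (2 * B)) powr (1 / \<kappa>)"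
  have \<rho>: "0 < \<rho>" using a B by (simp add: \<rho>_def)
  have half: "a / 2 \<le> norm (g (w + (0, s)))" if "s \<in> {0..\<rho>}" for s
  proof -
    have "norm (g (w + (0, s)) - g w) \<le> A * \<bar>s\<bar> powr \<kappa>"
      using tameD(2)[OF tame, of "w + (0, s)" w] by (simp add: norm_Pair_snd)
    also have "\<dots> \<le> B * \<rho> powr \<kappa>"
      using that B \<kappa> by (intro mult_mono powr_mono2) auto
    also have "\<dots> = a / 2"
      unfolding \<rho>_def powr_powr using \<kappa> a B by simp
    finally show ?thesis
      using norm_triangle_ineq2[of "g w" "g w - g (w + (0, s))"] by (simp add: a_def norm_minus_commute)
  qed
  have "ennreal (\<rho> * (a / 2) powr p) = (\<integral>\<^sup>+s. ennreal ((a / 2) powr p) * indicator {0..\<rho>} s \<partial>lborel)"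
    using \<rho> by (subst nn_integral_cmult) (simp_all add: ennreal_mult' mult.commute)
  also have "\<dots> \<le> (\<integral>\<^sup>+s. ennreal (norm (g (w + (0, s))) powr p) \<partial>lborel)"
    using half a p by (intro nn_integral_mono) (auto simp: indicator_def intro!: ennreal_leI powr_mono2)
  finally have le: "ennreal (\<rho> * (a / 2) powr p) \<le> (\<integral>\<^sup>+s. ennreal (norm (g (w + (0, s))) powr p) \<partial>lborel)" .
  have "line_const * (\<rho> * (a / 2) powr p) = a powr line_exp"
  proof -
    have "\<rho> * (2 * B) powr (1 / \<kappa>) = a powr (1 / \<kappa>)"
      unfolding \<rho>_def using a B by (simp add: powr_divide)
    moreover have "(a / 2) powr p * 2 powr p = a powr p" using a by (simp add: powr_divide)
    moreover have "line_const * (\<rho> * (a / 2) powr p) = (\<rho> * (2 * B) powr (1 / \<kappa>)) * ((a / 2) powr p * 2 powr p)"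
      by (simp add: line_const_def B_def)
    ultimately show ?thesis by (simp add: line_exp_def powr_add)
  qed
  then have "ennreal (a powr line_exp) = ennreal line_const * ennreal (\<rho> * (a / 2) powr p)"
    by (metis ennreal_mult' line_const_def mult_nonneg_nonneg powr_ge_zero)
  also have "\<dots> \<le> ennreal line_const * (\<integral>\<^sup>+s. ennreal (norm (g (w + (0, s))) powr p) \<partial>lborel)"
    by (intro mult_left_mono le) simp
  finally show ?thesis by (simp add: a_def)
qed simp

text \<open>The vertical lines through the points of a line that is not too steep sweep out the
  plane. The Jacobian is the first coordinate of \<open>v\<close>, at least \<open>1 / 2\<close> in
  modulus; hence the factor 2.\<close>

lemma line_integral_aux:
  assumes v: "1 / 2 \<le> \<bar>fst v\<bar>"
  shows "(\<integral>\<^sup>+t. ennreal (norm (g (z + t *\<^sub>R v)) powr line_exp) \<partial>lborel) \<le> ennreal (2 * line_const)"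
proof -
  define h where "h w = ennreal (norm (g w) powr p)" for w
  have [measurable]: "h \<in> borel_measurable borel" unfolding h_def[abs_def] by measurable
  have hp [measurable]: "(\<lambda>w. h w) \<in> borel_measurable (borel \<Otimes>\<^sub>M borel)" by (simp add: borel_prod)
  obtain z1 z2 v1 v2 where zv: "z = (z1, z2)" "v = (v1, v2)" by fastforce
  have v1: "v1 \<noteq> 0" "1 / 2 \<le> \<bar>v1\<bar>" using v zv by auto
  have c0: "0 \<le> line_const" by (simp add: line_const_def)
  define H where "H x = (\<integral>\<^sup>+s. h (x, s) \<partial>lborel)" for x
  have [measurable]: "H \<in> borel_measurable borel" unfolding H_def[abs_def] by measurable
  have inner: "(\<integral>\<^sup>+s. h (z + t *\<^sub>R v + (0, s)) \<partial>lborel) = H (z1 + v1 * t)" for t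
  proof -
    have "H (z1 + v1 * t) = ennreal \<bar>1\<bar> * (\<integral>\<^sup>+s. h (z1 + v1 * t, (z2 + t * v2) + 1 * s) \<partial>lborel)"
      unfolding H_def by (rule nn_integral_real_affine) auto
    then show ?thesis by (simp add: zv mult.commute)
  qed
  have "(\<integral>\<^sup>+t. ennreal (norm (g (z + t *\<^sub>R v)) powr line_exp) \<partial>lborel) \<le>
      (\<integral>\<^sup>+t. ennreal line_const * H (z1 + v1 * t) \<partial>lborel)"
    using powr_le_vertical_integral unfolding inner[symmetric] h_def by (intro nn_integral_mono) auto
  also have "\<dots> = ennreal line_const * (\<integral>\<^sup>+t. H (z1 + v1 * t) \<partial>lborel)"
    by (intro nn_integral_cmult) measurable
  also have "\<dots> \<le> ennreal line_const * 2"
  proof -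
    have "ennreal \<bar>v1\<bar> * (\<integral>\<^sup>+t. H (z1 + v1 * t) \<partial>lborel) = (\<integral>\<^sup>+x. H x \<partial>lborel)"
      using v1 by (intro nn_integral_real_affine[symmetric]) auto
    also have "\<dots> = (\<integral>\<^sup>+w. h w \<partial>lborel)"
      unfolding H_def by (rule nn_integral_lborel_prod(1)[symmetric]) measurable
    also have "\<dots> \<le> 1" unfolding h_def using tameD(3)[OF tame] .
    finally have le: "ennreal \<bar>v1\<bar> * (\<integral>\<^sup>+t. H (z1 + v1 * t) \<partial>lborel) \<le> 1" .
    have "(\<integral>\<^sup>+t. H (z1 + v1 * t) \<partial>lborel) \<le> ennreal (2 * \<bar>v1\<bar>) * (\<integral>\<^sup>+t. H (z1 + v1 * t) \<partial>lborel)"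
    proof -
      have "1 \<le> ennreal (2 * \<bar>v1\<bar>)" using v1 by (simp add: ennreal_leI flip: ennreal_1)
      then show ?thesis using mult_right_mono[of 1 "ennreal (2 * \<bar>v1\<bar>)"] by fastforce
    qed
    also have "\<dots> = 2 * (ennreal \<bar>v1\<bar> * (\<integral>\<^sup>+t. H (z1 + v1 * t) \<partial>lborel))"
      by (simp add: ennreal_mult' mult.assoc)
    also have "\<dots> \<le> 2 * 1" by (intro mult_left_mono le) simp
    finally have "(\<integral>\<^sup>+t. H (z1 + v1 * t) \<partial>lborel) \<le> 2" by simp
    then show ?thesis by (rule mult_left_mono) simp
  qed
  finally show ?thesis using c0 by (simp add: ennreal_mult' mult.commute)
qed

text \<open>For steep directions the roles of the coordinates are exchanged: the class of functions
  is symmetric.\<close>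

lemma tame_swap: "tame A \<kappa> p (\<lambda>z. g (prod.swap z))"
  unfolding tame_def
proof (intro conjI allI)
  have m: "g \<in> borel_measurable borel" by measurable
  have [measurable]: "(\<lambda>z. g z) \<in> borel_measurable (borel \<Otimes>\<^sub>M borel)"
    using m by (simp only: borel_prod)
  show "norm (g (prod.swap z)) \<le> A" for z by (rule tameD(1)[OF tame])
  show "norm (g (prod.swap z) - g (prod.swap w)) \<le> A * norm (z - w) powr \<kappa>" for z w
  proof -
    have "norm (prod.swap z - prod.swap w) = norm (z - w)"
      by (simp add: norm_prod_def add.commute)
    then show ?thesis using tameD(2)[OF tame, of "prod.swap z" "prod.swap w"] by simp
  qed
  have gs: "(\<lambda>z. ennreal (norm (g (prod.swap z)) powr p)) \<in> borel_measurable borel"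
    unfolding borel_prod[symmetric] prod.swap_def by measurable
  have "(\<integral>\<^sup>+z. ennreal (norm (g (prod.swap z)) powr p) \<partial>lborel) = (\<integral>\<^sup>+z. ennreal (norm (g z) powr p) \<partial>lborel)"
    using nn_integral_lborel_prod(1)[OF gs] nn_integral_lborel_prod(2)[of "\<lambda>z. ennreal (norm (g z) powr p)"] by simp
  then show "(\<integral>\<^sup>+z. ennreal (norm (g (prod.swap z)) powr p) \<partial>lborel) \<le> 1" using tameD(3)[OF tame] by simp
qed

end

lemma (in tame_fun) line_integral_le:
  assumes v: "norm v = 1"
  shows "(\<integral>\<^sup>+t. ennreal (norm (g (z + t *\<^sub>R v)) powr line_exp) \<partial>lborel) \<le> ennreal (2 * line_const)"
proof (cases "1 / 2 \<le> \<bar>fst v\<bar>")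
  case True
  then show ?thesis by (rule line_integral_aux)
next
  case False
  have "1 / 2 \<le> \<bar>snd v\<bar>"
  proof (rule ccontr)
    assume "\<not> 1 / 2 \<le> \<bar>snd v\<bar>"
    then have "norm v < 1 / 2 + 1 / 2" using False norm_Pair_le[of "fst v" "snd v"] by simp
    then show False using v by simp
  qed
  interpret swap: tame_fun A \<kappa> p "\<lambda>z. g (prod.swap z)"
    using tame_swap \<kappa> p by unfold_locales
  have "g (z + t *\<^sub>R v) = g (prod.swap (prod.swap z + t *\<^sub>R prod.swap v))" for t
    by (cases z; cases v) simp
  then show ?thesis
    using swap.line_integral_aux[of "prod.swap v" "prod.swap z"] \<open>1 / 2 \<le> \<bar>snd v\<bar>\<close>
    by (simp add: prod.swap_def)
qed

context tame_fun
begin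

text \<open>Subtracting \<open>g z\<close> for \<open>r \<le> 1\<close> only makes the integral over a single ray converge. The
  correction cancels between opposite rays, and against any \<open>\<Omega>\<close> of mean zero.\<close>

definition ray_kernel :: "real \<times> real \<Rightarrow> real \<times> real \<Rightarrow> real \<Rightarrow> complex" where
  "ray_kernel z v r = indicator {0<..} r *\<^sub>R ((g (z - r *\<^sub>R v) - indicator {..1} r *\<^sub>R g z) / of_real r)"

definition ray_integral :: "real \<times> real \<Rightarrow> real \<times> real \<Rightarrow> complex" where
  "ray_integral z v = (LINT r|lborel. ray_kernel z v r)"

text \<open>The summands bound three integrals: of
  \<open>sqrt (2 * A) * r powr (\<kappa> / 2 - 1)\<close> up to 1, of the power
  \<open>line_exp\<close> of \<open>norm g\<close> along the line, and of a negative power of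
  \<open>r\<close> beyond 1. The constant depends on \<open>A\<close>, \<kappa> and \<open>p\<close>
  only, hence not on \<open>g\<close>.\<close>

definition ray_const :: real where
  "ray_const = sqrt (2 * A) * (2 / \<kappa>) + 2 * line_const + (2 * line_exp - 1)"

lemma line_exp_gt_1: "1 < line_exp"
  using p \<kappa> by (simp add: line_exp_def add_pos_nonneg less_le_trans)

lemma ray_const_nonneg: "0 \<le> ray_const"
  using tameD(4)[OF tame] \<kappa> line_exp_gt_1 by (simp add: ray_const_def line_const_def)

text \<open>The difference is at most \<open>2 * m\<close> and at most
  \<open>A * r powr \<kappa>\<close>. The geometric mean of these bounds yields the factor
  \<open>sqrt m\<close> and leaves a power of \<open>r\<close> that is still integrable at 0 after
  division by \<open>r\<close>.\<close>

lemma ray_kernel_near: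
  assumes m: "\<And>z. norm (g z) \<le> m" and v: "norm v = 1" and r: "0 < r" "r \<le> 1"
  shows "norm (ray_kernel z v r) \<le> sqrt m * (sqrt (2 * A) * r powr (\<kappa> / 2 - 1))"
proof -
  define d where "d = norm (g (z - r *\<^sub>R v) - g z)"
  have A: "0 \<le> A" by (rule tameD(4)[OF tame])
  have m0: "0 \<le> m" using m[of z] norm_ge_zero order_trans by blast
  have "d \<le> 2 * m" unfolding d_def using m[of z] m[of "z - r *\<^sub>R v"] norm_triangle_ineq4 order_trans
    by (smt (verit))
  moreover have "d \<le> A * r powr \<kappa>" unfolding d_def using tameD(2)[OF tame, of "z - r *\<^sub>R v" z] v r by simp
  ultimately have "d * d \<le> (2 * m) * (A * r powr \<kappa>)" using m0 by (intro mult_mono) (auto simp: d_def)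
  then have "d \<le> sqrt ((2 * m) * (A * r powr \<kappa>))" by (intro real_le_rsqrt) (simp add: power2_eq_square)
  also have "\<dots> = sqrt m * sqrt (2 * A) * r powr (\<kappa> / 2)"
    using r by (simp add: real_sqrt_mult powr_half_sqrt[symmetric] powr_powr)
  finally have "d / r \<le> sqrt m * sqrt (2 * A) * (r powr (\<kappa> / 2) / r)" using r by (simp add: field_simps)
  moreover have "r powr (\<kappa> / 2) / r = r powr (\<kappa> / 2 - 1)" using r by (simp add: powr_diff)
  ultimately show ?thesis using r by (simp add: ray_kernel_def norm_divide d_def)
qed

text \<open>Write \<open>a\<close> for the modulus of \<open>g\<close>. One square root of
  \<open>a\<close> is given up to \<open>sqrt m\<close>; Young's inequality with exponent
  \<open>2 * line_exp\<close> is applied to the other one times \<open>1 / r\<close>. The first term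
  is then integrable along lines, and the conjugate exponent of \<open>1 / r\<close> exceeds
  1.\<close>

lemma ray_kernel_far:
  assumes m: "\<And>z. norm (g z) \<le> m" and r: "1 < r"
  shows "norm (ray_kernel z v r) \<le> sqrt m * (norm (g (z + r *\<^sub>R (- v))) powr line_exp + r powr (- (2 * line_exp) / (2 * line_exp - 1)))"
proof -
  define a where "a = norm (g (z + r *\<^sub>R (- v)))"
  define q where "q = 2 * line_exp"
  have q: "q > 1" using line_exp_gt_1 by (simp add: q_def)
  have a: "0 \<le> a" "a \<le> m" using m by (auto simp: a_def)
  have "norm (ray_kernel z v r) = a / r" using r by (simp add: ray_kernel_def norm_divide a_def)
  also have "a / r = sqrt a * (sqrt a * (1 / r))" using a by simp
  also have "sqrt a * (1 / r) \<le> sqrt a powr q / q + (1 / r) powr (q / (q - 1)) / (q / (q - 1))"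
    using a r q by (intro Youngs_inequality) (auto simp: field_simps)
  also have "\<dots> \<le> sqrt a powr q + (1 / r) powr (q / (q - 1))"
  proof -
    have d: "x / c \<le> x" if "0 \<le> x" "1 \<le> c" for x c :: real
      using that mult_left_mono[of 1 c x] by (simp add: divide_le_eq)
    show ?thesis using q by (intro add_mono d) (auto simp: field_simps)
  qed
  also have "sqrt a powr q = a powr line_exp" using a by (simp add: powr_half_sqrt[symmetric] powr_powr q_def)
  also have "(1 / r) powr (q / (q - 1)) = r powr (- q / (q - 1))" using r by (simp add: powr_divide powr_minus_divide)
  finally have "norm (ray_kernel z v r) \<le> sqrt a * (a powr line_exp + r powr (- q / (q - 1)))"
    using a by (simp add: mult_left_mono)
  also have "\<dots> \<le> sqrt m * (a powr line_exp + r powr (- q / (q - 1)))"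
    using a by (intro mult_right_mono) auto
  finally show ?thesis by (simp add: a_def q_def)
qed

lemma ray_kernel_borel [measurable]: "(\<lambda>x. ray_kernel (fst x) (fst (snd x)) (snd (snd x))) \<in> borel_measurable borel"
proof -
  have c: "(\<lambda>x::(real \<times> real) \<times> (real \<times> real) \<times> real. fst x - snd (snd x) *\<^sub>R fst (snd x)) \<in> borel_measurable borel"
    by (intro borel_measurable_continuous_onI continuous_intros)
  have s: "(\<lambda>x::(real \<times> real) \<times> (real \<times> real) \<times> real. snd (snd x)) \<in> borel_measurable borel"
    "(\<lambda>x::(real \<times> real) \<times> (real \<times> real) \<times> real. fst x) \<in> borel_measurable borel"
    by (intro borel_measurable_continuous_onI continuous_intros)+
  note [measurable] = measurable_compose[OF c g_borel] measurable_compose[OF s(2) g_borel] s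
    measurable_compose[OF s(1), of "indicator {0<..} :: real \<Rightarrow> real" borel] measurable_compose[OF s(1), of "indicator {..1} :: real \<Rightarrow> real" borel]
  show ?thesis unfolding ray_kernel_def by measurable
qed

text \<open>The sup bound \<open>m\<close> is kept apart from \<open>A\<close>: it is the quantity
  that becomes small with the Haar coefficients.\<close>

lemma nn_integral_ray_kernel_le:
  assumes m: "\<And>z. norm (g z) \<le> m" and v: "norm v = 1"
  shows "(\<integral>\<^sup>+r. ennreal (norm (ray_kernel z v r)) \<partial>lborel) \<le> ennreal (sqrt m * ray_const)"
proof -
  \<comment> \<open>The exponent conjugate to \<open>2 * line_exp\<close>. The integral of
    \<open>r powr (- \<beta>)\<close> beyond 1 is \<open>1 / (\<beta> - 1)\<close>, the third
    summand of \<open>ray_const\<close>.\<close>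
  define \<beta> where "\<beta> = 2 * line_exp / (2 * line_exp - 1)"
  have q: "2 * line_exp - 1 > 0" using line_exp_gt_1 by simp
  have \<beta>: "\<beta> > 1" "1 / (\<beta> - 1) = 2 * line_exp - 1" using q by (auto simp: \<beta>_def field_simps)
  have A: "0 \<le> A" by (rule tameD(4)[OF tame])
  have m0: "0 \<le> m" using m[of z] norm_ge_zero order_trans by blast
  define n1 where "n1 r = ennreal (r powr (\<kappa> / 2 - 1)) * indicator {0..1} r" for r :: real
  define n2 where "n2 r = ennreal (norm (g (z + r *\<^sub>R (- v))) powr line_exp)" for r :: real
  define n3 where "n3 r = ennreal (r powr (- \<beta>)) * indicator {1..} r" for r :: real
  have [measurable]: "(\<lambda>r. g (z + r *\<^sub>R (- v))) \<in> borel_measurable borel"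
    by (rule measurable_compose[OF _ g_borel]) (intro borel_measurable_continuous_onI continuous_intros)
  have [measurable]: "n1 \<in> borel_measurable borel" "n2 \<in> borel_measurable borel" "n3 \<in> borel_measurable borel"
    unfolding n1_def[abs_def] n2_def[abs_def] n3_def[abs_def] by measurable
  have i1: "(\<integral>\<^sup>+r. n1 r \<partial>lborel) = ennreal (2 / \<kappa>)"
    unfolding n1_def using has_integral_powr_from_0[of "\<kappa> / 2 - 1" 1] \<kappa>
    by (intro nn_integral_has_integral_lebesgue') auto
  have i2: "(\<integral>\<^sup>+r. n2 r \<partial>lborel) \<le> ennreal (2 * line_const)"
    unfolding n2_def using v by (intro line_integral_le) simp
  have i3: "(\<integral>\<^sup>+r. n3 r \<partial>lborel) = ennreal (2 * line_exp - 1)"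
  proof -
    have "- (1 powr (- \<beta> + 1)) / (- \<beta> + 1) = 1 / (\<beta> - 1)"
    proof -
      have "- \<beta> + 1 = - (\<beta> - 1)" by simp
      then show ?thesis by (simp only: powr_one_eq_one minus_divide_divide)
    qed
    then have "((\<lambda>x. x powr (- \<beta>)) has_integral (2 * line_exp - 1)) {1..}"
      using has_integral_powr_to_inf[of "- \<beta>" 1] \<beta>(1) unfolding \<beta>(2)[symmetric] by (metis neg_less_iff_less zero_less_one)
    then show ?thesis unfolding n3_def by (intro nn_integral_has_integral_lebesgue') auto
  qed
  have "ennreal (norm (ray_kernel z v r)) \<le> ennreal (sqrt m) * (ennreal (sqrt (2 * A)) * n1 r + n2 r + n3 r)" for r
  proof -
    consider "r \<le> 0" | "0 < r" "r \<le> 1" | "1 < r" by linarith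
    then show ?thesis
    proof cases
      case 1
      then show ?thesis by (simp add: ray_kernel_def)
    next
      case 2
      have "ennreal (norm (ray_kernel z v r)) \<le> ennreal (sqrt m * (sqrt (2 * A) * r powr (\<kappa> / 2 - 1)))"
        using ray_kernel_near[OF m v 2] by (rule ennreal_leI)
      also have "\<dots> = ennreal (sqrt m) * (ennreal (sqrt (2 * A)) * n1 r)"
        using 2 A m0 by (simp add: n1_def ennreal_mult')
      also have "\<dots> \<le> ennreal (sqrt m) * (ennreal (sqrt (2 * A)) * n1 r + n2 r + n3 r)"
        by (intro mult_left_mono) (auto simp: add.assoc)
      finally show ?thesis .
    next
      case 3
      have "ennreal (norm (ray_kernel z v r)) \<le> ennreal (sqrt m * (norm (g (z + r *\<^sub>R (- v))) powr line_exp + r powr (- \<beta>)))"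
        using ray_kernel_far[OF m 3] by (intro ennreal_leI) (simp add: \<beta>_def)
      also have "\<dots> = ennreal (sqrt m) * (n2 r + n3 r)"
        using 3 m0 by (simp add: n2_def n3_def ennreal_mult' ennreal_plus)
      also have "\<dots> \<le> ennreal (sqrt m) * (ennreal (sqrt (2 * A)) * n1 r + n2 r + n3 r)"
        by (intro mult_left_mono) (auto simp: add.assoc)
      finally show ?thesis .
    qed
  qed
  then have "(\<integral>\<^sup>+r. ennreal (norm (ray_kernel z v r)) \<partial>lborel) \<le>
      (\<integral>\<^sup>+r. ennreal (sqrt m) * (ennreal (sqrt (2 * A)) * n1 r + n2 r + n3 r) \<partial>lborel)"
    by (rule nn_integral_mono)
  also have "\<dots> = ennreal (sqrt m) * (ennreal (sqrt (2 * A)) * (\<integral>\<^sup>+r. n1 r \<partial>lborel) + (\<integral>\<^sup>+r. n2 r \<partial>lborel) + (\<integral>\<^sup>+r. n3 r \<partial>lborel))"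
    by (simp add: nn_integral_cmult nn_integral_add)
  also have "\<dots> \<le> ennreal (sqrt m) * (ennreal (sqrt (2 * A)) * ennreal (2 / \<kappa>) + ennreal (2 * line_const) + ennreal (2 * line_exp - 1))"
    unfolding i1 i3 by (intro mult_left_mono add_mono i2) auto
  also have "\<dots> = ennreal (sqrt m * ray_const)"
  proof -
    have a: "0 \<le> sqrt (2 * A) * (2 / \<kappa>)" "0 \<le> 2 * line_const" "0 \<le> 2 * line_exp - 1"
      using A q \<kappa> by (auto simp: line_const_def)
    have "ennreal (sqrt (2 * A)) * ennreal (2 / \<kappa>) = ennreal (sqrt (2 * A) * (2 / \<kappa>))"
      using A \<kappa> by (intro ennreal_mult[symmetric]) auto
    then have "ennreal (sqrt (2 * A)) * ennreal (2 / \<kappa>) + ennreal (2 * line_const) + ennreal (2 * line_exp - 1) = ennreal ray_const"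
      by (simp only: ray_const_def ennreal_plus[OF a(1,2), symmetric]
          ennreal_plus[OF add_nonneg_nonneg[OF a(1,2)] a(3), symmetric])
    then show ?thesis using m0 by (simp only: ennreal_mult' real_sqrt_ge_0_iff)
  qed
  finally show ?thesis .
qed

lemma ray_kernel_borel1 [measurable]: "ray_kernel z v \<in> borel_measurable borel"
proof -
  have "(\<lambda>r. (z, v, r)) \<in> borel_measurable borel" by (intro borel_measurable_continuous_onI continuous_intros)
  from measurable_compose[OF this ray_kernel_borel] show ?thesis by simp
qed

lemma ray_kernel_integrable: "norm v = 1 \<Longrightarrow> integrable lborel (ray_kernel z v)"
  using nn_integral_ray_kernel_le[OF tameD(1)[OF tame], of v z]
  by (intro integrableI_bounded) (auto intro: le_less_trans)

lemma norm_ray_integral_le: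
  assumes m: "\<And>z. norm (g z) \<le> m" and v: "norm v = 1"
  shows "norm (ray_integral z v) \<le> sqrt m * ray_const"
proof -
  have "0 \<le> sqrt m * ray_const"
  proof -
    have "0 \<le> m" using m[of z] norm_ge_zero order_trans by blast
    then show ?thesis using tameD(4)[OF tame] ray_const_nonneg by simp
  qed
  moreover have "ennreal (norm (ray_integral z v)) \<le> ennreal (sqrt m * ray_const)"
    unfolding ray_integral_def
    using integral_norm_bound_ennreal[OF ray_kernel_integrable[OF v]] nn_integral_ray_kernel_le[OF m v] order_trans by blast
  ultimately show ?thesis by simp
qed

lemma ray_integral_borel [measurable]: "(\<lambda>x. ray_integral (fst x) (snd x)) \<in> borel_measurable borel"
proof -
  have c: "(\<lambda>x::((real \<times> real) \<times> (real \<times> real)) \<times> real. (fst (fst x), snd (fst x), snd x)) \<in> borel_measurable borel"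
    by (intro borel_measurable_continuous_onI continuous_intros)
  have "(\<lambda>x. ray_kernel (fst (fst x)) (snd (fst x)) (snd x)) \<in> borel_measurable (borel \<Otimes>\<^sub>M borel)"
    using measurable_compose[OF c ray_kernel_borel] by (simp add: borel_prod)
  then have "(\<lambda>(x, r). ray_kernel (fst x) (snd x) r) \<in> borel_measurable (borel \<Otimes>\<^sub>M lborel)"
    by (simp add: case_prod_beta cong: measurable_cong_sets sets_pair_measure_cong)
  then show ?thesis
    unfolding ray_integral_def by (rule lborel.borel_measurable_lebesgue_integral)
qed

end

section \<open>Principal values\<close>

text \<open>A consequence of completeness. The Hilbert transform of \<open>F\<close> is computed
  through \<open>g\<close> only off a null set, and its measurability is obtained here.\<close>

lemma borel_measurable_lebesgue_cong_AE:
  fixes f f' :: "'a::euclidean_space \<Rightarrow> 'b::topological_space"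
  assumes f': "f' \<in> borel_measurable lebesgue" and ae: "AE x in lborel. f x = f' x"
  shows "f \<in> borel_measurable lebesgue"
proof (rule measurableI)
  fix A :: "'b set" assume A: "A \<in> sets borel"
  have "f' -` A \<inter> space lebesgue \<in> sets lebesgue" by (rule measurable_sets[OF f' A])
  then show "f -` A \<inter> space lebesgue \<in> sets lebesgue"
    by (rule completion.in_sets_AE[rotated]) (use AE_completion[OF ae] in auto)
qed simp

text \<open>Fubini's theorem and compositions are carried out for Borel functions, whereas
  \<open>F\<close>, its Bessel derivative and \<Omega> are merely Lebesgue measurable.\<close>

lemma borel_measurable_lebesgue_ex_borel:
  fixes f :: "'a::euclidean_space \<Rightarrow> complex"
  assumes "f \<in> borel_measurable lebesgue"
  obtains f' where "f' \<in> borel_measurable borel" "AE x in lborel. f x = f' x"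
proof -
  have "(\<lambda>x. Re (f x)) \<in> borel_measurable lebesgue" "(\<lambda>x. Im (f x)) \<in> borel_measurable lebesgue"
    using assms by measurable
  then obtain u w where u: "u \<in> borel_measurable lborel" "AE x in lborel. Re (f x) = u x"
    and w: "w \<in> borel_measurable lborel" "AE x in lborel. Im (f x) = w x"
    using completion_ex_borel_measurable_real by metis
  show ?thesis
  proof (rule that[of "\<lambda>x. Complex (u x) (w x)"])
    show "(\<lambda>x. Complex (u x) (w x)) \<in> borel_measurable borel"
      using u(1) w(1) unfolding Complex_eq by simp
    show "AE x in lborel. f x = Complex (u x) (w x)"
      using u(2) w(2) by eventually_elim (simp add: complex_eq_iff)
  qed
qed

text \<open>\<open>pv_integral\<close> is defined by \<open>Lim\<close>, whose value is meaningful
  only if the limit exists; here existence and value form one statement.\<close>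

definition has_pv :: "('a::euclidean_space \<Rightarrow> complex) \<Rightarrow> complex \<Rightarrow> bool" where
  "has_pv f l \<longleftrightarrow> (\<forall>\<epsilon>>0. set_integrable lebesgue {u. \<epsilon> < norm u} f) \<and>
     ((\<lambda>\<epsilon>. LINT u:{u. \<epsilon> < norm u}|lebesgue. f u) \<longlongrightarrow> l) (at_right 0)"

lemma has_pvD:
  assumes "has_pv f l"
  shows "pv_exists f" "pv_integral f = l"
  using assms unfolding has_pv_def pv_exists_def pv_integral_def
  by (auto intro!: tendsto_Lim trivial_limit_at_right_real)

lemma has_pvI_lborel:
  assumes i: "\<And>\<epsilon>. 0 < \<epsilon> \<Longrightarrow> integrable lborel (\<lambda>u. indicator {u. \<epsilon> < norm u} u *\<^sub>R f u)"
    and l: "((\<lambda>\<epsilon>. LINT u|lborel. indicator {u. \<epsilon> < norm u} u *\<^sub>R f u) \<longlongrightarrow> l) (at_right 0)"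
  shows "has_pv f l"
  unfolding has_pv_def
proof (intro conjI allI impI)
  show "set_integrable lebesgue {u. \<epsilon> < norm u} f" if "\<epsilon> > 0" for \<epsilon>
    unfolding set_integrable_def using i[OF that] by (simp add: integrable_completion borel_measurable_integrable)
  have "(LINT u:{u. \<epsilon> < norm u}|lebesgue. f u) = (LINT u|lborel. indicator {u. \<epsilon> < norm u} u *\<^sub>R f u)" if "\<epsilon> > 0" for \<epsilon>
    unfolding set_lebesgue_integral_def using i[OF that] by (simp add: integral_completion borel_measurable_integrable)
  then have "\<forall>\<^sub>F \<epsilon> in at_right 0. (LINT u|lborel. indicator {u. \<epsilon> < norm u} u *\<^sub>R f u) = (LINT u:{u. \<epsilon> < norm u}|lebesgue. f u)"
    by (auto simp: eventually_at_right_field intro: exI[of _ 1])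
  with l show "((\<lambda>\<epsilon>. LINT u:{u. \<epsilon> < norm u}|lebesgue. f u) \<longlongrightarrow> l) (at_right 0)"
    by (rule Lim_transform_eventually)
qed

text \<open>Carries principal values from \<open>g\<close> to \<open>F\<close>, which is a multiple
  of \<open>g\<close> only almost everywhere.\<close>

lemma has_pv_cmult_cong_AE:
  assumes f: "has_pv f l" and ae: "AE u in lborel. f' u = c * f u"
  shows "has_pv f' (c * l)"
proof -
  let ?S = "\<lambda>\<epsilon>::real. {u::'a. \<epsilon> < norm u}"
  have i: "integrable lebesgue (\<lambda>u. indicator (?S \<epsilon>) u *\<^sub>R (c * f u))" if "\<epsilon> > 0" for \<epsilon>
    using f that unfolding has_pv_def set_integrable_def mult_scaleR_right[symmetric]
    by (intro integrable_mult_right) auto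
  have ae': "AE u in lborel. indicator (?S \<epsilon>) u *\<^sub>R f' u = indicator (?S \<epsilon>) u *\<^sub>R (c * f u)" for \<epsilon>
    using ae by eventually_elim simp
  have m: "(\<lambda>u. indicator (?S \<epsilon>) u *\<^sub>R f' u) \<in> borel_measurable lebesgue" if "\<epsilon> > 0" for \<epsilon>
    by (rule borel_measurable_lebesgue_cong_AE[OF borel_measurable_integrable[OF i[OF that]] ae'])
  have "set_integrable lebesgue (?S \<epsilon>) f'" if "\<epsilon> > 0" for \<epsilon>
    unfolding set_integrable_def
    using integrable_cong_AE[OF m[OF that] borel_measurable_integrable[OF i[OF that]] AE_completion[OF ae']] i[OF that]
    by (rule iffD2)
  moreover have "((\<lambda>\<epsilon>. LINT u:?S \<epsilon>|lebesgue. f' u) \<longlongrightarrow> c * l) (at_right 0)"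
  proof -
    have "((\<lambda>\<epsilon>. c * (LINT u:?S \<epsilon>|lebesgue. f u)) \<longlongrightarrow> c * l) (at_right 0)"
      using f unfolding has_pv_def by (intro tendsto_mult_left) auto
    moreover have "c * (LINT u:?S \<epsilon>|lebesgue. f u) = (LINT u:?S \<epsilon>|lebesgue. f' u)" if "\<epsilon> > 0" for \<epsilon>
    proof -
      have "(LINT u:?S \<epsilon>|lebesgue. f' u) = (LINT u|lebesgue. indicator (?S \<epsilon>) u *\<^sub>R (c * f u))"
        unfolding set_lebesgue_integral_def
        by (intro integral_cong_AE m[OF that] borel_measurable_integrable[OF i[OF that]] AE_completion[OF ae'])
      then show ?thesis unfolding set_lebesgue_integral_def by (simp flip: integral_mult_right_zero)
    qed
    then have "\<forall>\<^sub>F \<epsilon> in at_right 0. c * (LINT u:?S \<epsilon>|lebesgue. f u) = (LINT u:?S \<epsilon>|lebesgue. f' u)"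
      by (auto simp: eventually_at_right_field intro: exI[of _ 1])
    ultimately show ?thesis by (rule Lim_transform_eventually)
  qed
  ultimately show ?thesis unfolding has_pv_def by blast
qed

text \<open>Dominated convergence in a continuous parameter, by testing all sequences of positive
  numbers that tend to 0.\<close>

lemma integral_dominated_convergence_at_right:
  fixes s :: "real \<Rightarrow> 'a \<Rightarrow> 'b::{banach, second_countable_topology}" and w :: "'a \<Rightarrow> real"
  assumes "f \<in> borel_measurable M" "\<And>t. s t \<in> borel_measurable M" "integrable M w"
    and lim: "\<And>x. ((\<lambda>t. s t x) \<longlongrightarrow> f x) (at_right 0)"
    and b: "\<And>t x. 0 < t \<Longrightarrow> norm (s t x) \<le> w x"
  shows "((\<lambda>t. LINT x|M. s t x) \<longlongrightarrow> (LINT x|M. f x)) (at_right 0)"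
  unfolding tendsto_at_iff_sequentially comp_def
proof (intro allI impI)
  fix X :: "nat \<Rightarrow> real" assume X: "\<forall>i. X i \<in> {0<..} - {0}" "X \<longlonglongrightarrow> 0"
  show "(\<lambda>n. LINT x|M. s (X n) x) \<longlonglongrightarrow> (LINT x|M. f x)"
  proof (rule integral_dominated_convergence[where w = w])
    show "AE x in M. (\<lambda>i. s (X i) x) \<longlonglongrightarrow> f x"
      using lim X unfolding tendsto_at_iff_sequentially comp_def by auto
    show "AE x in M. norm (s (X i) x) \<le> w x" for i using b X by auto
  qed (use assms in auto)
qed

context tame_fun
begin

definition ray_tail :: "real \<Rightarrow> real \<times> real \<Rightarrow> real \<times> real \<Rightarrow> complex" where
  "ray_tail \<epsilon> z v = (LINT r|lborel. indicator {\<epsilon><..} r *\<^sub>R ray_kernel z v r)"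

text \<open>Equal to \<open>ln (1 / \<epsilon>)\<close> for \<epsilon> in (0, 1]: the divergent part
  of a single truncated ray, the same in every direction.\<close>

definition log_tail :: "real \<Rightarrow> real" where
  "log_tail \<epsilon> = (LINT r|lborel. indicator {\<epsilon><..1} r / r)"

lemma ray_tail_tendsto:
  assumes v: "norm v = 1"
  shows "((\<lambda>\<epsilon>. ray_tail \<epsilon> z v) \<longlongrightarrow> ray_integral z v) (at_right 0)"
  unfolding ray_tail_def ray_integral_def
proof (rule integral_dominated_convergence_at_right[where w = "\<lambda>r. norm (ray_kernel z v r)"])
  show "((\<lambda>\<epsilon>. indicator {\<epsilon><..} r *\<^sub>R ray_kernel z v r) \<longlongrightarrow> ray_kernel z v r) (at_right 0)" for r
  proof (cases "r > 0")
    case True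
    then have "\<forall>\<^sub>F \<epsilon> in at_right 0. ray_kernel z v r = indicator {\<epsilon><..} r *\<^sub>R ray_kernel z v r"
      by (auto simp: eventually_at_right_field intro!: exI[of _ r])
    then show ?thesis by (rule Lim_transform_eventually[OF tendsto_const])
  qed (simp add: ray_kernel_def)
qed (use ray_kernel_integrable[OF v] in \<open>auto simp: indicator_def\<close>)

lemma ray_tail_integrable: "norm v = 1 \<Longrightarrow> integrable lborel (\<lambda>r. indicator {\<epsilon><..} r *\<^sub>R ray_kernel z v r)"
  using ray_kernel_integrable by (intro integrable_mult_indicator) auto

lemma norm_ray_tail_le:
  assumes "norm v = 1"
  shows "norm (ray_tail \<epsilon> z v) \<le> sqrt A * ray_const"
proof -
  have nn: "0 \<le> sqrt A * ray_const"
    using tameD(4)[OF tame] ray_const_nonneg by simp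
  have "ennreal (norm (ray_tail \<epsilon> z v)) \<le> (\<integral>\<^sup>+r. ennreal (norm (indicator {\<epsilon><..} r *\<^sub>R ray_kernel z v r)) \<partial>lborel)"
    unfolding ray_tail_def by (rule integral_norm_bound_ennreal[OF ray_tail_integrable[OF assms]])
  also have "\<dots> \<le> (\<integral>\<^sup>+r. ennreal (norm (ray_kernel z v r)) \<partial>lborel)"
    by (intro nn_integral_mono ennreal_leI) (auto simp: indicator_def)
  also have "\<dots> \<le> ennreal (sqrt A * ray_const)"
    by (rule nn_integral_ray_kernel_le[OF tameD(1)[OF tame] assms])
  finally show ?thesis using nn by simp
qed

text \<open>The truncated integrand along one ray before the correction by
  \<open>g z\<close>.\<close>

definition cut_kernel :: "real \<Rightarrow> real \<times> real \<Rightarrow> real \<times> real \<Rightarrow> real \<Rightarrow> complex" where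
  "cut_kernel \<epsilon> z v r = indicator {\<epsilon><..} r *\<^sub>R (g (z - r *\<^sub>R v) / of_real r)"

lemma log_integrable: "0 < \<epsilon> \<Longrightarrow> integrable lborel (\<lambda>r::real. indicator {\<epsilon><..1} r / r :: real)"
proof (rule Bochner_Integration.integrable_bound)
  assume \<epsilon>: "0 < \<epsilon>"
  show "integrable lborel (\<lambda>r::real. (1 / \<epsilon>) * indicator {\<epsilon><..1} r :: real)"
    by (cases "\<epsilon> \<le> 1") (intro integrable_mult_right integrable_real_indicator; simp)+
  show "AE r in lborel. norm (indicator {\<epsilon><..1} r / r :: real) \<le> norm ((1 / \<epsilon>) * indicator {\<epsilon><..1} r :: real)"
    using \<epsilon> by (auto simp: indicator_def field_simps)
qed auto

lemma cut_kernel_eq: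
  assumes "0 < \<epsilon>"
  shows "cut_kernel \<epsilon> z v r = indicator {\<epsilon><..} r *\<^sub>R ray_kernel z v r + (indicator {\<epsilon><..1} r / r) *\<^sub>R g z"
  using assms by (auto simp: cut_kernel_def ray_kernel_def indicator_def scaleR_conv_of_real diff_divide_distrib)

lemma cut_kernel_integral:
  assumes "0 < \<epsilon>" "norm v = 1"
  shows "integrable lborel (cut_kernel \<epsilon> z v)"
    and "(LINT r|lborel. cut_kernel \<epsilon> z v r) = ray_tail \<epsilon> z v + log_tail \<epsilon> *\<^sub>R g z"
proof -
  have i: "integrable lborel (\<lambda>r. (indicator {\<epsilon><..1} r / r) *\<^sub>R g z)"
    using log_integrable[OF assms(1)] by (rule integrable_scaleR_left)
  show "integrable lborel (cut_kernel \<epsilon> z v)"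
    unfolding cut_kernel_eq[OF assms(1), abs_def]
    by (intro Bochner_Integration.integrable_add ray_tail_integrable assms i)
  show "(LINT r|lborel. cut_kernel \<epsilon> z v r) = ray_tail \<epsilon> z v + log_tail \<epsilon> *\<^sub>R g z"
    unfolding cut_kernel_eq[OF assms(1)] ray_tail_def log_tail_def
    using i ray_tail_integrable[OF assms(2)] log_integrable[OF assms(1)] by (subst Bochner_Integration.integral_add) auto
qed

text \<open>Absolute integrability for Fubini's theorem in polar coordinates. The bound is uniform
  in the direction \<open>v\<close>, while it may grow as \<epsilon> tends to 0.\<close>

lemma norm_cut_kernel_integral_le:
  assumes "0 < \<epsilon>" "norm v = 1"
  shows "(LINT r|lborel. norm (cut_kernel \<epsilon> z v r)) \<le> sqrt A * ray_const + log_tail \<epsilon> * A"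
proof -
  have k: "(LINT r|lborel. norm (ray_kernel z v r)) \<le> sqrt A * ray_const"
  proof -
    have "0 \<le> sqrt A * ray_const"
      using tameD(4)[OF tame] ray_const_nonneg by simp
    then show ?thesis
      using nn_integral_ray_kernel_le[OF tameD(1)[OF tame] assms(2), of z]
      by (subst integral_eq_nn_integral) (auto intro: enn2real_leI)
  qed
  have "(LINT r|lborel. norm (cut_kernel \<epsilon> z v r)) \<le> (LINT r|lborel. norm (ray_kernel z v r) + indicator {\<epsilon><..1} r / r * A)"
  proof (rule integral_mono)
    fix r :: real
    have "norm (cut_kernel \<epsilon> z v r) \<le> norm (indicator {\<epsilon><..} r *\<^sub>R ray_kernel z v r) + norm ((indicator {\<epsilon><..1} r / r) *\<^sub>R g z)"
      unfolding cut_kernel_eq[OF assms(1)] by (rule norm_triangle_ineq)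
    also have "norm (indicator {\<epsilon><..} r *\<^sub>R ray_kernel z v r) \<le> norm (ray_kernel z v r)"
      by (simp add: indicator_def)
    also have "norm ((indicator {\<epsilon><..1} r / r) *\<^sub>R g z) = indicator {\<epsilon><..1} r / r * norm (g z)"
      using assms(1) by (simp add: indicator_def)
    also have "\<dots> \<le> indicator {\<epsilon><..1} r / r * A"
      using assms(1) tameD(1)[OF tame, of z] by (intro mult_left_mono) (auto simp: indicator_def)
    finally show "norm (cut_kernel \<epsilon> z v r) \<le> norm (ray_kernel z v r) + indicator {\<epsilon><..1} r / r * A" by simp
    show "integrable lborel (\<lambda>r. norm (cut_kernel \<epsilon> z v r))"
      by (intro integrable_norm cut_kernel_integral(1) assms)
    show "integrable lborel (\<lambda>r. norm (ray_kernel z v r) + indicator {\<epsilon><..1} r / r * A)"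
      by (intro Bochner_Integration.integrable_add integrable_norm ray_kernel_integrable integrable_mult_left
          log_integrable assms)
  qed
  also have "\<dots> = (LINT r|lborel. norm (ray_kernel z v r)) + log_tail \<epsilon> * A"
  proof -
    have i: "integrable lborel (\<lambda>r. indicator {\<epsilon><..1} r / r * A)"
      by (intro integrable_mult_left log_integrable assms)
    show ?thesis
      unfolding Bochner_Integration.integral_add[OF integrable_norm[OF ray_kernel_integrable[OF assms(2)]] i]
      by (simp only: integral_mult_left_zero log_tail_def)
  qed
  finally show ?thesis using k by simp
qed

text \<open>Reflection turns the half-line of negative \<open>t\<close> into the ray in direction
  \<open>- v\<close>, with a minus sign from \<open>1 / t\<close>; thereby the two terms with
  \<open>log_tail \<epsilon>\<close> cancel.\<close>

lemma has_pv_hilbert: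
  assumes v: "norm v = 1"
  shows "has_pv (hilbert_integrand v g z) (ray_integral z v - ray_integral z (- v))"
proof (rule has_pvI_lborel)
  have v': "norm (- v) = 1" using v by simp
  have eq: "indicator {u. \<epsilon> < norm u} t *\<^sub>R hilbert_integrand v g z t =
      cut_kernel \<epsilon> z v t - cut_kernel \<epsilon> z (- v) (0 + (- 1) * t)" if "0 < \<epsilon>" for \<epsilon> t
    using that by (auto simp: hilbert_integrand_def cut_kernel_def indicator_def)
  have i: "integrable lborel (\<lambda>t. cut_kernel \<epsilon> z (- v) (0 + (- 1) * t))" if "0 < \<epsilon>" for \<epsilon>
    using cut_kernel_integral(1)[OF that v'] by (rule lborel_integrable_real_affine) simp
  show "integrable lborel (\<lambda>u. indicator {u. \<epsilon> < norm u} u *\<^sub>R hilbert_integrand v g z u)" if "0 < \<epsilon>" for \<epsilon>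
    unfolding eq[OF that] by (intro Bochner_Integration.integrable_diff cut_kernel_integral(1)[OF that v] i[OF that])
  have "(LINT u|lborel. indicator {u. \<epsilon> < norm u} u *\<^sub>R hilbert_integrand v g z u) = ray_tail \<epsilon> z v - ray_tail \<epsilon> z (- v)"
    if "0 < \<epsilon>" for \<epsilon>
  proof -
    have "(LINT t|lborel. cut_kernel \<epsilon> z (- v) t) = \<bar>- 1\<bar> *\<^sub>R (LINT t|lborel. cut_kernel \<epsilon> z (- v) (0 + (- 1) * t))"
      by (rule lborel_integral_real_affine) simp
    then have r: "(LINT t|lborel. cut_kernel \<epsilon> z (- v) (0 + (- 1) * t)) = (LINT t|lborel. cut_kernel \<epsilon> z (- v) t)" by simp
    show ?thesis
      unfolding eq[OF that] Bochner_Integration.integral_diff[OF cut_kernel_integral(1)[OF that v] i[OF that]]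
        r cut_kernel_integral(2)[OF that v] cut_kernel_integral(2)[OF that v'] by simp
  qed
  then have "\<forall>\<^sub>F \<epsilon> in at_right 0. ray_tail \<epsilon> z v - ray_tail \<epsilon> z (- v) =
      (LINT u|lborel. indicator {u. \<epsilon> < norm u} u *\<^sub>R hilbert_integrand v g z u)"
    by (auto simp: eventually_at_right_field intro: exI[of _ 1])
  moreover have "((\<lambda>\<epsilon>. ray_tail \<epsilon> z v - ray_tail \<epsilon> z (- v)) \<longlongrightarrow> ray_integral z v - ray_integral z (- v)) (at_right 0)"
    by (intro tendsto_diff ray_tail_tendsto v v')
  ultimately show "((\<lambda>\<epsilon>. LINT u|lborel. indicator {u. \<epsilon> < norm u} u *\<^sub>R hilbert_integrand v g z u) \<longlongrightarrow>
      ray_integral z v - ray_integral z (- v)) (at_right 0)"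
    by (rule Lim_transform_eventually[rotated])
qed

end

text \<open>A planar null set may contain a whole line, but by Fubini over translates it meets
  almost every line of a given direction in a null set. For this reason the Hilbert transform of
  \<open>F\<close> is controlled for almost every \<open>z\<close> only.\<close>

lemma AE_line:
  fixes P :: "real \<times> real \<Rightarrow> bool"
  assumes "AE w in lborel. P w"
  shows "AE z in lborel. AE t in lborel. P (z - t *\<^sub>R v)"
proof -
  obtain N where N: "N \<in> null_sets lborel" "{w. \<not> P w} \<subseteq> N"
  proof -
    obtain N where "{w \<in> space lborel. \<not> P w} \<subseteq> N" "emeasure lborel N = 0" "N \<in> sets lborel"
      using assms by (rule AE_E)
    then show ?thesis by (intro that[of N]) auto
  qed
  then have [measurable]: "N \<in> sets borel" by auto
  have m: "(\<lambda>x::(real \<times> real) \<times> real. fst x - snd x *\<^sub>R v) \<in> borel_measurable borel"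
    by (intro borel_measurable_continuous_onI continuous_intros)
  have [measurable]: "(\<lambda>x. indicator N (fst x - snd x *\<^sub>R v) :: ennreal) \<in> borel_measurable (lborel \<Otimes>\<^sub>M lborel)"
    using measurable_compose[OF m, of "indicator N :: _ \<Rightarrow> ennreal" borel] by (simp add: lborel_prod)
  have "(\<integral>\<^sup>+z. indicator N (z - t *\<^sub>R v) \<partial>lborel) = 0" for t
  proof -
    have ns: "{z. z - t *\<^sub>R v \<in> N} \<in> null_sets lborel" using null_sets_translation[OF N(1)] .
    have "(\<integral>\<^sup>+z. indicator N (z - t *\<^sub>R v) \<partial>lborel) = (\<integral>\<^sup>+z. indicator {z. z - t *\<^sub>R v \<in> N} z \<partial>lborel)"
      by (intro nn_integral_cong) (auto simp: indicator_def)
    also have "\<dots> = emeasure lborel {z. z - t *\<^sub>R v \<in> N}" using ns by (intro nn_integral_indicator) auto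
    finally show ?thesis using ns by auto
  qed
  then have "(\<integral>\<^sup>+z. \<integral>\<^sup>+t. indicator N (z - t *\<^sub>R v) \<partial>lborel \<partial>lborel) = 0"
    by (subst lborel_pair.Fubini') (auto simp: case_prod_beta)
  then have "AE z in lborel. (\<integral>\<^sup>+t. indicator N (z - t *\<^sub>R v) \<partial>lborel) = 0"
    by (subst (asm) nn_integral_0_iff_AE) (auto intro!: lborel.borel_measurable_nn_integral simp: case_prod_beta)
  then show ?thesis
  proof eventually_elim
    case (elim z)
    have [measurable]: "(\<lambda>t. indicator N (z - t *\<^sub>R v) :: ennreal) \<in> borel_measurable borel"
      by (rule measurable_compose[of _ borel borel]) (auto intro!: borel_measurable_continuous_onI continuous_intros)
    have "AE t in lborel. indicator N (z - t *\<^sub>R v) = (0 :: ennreal)"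
      using elim by (subst (asm) nn_integral_0_iff_AE) auto
    then show ?case by eventually_elim (use N(2) in \<open>auto simp: indicator_def split: if_splits\<close>)
  qed
qed

text \<open>The quotient is clamped to [-1, 1], where \<open>arccos\<close> is continuous, so that
  measurability holds on the whole plane.\<close>

definition polar_angle :: "real \<times> real \<Rightarrow> real" where
  "polar_angle u = (if 0 \<le> snd u then arccos (max (- 1) (min 1 (fst u / norm u)))
     else 2 * pi - arccos (max (- 1) (min 1 (fst u / norm u))))"

lemma polar_angle_borel [measurable]: "polar_angle \<in> borel_measurable borel"
proof -
  have c: "(\<lambda>x::real. arccos (max (- 1) (min 1 x))) \<in> borel_measurable borel"
    by (intro borel_measurable_continuous_onI continuous_on_arccos continuous_intros) auto
  have [measurable]: "(\<lambda>u::real \<times> real. fst u / norm u) \<in> borel_measurable borel"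
    "(\<lambda>u::real \<times> real. snd u) \<in> borel_measurable borel"
    by (rule borel_measurable_divide; intro borel_measurable_continuous_onI continuous_intros)
      (intro borel_measurable_continuous_onI continuous_intros)
  have [measurable]: "(\<lambda>u::real \<times> real. arccos (max (- 1) (min 1 (fst u / norm u)))) \<in> borel_measurable borel"
    by (rule measurable_compose[OF _ c]) measurable
  show ?thesis unfolding polar_angle_def[abs_def] by measurable
qed

lemma polar_angle_correct:
  assumes "u \<noteq> 0"
  shows "polar_angle u \<in> {0..2 * pi}" "u /\<^sub>R norm u = (cos (polar_angle u), sin (polar_angle u))"
proof -
  define c where "c = fst u / norm u"
  define s where "s = snd u / norm u"
  have n: "norm u > 0" using assms by simp
  have n2: "(norm u)\<^sup>2 = (fst u)\<^sup>2 + (snd u)\<^sup>2" by (simp add: norm_prod_def)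
  have cs: "c\<^sup>2 + s\<^sup>2 = 1"
    using n unfolding c_def s_def power_divide add_divide_distrib[symmetric] n2[symmetric] by simp
  then have c1: "\<bar>c\<bar> \<le> 1" by (metis abs_square_le_1 le_add_same_cancel1 zero_le_power2)
  then have mm: "max (- 1) (min 1 c) = c" by auto
  have a: "0 \<le> arccos c" "arccos c \<le> pi" using c1 arccos_bounded by (auto simp: abs_le_iff)
  have s_eq: "sin (arccos c) = \<bar>s\<bar>"
  proof -
    have "sin (arccos c) = sqrt (1 - c\<^sup>2)" using c1 by (intro sin_arccos) (auto simp: abs_le_iff)
    also have "1 - c\<^sup>2 = s\<^sup>2" using cs by simp
    finally show ?thesis by simp
  qed
  have c_eq: "cos (arccos c) = c" using c1 by (intro cos_arccos) (auto simp: abs_le_iff)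
  show "polar_angle u \<in> {0..2 * pi}"
    using a pi_ge_zero unfolding polar_angle_def c_def[symmetric] mm by auto
  have "(cos (polar_angle u), sin (polar_angle u)) = (c, s)"
  proof (cases "0 \<le> snd u")
    case True
    then have "0 \<le> s" using n by (simp add: s_def)
    then show ?thesis using True unfolding polar_angle_def c_def[symmetric] mm by (simp add: s_eq c_eq)
  next
    case False
    then have "s < 0" using n by (simp add: s_def divide_neg_pos)
    then show ?thesis using False unfolding polar_angle_def c_def[symmetric] mm
      by (simp add: s_eq c_eq cos_diff sin_diff)
  qed
  then show "u /\<^sub>R norm u = (cos (polar_angle u), sin (polar_angle u))"
    by (simp add: c_def s_def prod_eq_iff divide_inverse mult.commute)
qed

text \<open>The end angles are left out since 0 and \<open>2 * pi\<close> describe one direction, to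
  which \<open>polar_angle\<close> assigns 0.\<close>

lemma polar_angle_polar:
  assumes "0 < r" "0 < \<theta>" "\<theta> < 2 * pi"
  shows "polar_angle (r * cos \<theta>, r * sin \<theta>) = \<theta>"
proof -
  have n: "norm (r * cos \<theta>, r * sin \<theta>) = r"
  proof -
    have "(r * cos \<theta>)\<^sup>2 + (r * sin \<theta>)\<^sup>2 = r\<^sup>2 * ((cos \<theta>)\<^sup>2 + (sin \<theta>)\<^sup>2)"
      by (simp only: power_mult_distrib distrib_left)
    then show ?thesis using assms(1) by (simp add: norm_prod_def)
  qed
  have q: "fst (r * cos \<theta>, r * sin \<theta>) / r = cos \<theta>" using assms by simp
  have mm: "max (- 1) (min 1 (cos \<theta>)) = cos \<theta>" by simp
  show ?thesis
  proof (cases "\<theta> \<le> pi")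
    case True
    then have "0 \<le> sin \<theta>" using assms by (intro sin_ge_zero) auto
    then show ?thesis unfolding polar_angle_def n q mm using assms True by (simp add: arccos_cos)
  next
    case False
    then have "sin \<theta> < 0" using assms by (intro sin_lt_zero) auto
    then have "\<not> 0 \<le> r * sin \<theta>" using assms by (simp add: zero_le_mult_iff not_le)
    moreover have "arccos (cos \<theta>) = 2 * pi - \<theta>"
      using arccos_cos[of "2 * pi - \<theta>"] assms False by (simp add: cos_diff)
    ultimately show ?thesis unfolding polar_angle_def n q mm by simp
  qed
qed

text \<open>The cone over a null set of angles is a planar null set: in polar coordinates its
  measure is an integral over a null set of angles.\<close>

lemma AE_polar_angle:
  assumes "AE \<theta> in lborel. \<theta> \<in> {0..2 * pi} \<longrightarrow> P \<theta>"
  shows "AE u in lborel. P (polar_angle u)"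
proof -
  obtain N where N: "{\<theta> \<in> space lborel. \<not> (\<theta> \<in> {0..2 * pi} \<longrightarrow> P \<theta>)} \<subseteq> N" "emeasure lborel N = 0" "N \<in> sets lborel"
    using assms by (rule AE_E)
  then have [measurable]: "N \<in> sets borel" by simp
  have m: "polar_angle -` N \<in> sets borel" using measurable_sets[OF polar_angle_borel, of N] by simp
  have [measurable]: "(indicator (polar_angle -` N) :: _ \<Rightarrow> ennreal) \<in> borel_measurable borel" using m by measurable
  have "emeasure lborel (polar_angle -` N) = (\<integral>\<^sup>+u. indicator (polar_angle -` N) u \<partial>lborel)"
    using m by (intro nn_integral_indicator[symmetric]) simp
  also have "\<dots> = (\<integral>\<^sup>+\<theta>. indicator {0..2 * pi} \<theta> * (\<integral>\<^sup>+r. indicator {0<..} r * ennreal r *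
      indicator (polar_angle -` N) (r * cos \<theta>, r * sin \<theta>) \<partial>lborel) \<partial>lborel)"
    by (rule nn_integral_polar) measurable
  also have "\<dots> = (\<integral>\<^sup>+(\<theta>::real). 0 \<partial>lborel)"
  proof (rule nn_integral_cong_AE)
    have "AE \<theta>::real in lborel. \<theta> \<noteq> 0" "AE \<theta>::real in lborel. \<theta> \<noteq> 2 * pi" "AE \<theta> in lborel. \<theta> \<notin> N"
      using N by (auto intro: AE_lborel_singleton AE_not_in simp: null_sets_def)
    then show "AE \<theta> in lborel. indicator {0..2 * pi} \<theta> * (\<integral>\<^sup>+r. indicator {0<..} r * ennreal r *
      indicator (polar_angle -` N) (r * cos \<theta>, r * sin \<theta>) \<partial>lborel) = 0"
    proof eventually_elim
      case (elim \<theta>)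
      show ?case
      proof (cases "\<theta> \<in> {0..2 * pi}")
        case True
        then have "0 < \<theta>" "\<theta> < 2 * pi" using elim by auto
        then have Z: "indicator {0<..} r * ennreal r * indicator (polar_angle -` N) (r * cos \<theta>, r * sin \<theta>) = 0" for r
          using polar_angle_polar[of r \<theta>] elim by (auto simp: indicator_def)
        show ?thesis by (simp only: Z) simp
      qed simp
    qed
  qed
  finally have e0: "emeasure lborel (polar_angle -` N) = 0" by simp
  have "AE u::real \<times> real in lborel. u \<noteq> 0" by (rule AE_lborel_singleton)
  moreover have "AE u in lborel. u \<notin> polar_angle -` N"
    using m e0 by (intro AE_not_in) (auto simp: null_sets_def)
  ultimately show ?thesis
  proof eventually_elim
    case (elim u)
    then show ?case using N(1) polar_angle_correct(1)[of u] by auto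
  qed
qed

lemma lborel_polar:
  fixes f :: "real \<times> real \<Rightarrow> complex"
  assumes f [measurable]: "f \<in> borel_measurable borel"
  defines "h \<equiv> \<lambda>x. (indicator {0..2 * pi} (fst x) * (indicator {0<..} (snd x) * snd x)) *\<^sub>R f (snd x * cos (fst x), snd x * sin (fst x))"
  shows "integrable lborel f \<longleftrightarrow> integrable (lborel \<Otimes>\<^sub>M lborel) h"
    and "(LINT u|lborel. f u) = (LINT x|(lborel \<Otimes>\<^sub>M lborel). h x)"
proof -
  let ?w = "\<lambda>x::real \<times> real. indicator {0..2 * pi} (fst x) * (indicator {0<..} (snd x) * snd x) :: real"
  have pm: "polar_measure = density (lborel \<Otimes>\<^sub>M lborel) (\<lambda>x. ennreal (?w x))"
    unfolding polar_measure_def by (intro arg_cong2[where f = density] refl ext) (auto simp: indicator_def)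
  have [measurable]: "polar_map \<in> polar_measure \<rightarrow>\<^sub>M borel" unfolding polar_measure_def by simp
  have fp: "(\<lambda>x. f (polar_map x)) \<in> borel_measurable (lborel \<Otimes>\<^sub>M lborel)"
    by (rule measurable_compose[OF _ f]) simp
  have hp: "h = (\<lambda>x. ?w x *\<^sub>R f (polar_map x))" by (simp add: h_def polar_map_def case_prod_beta)
  have w0: "AE x in lborel \<Otimes>\<^sub>M lborel. 0 \<le> ?w x" by (auto simp: indicator_def)
  have wm: "?w \<in> borel_measurable (lborel \<Otimes>\<^sub>M lborel)" by measurable
  have "integrable lborel f \<longleftrightarrow> integrable polar_measure (\<lambda>x. f (polar_map x))"
    by (subst lborel_eq_distr_polar, rule integrable_distr_eq) auto
  also have "\<dots> \<longleftrightarrow> integrable (lborel \<Otimes>\<^sub>M lborel) h"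
    unfolding pm hp by (rule integrable_density[OF fp wm w0])
  finally show "integrable lborel f \<longleftrightarrow> integrable (lborel \<Otimes>\<^sub>M lborel) h" .
  have "(LINT u|lborel. f u) = (LINT x|polar_measure. f (polar_map x))"
    by (subst lborel_eq_distr_polar, rule integral_distr) auto
  also have "\<dots> = (LINT x|(lborel \<Otimes>\<^sub>M lborel). h x)"
    unfolding pm hp by (rule integral_density[OF fp wm w0])
  finally show "(LINT u|lborel. f u) = (LINT x|(lborel \<Otimes>\<^sub>M lborel). h x)" .
qed

text \<open>\<Omega> is only Lebesgue integrable in the angle. Its Borel version \<omega> vanishes
  outside [0, 2 pi], so that integrals over the circle become integrals over the line, and it agrees
  with \<Omega> in almost every point of the plane.\<close>

lemma circle_density:
  assumes "\<Omega> \<in> circle_L1"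
  obtains \<omega> where "\<omega> \<in> borel_measurable borel" "integrable lborel \<omega>"
    "(LINT \<theta>|lborel. \<omega> \<theta>) = circle_integral \<Omega>" "(LINT \<theta>|lborel. norm (\<omega> \<theta>)) = circle_L1_norm \<Omega>"
    "AE u in lborel. \<Omega> (u /\<^sub>R norm u) = \<omega> (polar_angle u)" "\<And>\<theta>. \<theta> \<notin> {0..2 * pi} \<Longrightarrow> \<omega> \<theta> = 0"
proof -
  define f where "f \<theta> = indicator {0..2 * pi} \<theta> *\<^sub>R \<Omega> (cos \<theta>, sin \<theta>)" for \<theta>
  have fi: "integrable lebesgue f"
    using assms unfolding circle_L1_def set_integrable_def f_def by simp
  obtain w where w [measurable]: "w \<in> borel_measurable borel" "AE \<theta> in lborel. f \<theta> = w \<theta>"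
    using borel_measurable_lebesgue_ex_borel[OF borel_measurable_integrable[OF fi]] by blast
  define \<omega> where "\<omega> \<theta> = indicator {0..2 * pi} \<theta> *\<^sub>R w \<theta>" for \<theta>
  have m [measurable]: "\<omega> \<in> borel_measurable borel" unfolding \<omega>_def[abs_def] by measurable
  have ae: "AE \<theta> in lborel. f \<theta> = \<omega> \<theta>"
    using w(2) by eventually_elim (auto simp: \<omega>_def f_def indicator_def)
  have mc: "\<omega> \<in> borel_measurable lebesgue" by (rule measurable_completion) simp
  have ae': "AE \<theta> in lebesgue. f \<theta> = \<omega> \<theta>" using ae by (rule AE_completion)
  have "integrable lebesgue \<omega>"
    using integrable_cong_AE[OF borel_measurable_integrable[OF fi] mc ae'] fi by simp
  then have i: "integrable lborel \<omega>" by (simp add: integrable_completion)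
  have 1: "(LINT \<theta>|lborel. \<omega> \<theta>) = circle_integral \<Omega>"
  proof -
    have "(LINT \<theta>|lebesgue. f \<theta>) = (LINT \<theta>|lebesgue. \<omega> \<theta>)"
      by (rule integral_cong_AE[OF borel_measurable_integrable[OF fi] mc ae'])
    then show ?thesis unfolding circle_integral_def set_lebesgue_integral_def f_def
      by (simp add: integral_completion)
  qed
  have 2: "(LINT \<theta>|lborel. norm (\<omega> \<theta>)) = circle_L1_norm \<Omega>"
  proof -
    have "(LINT \<theta>|lebesgue. norm (f \<theta>)) = (LINT \<theta>|lebesgue. norm (\<omega> \<theta>))"
    proof (rule integral_cong_AE)
      have "f \<in> borel_measurable lebesgue" by (rule borel_measurable_integrable[OF fi])
      then show "(\<lambda>\<theta>. norm (f \<theta>)) \<in> borel_measurable lebesgue" by measurable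
      show "(\<lambda>\<theta>. norm (\<omega> \<theta>)) \<in> borel_measurable lebesgue" using mc by measurable
    qed (use ae' in \<open>eventually_elim, simp\<close>)
    then show ?thesis unfolding circle_L1_norm_def set_lebesgue_integral_def f_def
      by (simp add: integral_completion)
  qed
  have "AE u in lborel. \<Omega> (cos (polar_angle u), sin (polar_angle u)) = \<omega> (polar_angle u)"
    by (rule AE_polar_angle) (use ae in \<open>auto simp: f_def elim!: eventually_mono\<close>)
  moreover have "AE u::real \<times> real in lborel. u \<noteq> 0" by (rule AE_lborel_singleton)
  ultimately have 3: "AE u in lborel. \<Omega> (u /\<^sub>R norm u) = \<omega> (polar_angle u)"
    by eventually_elim (metis polar_angle_correct(2))
  show ?thesis by (rule that[OF m i 1 2 3]) (simp add: \<omega>_def)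
qed

context tame_fun
begin

definition rough_value :: "(real \<Rightarrow> complex) \<Rightarrow> real \<times> real \<Rightarrow> complex" where
  "rough_value \<omega> z = (LINT \<theta>|lborel. \<omega> \<theta> * ray_integral z (cos \<theta>, sin \<theta>))"

lemma norm_cos_sin: "norm (cos \<theta>, sin \<theta>) = 1" for \<theta> :: real
  by (simp add: norm_prod_def)

lemma ray_integral_borel_circle [measurable]:
  "(\<lambda>x. ray_integral (fst x) (cos (snd x), sin (snd x))) \<in> borel_measurable borel"
proof -
  have c: "(\<lambda>x::(real \<times> real) \<times> real. (fst x, (cos (snd x), sin (snd x)))) \<in> borel_measurable borel"
    by (intro borel_measurable_continuous_onI continuous_intros)
  show ?thesis using measurable_compose[OF c ray_integral_borel] by simp
qed

lemma rough_value_borel: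
  assumes [measurable]: "\<omega> \<in> borel_measurable borel"
  shows "rough_value \<omega> \<in> borel_measurable borel"
proof -
  have "(\<lambda>x. ray_integral (fst x) (cos (snd x), sin (snd x))) \<in> borel_measurable (borel \<Otimes>\<^sub>M borel)"
    using ray_integral_borel_circle by (simp add: borel_prod)
  then have "(\<lambda>(z, \<theta>). \<omega> \<theta> * ray_integral z (cos \<theta>, sin \<theta>)) \<in> borel_measurable (borel \<Otimes>\<^sub>M lborel)"
    by (simp add: case_prod_beta)
  then show ?thesis
    unfolding rough_value_def[abs_def] by (rule lborel.borel_measurable_lebesgue_integral)
qed

lemma norm_rough_value_le:
  assumes m: "\<And>z. norm (g z) \<le> m" and i: "integrable lborel \<omega>"
  shows "norm (rough_value \<omega> z) \<le> (LINT \<theta>|lborel. norm (\<omega> \<theta>)) * (sqrt m * ray_const)"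
proof -
  have "0 \<le> m" using m[of z] norm_ge_zero order_trans by blast
  then have "0 \<le> sqrt m * ray_const"
    using tameD(4)[OF tame] ray_const_nonneg by simp
  then have nn: "0 \<le> norm (\<omega> \<theta>) * (sqrt m * ray_const)" for \<theta> by simp
  have "norm (rough_value \<omega> z) \<le> (LINT \<theta>|lborel. norm (\<omega> \<theta> * ray_integral z (cos \<theta>, sin \<theta>)))"
    unfolding rough_value_def by (rule integral_norm_bound)
  also have "\<dots> \<le> (LINT \<theta>|lborel. norm (\<omega> \<theta>) * (sqrt m * ray_const))"
    using i by (intro integral_mono' nn) (auto simp: norm_mult intro!: mult_left_mono norm_ray_integral_le m norm_cos_sin)
  finally show ?thesis using i by simp
qed

lemma cut_kernel_borel2 [measurable]:
  "(\<lambda>x. cut_kernel \<epsilon> z (cos (fst x), sin (fst x)) (snd x)) \<in> borel_measurable (borel \<Otimes>\<^sub>M borel)"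
proof -
  have c: "(\<lambda>x::real \<times> real. z - snd x *\<^sub>R (cos (fst x), sin (fst x))) \<in> borel_measurable borel"
    by (intro borel_measurable_continuous_onI continuous_intros)
  have [measurable]: "(\<lambda>x::real \<times> real. g (z - snd x *\<^sub>R (cos (fst x), sin (fst x)))) \<in> borel_measurable (borel \<Otimes>\<^sub>M borel)"
    using measurable_compose[OF c g_borel] by (simp add: borel_prod)
  show ?thesis unfolding cut_kernel_def by measurable
qed

lemma ray_tail_borel [measurable]: "(\<lambda>\<theta>. ray_tail \<epsilon> z (cos \<theta>, sin \<theta>)) \<in> borel_measurable borel"
proof -
  have c: "(\<lambda>x::real \<times> real. (z, (cos (fst x), sin (fst x)), snd x)) \<in> borel_measurable borel"
    by (intro borel_measurable_continuous_onI continuous_intros)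
  have [measurable]: "(\<lambda>x. ray_kernel z (cos (fst x), sin (fst x)) (snd x)) \<in> borel_measurable (borel \<Otimes>\<^sub>M borel)"
    using measurable_compose[OF c ray_kernel_borel] by (simp add: borel_prod)
  have "(\<lambda>(\<theta>, r). indicator {\<epsilon><..} r *\<^sub>R ray_kernel z (cos \<theta>, sin \<theta>) r) \<in> borel_measurable (borel \<Otimes>\<^sub>M lborel)"
    by (simp add: case_prod_beta)
  then show ?thesis
    unfolding ray_tail_def by (rule lborel.borel_measurable_lebesgue_integral)
qed

text \<open>In polar coordinates the truncated integral becomes an integral of \<open>\<omega>\<close> against the truncated ray
  integrals; their common divergent part \<open>log_tail \<epsilon> *\<^sub>R g z\<close> is annihilated by the mean zero
  condition.\<close>

lemma has_pv_rough:
  assumes \<omega> [measurable]: "\<omega> \<in> borel_measurable borel" and i: "integrable lborel \<omega>"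
    and mean: "(LINT \<theta>|lborel. \<omega> \<theta>) = 0" and supp: "\<And>\<theta>. \<theta> \<notin> {0..2 * pi} \<Longrightarrow> \<omega> \<theta> = 0"
  shows "has_pv (\<lambda>u. g (z - u) * \<omega> (polar_angle u) / of_real ((norm u)\<^sup>2)) (rough_value \<omega> z)"
proof (rule has_pvI_lborel)
  let ?e = "\<lambda>\<theta>::real. (cos \<theta>, sin \<theta>)"
  define f where "f \<epsilon> u = indicator {u. \<epsilon> < norm u} u *\<^sub>R (g (z - u) * \<omega> (polar_angle u) / of_real ((norm u)\<^sup>2))" for \<epsilon> u
  have fm [measurable]: "f \<epsilon> \<in> borel_measurable borel" for \<epsilon>
  proof -
    have [measurable]: "(\<lambda>u. g (z - u)) \<in> borel_measurable borel"
      by (rule measurable_compose[OF _ g_borel]) (intro borel_measurable_continuous_onI continuous_intros)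
    have [measurable]: "{u::real \<times> real. \<epsilon> < norm u} \<in> sets borel"
      by (intro borel_open open_Collect_less continuous_intros)
    have [measurable]: "(\<lambda>u. \<omega> (polar_angle u)) \<in> borel_measurable borel"
      by (rule measurable_compose[OF polar_angle_borel \<omega>])
    show ?thesis unfolding f_def[abs_def] by measurable
  qed
  \<comment> \<open>\<open>h\<close> is the truncated integrand in polar coordinates, and
    \<open>k\<close> is the angular factor times the radial \<open>cut_kernel\<close>; they agree
    except at the end angles.\<close>
  define h where "h \<epsilon> x = (indicator {0..2 * pi} (fst x) * (indicator {0<..} (snd x) * snd x)) *\<^sub>R f \<epsilon> (snd x * cos (fst x), snd x * sin (fst x))" for \<epsilon> x
  define k where "k \<epsilon> x = \<omega> (fst x) * cut_kernel \<epsilon> z (?e (fst x)) (snd x)" for \<epsilon> x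
  have nrm: "norm (r * cos \<theta>, r * sin \<theta>) = r" if "0 < r" for r \<theta> :: real
    using norm_scaleR[of r "?e \<theta>"] that norm_cos_sin[of \<theta>] by simp
  have hk0: "h \<epsilon> (\<theta>, r) = k \<epsilon> (\<theta>, r)" if "0 < \<epsilon>" "\<theta> \<noteq> 0" "\<theta> \<noteq> 2 * pi" for \<epsilon> \<theta> r
  proof (cases "0 < r \<and> \<theta> \<in> {0..2 * pi}")
    case True
    then have r: "0 < r" "polar_angle (r * cos \<theta>, r * sin \<theta>) = \<theta>"
      using that polar_angle_polar[of r \<theta>] by auto
    \<comment> \<open>The Jacobian \<open>r\<close> turns \<open>1 / r^2\<close> into the
      \<open>1 / r\<close> of \<open>cut_kernel\<close>.\<close>
    have "h \<epsilon> (\<theta>, r) = r *\<^sub>R (indicator {\<epsilon><..} r *\<^sub>R (g (z - r *\<^sub>R ?e \<theta>) * \<omega> \<theta> / of_real (r\<^sup>2)))"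
      using True by (simp add: h_def f_def r(2) nrm indicator_def)
    then show ?thesis using r(1) by (simp add: k_def cut_kernel_def scaleR_conv_of_real power2_eq_square)
  next
    case False
    then show ?thesis
      using that supp[of \<theta>] by (auto simp: h_def k_def cut_kernel_def indicator_def)
  qed
  have km [measurable]: "k \<epsilon> \<in> borel_measurable (lborel \<Otimes>\<^sub>M lborel)" for \<epsilon>
  proof -
    have "k \<epsilon> \<in> borel_measurable (borel \<Otimes>\<^sub>M borel)" unfolding k_def[abs_def] by measurable
    then show ?thesis by (simp cong: measurable_cong_sets)
  qed
  have hm [measurable]: "h \<epsilon> \<in> borel_measurable (lborel \<Otimes>\<^sub>M lborel)" for \<epsilon>
  proof -
    have "(\<lambda>x::real \<times> real. (snd x * cos (fst x), snd x * sin (fst x))) \<in> borel_measurable borel"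
      by (intro borel_measurable_continuous_onI continuous_intros)
    from measurable_compose[OF this fm]
    have [measurable]: "(\<lambda>x. f \<epsilon> (snd x * cos (fst x), snd x * sin (fst x))) \<in> borel_measurable (borel \<Otimes>\<^sub>M borel)"
      by (simp add: borel_prod)
    have "h \<epsilon> \<in> borel_measurable (borel \<Otimes>\<^sub>M borel)" unfolding h_def[abs_def] by measurable
    then show ?thesis by (simp cong: measurable_cong_sets)
  qed
  have hk: "AE x in lborel \<Otimes>\<^sub>M lborel. h \<epsilon> x = k \<epsilon> x" if "0 < \<epsilon>" for \<epsilon>
  proof -
    have "AE \<theta>::real in lborel. \<theta> \<noteq> 0" "AE \<theta>::real in lborel. \<theta> \<noteq> 2 * pi" by (rule AE_lborel_singleton)+
    then have "AE \<theta> in lborel. AE r in lborel. h \<epsilon> (\<theta>, r) = k \<epsilon> (\<theta>, r)"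
      by eventually_elim (use hk0[OF that] in simp)
    then show ?thesis by (rule lborel_pair.AE_pair_measure[OF measurable_equality_set[OF hm km]])
  qed
  have ki: "integrable (lborel \<Otimes>\<^sub>M lborel) (k \<epsilon>)" if "0 < \<epsilon>" for \<epsilon>
  proof (rule lborel_pair.Fubini_integrable[OF km])
    have eq: "(LINT r|lborel. norm (k \<epsilon> (\<theta>, r))) = norm (\<omega> \<theta>) * (LINT r|lborel. norm (cut_kernel \<epsilon> z (?e \<theta>) r))" for \<theta>
      by (simp add: k_def norm_mult)
    show "integrable lborel (\<lambda>\<theta>. LINT r|lborel. norm (k \<epsilon> (\<theta>, r)))"
    proof (rule Bochner_Integration.integrable_bound)
      show "integrable lborel (\<lambda>\<theta>. norm (\<omega> \<theta>) * (sqrt A * ray_const + log_tail \<epsilon> * A))" using i by simp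
      show "AE \<theta> in lborel. norm (LINT r|lborel. norm (k \<epsilon> (\<theta>, r))) \<le> norm (norm (\<omega> \<theta>) * (sqrt A * ray_const + log_tail \<epsilon> * A))"
      proof (rule AE_I2)
        fix \<theta>
        have "0 \<le> (LINT r|lborel. norm (cut_kernel \<epsilon> z (?e \<theta>) r))" by simp
        then show "norm (LINT r|lborel. norm (k \<epsilon> (\<theta>, r))) \<le> norm (norm (\<omega> \<theta>) * (sqrt A * ray_const + log_tail \<epsilon> * A))"
          unfolding eq using norm_cut_kernel_integral_le[OF that norm_cos_sin, of z \<theta>]
          by (auto simp: abs_mult intro!: mult_left_mono)
      qed
      show "(\<lambda>\<theta>. LINT r|lborel. norm (k \<epsilon> (\<theta>, r))) \<in> borel_measurable lborel" by measurable
    qed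
    show "AE \<theta> in lborel. integrable lborel (\<lambda>r. k \<epsilon> (\<theta>, r))"
      unfolding k_def using cut_kernel_integral(1)[OF that norm_cos_sin] by simp
  qed
  have hi: "integrable (lborel \<Otimes>\<^sub>M lborel) (h \<epsilon>)" if "0 < \<epsilon>" for \<epsilon>
    using integrable_cong_AE[OF hm km hk[OF that]] ki[OF that] by (rule iffD2)
  have fi: "integrable lborel (f \<epsilon>)" if "0 < \<epsilon>" for \<epsilon>
    using lborel_polar(1)[OF fm, of \<epsilon>] hi[OF that] by (simp add: h_def[abs_def])
  then show "integrable lborel (\<lambda>u. indicator {u. \<epsilon> < norm u} u *\<^sub>R (g (z - u) * \<omega> (polar_angle u) / of_real ((norm u)\<^sup>2)))" if "0 < \<epsilon>" for \<epsilon>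
    using that by (simp add: f_def[abs_def])
  have ti: "integrable lborel (\<lambda>\<theta>. \<omega> \<theta> * ray_tail \<epsilon> z (?e \<theta>))" for \<epsilon>
  proof (rule Bochner_Integration.integrable_bound)
    show "integrable lborel (\<lambda>\<theta>. norm (\<omega> \<theta>) * (sqrt A * ray_const))" using i by simp
    show "AE \<theta> in lborel. norm (\<omega> \<theta> * ray_tail \<epsilon> z (?e \<theta>)) \<le> norm (norm (\<omega> \<theta>) * (sqrt A * ray_const))"
    proof (rule AE_I2)
      fix \<theta>
      have "0 \<le> sqrt A * ray_const"
        using tameD(4)[OF tame] ray_const_nonneg by simp
      then have "norm (norm (\<omega> \<theta>) * (sqrt A * ray_const)) = norm (\<omega> \<theta>) * (sqrt A * ray_const)"
        unfolding real_norm_def by (intro abs_of_nonneg mult_nonneg_nonneg[OF norm_ge_zero])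
      moreover have "norm (\<omega> \<theta> * ray_tail \<epsilon> z (?e \<theta>)) \<le> norm (\<omega> \<theta>) * (sqrt A * ray_const)"
        unfolding norm_mult by (intro mult_left_mono norm_ray_tail_le norm_cos_sin) simp
      ultimately show "norm (\<omega> \<theta> * ray_tail \<epsilon> z (?e \<theta>)) \<le> norm (norm (\<omega> \<theta>) * (sqrt A * ray_const))"
        by (simp only:)
    qed
  qed measurable
  have fval: "(LINT u|lborel. f \<epsilon> u) = (LINT \<theta>|lborel. \<omega> \<theta> * ray_tail \<epsilon> z (?e \<theta>))" if "0 < \<epsilon>" for \<epsilon>
  proof -
    have "(LINT u|lborel. f \<epsilon> u) = (LINT x|(lborel \<Otimes>\<^sub>M lborel). h \<epsilon> x)"
      using lborel_polar(2)[OF fm, of \<epsilon>] by (simp add: h_def[abs_def])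
    also have "\<dots> = (LINT x|(lborel \<Otimes>\<^sub>M lborel). k \<epsilon> x)" by (rule integral_cong_AE[OF hm km hk[OF that]])
    also have "\<dots> = (LINT \<theta>|lborel. LINT r|lborel. k \<epsilon> (\<theta>, r))"
      by (rule lborel_pair.integral_fst'[OF ki[OF that], symmetric])
    also have "\<dots> = (LINT \<theta>|lborel. \<omega> \<theta> * (ray_tail \<epsilon> z (?e \<theta>) + log_tail \<epsilon> *\<^sub>R g z))"
      unfolding k_def by (simp add: cut_kernel_integral(2)[OF that norm_cos_sin])
    also have "\<dots> = (LINT \<theta>|lborel. \<omega> \<theta> * ray_tail \<epsilon> z (?e \<theta>) + \<omega> \<theta> * (log_tail \<epsilon> *\<^sub>R g z))"
      by (simp only: distrib_left)
    also have "\<dots> = (LINT \<theta>|lborel. \<omega> \<theta> * ray_tail \<epsilon> z (?e \<theta>)) + (LINT \<theta>|lborel. \<omega> \<theta> * (log_tail \<epsilon> *\<^sub>R g z))"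
      using ti i by (intro Bochner_Integration.integral_add integrable_mult_left) auto
    also have "(LINT \<theta>|lborel. \<omega> \<theta> * (log_tail \<epsilon> *\<^sub>R g z)) = 0" by (simp only: integral_mult_left_zero mean) simp
    finally show ?thesis by simp
  qed
  have "((\<lambda>\<epsilon>. LINT \<theta>|lborel. \<omega> \<theta> * ray_tail \<epsilon> z (?e \<theta>)) \<longlongrightarrow> rough_value \<omega> z) (at_right 0)"
    unfolding rough_value_def
  proof (rule integral_dominated_convergence_at_right[where w = "\<lambda>\<theta>. norm (\<omega> \<theta>) * (sqrt A * ray_const)"])
    show "(\<lambda>\<theta>. \<omega> \<theta> * ray_integral z (?e \<theta>)) \<in> borel_measurable lborel"
    proof -
      have "(\<lambda>\<theta>::real. (z, \<theta>)) \<in> borel_measurable borel" by (intro borel_measurable_continuous_onI continuous_intros)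
      from measurable_compose[OF this ray_integral_borel_circle]
      have [measurable]: "(\<lambda>\<theta>. ray_integral z (?e \<theta>)) \<in> borel_measurable borel" by simp
      show ?thesis by measurable
    qed
    show "((\<lambda>\<epsilon>. \<omega> \<theta> * ray_tail \<epsilon> z (?e \<theta>)) \<longlongrightarrow> \<omega> \<theta> * ray_integral z (?e \<theta>)) (at_right 0)" for \<theta>
      by (intro tendsto_mult_left ray_tail_tendsto norm_cos_sin)
    show "norm (\<omega> \<theta> * ray_tail \<epsilon> z (?e \<theta>)) \<le> norm (\<omega> \<theta>) * (sqrt A * ray_const)" for \<epsilon> \<theta>
      unfolding norm_mult by (intro mult_left_mono norm_ray_tail_le norm_cos_sin) simp
  qed (use i in auto)
  moreover have "\<forall>\<^sub>F \<epsilon> in at_right 0. (LINT \<theta>|lborel. \<omega> \<theta> * ray_tail \<epsilon> z (?e \<theta>)) = (LINT u|lborel. f \<epsilon> u)"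
    using fval by (auto simp: eventually_at_right_field intro: exI[of _ 1])
  ultimately have "((\<lambda>\<epsilon>. LINT u|lborel. f \<epsilon> u) \<longlongrightarrow> rough_value \<omega> z) (at_right 0)"
    by (rule Lim_transform_eventually)
  then show "((\<lambda>\<epsilon>. LINT u|lborel. indicator {u. \<epsilon> < norm u} u *\<^sub>R (g (z - u) * \<omega> (polar_angle u) / of_real ((norm u)\<^sup>2))) \<longlongrightarrow> rough_value \<omega> z) (at_right 0)"
    by (simp add: f_def)
qed

end

section \<open>The Schwartz functions used as test functions\<close>

definition bessel_mult :: "real \<times> real \<Rightarrow> real" where
  "bessel_mult \<xi> = 1 + 4 * pi\<^sup>2 * (norm \<xi>)\<^sup>2"

lemma bessel_mult_ge_1: "1 \<le> bessel_mult \<xi>"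
  by (simp add: bessel_mult_def)

text \<open>With exponent \<open>- (s / 2)\<close> these are the test functions inserted into the
  duality that defines the Bessel derivative; the multiplier raises the exponent to 0. The Gaussian
  makes them Schwartz functions, and the character places the Fourier transform around
  \<open>z\<close>.\<close>

definition gauss_char :: "real \<Rightarrow> real \<times> real \<Rightarrow> real \<Rightarrow> real \<times> real \<Rightarrow> complex" where
  "gauss_char c z a \<xi> = of_real (bessel_mult \<xi> powr a) *
     exp (of_real (- c * (norm \<xi>)\<^sup>2) + 2 * of_real pi * \<i> * of_real (z \<bullet> \<xi>))"

text \<open>The closure of the functions \<open>gauss_char\<close> under partial derivatives lies in this class, on which rapid
  decay is an easy induction.\<close>

inductive gauss_poly :: "real \<Rightarrow> real \<times> real \<Rightarrow> (real \<times> real \<Rightarrow> complex) \<Rightarrow> bool" for c z where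
  base: "gauss_poly c z (gauss_char c z a)"
| add: "gauss_poly c z f \<Longrightarrow> gauss_poly c z g \<Longrightarrow> gauss_poly c z (\<lambda>\<xi>. f \<xi> + g \<xi>)"
| scale: "gauss_poly c z f \<Longrightarrow> gauss_poly c z (\<lambda>\<xi>. k * f \<xi>)"
| fst: "gauss_poly c z f \<Longrightarrow> gauss_poly c z (\<lambda>\<xi>. of_real (fst \<xi>) * f \<xi>)"
| snd: "gauss_poly c z f \<Longrightarrow> gauss_poly c z (\<lambda>\<xi>. of_real (snd \<xi>) * f \<xi>)"

text \<open>Grouped so that both coefficient functions are visibly built by the rules of
  \<open>gauss_poly\<close>. Differentiating the power of the symbol lowers its exponent by 1 and
  brings out \<open>8 * pi\<^sup>2 * a\<close> times a coordinate.\<close>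

lemma gauss_char_deriv:
  "(gauss_char c z a has_derivative (\<lambda>h.
      of_real (fst h) * (of_real (8 * pi\<^sup>2 * a) * (of_real (fst \<xi>) * gauss_char c z (a - 1) \<xi>)
        + (of_real (- 2 * c) * (of_real (fst \<xi>) * gauss_char c z a \<xi>) + (2 * of_real pi * \<i> * of_real (fst z)) * gauss_char c z a \<xi>)) +
      of_real (snd h) * (of_real (8 * pi\<^sup>2 * a) * (of_real (snd \<xi>) * gauss_char c z (a - 1) \<xi>)
        + (of_real (- 2 * c) * (of_real (snd \<xi>) * gauss_char c z a \<xi>) + (2 * of_real pi * \<i> * of_real (snd z)) * gauss_char c z a \<xi>)))) (at \<xi>)"
proof -
  have pos: "bessel_mult \<xi> > 0" using bessel_mult_ge_1[of \<xi>] by linarith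
  have m: "(bessel_mult has_derivative (\<lambda>h. 8 * pi\<^sup>2 * (\<xi> \<bullet> h))) (at \<xi>)"
    unfolding bessel_mult_def[abs_def] power2_norm_eq_inner
    by (auto intro!: derivative_eq_intros simp: inner_commute)
  have mp: "((\<lambda>\<xi>. complex_of_real (bessel_mult \<xi> powr a)) has_derivative
      (\<lambda>h. of_real (a * bessel_mult \<xi> powr (a - 1) * (8 * pi\<^sup>2 * (\<xi> \<bullet> h))))) (at \<xi>)"
  proof (rule has_derivative_of_real)
    have "((\<lambda>t. t powr a) has_real_derivative a * bessel_mult \<xi> powr (a - 1)) (at (bessel_mult \<xi>))"
      using pos by (auto intro!: derivative_eq_intros simp: powr_diff)
    from has_derivative_compose[OF m has_field_derivative_imp_has_derivative[OF this]]
    show "((\<lambda>\<xi>. bessel_mult \<xi> powr a) has_derivative (\<lambda>h. a * bessel_mult \<xi> powr (a - 1) * (8 * pi\<^sup>2 * (\<xi> \<bullet> h)))) (at \<xi>)"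
      by (simp add: mult_ac)
  qed
  define e where "e \<xi> = complex_of_real (- c * (norm \<xi>)\<^sup>2) + 2 * of_real pi * \<i> * of_real (z \<bullet> \<xi>)" for \<xi>
  have ed: "(e has_derivative (\<lambda>h. of_real (- 2 * c * (\<xi> \<bullet> h)) + 2 * of_real pi * \<i> * of_real (z \<bullet> h))) (at \<xi>)"
    unfolding e_def[abs_def] power2_norm_eq_inner
    by (auto intro!: derivative_eq_intros simp: inner_commute algebra_simps)
  have ex: "((\<lambda>\<xi>. exp (e \<xi>)) has_derivative
      (\<lambda>h. exp (e \<xi>) * (of_real (- 2 * c * (\<xi> \<bullet> h)) + 2 * of_real pi * \<i> * of_real (z \<bullet> h)))) (at \<xi>)"
    using has_derivative_compose[OF ed has_field_derivative_imp_has_derivative[OF DERIV_exp[of "e \<xi>"]]] by simp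
  show ?thesis
  proof (rule has_derivative_eq_rhs)
    show "(gauss_char c z a has_derivative (\<lambda>h. of_real (bessel_mult \<xi> powr a) * (exp (e \<xi>) * (of_real (- 2 * c * (\<xi> \<bullet> h)) + 2 * of_real pi * \<i> * of_real (z \<bullet> h)))
        + of_real (a * bessel_mult \<xi> powr (a - 1) * (8 * pi\<^sup>2 * (\<xi> \<bullet> h))) * exp (e \<xi>))) (at \<xi>)"
      unfolding gauss_char_def[abs_def] e_def[symmetric] by (rule has_derivative_mult[OF mp ex])
    show "(\<lambda>h. of_real (bessel_mult \<xi> powr a) * (exp (e \<xi>) * (of_real (- 2 * c * (\<xi> \<bullet> h)) + 2 * of_real pi * \<i> * of_real (z \<bullet> h)))
        + of_real (a * bessel_mult \<xi> powr (a - 1) * (8 * pi\<^sup>2 * (\<xi> \<bullet> h))) * exp (e \<xi>)) = (\<lambda>h.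
      of_real (fst h) * (of_real (8 * pi\<^sup>2 * a) * (of_real (fst \<xi>) * gauss_char c z (a - 1) \<xi>)
        + (of_real (- 2 * c) * (of_real (fst \<xi>) * gauss_char c z a \<xi>) + (2 * of_real pi * \<i> * of_real (fst z)) * gauss_char c z a \<xi>)) +
      of_real (snd h) * (of_real (8 * pi\<^sup>2 * a) * (of_real (snd \<xi>) * gauss_char c z (a - 1) \<xi>)
        + (of_real (- 2 * c) * (of_real (snd \<xi>) * gauss_char c z a \<xi>) + (2 * of_real pi * \<i> * of_real (snd z)) * gauss_char c z a \<xi>)))"
    proof
      fix h :: "real \<times> real"
      have gc: "gauss_char c z b \<xi> = of_real (bessel_mult \<xi> powr b) * exp (e \<xi>)" for b
        by (simp only: gauss_char_def e_def)
      define E where "E = exp (e \<xi>)"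
      show "of_real (bessel_mult \<xi> powr a) * (exp (e \<xi>) * (of_real (- 2 * c * (\<xi> \<bullet> h)) + 2 * of_real pi * \<i> * of_real (z \<bullet> h)))
          + of_real (a * bessel_mult \<xi> powr (a - 1) * (8 * pi\<^sup>2 * (\<xi> \<bullet> h))) * exp (e \<xi>) =
        of_real (fst h) * (of_real (8 * pi\<^sup>2 * a) * (of_real (fst \<xi>) * gauss_char c z (a - 1) \<xi>)
          + (of_real (- 2 * c) * (of_real (fst \<xi>) * gauss_char c z a \<xi>) + (2 * of_real pi * \<i> * of_real (fst z)) * gauss_char c z a \<xi>)) +
        of_real (snd h) * (of_real (8 * pi\<^sup>2 * a) * (of_real (snd \<xi>) * gauss_char c z (a - 1) \<xi>)
          + (of_real (- 2 * c) * (of_real (snd \<xi>) * gauss_char c z a \<xi>) + (2 * of_real pi * \<i> * of_real (snd z)) * gauss_char c z a \<xi>))"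
        unfolding gc E_def[symmetric] inner_prod_def by (simp add: algebra_simps)
    qed
  qed
qed

lemma gauss_poly_deriv:
  assumes "gauss_poly c z f"
  shows "\<exists>f1 f2. gauss_poly c z f1 \<and> gauss_poly c z f2 \<and>
    (\<forall>\<xi>. (f has_derivative (\<lambda>h. of_real (fst h) * f1 \<xi> + of_real (snd h) * f2 \<xi>)) (at \<xi>))"
  using assms
proof induction
  case (base a)
  show ?case
    by (rule exI, rule exI, intro conjI allI, rule gauss_poly.add[OF gauss_poly.scale[OF gauss_poly.fst[OF gauss_poly.base[where a = "a - 1"]], where k = "of_real (8 * pi\<^sup>2 * a)"]
            gauss_poly.add[OF gauss_poly.scale[OF gauss_poly.fst[OF gauss_poly.base[where a = a]], where k = "of_real (- 2 * c)"]
              gauss_poly.scale[OF gauss_poly.base[where a = a], where k = "2 * of_real pi * \<i> * of_real (fst z)"]]],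
        rule gauss_poly.add[OF gauss_poly.scale[OF gauss_poly.snd[OF gauss_poly.base[where a = "a - 1"]], where k = "of_real (8 * pi\<^sup>2 * a)"]
            gauss_poly.add[OF gauss_poly.scale[OF gauss_poly.snd[OF gauss_poly.base[where a = a]], where k = "of_real (- 2 * c)"]
              gauss_poly.scale[OF gauss_poly.base[where a = a], where k = "2 * of_real pi * \<i> * of_real (snd z)"]]],
        rule gauss_char_deriv)
next
  case (add f g)
  obtain f1 f2 where f: "gauss_poly c z f1" "gauss_poly c z f2"
    "\<And>\<xi>. (f has_derivative (\<lambda>h. of_real (fst h) * f1 \<xi> + of_real (snd h) * f2 \<xi>)) (at \<xi>)"
    using add.IH(1) by blast
  obtain g1 g2 where g: "gauss_poly c z g1" "gauss_poly c z g2"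
    "\<And>\<xi>. (g has_derivative (\<lambda>h. of_real (fst h) * g1 \<xi> + of_real (snd h) * g2 \<xi>)) (at \<xi>)"
    using add.IH(2) by blast
  have "((\<lambda>\<xi>. f \<xi> + g \<xi>) has_derivative (\<lambda>h. of_real (fst h) * (f1 \<xi> + g1 \<xi>) + of_real (snd h) * (f2 \<xi> + g2 \<xi>))) (at \<xi>)" for \<xi>
    by (rule has_derivative_eq_rhs[OF has_derivative_add[OF f(3) g(3)]]) (simp add: algebra_simps fun_eq_iff)
  then show ?case using gauss_poly.add[OF f(1) g(1)] gauss_poly.add[OF f(2) g(2)] by blast
next
  case (scale f k)
  obtain f1 f2 where f: "gauss_poly c z f1" "gauss_poly c z f2"
    "\<And>\<xi>. (f has_derivative (\<lambda>h. of_real (fst h) * f1 \<xi> + of_real (snd h) * f2 \<xi>)) (at \<xi>)"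
    using scale.IH by blast
  have "((\<lambda>\<xi>. k * f \<xi>) has_derivative (\<lambda>h. of_real (fst h) * (k * f1 \<xi>) + of_real (snd h) * (k * f2 \<xi>))) (at \<xi>)" for \<xi>
    by (rule has_derivative_eq_rhs[OF has_derivative_mult_right[OF f(3)]]) (simp add: algebra_simps fun_eq_iff)
  then show ?case using gauss_poly.scale[OF f(1)] gauss_poly.scale[OF f(2)] by blast
next
  case (fst f)
  obtain f1 f2 where f: "gauss_poly c z f1" "gauss_poly c z f2"
    "\<And>\<xi>. (f has_derivative (\<lambda>h. of_real (fst h) * f1 \<xi> + of_real (snd h) * f2 \<xi>)) (at \<xi>)"
    using fst.IH by blast
  have d: "((\<lambda>\<xi>::real \<times> real. complex_of_real (fst \<xi>)) has_derivative (\<lambda>h. of_real (fst h))) (at \<xi>)" for \<xi>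
    by (auto intro!: derivative_eq_intros)
  have "((\<lambda>\<xi>. of_real (fst \<xi>) * f \<xi>) has_derivative (\<lambda>h. of_real (fst h) * (f \<xi> + of_real (fst \<xi>) * f1 \<xi>) + of_real (snd h) * (of_real (fst \<xi>) * f2 \<xi>))) (at \<xi>)" for \<xi>
    by (rule has_derivative_eq_rhs[OF has_derivative_mult[OF d f(3)]]) (simp add: algebra_simps fun_eq_iff)
  then show ?case using gauss_poly.add[OF fst.hyps gauss_poly.fst[OF f(1)]] gauss_poly.fst[OF f(2)] by blast
next
  case (snd f)
  obtain f1 f2 where f: "gauss_poly c z f1" "gauss_poly c z f2"
    "\<And>\<xi>. (f has_derivative (\<lambda>h. of_real (fst h) * f1 \<xi> + of_real (snd h) * f2 \<xi>)) (at \<xi>)"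
    using snd.IH by blast
  have d: "((\<lambda>\<xi>::real \<times> real. complex_of_real (snd \<xi>)) has_derivative (\<lambda>h. of_real (snd h))) (at \<xi>)" for \<xi>
    by (auto intro!: derivative_eq_intros)
  have "((\<lambda>\<xi>. of_real (snd \<xi>) * f \<xi>) has_derivative (\<lambda>h. of_real (fst h) * (of_real (snd \<xi>) * f1 \<xi>) + of_real (snd h) * (f \<xi> + of_real (snd \<xi>) * f2 \<xi>))) (at \<xi>)" for \<xi>
    by (rule has_derivative_eq_rhs[OF has_derivative_mult[OF d f(3)]]) (simp add: algebra_simps fun_eq_iff)
  then show ?case using gauss_poly.snd[OF f(1)] gauss_poly.add[OF snd.hyps gauss_poly.snd[OF f(2)]] by blast
qed

lemma gauss_poly_iterated_deriv:
  assumes "gauss_poly c z f" "set ds \<subseteq> Basis"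
  shows "gauss_poly c z (iterated_deriv ds f)"
  using assms(2)
proof (induction ds)
  case (Cons d ds)
  let ?g = "iterated_deriv ds f"
  obtain f1 f2 where f: "gauss_poly c z f1" "gauss_poly c z f2"
    "\<And>\<xi>. (?g has_derivative (\<lambda>h. of_real (fst h) * f1 \<xi> + of_real (snd h) * f2 \<xi>)) (at \<xi>)"
    using gauss_poly_deriv[of c z ?g] Cons by auto
  have "iterated_deriv (d # ds) f = (\<lambda>\<xi>. of_real (fst d) * f1 \<xi> + of_real (snd d) * f2 \<xi>)"
    using frechet_derivative_at[OF f(3)] by (auto simp: fun_eq_iff dest: fun_cong)
  moreover have "d = (1, 0) \<or> d = (0, 1)" using Cons.prems by (auto simp: Basis_prod_def)
  ultimately show ?case using f(1,2) by auto
qed (use assms in simp)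

text \<open>A single term of the exponential series gives
  \<open>(1 + r) ^ n \<le> fact n * exp (1 + r)\<close>, and completing the square gives
  \<open>r - c * r^2 \<le> 1 / (4 * c)\<close>.\<close>

lemma gauss_decay:
  fixes c r :: real
  assumes "0 < c" "0 \<le> r"
  shows "(1 + r) ^ n * exp (- c * r\<^sup>2) \<le> fact n * exp (1 + 1 / (4 * c))"
proof -
  have "(1 + r) ^ n / fact n \<le> exp (1 + r)"
  proof -
    have "(\<Sum>k\<in>{n}. (1 + r) ^ k /\<^sub>R fact k) \<le> exp (1 + r)"
      unfolding exp_def using assms by (intro sum_le_suminf summable_exp_generic) auto
    then show ?thesis by (simp add: divide_inverse mult.commute)
  qed
  then have "(1 + r) ^ n \<le> fact n * exp (1 + r)" by (simp add: field_simps)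
  then have "(1 + r) ^ n * exp (- c * r\<^sup>2) \<le> fact n * exp (1 + r) * exp (- c * r\<^sup>2)"
    by (rule mult_right_mono) simp
  also have "\<dots> = fact n * exp (1 + r - c * r\<^sup>2)" by (simp add: exp_diff exp_minus field_simps)
  also have "\<dots> \<le> fact n * exp (1 + 1 / (4 * c))"
  proof -
    have "0 \<le> (2 * c * r - 1)\<^sup>2" by simp
    then have "r - c * r\<^sup>2 \<le> 1 / (4 * c)" using assms by (simp add: field_simps power2_eq_square)
    then show ?thesis by simp
  qed
  finally show ?thesis .
qed

text \<open>The power \<open>k\<close> varies in the induction because a coordinate factor is
  absorbed by the estimate for \<open>Suc k\<close>. In the base case the power of the symbol is
  dominated by a polynomial.\<close>

lemma gauss_poly_decay:
  assumes "0 < c" "gauss_poly c z f"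
  shows "\<exists>B. \<forall>\<xi>. (1 + norm \<xi>) ^ k * norm (f \<xi>) \<le> B"
  using assms(2)
proof (induction arbitrary: k)
  case (base a)
  \<comment> \<open>For negative \<open>a\<close> this is 0, in accordance with a power that is at
    most 1.\<close>
  define j where "j = nat \<lceil>a\<rceil>"
  have "(1 + norm \<xi>) ^ k * norm (gauss_char c z a \<xi>) \<le> (1 + 4 * pi\<^sup>2) ^ j * (fact (k + 2 * j) * exp (1 + 1 / (4 * c)))" for \<xi>
  proof -
    let ?r = "norm \<xi>"
    have "bessel_mult \<xi> powr a \<le> bessel_mult \<xi> powr (real j)"
      using bessel_mult_ge_1[of \<xi>] by (intro powr_mono) (auto simp: j_def real_nat_ceiling_ge)
    also have "\<dots> = bessel_mult \<xi> ^ j" using bessel_mult_ge_1[of \<xi>] by (intro powr_realpow) linarith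
    also have "\<dots> \<le> ((1 + 4 * pi\<^sup>2) * (1 + ?r)\<^sup>2) ^ j"
    proof (intro power_mono)
      have "1 \<le> (1 + ?r)\<^sup>2" "?r\<^sup>2 \<le> (1 + ?r)\<^sup>2" by (auto simp: power2_eq_square algebra_simps)
      then have "1 + 4 * pi\<^sup>2 * ?r\<^sup>2 \<le> (1 + ?r)\<^sup>2 + 4 * pi\<^sup>2 * (1 + ?r)\<^sup>2" by (intro add_mono mult_left_mono) auto
      then show "bessel_mult \<xi> \<le> (1 + 4 * pi\<^sup>2) * (1 + ?r)\<^sup>2" by (simp add: bessel_mult_def algebra_simps)
    qed (use bessel_mult_ge_1[of \<xi>] in linarith)
    also have "\<dots> = (1 + 4 * pi\<^sup>2) ^ j * (1 + ?r) ^ (2 * j)" by (simp add: power_mult_distrib power_mult)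
    finally have m: "bessel_mult \<xi> powr a \<le> (1 + 4 * pi\<^sup>2) ^ j * (1 + ?r) ^ (2 * j)" .
    have "norm (gauss_char c z a \<xi>) = bessel_mult \<xi> powr a * exp (- c * ?r\<^sup>2)"
      by (simp add: gauss_char_def norm_mult norm_exp_eq_Re)
    then have "(1 + ?r) ^ k * norm (gauss_char c z a \<xi>) = (1 + ?r) ^ k * (bessel_mult \<xi> powr a * exp (- c * ?r\<^sup>2))" by simp
    also have "\<dots> \<le> (1 + ?r) ^ k * (((1 + 4 * pi\<^sup>2) ^ j * (1 + ?r) ^ (2 * j)) * exp (- c * ?r\<^sup>2))"
      by (intro mult_left_mono mult_right_mono m) auto
    also have "\<dots> = (1 + 4 * pi\<^sup>2) ^ j * ((1 + ?r) ^ (k + 2 * j) * exp (- c * ?r\<^sup>2))" by (simp add: power_add mult_ac)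
    also have "\<dots> \<le> (1 + 4 * pi\<^sup>2) ^ j * (fact (k + 2 * j) * exp (1 + 1 / (4 * c)))"
      by (intro mult_left_mono gauss_decay assms) auto
    finally show ?thesis .
  qed
  then show ?case by blast
next
  case (add f g)
  obtain B1 B2 where B: "\<And>\<xi>. (1 + norm \<xi>) ^ k * norm (f \<xi>) \<le> B1" "\<And>\<xi>. (1 + norm \<xi>) ^ k * norm (g \<xi>) \<le> B2"
    using add.IH by meson
  have "(1 + norm \<xi>) ^ k * norm (f \<xi> + g \<xi>) \<le> B1 + B2" for \<xi>
  proof -
    have "(1 + norm \<xi>) ^ k * norm (f \<xi> + g \<xi>) \<le> (1 + norm \<xi>) ^ k * (norm (f \<xi>) + norm (g \<xi>))"
      by (intro mult_left_mono norm_triangle_ineq) simp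
    then show ?thesis using B[of \<xi>] by (simp add: distrib_left)
  qed
  then show ?case by blast
next
  case (scale f l)
  obtain B where B: "\<And>\<xi>. (1 + norm \<xi>) ^ k * norm (f \<xi>) \<le> B" using scale.IH by meson
  have "(1 + norm \<xi>) ^ k * norm (l * f \<xi>) \<le> norm l * B" for \<xi>
    using mult_left_mono[OF B[of \<xi>], of "norm l"] by (simp add: norm_mult mult_ac)
  then show ?case by blast
next
  case (fst f)
  obtain B where B: "\<And>\<xi>. (1 + norm \<xi>) ^ Suc k * norm (f \<xi>) \<le> B" using fst.IH by meson
  have "(1 + norm \<xi>) ^ k * norm (of_real (fst \<xi>) * f \<xi>) \<le> B" for \<xi>
  proof -
    have "\<bar>fst \<xi>\<bar> \<le> 1 + norm \<xi>" using norm_fst_le[of "fst \<xi>" "snd \<xi>"] by simp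
    then have "(1 + norm \<xi>) ^ k * (\<bar>fst \<xi>\<bar> * norm (f \<xi>)) \<le> (1 + norm \<xi>) ^ k * ((1 + norm \<xi>) * norm (f \<xi>))"
      by (intro mult_left_mono mult_right_mono) auto
    then show ?thesis using B[of \<xi>] by (simp add: norm_mult mult_ac)
  qed
  then show ?case by blast
next
  case (snd f)
  obtain B where B: "\<And>\<xi>. (1 + norm \<xi>) ^ Suc k * norm (f \<xi>) \<le> B" using snd.IH by meson
  have "(1 + norm \<xi>) ^ k * norm (of_real (snd \<xi>) * f \<xi>) \<le> B" for \<xi>
  proof -
    have "\<bar>snd \<xi>\<bar> \<le> 1 + norm \<xi>" using norm_snd_le[of "snd \<xi>" "fst \<xi>"] by simp
    then have "(1 + norm \<xi>) ^ k * (\<bar>snd \<xi>\<bar> * norm (f \<xi>)) \<le> (1 + norm \<xi>) ^ k * ((1 + norm \<xi>) * norm (f \<xi>))"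
      by (intro mult_left_mono mult_right_mono) auto
    then show ?thesis using B[of \<xi>] by (simp add: norm_mult mult_ac)
  qed
  then show ?case by blast
qed

lemma schwartz_gauss_char:
  assumes "0 < c"
  shows "schwartz (gauss_char c z a)"
  unfolding schwartz_def
proof (intro allI impI conjI)
  fix ds :: "(real \<times> real) list" assume "set ds \<subseteq> Basis"
  then have g: "gauss_poly c z (iterated_deriv ds (gauss_char c z a))"
    by (intro gauss_poly_iterated_deriv gauss_poly.base)
  show "iterated_deriv ds (gauss_char c z a) differentiable at \<xi>" for \<xi>
    using gauss_poly_deriv[OF g] unfolding differentiable_def by blast
  fix k :: nat
  obtain B where B: "\<And>\<xi>. (1 + norm \<xi>) ^ k * norm (iterated_deriv ds (gauss_char c z a) \<xi>) \<le> B"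
    using gauss_poly_decay[OF assms g, of k] by blast
  show "bounded (range (\<lambda>\<xi>. (1 + norm \<xi>) ^ k *\<^sub>R iterated_deriv ds (gauss_char c z a) \<xi>))"
    by (rule boundedI[of _ B]) (use B in \<open>auto simp: power_abs abs_of_nonneg\<close>)
qed

section \<open>Gauss kernels and Bessel potentials\<close>

text \<open>The Fourier transform of the Gaussian \<open>exp (- c * (norm \<xi>)\<^sup>2)\<close>,
  that is, the heat kernel at time \<open>c / (4 * pi\<^sup>2)\<close>. The parameter
  \<open>c\<close> adds under convolution, whence the later
  \<open>c + 4 * pi\<^sup>2 * t\<close>.\<close>

definition gauss_kernel :: "real \<Rightarrow> real \<times> real \<Rightarrow> real" where
  "gauss_kernel c x = pi / c * exp (- (pi\<^sup>2 * (norm x)\<^sup>2 / c))"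

lemma gauss_kernel_nonneg: "0 < c \<Longrightarrow> 0 \<le> gauss_kernel c x"
  by (simp add: gauss_kernel_def)

lemma gauss_kernel_le: "0 < c \<Longrightarrow> gauss_kernel c x \<le> pi / c"
  by (simp add: gauss_kernel_def divide_right_mono mult_left_le)

lemma gauss_kernel_minus: "gauss_kernel c (- x) = gauss_kernel c x"
  by (simp add: gauss_kernel_def)

lemma gauss_kernel_borel2 [measurable]: "(\<lambda>x. gauss_kernel (fst x) (snd x)) \<in> borel_measurable borel"
proof -
  have [measurable]: "(\<lambda>x::real \<times> real \<times> real. fst x) \<in> borel_measurable borel"
    "(\<lambda>x::real \<times> real \<times> real. (norm (snd x))\<^sup>2) \<in> borel_measurable borel"
    by (intro borel_measurable_continuous_onI continuous_intros)+
  show ?thesis unfolding gauss_kernel_def by measurable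
qed

lemma gauss_kernel_borel [measurable]: "gauss_kernel c \<in> borel_measurable borel"
  unfolding gauss_kernel_def[abs_def] by measurable

lemma gauss_kernel_prod:
  assumes "0 < c"
  shows "gauss_kernel c x = normal_density 0 (sqrt (c / 2) / pi) (fst x) * normal_density 0 (sqrt (c / 2) / pi) (snd x)"
proof -
  define \<sigma> where "\<sigma> = sqrt (c / 2) / pi"
  have s: "2 * \<sigma>\<^sup>2 = c / pi\<^sup>2" using assms by (simp add: \<sigma>_def power_divide)
  have s': "2 * pi * \<sigma>\<^sup>2 = c / pi"
  proof -
    have "2 * pi * \<sigma>\<^sup>2 = pi * (2 * \<sigma>\<^sup>2)" by simp
    then show ?thesis unfolding s by (simp add: power2_eq_square)
  qed
  have "normal_density 0 \<sigma> a * normal_density 0 \<sigma> b = pi / c * exp (- (pi\<^sup>2 * (a\<^sup>2 + b\<^sup>2) / c))" for a b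
  proof -
    have "normal_density 0 \<sigma> a * normal_density 0 \<sigma> b = 1 / (c / pi) * (exp (- a\<^sup>2 / (c / pi\<^sup>2)) * exp (- b\<^sup>2 / (c / pi\<^sup>2)))"
      unfolding normal_density_def s s' using assms by (simp add: real_sqrt_mult[symmetric] real_sqrt_divide)
    also have "\<dots> = pi / c * exp (- (pi\<^sup>2 * (a\<^sup>2 + b\<^sup>2) / c))"
      by (simp add: exp_add[symmetric] add_divide_distrib distrib_left mult.commute)
    finally show ?thesis .
  qed
  then show ?thesis unfolding gauss_kernel_def \<sigma>_def[symmetric] by (simp add: norm_prod_def)
qed

lemma
  assumes "0 < c"
  shows gauss_kernel_integrable: "integrable lborel (gauss_kernel c)"
    and gauss_kernel_integral: "(LINT x|lborel. gauss_kernel c x) = 1"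
    and nn_integral_gauss_kernel: "(\<integral>\<^sup>+x. ennreal (gauss_kernel c x) \<partial>lborel) = 1"
proof -
  have s: "0 < sqrt (c / 2) / pi" using assms by simp
  show i: "integrable lborel (gauss_kernel c)"
    unfolding gauss_kernel_prod[OF assms, abs_def]
    by (intro integrable_lborel_prod integrable_normal_density s)
  show l: "(LINT x|lborel. gauss_kernel c x) = 1"
    unfolding gauss_kernel_prod[OF assms]
    by (subst integral_lborel_prod) (auto intro!: integrable_normal_density s simp: integral_normal_density[OF s])
  show "(\<integral>\<^sup>+x. ennreal (gauss_kernel c x) \<partial>lborel) = 1"
    using nn_integral_eq_integral[OF i] gauss_kernel_nonneg[OF assms] l by simp
qed

text \<open>For \<open>d \<le> 1\<close> the inequality \<open>1 - exp (- x) \<le> x\<close> gives a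
  bound linear in \<open>d\<close>, hence in \<open>d powr \<kappa>\<close>, and half of the
  Gaussian absorbs the factor \<open>u\<close>. For \<open>d > 1\<close> the first Gaussian alone is
  below the right side.\<close>

lemma gauss_decrease:
  fixes u d :: real
  assumes "0 \<le> u" "0 \<le> d" "0 < \<kappa>" "\<kappa> \<le> 1"
  shows "exp (- u\<^sup>2) - exp (- (u + d)\<^sup>2) \<le> 3 * d powr \<kappa> * exp (- (u\<^sup>2 / 2))"
proof (cases "d \<le> 1")
  case True
  have "d powr 1 \<le> d powr \<kappa>" using assms True by (intro powr_mono') auto
  then have d: "d \<le> d powr \<kappa>" using assms by simp
  have ue: "u * exp (- (u\<^sup>2 / 2)) \<le> 1"
  proof -
    have "0 \<le> (u - 1)\<^sup>2" by simp
    then have "u \<le> 1 + u\<^sup>2 / 2" by (simp add: power2_eq_square field_simps)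
    also have "\<dots> \<le> exp (u\<^sup>2 / 2)" by (rule exp_ge_add_one_self)
    finally show ?thesis by (simp add: exp_minus field_simps)
  qed
  have half: "exp (- u\<^sup>2) = exp (- (u\<^sup>2 / 2)) * exp (- (u\<^sup>2 / 2))" by (simp add: exp_add[symmetric])
  have "1 - exp (- (2 * u * d + d\<^sup>2)) \<le> 2 * u * d + d\<^sup>2"
    using exp_ge_add_one_self[of "- (2 * u * d + d\<^sup>2)"] by linarith
  then have "exp (- u\<^sup>2) * (1 - exp (- (2 * u * d + d\<^sup>2))) \<le> exp (- u\<^sup>2) * (2 * u * d + d\<^sup>2)"
    by (rule mult_left_mono) simp
  moreover have "exp (- (u + d)\<^sup>2) = exp (- u\<^sup>2) * exp (- (2 * u * d + d\<^sup>2))"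
    by (simp add: exp_add[symmetric] power2_sum algebra_simps)
  ultimately have "exp (- u\<^sup>2) - exp (- (u + d)\<^sup>2) \<le> exp (- u\<^sup>2) * (2 * u * d + d\<^sup>2)"
    by (simp add: right_diff_distrib)
  also have "\<dots> = exp (- (u\<^sup>2 / 2)) * (2 * d * (u * exp (- (u\<^sup>2 / 2))) + d * d * exp (- (u\<^sup>2 / 2)))"
    unfolding half by (simp add: algebra_simps power2_eq_square)
  also have "\<dots> \<le> exp (- (u\<^sup>2 / 2)) * (2 * d * 1 + d * 1 * 1)"
    using assms True ue by (intro mult_left_mono add_mono mult_mono) auto
  also have "\<dots> \<le> exp (- (u\<^sup>2 / 2)) * (3 * d powr \<kappa>)" using d by (intro mult_left_mono) auto
  finally show ?thesis by (simp add: mult_ac)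
next
  case False
  then have "1 \<le> d powr \<kappa>" using assms by (intro ge_one_powr_ge_zero) auto
  then have "1 * exp (- (u\<^sup>2 / 2)) \<le> 3 * d powr \<kappa> * exp (- (u\<^sup>2 / 2))" by (intro mult_right_mono) auto
  moreover have "exp (- u\<^sup>2) \<le> exp (- (u\<^sup>2 / 2))" by simp
  moreover have "0 \<le> exp (- (u + d)\<^sup>2)" by simp
  ultimately show ?thesis by linarith
qed

text \<open>Reduction to the radial variable: \<open>u\<close> and \<open>u + d\<close> are the
  rescaled moduli of \<open>x\<close> and \<open>y\<close>. The halved exponent belongs to the
  Gaussian of width \<open>2 * c\<close>, whose normalisation \<open>pi / (2 * c)\<close> turns the
  3 of \<open>gauss_decrease\<close> into 6.\<close>

lemma gauss_kernel_holder_aux: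
  assumes c: "0 < c" and k: "0 < \<kappa>" "\<kappa> \<le> 1" and le: "norm x \<le> norm y"
  shows "\<bar>gauss_kernel c x - gauss_kernel c y\<bar> \<le> 6 * (pi * norm (x - y) / sqrt c) powr \<kappa> * gauss_kernel (2 * c) x"
proof -
  define u where "u = pi * norm x / sqrt c"
  define d where "d = pi * (norm y - norm x) / sqrt c"
  have u2: "u\<^sup>2 = pi\<^sup>2 * (norm x)\<^sup>2 / c" using c by (simp add: u_def power_divide power_mult_distrib)
  have ud2: "(u + d)\<^sup>2 = pi\<^sup>2 * (norm y)\<^sup>2 / c"
  proof -
    have "u + d = pi * norm y / sqrt c" by (simp add: u_def d_def add_divide_distrib[symmetric] algebra_simps)
    then show ?thesis using c by (simp add: power_divide power_mult_distrib)
  qed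
  have ud: "0 \<le> u" "0 \<le> d" using c le by (auto simp: u_def d_def)
  have dle: "d powr \<kappa> \<le> (pi * norm (x - y) / sqrt c) powr \<kappa>"
    using ud k c norm_triangle_ineq2[of y x] unfolding d_def
    by (intro powr_mono2 divide_right_mono mult_left_mono) (auto simp: norm_minus_commute)
  have "exp (- (u + d)\<^sup>2) \<le> exp (- u\<^sup>2)" using ud by (simp add: power_mono)
  then have "\<bar>gauss_kernel c x - gauss_kernel c y\<bar> = pi / c * (exp (- u\<^sup>2) - exp (- (u + d)\<^sup>2))"
  proof -
    have "gauss_kernel c x = pi / c * exp (- u\<^sup>2)" "gauss_kernel c y = pi / c * exp (- (u + d)\<^sup>2)"
      by (simp_all only: gauss_kernel_def u2 ud2)
    moreover have "0 \<le> pi / c * (exp (- u\<^sup>2) - exp (- (u + d)\<^sup>2))"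
      using c \<open>exp (- (u + d)\<^sup>2) \<le> exp (- u\<^sup>2)\<close> by simp
    ultimately show ?thesis by (simp only: right_diff_distrib[symmetric] abs_of_nonneg)
  qed
  also have "\<dots> \<le> pi / c * (3 * d powr \<kappa> * exp (- (u\<^sup>2 / 2)))"
    using c gauss_decrease[OF ud k] by (intro mult_left_mono) auto
  also have "\<dots> = 6 * d powr \<kappa> * gauss_kernel (2 * c) x"
    unfolding gauss_kernel_def u2 using c by simp
  also have "\<dots> \<le> 6 * (pi * norm (x - y) / sqrt c) powr \<kappa> * gauss_kernel (2 * c) x"
    using dle c by (intro mult_right_mono mult_left_mono gauss_kernel_nonneg) auto
  finally show ?thesis .
qed

lemma gauss_kernel_holder:
  assumes c: "0 < c" and k: "0 < \<kappa>" "\<kappa> \<le> 1"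
  shows "\<bar>gauss_kernel c x - gauss_kernel c y\<bar> \<le>
    6 * (pi * norm (x - y) / sqrt c) powr \<kappa> * (gauss_kernel (2 * c) x + gauss_kernel (2 * c) y)"
proof -
  let ?K = "6 * (pi * norm (x - y) / sqrt c) powr \<kappa>"
  have nn: "0 \<le> ?K * gauss_kernel (2 * c) x" "0 \<le> ?K * gauss_kernel (2 * c) y"
    using c gauss_kernel_nonneg[of "2 * c"] by (auto intro!: mult_nonneg_nonneg)
  show ?thesis
  proof (cases "norm x \<le> norm y")
    case True
    then show ?thesis using gauss_kernel_holder_aux[OF c k True] nn unfolding distrib_left by linarith
  next
    case False
    then have "norm y \<le> norm x" by simp
    from gauss_kernel_holder_aux[OF c k this]
    have "\<bar>gauss_kernel c x - gauss_kernel c y\<bar> \<le> ?K * gauss_kernel (2 * c) y"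
      by (simp only: norm_minus_commute[of y x] abs_minus_commute[of "gauss_kernel c y"])
    then show ?thesis using nn unfolding distrib_left by linarith
  qed
qed

text \<open>One integrable majorant for all widths between \<open>c\<close> and
  \<open>2 * c\<close>, for dominated convergence in the width.\<close>

lemma gauss_kernel_le_double:
  assumes "0 < c" "c \<le> c'" "c' \<le> 2 * c"
  shows "gauss_kernel c' x \<le> 2 * gauss_kernel (2 * c) x"
proof -
  have "pi / c' * exp (- (pi\<^sup>2 * (norm x)\<^sup>2 / c')) \<le> pi / c * exp (- (pi\<^sup>2 * (norm x)\<^sup>2 / (2 * c)))"
    using assms by (intro mult_mono divide_left_mono) (auto intro!: divide_left_mono)
  then show ?thesis using assms by (simp add: gauss_kernel_def)
qed

text \<open>The characteristic function of the standard normal distribution, rescaled by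
  \<open>b = sqrt (2 * c)\<close>.\<close>

lemma gauss_fourier_1d:
  assumes "0 < c"
  shows "integrable lborel (\<lambda>t. exp (of_real (- c * t\<^sup>2) + 2 * of_real pi * \<i> * of_real (y * t)))"
    and "(LINT t|lborel. exp (of_real (- c * t\<^sup>2) + 2 * of_real pi * \<i> * of_real (y * t))) =
      of_real (sqrt (pi / c) * exp (- (pi\<^sup>2 * y\<^sup>2 / c)))"
proof -
  define b where "b = sqrt (2 * c)"
  have b: "0 < b" "b\<^sup>2 = 2 * c" using assms by (simp_all add: b_def)
  define \<tau> where "\<tau> = 2 * pi * y / b"
  define f where "f x = std_normal_density x *\<^sub>R iexp (\<tau> * x)" for x
  have fi: "integrable lborel f"
    unfolding f_def
  proof (rule Bochner_Integration.integrable_bound[of _ std_normal_density])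
    show "integrable lborel std_normal_density" by (rule integrable_normal_density) simp
  qed (auto simp: norm_mult)
  have "char std_normal_distribution \<tau> = (LINT x|lborel. f x)"
    unfolding char_def f_def by (subst integral_density) (auto simp: normal_density_nonneg)
  then have fv: "(LINT x|lborel. f x) = of_real (exp (- (\<tau>\<^sup>2) / 2))"
    by (simp add: char_std_normal_distribution)
  have eq: "exp (of_real (- c * t\<^sup>2) + 2 * of_real pi * \<i> * of_real (y * t)) = of_real (sqrt (2 * pi)) * f (0 + b * t)" for t
  proof -
    have 1: "std_normal_density (b * t) = 1 / sqrt (2 * pi) * exp (- c * t\<^sup>2)"
      using b by (simp add: std_normal_density_def power_mult_distrib)
    have 2: "\<tau> * (b * t) = 2 * pi * (y * t)" using b by (simp add: \<tau>_def)
    have "of_real (sqrt (2 * pi)) * f (0 + b * t) = of_real (exp (- c * t\<^sup>2)) * iexp (2 * pi * (y * t))"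
      by (simp add: f_def 1 2 scaleR_conv_of_real)
    also have "\<dots> = exp (of_real (- c * t\<^sup>2) + \<i> * of_real (2 * pi * (y * t)))"
      by (simp only: exp_add exp_of_real)
    also have "\<i> * of_real (2 * pi * (y * t)) = 2 * of_real pi * \<i> * of_real (y * t)" by simp
    finally show ?thesis by simp
  qed
  have ai: "integrable lborel (\<lambda>t. f (0 + b * t))" using fi b by (intro lborel_integrable_real_affine) auto
  then show "integrable lborel (\<lambda>t. exp (of_real (- c * t\<^sup>2) + 2 * of_real pi * \<i> * of_real (y * t)))"
    unfolding eq by (rule integrable_mult_right)
  have "(LINT x|lborel. f x) = \<bar>b\<bar> *\<^sub>R (LINT t|lborel. f (0 + b * t))"
    using b by (intro lborel_integral_real_affine) auto
  then have av: "(LINT t|lborel. f (0 + b * t)) = of_real (exp (- (\<tau>\<^sup>2) / 2) / b)"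
    using b fv by (simp add: scaleR_conv_of_real field_simps)
  have "(LINT t|lborel. exp (of_real (- c * t\<^sup>2) + 2 * of_real pi * \<i> * of_real (y * t))) =
      of_real (sqrt (2 * pi)) * of_real (exp (- (\<tau>\<^sup>2) / 2) / b)"
    unfolding eq av[symmetric] by (rule integral_mult_right_zero)
  also have "\<dots> = of_real (sqrt (2 * pi) / b * exp (- (\<tau>\<^sup>2) / 2))" by simp
  also have "sqrt (2 * pi) / b = sqrt (pi / c)" using assms by (simp add: b_def real_sqrt_divide[symmetric])
  also have "- (\<tau>\<^sup>2) / 2 = - (pi\<^sup>2 * y\<^sup>2 / c)" using b assms by (simp add: \<tau>_def power_divide power_mult_distrib)
  finally show "(LINT t|lborel. exp (of_real (- c * t\<^sup>2) + 2 * of_real pi * \<i> * of_real (y * t))) =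
      of_real (sqrt (pi / c) * exp (- (pi\<^sup>2 * y\<^sup>2 / c)))" .
qed

lemma
  assumes c: "0 < c"
  shows integrable_gauss_fourier: "integrable lborel (\<lambda>\<xi>. exp (- 2 * of_real pi * \<i> * of_real (\<xi> \<bullet> w)) * gauss_char c z 0 \<xi>)"
    and integral_gauss_fourier: "(LINT \<xi>|lborel. exp (- 2 * of_real pi * \<i> * of_real (\<xi> \<bullet> w)) * gauss_char c z 0 \<xi>) = of_real (gauss_kernel c (z - w))"
proof -
  define f where "f y t = exp (of_real (- c * t\<^sup>2) + 2 * of_real pi * \<i> * of_real (y * t))" for y t :: real
  have eq: "exp (- 2 * of_real pi * \<i> * of_real (\<xi> \<bullet> w)) * gauss_char c z 0 \<xi> = f (fst (z - w)) (fst \<xi>) * f (snd (z - w)) (snd \<xi>)" for \<xi>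
  proof -
    have "bessel_mult \<xi> powr 0 = 1" using bessel_mult_ge_1[of \<xi>] by simp
    moreover have "(norm \<xi>)\<^sup>2 = (fst \<xi>)\<^sup>2 + (snd \<xi>)\<^sup>2" by (simp add: norm_prod_def)
    ultimately show ?thesis
      unfolding gauss_char_def f_def by (simp add: exp_add[symmetric] inner_prod_def algebra_simps)
  qed
  show "integrable lborel (\<lambda>\<xi>. exp (- 2 * of_real pi * \<i> * of_real (\<xi> \<bullet> w)) * gauss_char c z 0 \<xi>)"
    unfolding eq f_def by (intro integrable_lborel_prod gauss_fourier_1d(1) c)
  have "(LINT \<xi>|lborel. exp (- 2 * of_real pi * \<i> * of_real (\<xi> \<bullet> w)) * gauss_char c z 0 \<xi>) =
    (LINT t|lborel. f (fst (z - w)) t) * (LINT t|lborel. f (snd (z - w)) t)"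
    unfolding eq f_def by (intro integral_lborel_prod gauss_fourier_1d(1) c)
  also have "\<dots> = of_real (sqrt (pi / c) * exp (- (pi\<^sup>2 * (fst (z - w))\<^sup>2 / c)) * (sqrt (pi / c) * exp (- (pi\<^sup>2 * (snd (z - w))\<^sup>2 / c))))"
    unfolding f_def gauss_fourier_1d(2)[OF c] by simp
  also have "sqrt (pi / c) * exp (- (pi\<^sup>2 * (fst (z - w))\<^sup>2 / c)) * (sqrt (pi / c) * exp (- (pi\<^sup>2 * (snd (z - w))\<^sup>2 / c))) =
     (sqrt (pi / c) * sqrt (pi / c)) * (exp (- (pi\<^sup>2 * (fst (z - w))\<^sup>2 / c)) * exp (- (pi\<^sup>2 * (snd (z - w))\<^sup>2 / c)))"
    by (simp only: mult_ac)
  also have "\<dots> = gauss_kernel c (z - w)"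
    using c by (simp add: gauss_kernel_def norm_prod_def exp_add[symmetric] add_divide_distrib distrib_left)
  finally show "(LINT \<xi>|lborel. exp (- 2 * of_real pi * \<i> * of_real (\<xi> \<bullet> w)) * gauss_char c z 0 \<xi>) = of_real (gauss_kernel c (z - w))" .
qed

text \<open>The density of the Gamma distribution of shape \<open>b\<close>. Used as the weight in a
  superposition of heat kernels, it produces the Bessel kernel of order
  \<open>2 * b\<close>.\<close>

definition bessel_weight :: "real \<Rightarrow> real \<Rightarrow> real" where
  "bessel_weight b t = indicator {0..} t * t powr (b - 1) / exp t / Gamma b"

lemma bessel_weight_borel [measurable]: "bessel_weight b \<in> borel_measurable borel"
  unfolding bessel_weight_def[abs_def] by measurable

lemma bessel_weight_nonneg: "0 < b \<Longrightarrow> 0 \<le> bessel_weight b t"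
  by (simp add: bessel_weight_def Gamma_real_pos less_imp_le)

lemma
  assumes b: "0 < b"
  shows nn_integral_bessel_weight: "(\<integral>\<^sup>+t. ennreal (bessel_weight b t) \<partial>lborel) = 1"
    and bessel_weight_integrable: "integrable lborel (bessel_weight b)"
    and bessel_weight_integral: "(LINT t|lborel. bessel_weight b t) = 1"
proof -
  have G: "0 < Gamma b" using b by (rule Gamma_real_pos)
  have "ennreal (Gamma b) = (\<integral>\<^sup>+t. ennreal (Gamma b * bessel_weight b t) \<partial>lborel)"
    unfolding bessel_weight_def using G by (simp add: Gamma_conv_nn_integral_real[OF b])
  also have "\<dots> = ennreal (Gamma b) * (\<integral>\<^sup>+t. ennreal (bessel_weight b t) \<partial>lborel)"
    using G by (subst nn_integral_cmult[symmetric]) (auto simp: ennreal_mult')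
  finally show n: "(\<integral>\<^sup>+t. ennreal (bessel_weight b t) \<partial>lborel) = 1"
    using G by (metis ennreal_mult_cancel_left ennreal_eq_0_iff ennreal_neq_top mult.right_neutral not_le)
  show i: "integrable lborel (bessel_weight b)"
    using n bessel_weight_nonneg[OF b] by (intro integrableI_nonneg) auto
  show "(LINT t|lborel. bessel_weight b t) = 1"
    using n bessel_weight_nonneg[OF b] by (subst integral_eq_nn_integral) auto
qed

text \<open>Subordination: a negative power of the symbol is a superposition of Gaussians.\<close>

lemma bessel_weight_laplace:
  assumes b: "0 < b" and m: "0 \<le> m"
  shows "(LINT t|lborel. bessel_weight b t * exp (- m * t)) = (1 + m) powr (- b)"
proof -
  \<comment> \<open>Evaluating the Gamma density at \<open>(1 + m) * t\<close> brings out
    \<open>exp (- m * t)\<close>; the total mass 1 then gives the formula.\<close>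
  have eq: "bessel_weight b (0 + (1 + m) * t) = (1 + m) powr (b - 1) * (bessel_weight b t * exp (- m * t))" for t
  proof -
    have i: "indicator {0..} ((1 + m) * t) = (indicator {0..} t :: real)"
      using m by (simp add: indicator_def zero_le_mult_iff)
    have e: "exp ((1 + m) * t) = exp t * exp (m * t)" by (simp add: exp_add[symmetric] distrib_right)
    note ie = i e
    show ?thesis
    proof (cases "0 \<le> t")
      case True
      have "((1 + m) * t) powr (b - 1) = (1 + m) powr (b - 1) * t powr (b - 1)"
        using True m by (simp only: powr_mult)
      moreover have "exp (- m * t) = inverse (exp (m * t))" by (simp add: exp_minus)
      ultimately show ?thesis using ie unfolding bessel_weight_def add_0
        by (simp only: divide_inverse inverse_mult_distrib mult_ac)
    next
      case False
      then have "indicator {0..} t = (0 :: real)" by simp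
      then show ?thesis unfolding bessel_weight_def add_0 i by simp
    qed
  qed
  have "1 = \<bar>1 + m\<bar> *\<^sub>R (LINT t|lborel. bessel_weight b (0 + (1 + m) * t))"
    using lborel_integral_real_affine[of "1 + m" "bessel_weight b" 0] m bessel_weight_integral[OF b] by simp
  also have "\<dots> = (1 + m) * (1 + m) powr (b - 1) * (LINT t|lborel. bessel_weight b t * exp (- m * t))"
    unfolding eq using m by simp
  also have "(1 + m) * (1 + m) powr (b - 1) = (1 + m) powr b" using m by (simp add: powr_mult_base)
  finally show ?thesis using m by (simp add: powr_minus field_simps)
qed

text \<open>The kernel of the inverse of \<open>(1 - \<Delta>)\<^sup>s\<^sup>/\<^sup>2\<close>,
  smoothed by the Gaussian of width \<open>c\<close>. For \<open>c > 0\<close> it has no singularity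
  at the origin.\<close>

definition bessel_kernel :: "real \<Rightarrow> real \<Rightarrow> real \<times> real \<Rightarrow> real" where
  "bessel_kernel s c x = (LINT t|lborel. bessel_weight (s / 2) t * gauss_kernel (c + 4 * pi\<^sup>2 * t) x)"

lemma fourier_gauss_char:
  assumes c: "0 < c"
  shows "fourier (gauss_char c z 0) w = of_real (gauss_kernel c (z - w))"
proof -
  have "fourier (gauss_char c z 0) w = (LINT \<xi>|lborel. exp (- 2 * of_real pi * \<i> * of_real (\<xi> \<bullet> w)) * gauss_char c z 0 \<xi>)"
    unfolding fourier_def
    using borel_measurable_integrable[OF integrable_gauss_fourier[OF c, of w z]] by (subst integral_completion) auto
  then show ?thesis by (simp only: integral_gauss_fourier[OF c])
qed

lemma gauss_char_borel [measurable]: "(\<lambda>x. gauss_char (fst x) z a (snd x)) \<in> borel_measurable borel"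
proof -
  have [measurable]: "(\<lambda>x::real \<times> real \<times> real. bessel_mult (snd x)) \<in> borel_measurable borel"
    "(\<lambda>x::real \<times> real \<times> real. exp (complex_of_real (- fst x * (norm (snd x))\<^sup>2) + 2 * of_real pi * \<i> * of_real (z \<bullet> snd x))) \<in> borel_measurable borel"
    unfolding bessel_mult_def by (intro borel_measurable_continuous_onI continuous_intros)+
  show ?thesis unfolding gauss_char_def by measurable
qed

text \<open>In the Laplace formula for the power of the symbol the exponential merges with the
  Gaussian into one of width \<open>c + 4 * pi\<^sup>2 * t\<close>. After Fubini only pure Gaussians
  have to be transformed.\<close>

lemma fourier_gauss_char_bessel:
  assumes c: "0 < c" and s: "0 < s"
  shows "fourier (gauss_char c z (- (s / 2))) w = of_real (bessel_kernel s c (z - w))"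
proof -
  define E where "E \<xi> = exp (- 2 * complex_of_real pi * \<i> * of_real (\<xi> \<bullet> w))" for \<xi>
  define H where "H \<xi> t = of_real (bessel_weight (s / 2) t) * (E \<xi> * gauss_char (c + 4 * pi\<^sup>2 * t) z 0 \<xi>)" for \<xi> t
  have s2: "0 < s / 2" using s by simp
  have [measurable]: "E \<in> borel_measurable borel"
    unfolding E_def[abs_def] by (intro borel_measurable_continuous_onI continuous_intros)
  have fac: "gauss_char (c + 4 * pi\<^sup>2 * t) z 0 \<xi> = gauss_char c z 0 \<xi> * of_real (exp (- (4 * pi\<^sup>2 * (norm \<xi>)\<^sup>2) * t))" for t \<xi>
    unfolding gauss_char_def by (simp add: exp_of_real[symmetric] exp_add[symmetric] algebra_simps)
  have inner: "(LINT t|lborel. H \<xi> t) = E \<xi> * gauss_char c z (- (s / 2)) \<xi>" for \<xi>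
  proof -
    have "(LINT t|lborel. H \<xi> t) = (LINT t|lborel. (E \<xi> * gauss_char c z 0 \<xi>) * of_real (bessel_weight (s / 2) t * exp (- (4 * pi\<^sup>2 * (norm \<xi>)\<^sup>2) * t)))"
      unfolding H_def fac by (simp add: mult_ac)
    also have "\<dots> = (E \<xi> * gauss_char c z 0 \<xi>) * of_real (LINT t|lborel. bessel_weight (s / 2) t * exp (- (4 * pi\<^sup>2 * (norm \<xi>)\<^sup>2) * t))"
      by (simp only: integral_mult_right_zero integral_complex_of_real)
    also have "(LINT t|lborel. bessel_weight (s / 2) t * exp (- (4 * pi\<^sup>2 * (norm \<xi>)\<^sup>2) * t)) = bessel_mult \<xi> powr (- (s / 2))"
      by (subst bessel_weight_laplace[OF s2]) (auto simp: bessel_mult_def)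
    also have "(E \<xi> * gauss_char c z 0 \<xi>) * of_real (bessel_mult \<xi> powr (- (s / 2))) = E \<xi> * gauss_char c z (- (s / 2)) \<xi>"
    proof -
      have "bessel_mult \<xi> powr 0 = 1" using bessel_mult_ge_1[of \<xi>] by simp
      then show ?thesis by (simp add: gauss_char_def)
    qed
    finally show ?thesis .
  qed
  \<comment> \<open>For \<open>t < 0\<close> the width may fail to be positive, but there the weight
    vanishes.\<close>
  have outer: "(LINT \<xi>|lborel. H \<xi> t) = of_real (bessel_weight (s / 2) t * gauss_kernel (c + 4 * pi\<^sup>2 * t) (z - w))" for t
  proof (cases "0 \<le> t")
    case True
    then have "0 < c + 4 * pi\<^sup>2 * t" using c by (simp add: add_pos_nonneg)
    from integral_gauss_fourier[OF this, of w z] show ?thesis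
      unfolding H_def E_def integral_mult_right_zero by simp
  qed (simp add: H_def bessel_weight_def)
  have Hm [measurable]: "(\<lambda>(\<xi>, t). H \<xi> t) \<in> borel_measurable (lborel \<Otimes>\<^sub>M lborel)"
  proof -
    have "(\<lambda>x::(real \<times> real) \<times> real. (c + 4 * pi\<^sup>2 * snd x, fst x)) \<in> borel_measurable borel"
      by (intro borel_measurable_continuous_onI continuous_intros)
    from measurable_compose[OF this gauss_char_borel]
    have [measurable]: "(\<lambda>x::(real \<times> real) \<times> real. gauss_char (c + 4 * pi\<^sup>2 * snd x) z 0 (fst x)) \<in> borel_measurable (lborel \<Otimes>\<^sub>M lborel)"
      by (simp add: lborel_prod)
    show ?thesis unfolding H_def case_prod_beta by measurable
  qed
  have nH: "norm (H \<xi> t) = bessel_weight (s / 2) t * norm (gauss_char (c + 4 * pi\<^sup>2 * t) z 0 \<xi>)" for \<xi> t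
    by (simp add: H_def E_def norm_mult bessel_weight_nonneg[OF s2] norm_exp_eq_Re)
  have ng: "norm (gauss_char c z 0 \<xi>) = exp (- c * (norm \<xi>)\<^sup>2)" for c \<xi>
    using bessel_mult_ge_1[of \<xi>] by (simp add: gauss_char_def norm_mult norm_exp_eq_Re)
  have gi: "integrable lborel (\<lambda>\<xi>. norm (gauss_char c z 0 \<xi>))"
    using integrable_norm[OF integrable_gauss_fourier[OF c, of 0 z]] by simp
  have Hi: "integrable (lborel \<Otimes>\<^sub>M lborel) (\<lambda>(\<xi>, t). H \<xi> t)"
  proof (rule Bochner_Integration.integrable_bound)
    have "integrable (lborel \<Otimes>\<^sub>M lborel) (\<lambda>x::(real \<times> real) \<times> real. norm (gauss_char c z 0 (fst x)) * bessel_weight (s / 2) (snd x))"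
    proof (rule lborel_pair.Fubini_integrable)
      have [measurable]: "(\<lambda>\<xi>. norm (gauss_char c z 0 \<xi>)) \<in> borel_measurable borel"
        using borel_measurable_integrable[OF gi] by simp
      show "(\<lambda>x::(real \<times> real) \<times> real. norm (gauss_char c z 0 (fst x)) * bessel_weight (s / 2) (snd x)) \<in> borel_measurable (lborel \<Otimes>\<^sub>M lborel)"
        by measurable
      show "integrable lborel (\<lambda>\<xi>. LINT t|lborel. norm (norm (gauss_char c z 0 (fst (\<xi>, t))) * bessel_weight (s / 2) (snd (\<xi>, t))))"
        using gi bessel_weight_nonneg[OF s2] by (simp add: abs_mult)
      show "AE \<xi> in lborel. integrable lborel (\<lambda>t. norm (gauss_char c z 0 (fst (\<xi>, t))) * bessel_weight (s / 2) (snd (\<xi>, t)))"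
        using bessel_weight_integrable[OF s2] by simp
    qed
    then show "integrable (lborel \<Otimes>\<^sub>M lborel) (\<lambda>x::(real \<times> real) \<times> real. norm (gauss_char c z 0 (fst x)) * bessel_weight (s / 2) (snd x))" .
    show "AE x in lborel \<Otimes>\<^sub>M lborel. norm (case x of (\<xi>, t) \<Rightarrow> H \<xi> t) \<le> norm (norm (gauss_char c z 0 (fst x)) * bessel_weight (s / 2) (snd x))"
    proof (rule AE_I2)
      fix x :: "(real \<times> real) \<times> real"
      obtain \<xi> t where x: "x = (\<xi>, t)" by (rule prod.exhaust)
      have "norm (H \<xi> t) \<le> bessel_weight (s / 2) t * norm (gauss_char c z 0 \<xi>)"
      proof (cases "0 \<le> t")
        case True
        then have "exp (- (c + 4 * pi\<^sup>2 * t) * (norm \<xi>)\<^sup>2) \<le> exp (- c * (norm \<xi>)\<^sup>2)" by (simp add: algebra_simps)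
        then show ?thesis unfolding nH ng by (intro mult_left_mono bessel_weight_nonneg s2)
      qed (simp add: nH bessel_weight_def)
      then show "norm (case x of (\<xi>, t) \<Rightarrow> H \<xi> t) \<le> norm (norm (gauss_char c z 0 (fst x)) * bessel_weight (s / 2) (snd x))"
        using bessel_weight_nonneg[OF s2, of t] by (simp add: x abs_mult mult.commute)
    qed
  qed (rule Hm)
  have em: "(\<lambda>\<xi>. E \<xi> * gauss_char c z (- (s / 2)) \<xi>) \<in> borel_measurable lborel"
  proof -
    have "(\<lambda>\<xi>::real \<times> real. (c, \<xi>)) \<in> borel_measurable borel" by (intro borel_measurable_continuous_onI continuous_intros)
    from measurable_compose[OF this gauss_char_borel]
    have [measurable]: "gauss_char c z (- (s / 2)) \<in> borel_measurable borel" by simp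
    show ?thesis by measurable
  qed
  have "fourier (gauss_char c z (- (s / 2))) w = (LINT \<xi>|lborel. E \<xi> * gauss_char c z (- (s / 2)) \<xi>)"
    unfolding fourier_def E_def[symmetric] using em by (subst integral_completion) (auto simp: E_def)
  also have "\<dots> = (LINT \<xi>|lborel. LINT t|lborel. H \<xi> t)" by (simp only: inner)
  also have "\<dots> = (LINT t|lborel. LINT \<xi>|lborel. H \<xi> t)" by (rule lborel_pair.Fubini_integral[OF Hi, symmetric])
  also have "\<dots> = of_real (bessel_kernel s c (z - w))"
    unfolding outer bessel_kernel_def by (rule integral_complex_of_real)
  finally show ?thesis .
qed

section \<open>Regularity of Bessel potentials\<close>

lemma nn_integral_lborel_shift:
  fixes f :: "'a::euclidean_space \<Rightarrow> ennreal"
  assumes [measurable]: "f \<in> borel_measurable borel"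
  shows "(\<integral>\<^sup>+x. f (a + x) \<partial>lborel) = (\<integral>\<^sup>+x. f x \<partial>lborel)"
  by (subst (2) lborel_distr_plus[symmetric, of a]) (simp add: nn_integral_distr)

lemma integral_lborel_shift:
  fixes f :: "'a::euclidean_space \<Rightarrow> complex"
  assumes [measurable]: "f \<in> borel_measurable borel"
  shows "(LINT x|lborel. f (a + x)) = (LINT x|lborel. f x)"
  by (subst (2) lborel_distr_plus[symmetric, of a]) (simp add: integral_distr)

lemma nn_integral_gauss_kernel_shift:
  "(\<integral>\<^sup>+w. ennreal (gauss_kernel c (z - w)) \<partial>lborel) = (\<integral>\<^sup>+w. ennreal (gauss_kernel c w) \<partial>lborel)"
  "(\<integral>\<^sup>+z. ennreal (gauss_kernel c (z - w)) \<partial>lborel) = (\<integral>\<^sup>+w. ennreal (gauss_kernel c w) \<partial>lborel)"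
proof -
  have *: "(\<integral>\<^sup>+z. ennreal (gauss_kernel c (z - w)) \<partial>lborel) = (\<integral>\<^sup>+w. ennreal (gauss_kernel c w) \<partial>lborel)" for w
    using nn_integral_lborel_shift[of "\<lambda>w. ennreal (gauss_kernel c w)" "- w"] by simp
  then show "(\<integral>\<^sup>+z. ennreal (gauss_kernel c (z - w)) \<partial>lborel) = (\<integral>\<^sup>+w. ennreal (gauss_kernel c w) \<partial>lborel)" .
  have "gauss_kernel c (z - w) = gauss_kernel c (w - z)" for w
    using gauss_kernel_minus[of c "z - w"] by simp
  then show "(\<integral>\<^sup>+w. ennreal (gauss_kernel c (z - w)) \<partial>lborel) = (\<integral>\<^sup>+w. ennreal (gauss_kernel c w) \<partial>lborel)"
    using * by simp
qed

text \<open>\<open>ennreal\<close> sends these nonpositive values to 0. So the mass bound below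
  holds for every real \<open>c\<close>, and integrals over all \<open>t\<close> can be estimated
  without splitting.\<close>

lemma gauss_kernel_0: "c \<le> 0 \<Longrightarrow> gauss_kernel c x \<le> 0"
  by (auto simp: gauss_kernel_def divide_le_0_iff mult_le_0_iff zero_le_divide_iff)

lemma nn_integral_gauss_kernel_le: "(\<integral>\<^sup>+w. ennreal (gauss_kernel c w) \<partial>lborel) \<le> 1"
proof (cases "0 < c")
  case False
  then have "ennreal (gauss_kernel c w) = 0" for w using gauss_kernel_0[of c w] by (simp add: ennreal_neg)
  then show ?thesis by simp
qed (simp add: nn_integral_gauss_kernel)

text \<open>The factor 2 is lost by using \<open>le_young\<close> instead of Jensen's inequality; it is harmless here.\<close>

lemma nn_integral_power_mean:
  fixes h :: "'a \<Rightarrow> real"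
  assumes h [measurable]: "h \<in> borel_measurable M" and h0: "\<And>x. 0 \<le> h x" and M: "emeasure M (space M) \<le> 1"
    and p: "1 < p" and I: "(\<integral>\<^sup>+x. ennreal (h x powr p) \<partial>M) \<le> ennreal I" "0 \<le> I"
  shows "(\<integral>\<^sup>+x. ennreal (h x) \<partial>M) \<le> ennreal (2 * I powr (1 / p))"
proof -
  have le: "(\<integral>\<^sup>+x. ennreal (h x) \<partial>M) \<le> ennreal (l + l powr (1 - p) * I)" if l: "0 < l" for l
  proof -
    have "(\<integral>\<^sup>+x. ennreal (h x) \<partial>M) \<le> (\<integral>\<^sup>+x. ennreal l + ennreal (l powr (1 - p)) * ennreal (h x powr p) \<partial>M)"
    proof (rule nn_integral_mono)
      fix x
      have "ennreal (h x) \<le> ennreal (l + l powr (1 - p) * h x powr p)"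
        using le_young[OF l p h0] by (rule ennreal_leI)
      then show "ennreal (h x) \<le> ennreal l + ennreal (l powr (1 - p)) * ennreal (h x powr p)"
        using l by (simp add: ennreal_plus ennreal_mult')
    qed
    also have "\<dots> = ennreal l * emeasure M (space M) + ennreal (l powr (1 - p)) * (\<integral>\<^sup>+x. ennreal (h x powr p) \<partial>M)"
      by (simp add: nn_integral_add nn_integral_cmult)
    also have "\<dots> \<le> ennreal l * 1 + ennreal (l powr (1 - p)) * ennreal I"
      by (intro add_mono mult_left_mono M I(1)) auto
    also have "\<dots> = ennreal (l + l powr (1 - p) * I)"
      using l I(2) by (simp add: ennreal_plus ennreal_mult')
    finally show ?thesis .
  qed
  show ?thesis
  \<comment> \<open>The balancing choice of \<open>l\<close> is \<open>I powr (1 / p)\<close>; for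
    \<open>I = 0\<close> it degenerates, and \<open>l\<close> tends to 0 instead.\<close>
  proof (cases "I = 0")
    case True
    have "(\<integral>\<^sup>+x. ennreal (h x) \<partial>M) \<le> 0"
    proof (rule ennreal_le_epsilon)
      fix e :: real assume "0 < e"
      then show "(\<integral>\<^sup>+x. ennreal (h x) \<partial>M) \<le> 0 + ennreal e" using le[of e] True by simp
    qed
    then show ?thesis by simp
  next
    case False
    then have Ip: "0 < I" using I(2) by simp
    define l where "l = I powr (1 / p)"
    have l: "0 < l" using Ip by (simp add: l_def)
    have "1 / p * (1 - p) + 1 = 1 / p" using p by (simp add: field_simps)
    then have "l powr (1 - p) * I = l"
      using Ip unfolding l_def powr_powr by (metis powr_add powr_one less_imp_le)
    then show ?thesis using le[OF l] by (simp add: l_def)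
  qed
qed

section \<open>Gaussian means of a function in L^p\<close>

locale lp_fun =
  fixes p N :: real and G :: "real \<times> real \<Rightarrow> complex"
  assumes p: "1 < p" and N: "0 < N" and G_borel [measurable]: "G \<in> borel_measurable borel"
    and G_norm: "(\<integral>\<^sup>+w. ennreal (norm (G w) powr p) \<partial>lborel) \<le> ennreal (N powr p)"
begin

definition heat :: "real \<Rightarrow> real \<times> real \<Rightarrow> complex" where
  "heat c z = (LINT w|lborel. G w * of_real (gauss_kernel c (z - w)))"

lemma kernel_shift_borel [measurable]: "(\<lambda>w. gauss_kernel c (z - w)) \<in> borel_measurable borel"
  by (rule measurable_compose[OF _ gauss_kernel_borel]) simp

lemma kernel_joint_borel:
  "(\<lambda>x::(real \<times> real \<times> real) \<times> (real \<times> real). gauss_kernel (fst (fst x)) (snd (fst x) - snd x)) \<in> borel_measurable borel"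
proof -
  have c: "(\<lambda>x::(real \<times> real \<times> real) \<times> (real \<times> real). (fst (fst x), snd (fst x) - snd x)) \<in> borel_measurable borel"
    by (intro borel_measurable_continuous_onI continuous_intros)
  from measurable_compose[OF c gauss_kernel_borel2] show ?thesis by simp
qed

lemma heat_borel [measurable]: "(\<lambda>x. heat (fst x) (snd x)) \<in> borel_measurable borel"
proof -
  have [measurable]: "(\<lambda>x::(real \<times> real \<times> real) \<times> (real \<times> real). gauss_kernel (fst (fst x)) (snd (fst x) - snd x)) \<in> borel_measurable (borel \<Otimes>\<^sub>M borel)"
    using kernel_joint_borel by (simp add: borel_prod)
  have "(\<lambda>(x, w). G w * of_real (gauss_kernel (fst x) (snd x - w))) \<in> borel_measurable (borel \<Otimes>\<^sub>M lborel)"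
    unfolding case_prod_beta by measurable
  then show ?thesis unfolding heat_def by (rule lborel.borel_measurable_lebesgue_integral)
qed

text \<open>With respect to the kernel, a probability density bounded by \<open>pi / c\<close>, the
  \<open>p\<close>-integral of \<open>G\<close> is at most \<open>pi / c * N powr p\<close>; then
  the power mean inequality applies.\<close>

lemma heat_abs_le:
  assumes c: "0 < c"
  shows "(\<integral>\<^sup>+w. ennreal (norm (G w) * gauss_kernel c (z - w)) \<partial>lborel) \<le> ennreal (2 * N * (pi / c) powr (1 / p))"
proof -
  define M where "M = density lborel (\<lambda>w. ennreal (gauss_kernel c (z - w)))"
  have k0: "0 \<le> gauss_kernel c x" for x using c by (rule gauss_kernel_nonneg)
  have "emeasure M (space M) = (\<integral>\<^sup>+w. ennreal (gauss_kernel c (z - w)) \<partial>lborel)"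
    unfolding M_def by (simp add: emeasure_density)
  then have M1: "emeasure M (space M) \<le> 1"
    using nn_integral_gauss_kernel_shift(1)[of c z] nn_integral_gauss_kernel_le[of c] by simp
  have Gm: "(\<lambda>w. norm (G w)) \<in> borel_measurable M" unfolding M_def by measurable
  have "(\<integral>\<^sup>+w. ennreal (norm (G w) powr p) \<partial>M) = (\<integral>\<^sup>+w. ennreal (gauss_kernel c (z - w)) * ennreal (norm (G w) powr p) \<partial>lborel)"
    unfolding M_def by (simp add: nn_integral_density)
  also have "\<dots> \<le> (\<integral>\<^sup>+w. ennreal (pi / c) * ennreal (norm (G w) powr p) \<partial>lborel)"
    by (intro nn_integral_mono mult_right_mono ennreal_leI gauss_kernel_le c) auto
  also have "\<dots> \<le> ennreal (pi / c) * ennreal (N powr p)"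
    by (subst nn_integral_cmult) (auto intro!: mult_left_mono G_norm)
  also have "\<dots> = ennreal (pi / c * N powr p)" using c by (intro ennreal_mult[symmetric]) auto
  finally have I: "(\<integral>\<^sup>+w. ennreal (norm (G w) powr p) \<partial>M) \<le> ennreal (pi / c * N powr p)" .
  have "(\<integral>\<^sup>+w. ennreal (norm (G w) * gauss_kernel c (z - w)) \<partial>lborel) = (\<integral>\<^sup>+w. ennreal (norm (G w)) \<partial>M)"
    unfolding M_def using k0 by (simp add: nn_integral_density ennreal_mult' mult.commute)
  also have "\<dots> \<le> ennreal (2 * (pi / c * N powr p) powr (1 / p))"
    using c by (intro nn_integral_power_mean[OF Gm _ M1 p I]) auto
  also have "(pi / c * N powr p) powr (1 / p) = (pi / c) powr (1 / p) * N"
    unfolding powr_mult powr_powr using N p by simp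
  finally show ?thesis by (simp add: mult_ac)
qed

lemma heat_integrable: "0 < c \<Longrightarrow> integrable lborel (\<lambda>w. G w * of_real (gauss_kernel c (z - w)))"
proof (rule integrableI_bounded)
  assume c: "0 < c"
  have "(\<integral>\<^sup>+w. ennreal (norm (G w * of_real (gauss_kernel c (z - w)))) \<partial>lborel) = (\<integral>\<^sup>+w. ennreal (norm (G w) * gauss_kernel c (z - w)) \<partial>lborel)"
    using gauss_kernel_nonneg[OF c] by (simp add: norm_mult)
  also have "\<dots> < \<infinity>" using heat_abs_le[OF c, of z] by (auto intro: le_less_trans)
  finally show "(\<integral>\<^sup>+w. ennreal (norm (G w * of_real (gauss_kernel c (z - w)))) \<partial>lborel) < \<infinity>" .
qed measurable

lemma heat_abs_integral_le:
  assumes c: "0 < c"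
  shows "(LINT w|lborel. norm (G w) * gauss_kernel c (z - w)) \<le> 2 * N * (pi / c) powr (1 / p)"
  using heat_abs_le[OF c, of z] gauss_kernel_nonneg[OF c] N
  by (subst integral_eq_nn_integral) (auto intro!: enn2real_leI)

lemma heat_abs_integrable: "0 < c \<Longrightarrow> integrable lborel (\<lambda>w. norm (G w) * gauss_kernel c (z - w))"
  using integrable_norm[OF heat_integrable[of c z]] gauss_kernel_nonneg[of c] by (simp add: norm_mult)

lemma norm_heat_le:
  assumes c: "0 < c"
  shows "norm (heat c z) \<le> 2 * N * (pi / c) powr (1 / p)"
proof -
  have "norm (heat c z) \<le> (LINT w|lborel. norm (G w * of_real (gauss_kernel c (z - w))))"
    unfolding heat_def by (rule integral_norm_bound)
  also have "\<dots> = (LINT w|lborel. norm (G w) * gauss_kernel c (z - w))"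
    using gauss_kernel_nonneg[OF c] by (simp add: norm_mult)
  finally show ?thesis using heat_abs_integral_le[OF c, of z] by simp
qed

text \<open>24 is the 6 of the kernel estimate, times 2 for its two Gaussians, times the 2 of
  \<open>heat_abs_integral_le\<close>.\<close>

lemma heat_holder:
  assumes c: "0 < c" and k: "0 < \<kappa>" "\<kappa> \<le> 1"
  shows "norm (heat c z - heat c z') \<le> 24 * N * (pi * norm (z - z') / sqrt c) powr \<kappa> * (pi / (2 * c)) powr (1 / p)"
proof -
  define K where "K = 6 * (pi * norm (z - z') / sqrt c) powr \<kappa>"
  have c2: "0 < 2 * c" using c by simp
  note i = heat_abs_integrable[OF c2]
  have "heat c z - heat c z' = (LINT w|lborel. G w * of_real (gauss_kernel c (z - w)) - G w * of_real (gauss_kernel c (z' - w)))"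
    unfolding heat_def by (rule Bochner_Integration.integral_diff[symmetric]) (rule heat_integrable[OF c])+
  also have "norm \<dots> \<le> (LINT w|lborel. norm (G w * of_real (gauss_kernel c (z - w)) - G w * of_real (gauss_kernel c (z' - w))))"
    by (rule integral_norm_bound)
  also have "\<dots> \<le> (LINT w|lborel. K * (norm (G w) * gauss_kernel (2 * c) (z - w) + norm (G w) * gauss_kernel (2 * c) (z' - w)))"
  proof (rule integral_mono)
    fix w
    have "norm (G w * of_real (gauss_kernel c (z - w)) - G w * of_real (gauss_kernel c (z' - w))) =
        norm (G w) * \<bar>gauss_kernel c (z - w) - gauss_kernel c (z' - w)\<bar>"
      by (simp add: norm_mult right_diff_distrib[symmetric] flip: of_real_diff)
    also have "\<dots> \<le> norm (G w) * (K * (gauss_kernel (2 * c) (z - w) + gauss_kernel (2 * c) (z' - w)))"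
      using gauss_kernel_holder[OF c k, of "z - w" "z' - w"] by (intro mult_left_mono) (auto simp: K_def)
    finally show "norm (G w * of_real (gauss_kernel c (z - w)) - G w * of_real (gauss_kernel c (z' - w))) \<le>
        K * (norm (G w) * gauss_kernel (2 * c) (z - w) + norm (G w) * gauss_kernel (2 * c) (z' - w))"
      by (simp add: algebra_simps)
  qed (intro integrable_norm Bochner_Integration.integrable_diff heat_integrable c integrable_mult_right
      Bochner_Integration.integrable_add i)+
  also have "\<dots> = K * ((LINT w|lborel. norm (G w) * gauss_kernel (2 * c) (z - w)) + (LINT w|lborel. norm (G w) * gauss_kernel (2 * c) (z' - w)))"
    using i by simp
  also have "\<dots> \<le> K * (2 * N * (pi / (2 * c)) powr (1 / p) + 2 * N * (pi / (2 * c)) powr (1 / p))"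
    by (intro mult_left_mono add_mono heat_abs_integral_le c2) (simp add: K_def)
  finally show ?thesis by (simp add: K_def mult_ac)
qed

lemma heat_continuous_right:
  assumes c: "0 < c" and e: "e \<longlonglongrightarrow> 0" "\<And>n. 0 \<le> e n"
  shows "(\<lambda>n. heat (c + e n) z) \<longlonglongrightarrow> heat c z"
proof -
  \<comment> \<open>Capping at \<open>c\<close> keeps the widths between \<open>c\<close> and
    \<open>2 * c\<close>, where the majorant is valid. It changes only finitely many terms of the
    sequence.\<close>
  define e' where "e' n = min (e n) c" for n
  have e'0: "e' \<longlonglongrightarrow> 0"
    using tendsto_min[OF e(1) tendsto_const[of c]] c by (simp add: e'_def[abs_def])
  have e': "0 \<le> e' n" "e' n \<le> c" for n using e(2) c by (auto simp: e'_def)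
  have "(\<lambda>n. heat (c + e' n) z) \<longlonglongrightarrow> heat c z"
    unfolding heat_def
  proof (rule integral_dominated_convergence[where w = "\<lambda>w. 2 * (norm (G w) * gauss_kernel (2 * c) (z - w))"])
    show "integrable lborel (\<lambda>w. 2 * (norm (G w) * gauss_kernel (2 * c) (z - w)))"
      using c by (intro integrable_mult_right heat_abs_integrable) auto
    show "AE w in lborel. (\<lambda>n. G w * of_real (gauss_kernel (c + e' n) (z - w))) \<longlonglongrightarrow> G w * of_real (gauss_kernel c (z - w))"
    proof (rule AE_I2)
      fix w
      have "(\<lambda>n. c + e' n) \<longlonglongrightarrow> c" using tendsto_add[OF tendsto_const e'0, of c] by simp
      then show "(\<lambda>n. G w * of_real (gauss_kernel (c + e' n) (z - w))) \<longlonglongrightarrow> G w * of_real (gauss_kernel c (z - w))"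
        unfolding gauss_kernel_def using c by (intro tendsto_intros) auto
    qed
    show "AE w in lborel. norm (G w * of_real (gauss_kernel (c + e' n) (z - w))) \<le> 2 * (norm (G w) * gauss_kernel (2 * c) (z - w))" for n
    proof (rule AE_I2)
      fix w
      have "0 < c + e' n" "c + e' n \<le> 2 * c" "c \<le> c + e' n" using c e'[of n] by auto
      then have "\<bar>gauss_kernel (c + e' n) (z - w)\<bar> \<le> 2 * gauss_kernel (2 * c) (z - w)"
        using gauss_kernel_le_double[OF c] gauss_kernel_nonneg[of "c + e' n"] by simp
      then have "norm (G w) * \<bar>gauss_kernel (c + e' n) (z - w)\<bar> \<le> norm (G w) * (2 * gauss_kernel (2 * c) (z - w))"
        by (rule mult_left_mono) simp
      then show "norm (G w * of_real (gauss_kernel (c + e' n) (z - w))) \<le> 2 * (norm (G w) * gauss_kernel (2 * c) (z - w))"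
        by (simp add: norm_mult)
    qed
  qed measurable
  moreover have "\<forall>\<^sub>F n in sequentially. heat (c + e' n) z = heat (c + e n) z"
    using order_tendstoD(2)[OF e(1) c] by eventually_elim (simp add: e'_def)
  ultimately show ?thesis by (rule Lim_transform_eventually)
qed

end

text \<open>Dividing by a power of \<open>t\<close> only lowers the shape of the Gamma density, so
  the negative moments are quotients of Gamma values.\<close>

lemma bessel_weight_powr:
  assumes "0 < b" "0 < b - a"
  shows "bessel_weight b t * t powr (- a) = Gamma (b - a) / Gamma b * bessel_weight (b - a) t"
proof (cases "0 < t")
  case True
  have "t powr (b - 1) * t powr (- a) = t powr (b - a - 1)" using True by (simp add: powr_add[symmetric] algebra_simps)
  then show ?thesis
    using Gamma_real_pos[OF assms(1)] Gamma_real_pos[OF assms(2)] by (simp add: bessel_weight_def field_simps)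
next
  case False
  then show ?thesis by (cases "t = 0") (auto simp: bessel_weight_def)
qed

section \<open>Boundedness, Hoelder continuity and integrability of Bessel potentials\<close>

locale bessel_potential = lp_fun +
  fixes s \<kappa> :: real
  assumes s: "2 / p < s" and \<kappa>: "0 < \<kappa>" "\<kappa> \<le> 1" "\<kappa> < s - 2 / p"
begin

text \<open>For \<open>c = 0\<close> the Bessel potential of order \<open>s\<close> of
  \<open>G\<close>, for \<open>c > 0\<close> its Gaussian mean. Integrating in \<open>t\<close> last
  avoids the singularity of the Bessel kernel.\<close>

definition potential :: "real \<Rightarrow> real \<times> real \<Rightarrow> complex" where
  "potential c z = (LINT t|lborel. of_real (bessel_weight (s / 2) t) * heat (c + 4 * pi\<^sup>2 * t) z)"

definition potential_const :: "real \<Rightarrow> real" where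
  "potential_const a = Gamma (s / 2 - a) / Gamma (s / 2)"

text \<open>The last two numbers are the shapes of the Gamma densities left in the sup estimate and
  in the Hoelder estimate. Their positivity is the convergence of the integrals at
  \<open>t = 0\<close>.\<close>

lemma s_pos: "0 < s" "0 < s / 2 - 1 / p" "0 < s / 2 - (1 / p + \<kappa> / 2)"
proof -
  have "0 < 2 / p" using p by simp
  then show "0 < s" using s by linarith
  show "0 < s / 2 - 1 / p" "0 < s / 2 - (1 / p + \<kappa> / 2)" using s \<kappa> by (auto simp: field_simps)
qed

lemma weight_moment:
  assumes "0 < s / 2 - a"
  shows "integrable lborel (\<lambda>t. bessel_weight (s / 2) t * t powr (- a))"
    "(LINT t|lborel. bessel_weight (s / 2) t * t powr (- a)) = potential_const a"
proof -
  have "0 < s / 2" using s_pos by simp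
  note eq = bessel_weight_powr[OF this assms]
  show "integrable lborel (\<lambda>t. bessel_weight (s / 2) t * t powr (- a))"
    unfolding eq by (intro integrable_mult_right bessel_weight_integrable assms)
  show "(LINT t|lborel. bessel_weight (s / 2) t * t powr (- a)) = potential_const a"
    unfolding eq by (simp add: bessel_weight_integral[OF assms] potential_const_def)
qed

lemma weight_nonneg: "0 \<le> bessel_weight (s / 2) t"
  using s_pos by (intro bessel_weight_nonneg) simp

text \<open>Uniform in \<open>c \<ge> 0\<close>: the same majorant bounds the potential and
  justifies its limit as \<open>c\<close> tends to 0.\<close>

lemma weight_heat_le:
  assumes c: "0 \<le> c"
  shows "norm (of_real (bessel_weight (s / 2) t) * heat (c + 4 * pi\<^sup>2 * t) z) \<le> 2 * N * (bessel_weight (s / 2) t * t powr (- (1 / p)))"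
proof (cases "0 < t")
  case True
  have pos: "0 < c + 4 * pi\<^sup>2 * t" using True c by (simp add: add_nonneg_pos)
  have "pi * t \<le> 4 * pi\<^sup>2 * t"
    using True pi_gt3 by (simp add: power2_eq_square)
  then have "pi * t \<le> c + 4 * pi\<^sup>2 * t" using c by simp
  then have "pi / (c + 4 * pi\<^sup>2 * t) \<le> 1 / t" using True pos by (simp add: field_simps)
  then have "(pi / (c + 4 * pi\<^sup>2 * t)) powr (1 / p) \<le> (1 / t) powr (1 / p)"
    using p pos by (intro powr_mono2) auto
  also have "\<dots> = t powr (- (1 / p))" using True by (simp add: powr_divide powr_minus_divide)
  finally have le: "(pi / (c + 4 * pi\<^sup>2 * t)) powr (1 / p) \<le> t powr (- (1 / p))" .
  have "norm (heat (c + 4 * pi\<^sup>2 * t) z) \<le> 2 * N * (pi / (c + 4 * pi\<^sup>2 * t)) powr (1 / p)" by (rule norm_heat_le[OF pos])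
  also have "\<dots> \<le> 2 * N * t powr (- (1 / p))" using le N by (intro mult_left_mono) auto
  finally have "bessel_weight (s / 2) t * norm (heat (c + 4 * pi\<^sup>2 * t) z) \<le> bessel_weight (s / 2) t * (2 * N * t powr (- (1 / p)))"
    using weight_nonneg by (rule mult_left_mono)
  then show ?thesis using weight_nonneg[of t] by (simp add: norm_mult mult_ac)
qed (auto simp: bessel_weight_def indicator_def)

lemma weight_heat_borel [measurable]: "(\<lambda>t. of_real (bessel_weight (s / 2) t) * heat (c + 4 * pi\<^sup>2 * t) z) \<in> borel_measurable borel"
proof -
  have "(\<lambda>t::real. (c + 4 * pi\<^sup>2 * t, z)) \<in> borel_measurable borel"
    by (intro borel_measurable_continuous_onI continuous_intros)
  from measurable_compose[OF this heat_borel] have [measurable]: "(\<lambda>t. heat (c + 4 * pi\<^sup>2 * t) z) \<in> borel_measurable borel" by simp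
  show ?thesis by measurable
qed

lemma weight_heat_integrable:
  assumes c: "0 \<le> c"
  shows "integrable lborel (\<lambda>t. of_real (bessel_weight (s / 2) t) * heat (c + 4 * pi\<^sup>2 * t) z)"
proof (rule Bochner_Integration.integrable_bound)
  show "integrable lborel (\<lambda>t. 2 * N * (bessel_weight (s / 2) t * t powr (- (1 / p))))"
    by (intro integrable_mult_right weight_moment s_pos)
  show "AE t in lborel. norm (of_real (bessel_weight (s / 2) t) * heat (c + 4 * pi\<^sup>2 * t) z) \<le> norm (2 * N * (bessel_weight (s / 2) t * t powr (- (1 / p))))"
    using weight_heat_le[OF c] by (intro AE_I2) (metis abs_ge_self order_trans real_norm_def)
qed measurable

lemma norm_potential_le:
  assumes c: "0 \<le> c"
  shows "norm (potential c z) \<le> 2 * N * potential_const (1 / p)"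
proof -
  have "norm (potential c z) \<le> (LINT t|lborel. norm (of_real (bessel_weight (s / 2) t) * heat (c + 4 * pi\<^sup>2 * t) z))"
    unfolding potential_def by (rule integral_norm_bound)
  also have "\<dots> \<le> (LINT t|lborel. 2 * N * (bessel_weight (s / 2) t * t powr (- (1 / p))))"
    by (rule integral_mono[OF integrable_norm[OF weight_heat_integrable[OF c]] _ weight_heat_le[OF c]])
      (rule integrable_mult_right, rule weight_moment(1)[OF s_pos(2)])
  also have "\<dots> = 2 * N * potential_const (1 / p)"
    by (simp only: integral_mult_right_zero weight_moment(2)[OF s_pos(2)])
  finally show ?thesis .
qed

text \<open>A difference of Gaussian means costs \<open>t powr (- (\<kappa> / 2))\<close> in
  addition to \<open>t powr (- (1 / p))\<close>; the resulting moment is finite because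
  \<open>\<kappa> < s - 2 / p\<close>.\<close>

lemma potential_holder:
  "norm (potential 0 z - potential 0 z') \<le> 2 * N * (12 * potential_const (1 / p + \<kappa> / 2)) * norm (z - z') powr \<kappa>"
proof -
  define h where "h = norm (z - z') powr \<kappa>"
  let ?w = "bessel_weight (s / 2)"
  have pt: "norm (of_real (?w t) * heat (0 + 4 * pi\<^sup>2 * t) z - of_real (?w t) * heat (0 + 4 * pi\<^sup>2 * t) z') \<le>
      24 * N * h * (?w t * t powr (- (1 / p + \<kappa> / 2)))" for t
  proof (cases "0 < t")
    case True
    define c where "c = 4 * pi\<^sup>2 * t"
    have c: "0 < c" using True by (simp add: c_def)
    have sc: "sqrt c = 2 * pi * sqrt t" using True by (simp add: c_def real_sqrt_mult)
    have "pi * norm (z - z') / sqrt c \<le> norm (z - z') / sqrt t"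
      unfolding sc using True by (simp add: divide_simps mult_left_le)
    then have "(pi * norm (z - z') / sqrt c) powr \<kappa> \<le> (norm (z - z') / sqrt t) powr \<kappa>"
      using c \<kappa> by (intro powr_mono2) auto
    also have "\<dots> = h * t powr (- (\<kappa> / 2))"
      using True by (simp add: h_def powr_divide powr_half_sqrt[symmetric] powr_powr powr_minus_divide)
    finally have 1: "(pi * norm (z - z') / sqrt c) powr \<kappa> \<le> h * t powr (- (\<kappa> / 2))" .
    have "pi * t \<le> 2 * c" using True pi_gt3 by (simp add: c_def power2_eq_square)
    then have "pi / (2 * c) \<le> 1 / t" using True c by (simp add: field_simps)
    then have "(pi / (2 * c)) powr (1 / p) \<le> (1 / t) powr (1 / p)" using p c by (intro powr_mono2) auto
    also have "\<dots> = t powr (- (1 / p))" using True by (simp add: powr_divide powr_minus_divide)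
    finally have 2: "(pi / (2 * c)) powr (1 / p) \<le> t powr (- (1 / p))" .
    have "norm (heat c z - heat c z') \<le> 24 * N * (pi * norm (z - z') / sqrt c) powr \<kappa> * (pi / (2 * c)) powr (1 / p)"
      by (rule heat_holder[OF c \<kappa>(1,2)])
    also have "\<dots> \<le> 24 * N * (h * t powr (- (\<kappa> / 2))) * t powr (- (1 / p))"
      using N by (intro mult_mono 1 2 mult_left_mono) (auto simp: h_def)
    also have "\<dots> = 24 * N * h * t powr (- (1 / p + \<kappa> / 2))"
      using True by (simp add: powr_add[symmetric] algebra_simps)
    finally have "?w t * norm (heat c z - heat c z') \<le> ?w t * (24 * N * h * t powr (- (1 / p + \<kappa> / 2)))"
      using weight_nonneg by (rule mult_left_mono)
    moreover have "norm (of_real (?w t) * heat (0 + 4 * pi\<^sup>2 * t) z - of_real (?w t) * heat (0 + 4 * pi\<^sup>2 * t) z') =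
        ?w t * norm (heat c z - heat c z')"
      using weight_nonneg[of t] by (simp add: c_def norm_mult right_diff_distrib[symmetric])
    ultimately show ?thesis by (simp add: mult_ac)
  qed (auto simp: bessel_weight_def indicator_def)
  have d: "potential 0 z - potential 0 z' = (LINT t|lborel. of_real (?w t) * heat (0 + 4 * pi\<^sup>2 * t) z - of_real (?w t) * heat (0 + 4 * pi\<^sup>2 * t) z')"
    unfolding potential_def by (intro Bochner_Integration.integral_diff[symmetric] weight_heat_integrable) auto
  have "norm (potential 0 z - potential 0 z') \<le> (LINT t|lborel. norm (of_real (?w t) * heat (0 + 4 * pi\<^sup>2 * t) z - of_real (?w t) * heat (0 + 4 * pi\<^sup>2 * t) z'))"
    unfolding d by (rule integral_norm_bound)
  also have "\<dots> \<le> (LINT t|lborel. 24 * N * h * (?w t * t powr (- (1 / p + \<kappa> / 2))))"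
  proof (rule integral_mono)
    show "integrable lborel (\<lambda>t. norm (of_real (?w t) * heat (0 + 4 * pi\<^sup>2 * t) z - of_real (?w t) * heat (0 + 4 * pi\<^sup>2 * t) z'))"
      by (rule integrable_norm[OF Bochner_Integration.integrable_diff[OF weight_heat_integrable[OF order_refl] weight_heat_integrable[OF order_refl]]])
    show "integrable lborel (\<lambda>t. 24 * N * h * (?w t * t powr (- (1 / p + \<kappa> / 2))))"
      by (rule integrable_mult_right) (rule weight_moment(1)[OF s_pos(3)])
  qed (rule pt)
  also have "\<dots> = 24 * N * h * potential_const (1 / p + \<kappa> / 2)"
    by (simp only: integral_mult_right_zero weight_moment(2)[OF s_pos(3)])
  finally show ?thesis by (simp add: h_def mult_ac)
qed

lemma potential_borel [measurable]: "(\<lambda>z. potential c z) \<in> borel_measurable borel"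
proof -
  have "(\<lambda>x::(real \<times> real) \<times> real. (c + 4 * pi\<^sup>2 * snd x, fst x)) \<in> borel_measurable borel"
    by (intro borel_measurable_continuous_onI continuous_intros)
  from measurable_compose[OF this heat_borel]
  have [measurable]: "(\<lambda>x::(real \<times> real) \<times> real. heat (c + 4 * pi\<^sup>2 * snd x) (fst x)) \<in> borel_measurable (borel \<Otimes>\<^sub>M borel)"
    by (simp add: borel_prod)
  have "(\<lambda>(z, t). of_real (bessel_weight (s / 2) t) * heat (c + 4 * pi\<^sup>2 * t) z) \<in> borel_measurable (borel \<Otimes>\<^sub>M lborel)"
    unfolding case_prod_beta by measurable
  then show ?thesis unfolding potential_def by (rule lborel.borel_measurable_lebesgue_integral)
qed

lemma potential_tendsto: "(\<lambda>n. potential (1 / real (Suc n)) z) \<longlonglongrightarrow> potential 0 z"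
  unfolding potential_def
proof (rule integral_dominated_convergence[where w = "\<lambda>t. 2 * N * (bessel_weight (s / 2) t * t powr (- (1 / p)))"])
  show "integrable lborel (\<lambda>t. 2 * N * (bessel_weight (s / 2) t * t powr (- (1 / p))))"
    by (intro integrable_mult_right weight_moment s_pos)
  show "AE t in lborel. norm (of_real (bessel_weight (s / 2) t) * heat (1 / real (Suc n) + 4 * pi\<^sup>2 * t) z)
      \<le> 2 * N * (bessel_weight (s / 2) t * t powr (- (1 / p)))" for n
    by (intro AE_I2 weight_heat_le) simp
  show "AE t in lborel. (\<lambda>n. of_real (bessel_weight (s / 2) t) * heat (1 / real (Suc n) + 4 * pi\<^sup>2 * t) z) \<longlonglongrightarrow>
      of_real (bessel_weight (s / 2) t) * heat (0 + 4 * pi\<^sup>2 * t) z"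
  proof (rule AE_I2)
    fix t :: real
    show "(\<lambda>n. of_real (bessel_weight (s / 2) t) * heat (1 / real (Suc n) + 4 * pi\<^sup>2 * t) z) \<longlonglongrightarrow>
      of_real (bessel_weight (s / 2) t) * heat (0 + 4 * pi\<^sup>2 * t) z"
    proof (cases "0 < t")
      case True
      have "(\<lambda>n. 1 / real (Suc n)) \<longlonglongrightarrow> 0" using LIMSEQ_inverse_real_of_nat by (simp add: inverse_eq_divide)
      from heat_continuous_right[OF _ this, of "4 * pi\<^sup>2 * t" z] show ?thesis
        using True by (intro tendsto_mult_left) (simp add: add.commute)
    qed (auto simp: bessel_weight_def indicator_def)
  qed
qed measurable

text \<open>Young's convolution inequality for the Bessel kernel \<open>K\<close>, whose mass is at
  most 1, with the factor 2 of the power mean inequality. \<open>K\<close> takes values in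
  \<open>ennreal\<close> since it may be infinite at the origin.\<close>

lemma potential_Lp: "(\<integral>\<^sup>+z. ennreal (norm (potential 0 z) powr p) \<partial>lborel) \<le> ennreal ((2 * N) powr p)"
proof -
  let ?w = "bessel_weight (s / 2)"
  define K where "K x = (\<integral>\<^sup>+t. ennreal (?w t) * ennreal (gauss_kernel (4 * pi\<^sup>2 * t) x) \<partial>lborel)" for x
  have gm: "(\<lambda>x::(real \<times> real) \<times> real. gauss_kernel (4 * pi\<^sup>2 * snd x) (fst x)) \<in> borel_measurable borel"
  proof -
    have "(\<lambda>x::(real \<times> real) \<times> real. (4 * pi\<^sup>2 * snd x, fst x)) \<in> borel_measurable borel"
      by (intro borel_measurable_continuous_onI continuous_intros)
    from measurable_compose[OF this gauss_kernel_borel2] show ?thesis by simp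
  qed
  then have [measurable]: "(\<lambda>x::(real \<times> real) \<times> real. gauss_kernel (4 * pi\<^sup>2 * snd x) (fst x)) \<in> borel_measurable (borel \<Otimes>\<^sub>M borel)"
    by (simp add: borel_prod)
  have Km [measurable]: "K \<in> borel_measurable borel"
    unfolding K_def[abs_def] by (rule lborel.borel_measurable_nn_integral) (simp add: case_prod_beta)
  have gm2: "(\<lambda>x::(real \<times> real) \<times> real. gauss_kernel (4 * pi\<^sup>2 * snd x) (z - fst x)) \<in> borel_measurable (borel \<Otimes>\<^sub>M borel)" for z
  proof -
    have "(\<lambda>x::(real \<times> real) \<times> real. (z - fst x, snd x)) \<in> borel_measurable borel"
      by (intro borel_measurable_continuous_onI continuous_intros)
    from measurable_compose[OF this gm] show ?thesis by (simp add: borel_prod)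
  qed
  have Kz [measurable]: "(\<lambda>w. K (z - w)) \<in> borel_measurable borel" "(\<lambda>z. K (z - w)) \<in> borel_measurable borel" for z w
    by (rule measurable_compose[OF _ Km]; simp)+
  have w1: "(\<integral>\<^sup>+t. ennreal (?w t) \<partial>lborel) = 1" using s_pos by (intro nn_integral_bessel_weight) simp
  have K1: "(\<integral>\<^sup>+x. K x \<partial>lborel) \<le> 1"
  proof -
    have "(\<integral>\<^sup>+x. K x \<partial>lborel) = (\<integral>\<^sup>+t. \<integral>\<^sup>+x. ennreal (?w t) * ennreal (gauss_kernel (4 * pi\<^sup>2 * t) x) \<partial>lborel \<partial>lborel)"
      unfolding K_def by (rule lborel_pair.Fubini'[symmetric]) (simp add: case_prod_beta)
    also have "\<dots> = (\<integral>\<^sup>+t. ennreal (?w t) * (\<integral>\<^sup>+x. ennreal (gauss_kernel (4 * pi\<^sup>2 * t) x) \<partial>lborel) \<partial>lborel)"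
      by (intro nn_integral_cong nn_integral_cmult) measurable
    also have "\<dots> \<le> (\<integral>\<^sup>+t. ennreal (?w t) * 1 \<partial>lborel)"
      by (intro nn_integral_mono mult_left_mono nn_integral_gauss_kernel_le) auto
    finally show ?thesis by (simp add: w1)
  qed
  have K2: "(\<integral>\<^sup>+w. K (z - w) \<partial>lborel) \<le> 1" "(\<integral>\<^sup>+w. K (w - z) \<partial>lborel) \<le> 1" for z
  proof -
    have *: "(\<integral>\<^sup>+w. K (w - z) \<partial>lborel) = (\<integral>\<^sup>+x. K x \<partial>lborel)" for z
      using nn_integral_lborel_shift[OF Km, of "- z"] by simp
    then show "(\<integral>\<^sup>+w. K (w - z) \<partial>lborel) \<le> 1" using K1 by simp
    have "K (z - w) = K (w - z)" for w
      unfolding K_def using gauss_kernel_minus[of _ "z - w"] by simp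
    then show "(\<integral>\<^sup>+w. K (z - w) \<partial>lborel) \<le> 1" using * K1 by simp
  qed
  have pw: "ennreal (norm (potential 0 z) powr p) \<le> ennreal (2 powr p) * (\<integral>\<^sup>+w. K (z - w) * ennreal (norm (G w) powr p) \<partial>lborel)"
    (is "_ \<le> _ * ?I") for z
  \<comment> \<open>The power mean inequality needs a real bound on its right side; in the infinite
    case nothing has to be shown.\<close>
  proof (cases "?I = \<infinity>")
    case True
    then show ?thesis by (simp add: ennreal_mult_top)
  next
    case False
    define M where "M = density lborel (\<lambda>w. K (z - w))"
    have M1: "emeasure M (space M) \<le> 1" unfolding M_def using K2(1)[of z] by (simp add: emeasure_density)
    have Gm: "(\<lambda>w. norm (G w)) \<in> borel_measurable M" unfolding M_def by measurable
    have I: "(\<integral>\<^sup>+w. ennreal (norm (G w) powr p) \<partial>M) = ?I" unfolding M_def by (simp add: nn_integral_density)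
    then have I': "(\<integral>\<^sup>+w. ennreal (norm (G w) powr p) \<partial>M) \<le> ennreal (enn2real ?I)" using False by (simp add: less_top)
    have "ennreal (norm (potential 0 z)) \<le> (\<integral>\<^sup>+t. ennreal (norm (of_real (?w t) * heat (0 + 4 * pi\<^sup>2 * t) z)) \<partial>lborel)"
      unfolding potential_def by (rule integral_norm_bound_ennreal[OF weight_heat_integrable]) simp
    also have "\<dots> \<le> (\<integral>\<^sup>+t. \<integral>\<^sup>+w. ennreal (norm (G w)) * (ennreal (?w t) * ennreal (gauss_kernel (4 * pi\<^sup>2 * t) (z - w))) \<partial>lborel \<partial>lborel)"
    proof (rule nn_integral_mono)
      fix t :: real
      show "ennreal (norm (of_real (?w t) * heat (0 + 4 * pi\<^sup>2 * t) z)) \<le>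
          (\<integral>\<^sup>+w. ennreal (norm (G w)) * (ennreal (?w t) * ennreal (gauss_kernel (4 * pi\<^sup>2 * t) (z - w))) \<partial>lborel)"
      proof (cases "0 < t")
        case True
        then have c: "0 < 4 * pi\<^sup>2 * t" by simp
        have "ennreal (norm (heat (4 * pi\<^sup>2 * t) z)) \<le> (\<integral>\<^sup>+w. ennreal (norm (G w * of_real (gauss_kernel (4 * pi\<^sup>2 * t) (z - w)))) \<partial>lborel)"
          unfolding heat_def by (rule integral_norm_bound_ennreal[OF heat_integrable[OF c]])
        then have "ennreal (?w t) * ennreal (norm (heat (4 * pi\<^sup>2 * t) z)) \<le>
            ennreal (?w t) * (\<integral>\<^sup>+w. ennreal (norm (G w * of_real (gauss_kernel (4 * pi\<^sup>2 * t) (z - w)))) \<partial>lborel)"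
          by (rule mult_left_mono) simp
        also have "\<dots> = (\<integral>\<^sup>+w. ennreal (?w t) * ennreal (norm (G w * of_real (gauss_kernel (4 * pi\<^sup>2 * t) (z - w)))) \<partial>lborel)"
          by (rule nn_integral_cmult[symmetric]) measurable
        also have "\<dots> = (\<integral>\<^sup>+w. ennreal (norm (G w)) * (ennreal (?w t) * ennreal (gauss_kernel (4 * pi\<^sup>2 * t) (z - w))) \<partial>lborel)"
          using gauss_kernel_nonneg[OF c] by (intro nn_integral_cong) (simp add: norm_mult ennreal_mult' mult_ac)
        finally show ?thesis using weight_nonneg[of t] by (simp add: norm_mult ennreal_mult')
      qed (auto simp: bessel_weight_def indicator_def)
    qed
    also have "\<dots> = (\<integral>\<^sup>+w. \<integral>\<^sup>+t. ennreal (norm (G w)) * (ennreal (?w t) * ennreal (gauss_kernel (4 * pi\<^sup>2 * t) (z - w))) \<partial>lborel \<partial>lborel)"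
    proof (rule lborel_pair.Fubini')
      show "(\<lambda>(w, t). ennreal (norm (G w)) * (ennreal (?w t) * ennreal (gauss_kernel (4 * pi\<^sup>2 * t) (z - w)))) \<in> borel_measurable (lborel \<Otimes>\<^sub>M lborel)"
        unfolding case_prod_beta using gm2[of z] by simp
    qed
    also have "\<dots> = (\<integral>\<^sup>+w. ennreal (norm (G w)) * K (z - w) \<partial>lborel)"
    proof (rule nn_integral_cong)
      fix w :: "real \<times> real"
      have "(\<lambda>t::real. (w, t)) \<in> borel \<rightarrow>\<^sub>M borel \<Otimes>\<^sub>M borel" by measurable
      from measurable_compose[OF this gm2[of z]]
      have [measurable]: "(\<lambda>t. gauss_kernel (4 * pi\<^sup>2 * t) (z - w)) \<in> borel_measurable borel" by simp
      show "(\<integral>\<^sup>+t. ennreal (norm (G w)) * (ennreal (?w t) * ennreal (gauss_kernel (4 * pi\<^sup>2 * t) (z - w))) \<partial>lborel) = ennreal (norm (G w)) * K (z - w)"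
        unfolding K_def by (rule nn_integral_cmult) measurable
    qed
    also have "\<dots> = (\<integral>\<^sup>+w. ennreal (norm (G w)) \<partial>M)" unfolding M_def by (simp add: nn_integral_density mult.commute)
    also have "\<dots> \<le> ennreal (2 * enn2real ?I powr (1 / p))"
      by (rule nn_integral_power_mean[OF Gm _ M1 p I']) auto
    finally have "norm (potential 0 z) \<le> 2 * enn2real ?I powr (1 / p)" by simp
    then have "norm (potential 0 z) powr p \<le> (2 * enn2real ?I powr (1 / p)) powr p"
      using p by (intro powr_mono2) auto
    also have "\<dots> = 2 powr p * enn2real ?I" using p by (simp add: powr_mult powr_powr)
    finally have "ennreal (norm (potential 0 z) powr p) \<le> ennreal (2 powr p * enn2real ?I)" by (rule ennreal_leI)
    also have "\<dots> = ennreal (2 powr p) * ?I" using False by (simp add: ennreal_mult' less_top)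
    finally show ?thesis .
  qed
  have "(\<integral>\<^sup>+z. ennreal (norm (potential 0 z) powr p) \<partial>lborel) \<le>
      (\<integral>\<^sup>+z. ennreal (2 powr p) * (\<integral>\<^sup>+w. K (z - w) * ennreal (norm (G w) powr p) \<partial>lborel) \<partial>lborel)"
    by (intro nn_integral_mono pw)
  also have "\<dots> = ennreal (2 powr p) * (\<integral>\<^sup>+z. \<integral>\<^sup>+w. K (z - w) * ennreal (norm (G w) powr p) \<partial>lborel \<partial>lborel)"
  proof (rule nn_integral_cmult)
    have [measurable]: "(\<lambda>x::(real \<times> real) \<times> (real \<times> real). K (fst x - snd x)) \<in> borel_measurable (borel \<Otimes>\<^sub>M lborel)"
      by (rule measurable_compose[OF _ Km]) measurable
    have "(\<lambda>z. \<integral>\<^sup>+w. K (z - w) * ennreal (norm (G w) powr p) \<partial>lborel) \<in> borel_measurable borel"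
      by (rule lborel.borel_measurable_nn_integral) (simp add: case_prod_beta)
    then show "(\<lambda>z. \<integral>\<^sup>+w. K (z - w) * ennreal (norm (G w) powr p) \<partial>lborel) \<in> borel_measurable lborel"
      by simp
  qed
  also have "(\<integral>\<^sup>+z. \<integral>\<^sup>+w. K (z - w) * ennreal (norm (G w) powr p) \<partial>lborel \<partial>lborel) =
      (\<integral>\<^sup>+w. \<integral>\<^sup>+z. K (z - w) * ennreal (norm (G w) powr p) \<partial>lborel \<partial>lborel)"
  proof (rule lborel_pair.Fubini'[symmetric])
    have [measurable]: "(\<lambda>x::(real \<times> real) \<times> (real \<times> real). K (fst x - snd x)) \<in> borel_measurable (lborel \<Otimes>\<^sub>M lborel)"
      by (rule measurable_compose[OF _ Km]) measurable
    show "(\<lambda>(z, w). K (z - w) * ennreal (norm (G w) powr p)) \<in> borel_measurable (lborel \<Otimes>\<^sub>M lborel)"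
      unfolding case_prod_beta by measurable
  qed
  also have "\<dots> = (\<integral>\<^sup>+w. (\<integral>\<^sup>+z. K (z - w) \<partial>lborel) * ennreal (norm (G w) powr p) \<partial>lborel)"
    by (intro nn_integral_cong nn_integral_multc) measurable
  also have "\<dots> \<le> (\<integral>\<^sup>+w. 1 * ennreal (norm (G w) powr p) \<partial>lborel)"
    by (intro nn_integral_mono mult_right_mono K2) auto
  also have "\<dots> \<le> ennreal (N powr p)" using G_norm by simp
  finally have "(\<integral>\<^sup>+z. ennreal (norm (potential 0 z) powr p) \<partial>lborel) \<le> ennreal (2 powr p) * ennreal (N powr p)"
    by (simp add: mult_left_mono)
  also have "\<dots> = ennreal ((2 * N) powr p)" using N by (simp add: powr_mult ennreal_mult')
  finally show ?thesis .
qed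

end

section \<open>Recovering a function from its Gaussian means over boxes\<close>

lemma lborel_integral_plane_affine:
  fixes f :: "real \<times> real \<Rightarrow> complex"
  assumes [measurable]: "f \<in> borel_measurable borel" and r: "r \<noteq> 0"
  shows "(LINT w|lborel. f w) = r\<^sup>2 *\<^sub>R (LINT u|lborel. f (z + r *\<^sub>R u))"
proof -
  have [measurable]: "(\<lambda>u::real \<times> real. z + r *\<^sub>R u) \<in> borel_measurable borel"
    by (intro borel_measurable_continuous_onI continuous_intros)
  have dim: "\<bar>r\<bar> ^ DIM(real \<times> real) = r\<^sup>2" by (simp add: power2_eq_square)
  have l: "lborel = density (distr lborel borel (\<lambda>u::real \<times> real. z + r *\<^sub>R u)) (\<lambda>_. ennreal (r\<^sup>2))"
    using lborel_affine[OF r, of z] unfolding dim by simp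
  show ?thesis
    by (subst l) (simp add: integral_density integral_distr)
qed

lemma emeasure_cbox_finite: "emeasure lborel (cbox a b :: (real \<times> real) set) < \<infinity>"
  by (rule emeasure_bounded_finite[OF bounded_cbox])

context lp_fun
begin

lemma indicator_norm_integrable:
  assumes [measurable]: "B \<in> sets borel" and B: "emeasure lborel B < \<infinity>"
  shows "integrable lborel (\<lambda>y. indicator B y * norm (G y))"
    and "(LINT y|lborel. indicator B y * norm (G y)) \<le> measure lborel B + N powr p"
proof -
  have Gi: "integrable lborel (\<lambda>w. norm (G w) powr p)"
    using G_norm by (intro integrableI_bounded) (auto intro: le_less_trans)
  have Gl: "(LINT w|lborel. norm (G w) powr p) \<le> N powr p"
    using G_norm by (subst integral_eq_nn_integral) (auto intro: enn2real_leI)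
  have Bi: "integrable lborel (indicator B :: _ \<Rightarrow> real)" using B by (intro integrable_real_indicator) auto
  have le: "indicator B y * norm (G y) \<le> indicator B y + norm (G y) powr p" for y
    using le_young[of 1 p "norm (G y)"] p by (simp add: indicator_def)
  show i: "integrable lborel (\<lambda>y. indicator B y * norm (G y))"
    by (rule Bochner_Integration.integrable_bound[OF Bochner_Integration.integrable_add[OF Bi Gi]])
      (use le in \<open>auto simp: indicator_def\<close>)
  have "(LINT y|lborel. indicator B y * norm (G y)) \<le> (LINT y|lborel. indicator B y + norm (G y) powr p)"
    by (rule integral_mono[OF i Bochner_Integration.integrable_add[OF Bi Gi] le])
  also have "\<dots> = measure lborel B + (LINT w|lborel. norm (G w) powr p)"
    using Bi Gi by simp
  finally show "(LINT y|lborel. indicator B y * norm (G y)) \<le> measure lborel B + N powr p" using Gl by simp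
qed

text \<open>Not normalised: the integral of \<open>G\<close> over the translate of \<open>B\<close>
  by \<open>- v\<close>.\<close>

definition box_average :: "(real \<times> real) set \<Rightarrow> real \<times> real \<Rightarrow> complex" where
  "box_average B v = (LINT y|lborel. indicator B (y + v) *\<^sub>R G y)"

lemma shifted_box:
  fixes v :: "real \<times> real"
  assumes [measurable]: "B \<in> sets borel"
  shows "{y. y + v \<in> B} \<in> sets borel" "emeasure lborel {y. y + v \<in> B} = emeasure lborel B"
    "measure lborel {y. y + v \<in> B} = measure lborel B"
proof -
  have m [measurable]: "(\<lambda>y::real \<times> real. y + v) \<in> borel_measurable borel" by measurable
  show s: "{y. y + v \<in> B} \<in> sets borel" using measurable_sets[OF m assms] by (simp add: vimage_def)
  have "emeasure lborel {y. y + v \<in> B} = (\<integral>\<^sup>+y. indicator {y. y + v \<in> B} y \<partial>lborel)"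
    using s by (intro nn_integral_indicator[symmetric]) auto
  also have "\<dots> = (\<integral>\<^sup>+y. indicator B (v + y) \<partial>lborel)"
    by (intro nn_integral_cong) (auto simp: indicator_def add.commute)
  also have "\<dots> = emeasure lborel B"
    by (subst nn_integral_lborel_shift) auto
  finally show e: "emeasure lborel {y. y + v \<in> B} = emeasure lborel B" .
  show "measure lborel {y. y + v \<in> B} = measure lborel B" by (simp add: measure_def e)
qed

lemma box_average_bound:
  assumes B: "B \<in> sets borel" "emeasure lborel B < \<infinity>"
  shows "integrable lborel (\<lambda>y. indicator B (y + v) *\<^sub>R G y)"
    and "(LINT y|lborel. norm (indicator B (y + v) *\<^sub>R G y)) \<le> measure lborel B + N powr p"
    and "norm (box_average B v) \<le> measure lborel B + N powr p"
proof -
  let ?S = "{y. y + v \<in> B}"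
  have S: "?S \<in> sets borel" "emeasure lborel ?S < \<infinity>" using shifted_box[OF B(1)] B(2) by auto
  have eq: "norm (indicator B (y + v) *\<^sub>R G y) = indicator ?S y * norm (G y)" for y
    by (simp add: indicator_def)
  have m: "(\<lambda>y. indicator B (y + v) *\<^sub>R G y) \<in> borel_measurable lborel"
  proof -
    have "(\<lambda>y. indicator ?S y *\<^sub>R G y) \<in> borel_measurable lborel" using S(1) by measurable
    moreover have "indicator ?S y = (indicator B (y + v) :: real)" for y by (simp add: indicator_def)
    ultimately show ?thesis by simp
  qed
  show i: "integrable lborel (\<lambda>y. indicator B (y + v) *\<^sub>R G y)"
    using integrable_norm_iff[OF m] indicator_norm_integrable(1)[OF S] unfolding eq by (rule iffD1)
  show l: "(LINT y|lborel. norm (indicator B (y + v) *\<^sub>R G y)) \<le> measure lborel B + N powr p"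
    unfolding eq using indicator_norm_integrable(2)[OF S] shifted_box(3)[OF B(1), of v] by simp
  show "norm (box_average B v) \<le> measure lborel B + N powr p"
    unfolding box_average_def by (rule order_trans[OF integral_norm_bound l])
qed

text \<open>Off the boundary of the box, a null set, the translated indicators converge
  pointwise.\<close>

lemma box_average_tendsto:
  assumes v: "v \<longlonglongrightarrow> 0"
  shows "(\<lambda>n. box_average (cbox a b) (v n)) \<longlonglongrightarrow> box_average (cbox a b) 0"
proof -
  obtain R where R: "\<And>n. norm (v n) \<le> R"
    using convergent_imp_Bseq[OF convergentI[OF v]] by (auto simp: Bseq_def)
  obtain M where M: "\<And>x. x \<in> cbox a b \<Longrightarrow> norm x \<le> M" using bounded_cbox[of a b] by (auto simp: bounded_iff)
  \<comment> \<open>A bounded set containing all the translated boxes, on which \<open>G\<close> is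
    integrable.\<close>
  define D where "D = cball (0::real \<times> real) (M + R)"
  have D: "D \<in> sets borel" "emeasure lborel D < \<infinity>"
    unfolding D_def by (simp, rule emeasure_bounded_finite[OF bounded_cball])
  have nf: "AE y in lborel. y \<notin> frontier (cbox a b)"
  proof -
    have "negligible (frontier (cbox a b))" by (rule negligible_convex_frontier) simp
    then have "frontier (cbox a b) \<in> null_sets lebesgue" by (simp add: negligible_iff_null_sets)
    then have "AE y in lebesgue. y \<notin> frontier (cbox a b)" by (rule AE_not_in)
    then show ?thesis by (simp add: AE_completion_iff)
  qed
  show ?thesis unfolding box_average_def
  proof (rule integral_dominated_convergence[where w = "\<lambda>y. indicator D y * norm (G y)"])
    show "integrable lborel (\<lambda>y. indicator D y * norm (G y))" by (rule indicator_norm_integrable(1)[OF D])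
    show "AE y in lborel. norm (indicator (cbox a b) (y + v n) *\<^sub>R G y) \<le> indicator D y * norm (G y)" for n
    proof (rule AE_I2)
      fix y
      have "y \<in> D" if "y + v n \<in> cbox a b"
        using M[OF that] R[of n] norm_triangle_ineq4[of "y + v n" "v n"] by (simp add: D_def)
      then show "norm (indicator (cbox a b) (y + v n) *\<^sub>R G y) \<le> indicator D y * norm (G y)"
        by (simp add: indicator_def)
    qed
    show "AE y in lborel. (\<lambda>n. indicator (cbox a b) (y + v n) *\<^sub>R G y) \<longlonglongrightarrow> indicator (cbox a b) (y + 0) *\<^sub>R G y"
      using nf
    proof eventually_elim
      case (elim y)
      have lim: "(\<lambda>n. y + v n) \<longlonglongrightarrow> y" using tendsto_add[OF tendsto_const v, of y] by simp
      have "\<forall>\<^sub>F n in sequentially. indicator (cbox a b) (y + 0) *\<^sub>R G y = indicator (cbox a b) (y + v n) *\<^sub>R G y"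
      proof (cases "y \<in> cbox a b")
        case True
        then have "y \<in> interior (cbox a b)" using elim by (simp add: frontier_def closure_cbox)
        then have "\<forall>\<^sub>F n in sequentially. y + v n \<in> interior (cbox a b)"
          using lim open_interior topological_tendstoD by blast
        then have "\<forall>\<^sub>F n in sequentially. y + v n \<in> cbox a b"
          by (rule eventually_mono) (rule subsetD[OF interior_subset])
        then show ?thesis by eventually_elim (use True in \<open>auto simp: indicator_def\<close>)
      next
        case False
        have "\<forall>\<^sub>F n in sequentially. y + v n \<in> - cbox a b"
          by (rule topological_tendstoD[OF lim]) (use False in \<open>auto intro: open_Compl closed_cbox\<close>)
        then show ?thesis by eventually_elim (use False in \<open>auto simp: indicator_def\<close>)
      qed
      then show ?case by (rule Lim_transform_eventually[OF tendsto_const])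
    qed
    show "(\<lambda>y. indicator (cbox a b) (y + 0) *\<^sub>R G y) \<in> borel_measurable lborel" by simp
    show "(\<lambda>y. indicator (cbox a b) (y + v n) *\<^sub>R G y) \<in> borel_measurable lborel" for n
      by (rule borel_measurable_integrable[OF box_average_bound(1)]) (rule emeasure_cbox_finite | simp)+
  qed
qed

text \<open>Fubini after the substitution \<open>w = z - sqrt c *\<^sub>R u\<close>.\<close>

lemma integral_box_heat:
  assumes c: "0 < c" and B: "B \<in> sets borel" "emeasure lborel B < \<infinity>"
  shows "(LINT z|lborel. indicator B z *\<^sub>R heat c z) = (LINT u|lborel. gauss_kernel 1 u *\<^sub>R box_average B (sqrt c *\<^sub>R u))"
proof -
  define r where "r = sqrt c"
  have r: "0 < r" "r\<^sup>2 = c" using c by (auto simp: r_def)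
  note [measurable] = B(1)
  define H where "H z u = gauss_kernel 1 u *\<^sub>R (indicator B z *\<^sub>R G (z - r *\<^sub>R u))" for z u
  have ht: "heat c z = (LINT u|lborel. gauss_kernel 1 u *\<^sub>R G (z - r *\<^sub>R u))" for z
  proof -
    have "heat c z = (- r)\<^sup>2 *\<^sub>R (LINT u|lborel. G (z + (- r) *\<^sub>R u) * of_real (gauss_kernel c (z - (z + (- r) *\<^sub>R u))))"
      unfolding heat_def by (rule lborel_integral_plane_affine) (use r in auto)
    also have "\<dots> = (LINT u|lborel. gauss_kernel 1 u *\<^sub>R G (z - r *\<^sub>R u))"
    proof -
      \<comment> \<open>The number \<open>c\<close> is both the square of \<open>r\<close>, that is,
        the planar Jacobian, and the normalisation of the Gaussian.\<close>
      have "c * gauss_kernel c (r *\<^sub>R u) = gauss_kernel 1 u" for u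
        using r c by (simp add: gauss_kernel_def power_mult_distrib)
      then have "(- r)\<^sup>2 *\<^sub>R (G (z + (- r) *\<^sub>R u) * of_real (gauss_kernel c (z - (z + (- r) *\<^sub>R u)))) = gauss_kernel 1 u *\<^sub>R G (z - r *\<^sub>R u)" for u
        by (simp add: r(2) scaleR_conv_of_real mult_ac flip: of_real_mult)
      then show ?thesis by (simp only: integral_scaleR_right[symmetric])
    qed
    finally show ?thesis .
  qed
  have ba: "(LINT z|lborel. H z u) = gauss_kernel 1 u *\<^sub>R box_average B (r *\<^sub>R u)" for u
  proof -
    have m: "(\<lambda>z. indicator B z *\<^sub>R G (z - r *\<^sub>R u)) \<in> borel_measurable borel"
    proof -
      have [measurable]: "(\<lambda>z. G (z - r *\<^sub>R u)) \<in> borel_measurable borel"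
        by (rule measurable_compose[OF _ G_borel]) simp
      show ?thesis by measurable
    qed
    have "(LINT z|lborel. indicator B z *\<^sub>R G (z - r *\<^sub>R u)) = box_average B (r *\<^sub>R u)"
      unfolding box_average_def using integral_lborel_shift[OF m, of "r *\<^sub>R u"] by (simp add: add.commute)
    then show ?thesis by (simp only: H_def integral_scaleR_right)
  qed
  have Hm: "(\<lambda>(z, u). H z u) \<in> borel_measurable (lborel \<Otimes>\<^sub>M lborel)"
  proof -
    have "(\<lambda>x::(real \<times> real) \<times> (real \<times> real). fst x - r *\<^sub>R snd x) \<in> borel_measurable borel"
      by (intro borel_measurable_continuous_onI continuous_intros)
    from measurable_compose[OF this G_borel]
    have [measurable]: "(\<lambda>x::(real \<times> real) \<times> (real \<times> real). G (fst x - r *\<^sub>R snd x)) \<in> borel_measurable (lborel \<Otimes>\<^sub>M lborel)"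
      by (simp add: lborel_prod)
    show ?thesis unfolding H_def case_prod_beta by measurable
  qed
  have Hi: "integrable (lborel \<Otimes>\<^sub>M lborel) (\<lambda>(u, z). H z u)"
  proof (rule lborel_pair.Fubini_integrable)
    show "(\<lambda>(u, z). H z u) \<in> borel_measurable (lborel \<Otimes>\<^sub>M lborel)"
      using measurable_compose[OF measurable_pair_swap' Hm] by (simp add: case_prod_beta)
    have iz: "integrable lborel (\<lambda>z. indicator B z *\<^sub>R G (z - r *\<^sub>R u))"
      "(LINT z|lborel. norm (indicator B z *\<^sub>R G (z - r *\<^sub>R u))) \<le> measure lborel B + N powr p" for u
    proof -
      have i: "integrable lborel (\<lambda>y. indicator B (y + r *\<^sub>R u) *\<^sub>R G y)" by (rule box_average_bound(1)[OF B])
      have m: "(\<lambda>z. indicator B z *\<^sub>R G (z - r *\<^sub>R u)) \<in> borel_measurable borel"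
      proof -
        have [measurable]: "(\<lambda>z. G (z - r *\<^sub>R u)) \<in> borel_measurable borel"
          by (rule measurable_compose[OF _ G_borel]) simp
        show ?thesis by measurable
      qed
      have eq: "(\<lambda>y. indicator B (y + r *\<^sub>R u) *\<^sub>R G y) = (\<lambda>y. (\<lambda>z. indicator B z *\<^sub>R G (z - r *\<^sub>R u)) (r *\<^sub>R u + y))"
        by (simp add: add.commute)
      have nn: "(\<integral>\<^sup>+z. ennreal (norm (indicator B z *\<^sub>R G (z - r *\<^sub>R u))) \<partial>lborel) = (\<integral>\<^sup>+y. ennreal (norm (indicator B (y + r *\<^sub>R u) *\<^sub>R G y)) \<partial>lborel)"
        using nn_integral_lborel_shift[of "\<lambda>z. ennreal (norm (indicator B z *\<^sub>R G (z - r *\<^sub>R u)))" "r *\<^sub>R u"] m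
        by (simp add: add.commute)
      show "integrable lborel (\<lambda>z. indicator B z *\<^sub>R G (z - r *\<^sub>R u))"
        using i m unfolding integrable_iff_bounded nn by simp
      have "(LINT z|lborel. norm (indicator B z *\<^sub>R G (z - r *\<^sub>R u))) = (LINT y|lborel. norm (indicator B (y + r *\<^sub>R u) *\<^sub>R G y))"
      proof -
        have "(\<lambda>z. norm (indicator B z *\<^sub>R G (z - r *\<^sub>R u))) \<in> borel_measurable lborel" using m by simp
        moreover have "(\<lambda>y. norm (indicator B (y + r *\<^sub>R u) *\<^sub>R G y)) \<in> borel_measurable lborel"
          by (rule measurable_compose[OF borel_measurable_integrable[OF i] borel_measurable_norm])
        ultimately show ?thesis by (simp only: integral_eq_nn_integral AE_I2 norm_ge_zero nn)
      qed
      then show "(LINT z|lborel. norm (indicator B z *\<^sub>R G (z - r *\<^sub>R u))) \<le> measure lborel B + N powr p"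
        using box_average_bound(2)[OF B, of "r *\<^sub>R u"] by simp
    qed
    have g1: "0 \<le> gauss_kernel 1 u" for u by (rule gauss_kernel_nonneg) simp
    have eqn: "(LINT z|lborel. norm (H z u)) = gauss_kernel 1 u * (LINT z|lborel. norm (indicator B z *\<^sub>R G (z - r *\<^sub>R u)))" for u
      unfolding H_def norm_scaleR abs_of_nonneg[OF g1] by (rule integral_mult_right_zero)
    show "integrable lborel (\<lambda>u. LINT z|lborel. norm (case (u, z) of (u, z) \<Rightarrow> H z u))"
    proof (rule Bochner_Integration.integrable_bound)
      show "integrable lborel (\<lambda>u. (measure lborel B + N powr p) * gauss_kernel 1 u)"
        by (intro integrable_mult_right gauss_kernel_integrable) simp
      have "(\<lambda>(u, z). norm (H z u)) \<in> borel_measurable (lborel \<Otimes>\<^sub>M lborel)"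
        using measurable_compose[OF measurable_pair_swap' Hm] by (simp add: case_prod_beta)
      then show "(\<lambda>u. LINT z|lborel. norm (case (u, z) of (u, z) \<Rightarrow> H z u)) \<in> borel_measurable lborel"
        by (simp add: lborel.borel_measurable_lebesgue_integral)
      show "AE u in lborel. norm (LINT z|lborel. norm (case (u, z) of (u, z) \<Rightarrow> H z u)) \<le> norm ((measure lborel B + N powr p) * gauss_kernel 1 u)"
      proof (rule AE_I2)
        fix u
        have "gauss_kernel 1 u * (LINT z|lborel. norm (indicator B z *\<^sub>R G (z - r *\<^sub>R u))) \<le> gauss_kernel 1 u * (measure lborel B + N powr p)"
          by (intro mult_left_mono iz g1)
        moreover have "0 \<le> gauss_kernel 1 u * (LINT z|lborel. norm (indicator B z *\<^sub>R G (z - r *\<^sub>R u)))"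
          by (intro mult_nonneg_nonneg g1 integral_nonneg_AE) auto
        ultimately show "norm (LINT z|lborel. norm (case (u, z) of (u, z) \<Rightarrow> H z u)) \<le> norm ((measure lborel B + N powr p) * gauss_kernel 1 u)"
          by (simp add: eqn mult.commute)
      qed
    qed
    show "AE u in lborel. integrable lborel (\<lambda>z. case (u, z) of (u, z) \<Rightarrow> H z u)"
      unfolding H_def using iz(1) by (intro AE_I2) (simp del: scaleR_scaleR)
  qed
  have "(LINT z|lborel. indicator B z *\<^sub>R heat c z) = (LINT z|lborel. LINT u|lborel. H z u)"
  proof (rule Bochner_Integration.integral_cong[OF refl])
    fix z
    have "H z u = indicator B z *\<^sub>R (gauss_kernel 1 u *\<^sub>R G (z - r *\<^sub>R u))" for u by (simp add: H_def mult.commute)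
    then show "indicator B z *\<^sub>R heat c z = (LINT u|lborel. H z u)" unfolding ht by (simp only: integral_scaleR_right)
  qed
  also have "\<dots> = (LINT u|lborel. LINT z|lborel. H z u)"
    using lborel_pair.Fubini_integral[OF Hi] by simp
  also have "\<dots> = (LINT u|lborel. gauss_kernel 1 u *\<^sub>R box_average B (r *\<^sub>R u))" by (simp only: ba)
  finally show ?thesis by (simp add: r_def)
qed

text \<open>Convergence of the Gaussian means to \<open>G\<close> is needed only after integration
  over boxes, so continuity of translations in L^p reduces to that of the integral over a moving
  box.\<close>

lemma integral_box_heat_tendsto:
  "(\<lambda>n. LINT z|lborel. indicator (cbox a b) z *\<^sub>R heat (1 / real (Suc n)) z) \<longlonglongrightarrow> (LINT z|lborel. indicator (cbox a b) z *\<^sub>R G z)"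
proof -
  let ?B = "cbox a b"
  have B: "?B \<in> sets borel" "emeasure lborel ?B < \<infinity>" by (simp, rule emeasure_cbox_finite)
  have lim0: "(\<lambda>n. 1 / real (Suc n)) \<longlonglongrightarrow> 0" using LIMSEQ_inverse_real_of_nat by (simp add: inverse_eq_divide)
  have am: "(\<lambda>u. box_average ?B (t *\<^sub>R u)) \<in> borel_measurable borel" for t
  proof -
    have "(\<lambda>x::(real \<times> real) \<times> (real \<times> real). snd x + t *\<^sub>R fst x) \<in> borel_measurable borel"
      by (intro borel_measurable_continuous_onI continuous_intros)
    from measurable_compose[OF this, of "indicator ?B :: _ \<Rightarrow> real" borel]
    have [measurable]: "(\<lambda>x::(real \<times> real) \<times> (real \<times> real). indicator ?B (snd x + t *\<^sub>R fst x) :: real) \<in> borel_measurable (borel \<Otimes>\<^sub>M borel)"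
      by (simp add: borel_prod)
    have "(\<lambda>(u, y). indicator ?B (y + t *\<^sub>R u) *\<^sub>R G y) \<in> borel_measurable (borel \<Otimes>\<^sub>M lborel)"
      unfolding case_prod_beta by measurable
    then show ?thesis unfolding box_average_def by (rule lborel.borel_measurable_lebesgue_integral)
  qed
  have "(\<lambda>n. LINT u|lborel. gauss_kernel 1 u *\<^sub>R box_average ?B (sqrt (1 / real (Suc n)) *\<^sub>R u)) \<longlonglongrightarrow>
      (LINT u|lborel. gauss_kernel 1 u *\<^sub>R box_average ?B 0)"
  proof (rule integral_dominated_convergence[where w = "\<lambda>u. (measure lborel ?B + N powr p) * gauss_kernel 1 u"])
    show "integrable lborel (\<lambda>u. (measure lborel ?B + N powr p) * gauss_kernel 1 u)"
      by (intro integrable_mult_right gauss_kernel_integrable) simp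
    show "AE u in lborel. (\<lambda>n. gauss_kernel 1 u *\<^sub>R box_average ?B (sqrt (1 / real (Suc n)) *\<^sub>R u)) \<longlonglongrightarrow> gauss_kernel 1 u *\<^sub>R box_average ?B 0"
    proof (rule AE_I2)
      fix u :: "real \<times> real"
      have "(\<lambda>n. sqrt (1 / real (Suc n))) \<longlonglongrightarrow> sqrt 0" using lim0 by (rule tendsto_real_sqrt)
      from tendsto_scaleR[OF this tendsto_const[of u]]
      have "(\<lambda>n. sqrt (1 / real (Suc n)) *\<^sub>R u) \<longlonglongrightarrow> 0" by simp
      then show "(\<lambda>n. gauss_kernel 1 u *\<^sub>R box_average ?B (sqrt (1 / real (Suc n)) *\<^sub>R u)) \<longlonglongrightarrow> gauss_kernel 1 u *\<^sub>R box_average ?B 0"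
        by (intro tendsto_scaleR tendsto_const box_average_tendsto) simp
    qed
    show "AE u in lborel. norm (gauss_kernel 1 u *\<^sub>R box_average ?B (sqrt (1 / real (Suc n)) *\<^sub>R u)) \<le> (measure lborel ?B + N powr p) * gauss_kernel 1 u" for n
    proof (rule AE_I2)
      fix u
      have g1: "0 \<le> gauss_kernel 1 u" by (rule gauss_kernel_nonneg) simp
      show "norm (gauss_kernel 1 u *\<^sub>R box_average ?B (sqrt (1 / real (Suc n)) *\<^sub>R u)) \<le> (measure lborel ?B + N powr p) * gauss_kernel 1 u"
        unfolding norm_scaleR abs_of_nonneg[OF g1] mult.commute[of "gauss_kernel 1 u"]
        by (intro mult_right_mono box_average_bound(3) B g1)
    qed
  qed (use am in auto)
  also have "(LINT u|lborel. gauss_kernel 1 u *\<^sub>R box_average ?B 0) = box_average ?B 0"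
    by (simp add: gauss_kernel_integral gauss_kernel_integrable)
  also have "box_average ?B 0 = (LINT z|lborel. indicator ?B z *\<^sub>R G z)" by (simp add: box_average_def)
  finally show ?thesis by (subst integral_box_heat[OF _ B]) simp_all
qed

end

context bessel_potential
begin

text \<open>Fubini is justified by \<open>c > 0\<close>: the Gaussian means of \<open>norm G\<close>
  are then bounded uniformly in \<open>t \<ge> 0\<close>, and the weight is integrable.\<close>

lemma integral_bessel_kernel:
  assumes c: "0 < c"
  shows "(LINT w|lborel. G w * of_real (bessel_kernel s c (z - w))) = potential c z"
proof -
  let ?w = "bessel_weight (s / 2)"
  define H where "H t w = of_real (?w t) * (G w * of_real (gauss_kernel (c + 4 * pi\<^sup>2 * t) (z - w)))" for t w
  have cp: "0 < c + 4 * pi\<^sup>2 * t" if "0 \<le> t" for t using c that by (simp add: add_pos_nonneg)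
  have w0: "?w t = 0" if "t < 0" for t using that by (simp add: bessel_weight_def)
  have Hm: "(\<lambda>(t, w). H t w) \<in> borel_measurable (lborel \<Otimes>\<^sub>M lborel)"
  proof -
    have "(\<lambda>x::real \<times> (real \<times> real). (c + 4 * pi\<^sup>2 * fst x, z - snd x)) \<in> borel_measurable borel"
      by (intro borel_measurable_continuous_onI continuous_intros)
    from measurable_compose[OF this gauss_kernel_borel2]
    have [measurable]: "(\<lambda>x::real \<times> (real \<times> real). gauss_kernel (c + 4 * pi\<^sup>2 * fst x) (z - snd x)) \<in> borel_measurable (lborel \<Otimes>\<^sub>M lborel)"
      by (simp add: lborel_prod)
    show ?thesis unfolding H_def case_prod_beta by measurable
  qed
  have Hi: "integrable (lborel \<Otimes>\<^sub>M lborel) (\<lambda>(t, w). H t w)"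
  proof (rule lborel_pair.Fubini_integrable[OF Hm])
    have eq: "(LINT w|lborel. norm (H t w)) = ?w t * (LINT w|lborel. norm (G w) * gauss_kernel (c + 4 * pi\<^sup>2 * t) (z - w))" for t
    proof (cases "0 \<le> t")
      case True
      have "norm (H t w) = ?w t * (norm (G w) * gauss_kernel (c + 4 * pi\<^sup>2 * t) (z - w))" for w
        using weight_nonneg[of t] gauss_kernel_nonneg[OF cp[OF True]] by (simp add: H_def norm_mult)
      then show ?thesis by simp
    qed (simp add: H_def w0)
    show "integrable lborel (\<lambda>t. LINT w|lborel. norm (case (t, w) of (t, w) \<Rightarrow> H t w))"
    proof (rule Bochner_Integration.integrable_bound)
      show "integrable lborel (\<lambda>t. (2 * N * (pi / c) powr (1 / p)) * ?w t)"
        using s_pos by (intro integrable_mult_right bessel_weight_integrable) simp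
      show "(\<lambda>t. LINT w|lborel. norm (case (t, w) of (t, w) \<Rightarrow> H t w)) \<in> borel_measurable lborel"
      proof -
        have "(\<lambda>(t, w). norm (H t w)) \<in> borel_measurable (lborel \<Otimes>\<^sub>M lborel)"
          using measurable_compose[OF Hm borel_measurable_norm] by (simp add: case_prod_beta)
        then show ?thesis by (simp add: lborel.borel_measurable_lebesgue_integral)
      qed
      show "AE t in lborel. norm (LINT w|lborel. norm (case (t, w) of (t, w) \<Rightarrow> H t w)) \<le> norm ((2 * N * (pi / c) powr (1 / p)) * ?w t)"
      proof (rule AE_I2)
        fix t
        show "norm (LINT w|lborel. norm (case (t, w) of (t, w) \<Rightarrow> H t w)) \<le> norm ((2 * N * (pi / c) powr (1 / p)) * ?w t)"
        proof (cases "0 \<le> t")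
          case True
          have "(LINT w|lborel. norm (G w) * gauss_kernel (c + 4 * pi\<^sup>2 * t) (z - w)) \<le> 2 * N * (pi / (c + 4 * pi\<^sup>2 * t)) powr (1 / p)"
            by (rule heat_abs_integral_le[OF cp[OF True]])
          also have "\<dots> \<le> 2 * N * (pi / c) powr (1 / p)"
            using True N p c cp[OF True] by (intro mult_left_mono powr_mono2 divide_left_mono) auto
          finally have "?w t * (LINT w|lborel. norm (G w) * gauss_kernel (c + 4 * pi\<^sup>2 * t) (z - w)) \<le> ?w t * (2 * N * (pi / c) powr (1 / p))"
            using weight_nonneg by (rule mult_left_mono)
          moreover have "0 \<le> ?w t * (LINT w|lborel. norm (G w) * gauss_kernel (c + 4 * pi\<^sup>2 * t) (z - w))"
            using weight_nonneg gauss_kernel_nonneg[OF cp[OF True]] by (intro mult_nonneg_nonneg integral_nonneg_AE) auto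
          moreover have "0 \<le> ?w t * (2 * N * (pi / c) powr (1 / p))" using weight_nonneg[of t] N by simp
          ultimately show ?thesis by (simp only: prod.case eq real_norm_def abs_of_nonneg mult.commute[of _ "?w t"])
        qed (simp add: H_def w0)
      qed
    qed
    show "AE t in lborel. integrable lborel (\<lambda>w. case (t, w) of (t, w) \<Rightarrow> H t w)"
    proof (rule AE_I2)
      fix t
      show "integrable lborel (\<lambda>w. case (t, w) of (t, w) \<Rightarrow> H t w)"
      proof (cases "0 \<le> t")
        case True
        then show ?thesis unfolding H_def prod.case by (intro integrable_mult_right heat_integrable cp)
      qed (simp add: H_def w0)
    qed
  qed
  have "potential c z = (LINT t|lborel. LINT w|lborel. H t w)"
    unfolding potential_def heat_def H_def by (simp only: integral_mult_right_zero)
  also have "\<dots> = (LINT w|lborel. LINT t|lborel. H t w)"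
    by (rule lborel_pair.Fubini_integral[OF Hi, symmetric])
  also have "\<dots> = (LINT w|lborel. G w * of_real (bessel_kernel s c (z - w)))"
  proof (rule Bochner_Integration.integral_cong[OF refl])
    fix w
    have "H t w = G w * of_real (?w t * gauss_kernel (c + 4 * pi\<^sup>2 * t) (z - w))" for t by (simp add: H_def)
    then show "(LINT t|lborel. H t w) = G w * of_real (bessel_kernel s c (z - w))"
      unfolding bessel_kernel_def by (simp only: integral_mult_right_zero integral_complex_of_real)
  qed
  finally show ?thesis by simp
qed

end

lemma Lp_space_lp_fun:
  assumes F: "F \<in> Lp_space p" and p: "1 < p" and N: "Lp_norm p F < N"
  obtains F' where "lp_fun p N F'" "AE z in lborel. F z = F' z"
proof -
  have Fm: "F \<in> borel_measurable lebesgue" and Fi: "integrable lebesgue (\<lambda>z. norm (F z) powr p)"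
    using F by (auto simp: Lp_space_def)
  obtain F' where F' [measurable]: "F' \<in> borel_measurable borel" "AE z in lborel. F z = F' z"
    using borel_measurable_lebesgue_ex_borel[OF Fm] by blast
  \<comment> \<open>The strict inequality forces \<open>N\<close> to be positive even if the norm of
    \<open>F\<close> is 0; later estimates divide by \<open>N\<close>.\<close>
  have N0: "0 < N" using N by (simp add: Lp_norm_def) (meson le_less_trans powr_ge_zero)
  define I where "I = (LINT z|lebesgue. norm (F z) powr p)"
  have I0: "0 \<le> I" by (simp add: I_def)
  have "I powr (1 / p) < N" using N by (simp add: Lp_norm_def I_def)
  then have "(I powr (1 / p)) powr p \<le> N powr p" using p by (intro powr_mono2) auto
  then have IN: "I \<le> N powr p" using I0 p by (simp add: powr_powr)
  have "(\<integral>\<^sup>+z. ennreal (norm (F' z) powr p) \<partial>lborel) = (\<integral>\<^sup>+z. ennreal (norm (F' z) powr p) \<partial>lebesgue)"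
    by (rule nn_integral_completion[symmetric]) 
  also have "\<dots> = (\<integral>\<^sup>+z. ennreal (norm (F z) powr p) \<partial>lebesgue)"
    using AE_completion[OF F'(2)] by (intro nn_integral_cong_AE) (auto elim: eventually_mono)
  also have "\<dots> = ennreal I" unfolding I_def by (rule nn_integral_eq_integral[OF Fi]) simp
  also have "\<dots> \<le> ennreal (N powr p)" using IN by (rule ennreal_leI)
  finally have "lp_fun p N F'" using p N0 by unfold_locales auto
  then show ?thesis using that F'(2) by blast
qed

text \<open>The duality yields the identity of \<open>F\<close> with a potential only after Gaussian
  smoothing; a limit over boxes and differentiation of integrals remove the smoothing. The divisor
  \<open>2 * N\<close> is dictated by \<open>potential_Lp\<close>, so that the
  \<open>p\<close>-integral of \<open>g\<close> is at most 1. \<open>A\<close> and \<kappa> are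
  chosen before \<open>F\<close>.\<close>

lemma sobolev_representation:
  assumes p: "1 < p" and s: "2 / p < s"
  shows "\<exists>A \<kappa>. 0 < \<kappa> \<and> \<kappa> \<le> 1 \<and> (\<forall>F\<in>sobolev_space s p. \<forall>N>sobolev_norm s p F.
    \<exists>g. tame A \<kappa> p g \<and> (AE z in lborel. F z = of_real (2 * N) * g z))"
proof -
  \<comment> \<open>Half of the available regularity, so that \<open>\<kappa> < s - 2 / p\<close>
    holds strictly.\<close>
  define \<kappa> where "\<kappa> = min 1 ((s - 2 / p) / 2)"
  have k: "0 < \<kappa>" "\<kappa> \<le> 1" "\<kappa> < s - 2 / p" using s by (auto simp: \<kappa>_def min_def)
  \<comment> \<open>The constants of the sup and of the Hoelder estimate after division by
    \<open>2 * N\<close>.\<close>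
  define A where "A = max (Gamma (s / 2 - 1 / p) / Gamma (s / 2)) (12 * (Gamma (s / 2 - (1 / p + \<kappa> / 2)) / Gamma (s / 2)))"
  show ?thesis
  proof (rule exI[of _ A], rule exI[of _ \<kappa>], intro conjI k(1,2) ballI allI impI)
    fix F N assume F: "F \<in> sobolev_space s p" and N: "sobolev_norm s p F < N"
    define G where "G = (SOME G. G \<in> Lp_space p \<and> bessel_derivative s F G)"
    have "\<exists>G. G \<in> Lp_space p \<and> bessel_derivative s F G" using F by (auto simp: sobolev_space_def)
    then have "G \<in> Lp_space p \<and> bessel_derivative s F G" unfolding G_def by (rule someI_ex)
    then have G: "G \<in> Lp_space p" "bessel_derivative s F G" by auto
    have "Lp_norm p G < N" using N by (simp add: sobolev_norm_def G_def)
    then obtain G' where G': "lp_fun p N G'" "AE z in lborel. G z = G' z"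
      using Lp_space_lp_fun[OF G(1) p] by blast
    have FL: "F \<in> Lp_space p" using F by (simp add: sobolev_space_def)
    obtain F' where F': "lp_fun p (Lp_norm p F + 1) F'" "AE z in lborel. F z = F' z"
      \<comment> \<open>Adding 1 provides the strict upper bound; its size does not influence the
        constants in the conclusion.\<close>
      using Lp_space_lp_fun[OF FL p, of "Lp_norm p F + 1"] by auto
    interpret F: lp_fun p "Lp_norm p F + 1" F' by (rule F'(1))
    interpret G: bessel_potential p N G' s \<kappa>
      using G'(1) s k unfolding bessel_potential_def bessel_potential_axioms_def by blast
    let ?g = "G.potential 0"
    have N0: "0 < N" by (rule G.N)
    \<comment> \<open>The Gaussian means of \<open>F\<close> are the smoothed potentials of
      \<open>G\<close>: the duality is tested with \<open>gauss_char c z (- (s / 2))\<close>, and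
      both Fourier transforms are known explicitly.\<close>
    have eq: "F.heat c z = G.potential c z" if c: "0 < c" for c z
    proof -
      have e: "(\<lambda>\<xi>. of_real ((1 + 4 * pi\<^sup>2 * (norm \<xi>)\<^sup>2) powr (s / 2)) * gauss_char c z (- (s / 2)) \<xi>) = gauss_char c z 0"
      proof
        fix \<xi>
        have pos: "bessel_mult \<xi> > 0" using bessel_mult_ge_1[of \<xi>] by linarith
        have "bessel_mult \<xi> powr (s / 2) * bessel_mult \<xi> powr (- (s / 2)) = bessel_mult \<xi> powr 0"
          by (simp only: powr_add[symmetric]) simp
        then have "complex_of_real (bessel_mult \<xi> powr (s / 2)) * of_real (bessel_mult \<xi> powr (- (s / 2))) = of_real (bessel_mult \<xi> powr 0)"
          by (simp only: of_real_mult[symmetric])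
        then show "of_real ((1 + 4 * pi\<^sup>2 * (norm \<xi>)\<^sup>2) powr (s / 2)) * gauss_char c z (- (s / 2)) \<xi> = gauss_char c z 0 \<xi>"
          unfolding bessel_mult_def[symmetric] gauss_char_def by (simp only: mult.assoc[symmetric])
      qed
      have sp: "schwartz (gauss_char c z (- (s / 2)))" by (rule schwartz_gauss_char[OF c])
      have b: "(LINT w|lebesgue. F w * of_real (gauss_kernel c (z - w))) = (LINT w|lebesgue. G w * of_real (bessel_kernel s c (z - w)))"
        using G(2)[unfolded bessel_derivative_def, rule_format, OF sp]
        unfolding e fourier_gauss_char[OF c] fourier_gauss_char_bessel[OF c G.s_pos(1)] .
      have tr: "(LINT w|lebesgue. P w * k w) = (LINT w|lborel. P' w * k w)"
        if P: "P \<in> borel_measurable lebesgue" "P' \<in> borel_measurable borel" "AE w in lborel. P w = P' w"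
          and km: "k \<in> borel_measurable borel" for P P' k :: "real \<times> real \<Rightarrow> complex"
      proof -
        have P'l: "P' \<in> borel_measurable lebesgue" "k \<in> borel_measurable lebesgue"
          using P(2) km by (auto intro: measurable_completion)
        have "(LINT w|lebesgue. P w * k w) = (LINT w|lebesgue. P' w * k w)"
          using P(1) P'l AE_completion[OF P(3)] by (intro integral_cong_AE borel_measurable_times) (auto elim: eventually_mono)
        also have "\<dots> = (LINT w|lborel. P' w * k w)" using P(2) km by (intro integral_completion) auto
        finally show ?thesis .
      qed
      have bm: "(\<lambda>w. complex_of_real (bessel_kernel s c (z - w))) \<in> borel_measurable borel"
      proof -
        have "(\<lambda>x::(real \<times> real) \<times> real. (c + 4 * pi\<^sup>2 * snd x, z - fst x)) \<in> borel_measurable borel"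
          by (intro borel_measurable_continuous_onI continuous_intros)
        from measurable_compose[OF this gauss_kernel_borel2]
        have [measurable]: "(\<lambda>x::(real \<times> real) \<times> real. gauss_kernel (c + 4 * pi\<^sup>2 * snd x) (z - fst x)) \<in> borel_measurable (borel \<Otimes>\<^sub>M borel)"
          by (simp add: borel_prod)
        have "(\<lambda>(w, t). bessel_weight (s / 2) t * gauss_kernel (c + 4 * pi\<^sup>2 * t) (z - w)) \<in> borel_measurable (borel \<Otimes>\<^sub>M lborel)"
          unfolding case_prod_beta by measurable
        from lborel.borel_measurable_lebesgue_integral[OF this] show ?thesis unfolding bessel_kernel_def by simp
      qed
      have "F.heat c z = (LINT w|lebesgue. F w * of_real (gauss_kernel c (z - w)))"
        unfolding F.heat_def using FL F.kernel_shift_borel by (intro tr[symmetric] F'(2) F.G_borel) (auto simp: Lp_space_def)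
      also have "\<dots> = (LINT w|lborel. G' w * of_real (bessel_kernel s c (z - w)))"
        unfolding b using G(1) by (intro tr G'(2) G.G_borel bm) (auto simp: Lp_space_def)
      finally show ?thesis unfolding G.integral_bessel_kernel[OF c] .
    qed
    have box: "(LINT z|lborel. indicator (cbox a b) z *\<^sub>R F' z) = (LINT z|lborel. indicator (cbox a b) z *\<^sub>R ?g z)" for a b
    proof (rule LIMSEQ_unique[OF F.integral_box_heat_tendsto])
      have "(\<lambda>n. LINT z|lborel. indicator (cbox a b) z *\<^sub>R G.potential (1 / real (Suc n)) z) \<longlonglongrightarrow> (LINT z|lborel. indicator (cbox a b) z *\<^sub>R ?g z)"
      proof (rule integral_dominated_convergence[where w = "\<lambda>z. indicator (cbox a b) z * (2 * N * G.potential_const (1 / p))"])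
        show "integrable lborel (\<lambda>z. indicator (cbox a b) z * (2 * N * G.potential_const (1 / p)))"
          by (intro integrable_mult_left integrable_real_indicator emeasure_cbox_finite) simp
        show "AE z in lborel. (\<lambda>n. indicator (cbox a b) z *\<^sub>R G.potential (1 / real (Suc n)) z) \<longlonglongrightarrow> indicator (cbox a b) z *\<^sub>R ?g z"
          by (intro AE_I2 tendsto_scaleR tendsto_const G.potential_tendsto)
        show "AE z in lborel. norm (indicator (cbox a b) z *\<^sub>R G.potential (1 / real (Suc n)) z) \<le> indicator (cbox a b) z * (2 * N * G.potential_const (1 / p))" for n
          using G.norm_potential_le[of "1 / real (Suc n)"] by (intro AE_I2) (auto simp: indicator_def)
      qed auto
      then show "(\<lambda>n. LINT z|lborel. indicator (cbox a b) z *\<^sub>R F.heat (1 / real (Suc n)) z) \<longlonglongrightarrow> (LINT z|lborel. indicator (cbox a b) z *\<^sub>R ?g z)"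
        by (simp add: eq)
    qed
    define g where "g z = ?g z / of_real (2 * N)" for z
    have t: "tame A \<kappa> p g"
      unfolding tame_def
    proof (intro conjI allI)
      show "norm (g z) \<le> A" for z
      proof -
        have "norm (?g z) \<le> 2 * N * G.potential_const (1 / p)" by (rule G.norm_potential_le) simp
        then have "norm (g z) \<le> G.potential_const (1 / p)" using N0 by (simp add: g_def norm_divide field_simps)
        then show ?thesis by (simp add: A_def G.potential_const_def)
      qed
      show "norm (g z - g w) \<le> A * norm (z - w) powr \<kappa>" for z w
      proof -
        have "norm (?g z - ?g w) \<le> 2 * N * (12 * G.potential_const (1 / p + \<kappa> / 2)) * norm (z - w) powr \<kappa>"
          by (rule G.potential_holder)
        then have "norm (g z - g w) \<le> 12 * G.potential_const (1 / p + \<kappa> / 2) * norm (z - w) powr \<kappa>"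
          using N0 by (simp add: g_def norm_divide diff_divide_distrib[symmetric] field_simps)
        also have "\<dots> \<le> A * norm (z - w) powr \<kappa>"
          by (intro mult_right_mono) (auto simp: A_def G.potential_const_def)
        finally show ?thesis .
      qed
      have "(\<integral>\<^sup>+z. ennreal (norm (g z) powr p) \<partial>lborel) = (\<integral>\<^sup>+z. ennreal (1 / (2 * N) powr p) * ennreal (norm (?g z) powr p) \<partial>lborel)"
        using N0 by (intro nn_integral_cong) (simp add: g_def norm_divide powr_divide ennreal_mult'[symmetric])
      also have "\<dots> = ennreal (1 / (2 * N) powr p) * (\<integral>\<^sup>+z. ennreal (norm (?g z) powr p) \<partial>lborel)"
        by (rule nn_integral_cmult) measurable
      also have "\<dots> \<le> ennreal (1 / (2 * N) powr p) * ennreal ((2 * N) powr p)"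
        by (intro mult_left_mono G.potential_Lp) simp
      also have "\<dots> = 1" using N0 by (simp add: ennreal_mult'[symmetric])
      finally show "(\<integral>\<^sup>+z. ennreal (norm (g z) powr p) \<partial>lborel) \<le> 1" .
    qed
    have gc: "continuous_on UNIV ?g"
    proof -
      have "?g = (\<lambda>z. of_real (2 * N) * g z)" using N0 by (simp add: g_def fun_eq_iff)
      then show ?thesis using tame_continuous[OF t k(1)] by (simp add: continuous_on_mult_left)
    qed
    have hk: "(f has_integral (LINT z|lborel. indicator (cbox a b) z *\<^sub>R f z)) (cbox a b)"
      if "integrable lborel (\<lambda>z. indicator (cbox a b) z *\<^sub>R f z)" for f :: "real \<times> real \<Rightarrow> complex" and a b
    proof -
      have "((\<lambda>z. indicator (cbox a b) z *\<^sub>R f z) has_integral (LINT z|lborel. indicator (cbox a b) z *\<^sub>R f z)) UNIV"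
        by (rule has_integral_integral_lborel[OF that])
      moreover have "(\<lambda>z. indicator (cbox a b) z *\<^sub>R f z) = (\<lambda>z. if z \<in> cbox a b then f z else 0)"
        by (auto simp: indicator_def)
      ultimately show ?thesis by (simp only: has_integral_restrict_UNIV)
    qed
    have Fi: "integrable lborel (\<lambda>z. indicator (cbox a b) z *\<^sub>R F' z)" for a b
      using F.box_average_bound(1)[OF _ emeasure_cbox_finite, of a b 0] by simp
    have gi: "integrable lborel (\<lambda>z. indicator (cbox a b) z *\<^sub>R ?g z)" for a b
      by (rule borel_integrable_compact) (auto intro: continuous_on_subset[OF gc])
    have diff: "((\<lambda>z. F' z - ?g z) has_integral 0) (cbox a b)" for a b
      using has_integral_diff[OF hk[OF Fi] hk[OF gi], of a b] by (simp add: box)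
    have int: "(\<lambda>z. F' z - ?g z) integrable_on cbox a b" for a b using diff by blast
    \<comment> \<open>All integrals of \<open>F' - ?g\<close> over boxes vanish, so by Lebesgue
      differentiation the function itself vanishes off a null set.\<close>
    obtain Z where Z: "negligible Z" "\<And>x e. \<lbrakk>x \<notin> Z; 0 < e\<rbrakk> \<Longrightarrow> \<exists>d>0. \<forall>h. 0 < h \<and> h < d \<longrightarrow>
        norm (integral (cbox x (x + h *\<^sub>R One)) (\<lambda>z. F' z - ?g z) /\<^sub>R h ^ DIM(real \<times> real) - (F' x - ?g x)) < e"
      by (rule integrable_ccontinuous_explicit[OF int]) (rule that)
    have "F' x = ?g x" if "x \<notin> Z" for x
    proof (rule ccontr)
      assume "F' x \<noteq> ?g x"
      then have "0 < norm (F' x - ?g x)" by simp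
      from Z(2)[OF that this] obtain d where d: "0 < d" "\<And>h. 0 < h \<Longrightarrow> h < d \<Longrightarrow>
        norm (integral (cbox x (x + h *\<^sub>R One)) (\<lambda>z. F' z - ?g z) /\<^sub>R h ^ DIM(real \<times> real) - (F' x - ?g x)) < norm (F' x - ?g x)"
        by blast
      have "integral (cbox x (x + (d / 2) *\<^sub>R One)) (\<lambda>z. F' z - ?g z) = 0" using diff by (rule integral_unique)
      then show False using d(2)[of "d / 2"] d(1) by (simp add: norm_minus_commute)
    qed
    then have "AE x in lebesgue. F' x = ?g x"
      using Z(1) by (intro AE_I'[of Z]) (auto simp: negligible_iff_null_sets)
    then have "AE x in lborel. F' x = ?g x" by (simp add: AE_completion_iff)
    then have "AE z in lborel. F z = of_real (2 * N) * g z"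
      using F'(2) by eventually_elim (use N0 in \<open>simp add: g_def\<close>)
    then show "\<exists>g. tame A \<kappa> p g \<and> (AE z in lborel. F z = of_real (2 * N) * g z)" using t by blast
  qed
qed

section \<open>Interpolation\<close>

lemma (in tame_fun) haar_coeff_cong:
  assumes F: "AE z in lborel. F z = of_real c * g z" and I: "I \<in> dyadic_intervals" and J: "J \<in> dyadic_intervals"
  shows "haar_coeff F I J = of_real c * haar_coeff g I J"
proof -
  have dy: "haar K \<in> borel_measurable borel" if "K \<in> dyadic_intervals" for K
  proof -
    obtain k j where "K = {2 powi k * of_int j ..< 2 powi k * (of_int j + 1)}"
      using \<open>K \<in> dyadic_intervals\<close> unfolding dyadic_intervals_def by blast
    then have "K = {2 powi k * of_int j ..< 2 powi k * of_int j + 2 powi k}" by (simp add: algebra_simps)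
    then show ?thesis by (simp add: haar_Ico_borel)
  qed
  have [measurable]: "(\<lambda>z. haar I (fst z) * haar J (snd z)) \<in> borel_measurable (borel :: (real \<times> real) measure)"
  proof -
    have [measurable]: "(\<lambda>z::real \<times> real. fst z) \<in> borel_measurable borel" "(\<lambda>z::real \<times> real. snd z) \<in> borel_measurable borel"
      by (intro borel_measurable_continuous_onI continuous_intros)+
    note [measurable] = measurable_compose[OF _ dy[OF I]] measurable_compose[OF _ dy[OF J]]
    show ?thesis by measurable
  qed
  define k where "k z = complex_of_real (haar I (fst z) * haar J (snd z))" for z
  have km [measurable]: "k \<in> borel_measurable borel" unfolding k_def[abs_def] by measurable
  have m: "(\<lambda>z. of_real c * g z * k z) \<in> borel_measurable lebesgue"
    by (rule measurable_completion) measurable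
  have ae: "AE z in lborel. F z * k z = of_real c * g z * k z" using F by eventually_elim simp
  have "haar_coeff F I J = (LINT z|lebesgue. of_real c * g z * k z)"
    unfolding haar_coeff_def k_def[symmetric]
    by (rule integral_cong_AE[OF borel_measurable_lebesgue_cong_AE[OF m ae] m AE_completion[OF ae]])
  then show ?thesis unfolding haar_coeff_def k_def[symmetric] by (simp add: mult.assoc)
qed

text \<open>The bound \<open>sqrt e\<close> on \<open>g\<close> for Haar coefficients of size \<open>e\<close> costs another square root in
  the singular integral. So any exponent up to \<open>1/4\<close> can be reached.\<close>

lemma tame_interpolation:
  assumes k: "0 < \<kappa>" "\<kappa> \<le> 1" and p: "1 < p" and \<theta>: "0 < \<theta>" "\<theta> \<le> 1 / 4"
  shows "\<exists>C\<ge>0. \<forall>g e. tame A \<kappa> p g \<longrightarrow> 0 < e \<longrightarrow>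
     (\<forall>I\<in>dyadic_intervals. \<forall>J\<in>dyadic_intervals.
        norm (haar_coeff g I J) \<le> e * sqrt (measure lebesgue I * measure lebesgue J)) \<longrightarrow>
     (\<exists>m\<ge>0. (\<forall>z. norm (g z) \<le> m) \<and> sqrt m * tame_fun.ray_const A \<kappa> p \<le> C * e powr \<theta>)"
proof -
  obtain C0 where C0: "0 \<le> C0" "\<And>g e z. tame A \<kappa> p g \<Longrightarrow> 0 < e \<Longrightarrow> e \<le> 1 \<Longrightarrow>
     (\<forall>I\<in>dyadic_intervals. \<forall>J\<in>dyadic_intervals.
        norm (haar_coeff g I J) \<le> e * sqrt (measure lebesgue I * measure lebesgue J)) \<Longrightarrow> norm (g z) \<le> C0 * sqrt e"
    using tame_sup_le[OF k p, of A] by blast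
  define R where "R = \<bar>tame_fun.ray_const A \<kappa> p\<bar>"
  define C where "C = sqrt (max C0 A) * R"
  show ?thesis
  proof (rule exI[of _ C], intro conjI allI impI)
    show "0 \<le> C" using C0(1) by (simp add: C_def R_def)
    fix g :: "real \<times> real \<Rightarrow> complex" and e :: real
    assume t: "tame A \<kappa> p g" and e: "0 < e"
      and H: "\<forall>I\<in>dyadic_intervals. \<forall>J\<in>dyadic_intervals.
        norm (haar_coeff g I J) \<le> e * sqrt (measure lebesgue I * measure lebesgue J)"
    have R: "tame_fun.ray_const A \<kappa> p \<le> R" "0 \<le> R" by (auto simp: R_def)
    show "\<exists>m\<ge>0. (\<forall>z. norm (g z) \<le> m) \<and> sqrt m * tame_fun.ray_const A \<kappa> p \<le> C * e powr \<theta>"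
    proof (cases "e \<le> 1")
      case True
      have s: "sqrt (sqrt e) = e powr (1 / 4)" using e by (simp add: powr_half_sqrt[symmetric] powr_powr)
      have "sqrt (C0 * sqrt e) * tame_fun.ray_const A \<kappa> p \<le> sqrt (C0 * sqrt e) * R"
        using C0(1) e R by (intro mult_left_mono) auto
      also have "\<dots> = sqrt C0 * R * e powr (1 / 4)" by (simp add: real_sqrt_mult s)
      \<comment> \<open>For \<open>e \<le> 1\<close> the smaller exponent gives the larger
        power.\<close>
      also have "\<dots> \<le> C * e powr \<theta>"
        unfolding C_def using e True \<theta> R C0(1) by (intro mult_mono powr_mono') auto
      finally have "sqrt (C0 * sqrt e) * tame_fun.ray_const A \<kappa> p \<le> C * e powr \<theta>" .
      then show ?thesis using C0(2)[OF t e True H] C0(1) e by (intro exI[of _ "C0 * sqrt e"]) auto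
    next
      case False
      \<comment> \<open>For \<open>e > 1\<close> the fixed bound \<open>A\<close> suffices, as
        \<open>e powr \<theta>\<close> is at least 1; \<open>max C0 A\<close> in \<open>C\<close>
        serves both cases.\<close>
      have A: "0 \<le> A" using tameD(4)[OF t] .
      have "1 \<le> e powr \<theta>" using False \<theta> by (intro ge_one_powr_ge_zero) auto
      have "sqrt A * tame_fun.ray_const A \<kappa> p \<le> sqrt (max C0 A) * R"
        using R A by (intro order_trans[OF mult_left_mono[OF R(1)] mult_right_mono]) auto
      also have "\<dots> = C * 1" by (simp add: C_def)
      also have "\<dots> \<le> C * e powr \<theta>" using \<open>0 \<le> C\<close> \<open>1 \<le> e powr \<theta>\<close> by (rule mult_left_mono[rotated])
      finally show ?thesis using tameD(1)[OF t] A by (intro exI[of _ A]) auto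
    qed
  qed
qed

lemma (in tame_fun) hilbert_bounded:
  assumes F: "AE z in lborel. F z = of_real c * g z" and c: "0 \<le> c" and v: "norm v = 1"
    and m: "\<And>z. norm (g z) \<le> m"
  shows "AE z in lebesgue. pv_exists (hilbert_integrand v F z)"
    and "hilbert v F \<in> borel_measurable lebesgue"
    and "AE z in lebesgue. norm (hilbert v F z) \<le> c * (2 * (sqrt m * ray_const))"
proof -
  define Q where "Q z = of_real c * (ray_integral z v - ray_integral z (- v))" for z
  have "AE z in lborel. AE t in lborel. F (z - t *\<^sub>R v) = of_real c * g (z - t *\<^sub>R v)"
    using AE_line[OF F, of v] .
  then have pv: "AE z in lborel. has_pv (hilbert_integrand v F z) (Q z)"
  proof eventually_elim
    case (elim z)
    have "AE t in lborel. hilbert_integrand v F z t = of_real c * hilbert_integrand v g z t"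
      using elim by eventually_elim (simp add: hilbert_integrand_def)
    then show ?case unfolding Q_def by (rule has_pv_cmult_cong_AE[OF has_pv_hilbert[OF v]])
  qed
  have "AE z in lborel. pv_exists (hilbert_integrand v F z)"
    using pv by eventually_elim (rule has_pvD(1))
  then show "AE z in lebesgue. pv_exists (hilbert_integrand v F z)" by (rule AE_completion)
  have h: "AE z in lborel. hilbert v F z = Q z"
    using pv by eventually_elim (simp add: hilbert_def has_pvD(2))
  have rm: "(\<lambda>z. ray_integral z w) \<in> borel_measurable borel" for w
  proof -
    have "(\<lambda>z::real \<times> real. (z, w)) \<in> borel_measurable borel" by (intro borel_measurable_continuous_onI continuous_intros)
    from measurable_compose[OF this ray_integral_borel] show ?thesis by simp
  qed
  have Qm: "Q \<in> borel_measurable lebesgue"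
    unfolding Q_def[abs_def] using rm by (intro measurable_completion) auto
  show "hilbert v F \<in> borel_measurable lebesgue" by (rule borel_measurable_lebesgue_cong_AE[OF Qm h])
  have Qb: "norm (Q z) \<le> c * (2 * (sqrt m * ray_const))" for z
  proof -
    have "norm (ray_integral z v - ray_integral z (- v)) \<le> sqrt m * ray_const + sqrt m * ray_const"
      by (intro order_trans[OF norm_triangle_ineq4] add_mono norm_ray_integral_le m) (use v in auto)
    then show ?thesis unfolding Q_def norm_mult using c by (intro mult_mono) auto
  qed
  have "AE z in lborel. norm (hilbert v F z) \<le> c * (2 * (sqrt m * ray_const))"
    using h by eventually_elim (simp only: Qb)
  then show "AE z in lebesgue. norm (hilbert v F z) \<le> c * (2 * (sqrt m * ray_const))" by (rule AE_completion)
qed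

lemma (in tame_fun) rough_bounded:
  assumes F: "AE z in lborel. F z = of_real c * g z" and c: "0 \<le> c"
    and \<Omega>: "\<Omega> \<in> circle_L1" "circle_integral \<Omega> = 0" and m: "\<And>z. norm (g z) \<le> m"
  shows "AE z in lebesgue. pv_exists (rough_integrand \<Omega> F z)"
    and "rough_operator \<Omega> F \<in> borel_measurable lebesgue"
    and "AE z in lebesgue. norm (rough_operator \<Omega> F z) \<le> c * (circle_L1_norm \<Omega> * (sqrt m * ray_const))"
proof -
  obtain \<omega> where \<omega>: "\<omega> \<in> borel_measurable borel" "integrable lborel \<omega>"
    "(LINT \<theta>|lborel. \<omega> \<theta>) = circle_integral \<Omega>" "(LINT \<theta>|lborel. norm (\<omega> \<theta>)) = circle_L1_norm \<Omega>"
    "AE u in lborel. \<Omega> (u /\<^sub>R norm u) = \<omega> (polar_angle u)" "\<And>\<theta>. \<theta> \<notin> {0..2 * pi} \<Longrightarrow> \<omega> \<theta> = 0"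
    by (rule circle_density[OF \<Omega>(1)]) (rule that)
  have mean: "(LINT \<theta>|lborel. \<omega> \<theta>) = 0" using \<omega>(3) \<Omega>(2) by simp
  obtain Z where Z: "{w \<in> space lborel. \<not> F w = of_real c * g w} \<subseteq> Z" "emeasure lborel Z = 0" "Z \<in> sets lborel"
    using F by (rule AE_E)
  \<comment> \<open>Here \<open>u\<close> runs over the whole plane and every translate of a null
    set is null, so in contrast to the integrals along lines the principal value exists for every
    \<open>z\<close>.\<close>
  have pv: "has_pv (rough_integrand \<Omega> F z) (of_real c * rough_value \<omega> z)" for z
  proof -
    have "AE u in lborel. z - u \<notin> Z"
    proof -
      have zb: "Z \<in> sets borel" using Z(3) by simp
      have [measurable]: "(\<lambda>u. indicator Z (z - u) :: ennreal) \<in> borel_measurable borel"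
        by (rule measurable_compose[OF _ borel_measurable_indicator[OF zb]]) simp
      have zi [measurable]: "(\<lambda>u. indicator Z (z + u) :: ennreal) \<in> borel_measurable borel"
        by (rule measurable_compose[OF _ borel_measurable_indicator[OF zb]]) simp
      have "(\<integral>\<^sup>+u. indicator Z (z - u) \<partial>lborel) = (\<integral>\<^sup>+u. indicator Z (z + u) \<partial>lborel)"
        using nn_integral_reflect_plane[OF zi] by simp
      also have "\<dots> = (\<integral>\<^sup>+u. indicator Z u \<partial>lborel)" using zb by (intro nn_integral_lborel_shift) simp
      also have "\<dots> = 0" using Z by simp
      finally have "AE u in lborel. indicator Z (z - u) = (0 :: ennreal)" by (subst (asm) nn_integral_0_iff_AE) auto
      then show ?thesis by eventually_elim (auto simp: indicator_def split: if_splits)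
    qed
    then have "AE u in lborel. rough_integrand \<Omega> F z u = of_real c * (g (z - u) * \<omega> (polar_angle u) / of_real ((norm u)\<^sup>2))"
      using \<omega>(5)
    proof eventually_elim
      case (elim u)
      then have "F (z - u) = of_real c * g (z - u)" using Z(1) by auto
      then show ?case using elim by (simp add: rough_integrand_def)
    qed
    moreover have "has_pv (\<lambda>u. g (z - u) * \<omega> (polar_angle u) / of_real ((norm u)\<^sup>2)) (rough_value \<omega> z)"
      by (rule has_pv_rough) (fact \<omega>(1) \<omega>(2) mean \<omega>(6))+
    ultimately show ?thesis by (intro has_pv_cmult_cong_AE)
  qed
  show "AE z in lebesgue. pv_exists (rough_integrand \<Omega> F z)" using has_pvD(1)[OF pv] by simp
  have r: "rough_operator \<Omega> F = (\<lambda>z. of_real c * rough_value \<omega> z)"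
    unfolding rough_operator_def[abs_def] using has_pvD(2)[OF pv] by simp
  show "rough_operator \<Omega> F \<in> borel_measurable lebesgue"
    unfolding r using rough_value_borel[OF \<omega>(1)] by (intro measurable_completion) auto
  have "norm (rough_operator \<Omega> F z) \<le> c * (circle_L1_norm \<Omega> * (sqrt m * ray_const))" for z
    unfolding r norm_mult using norm_rough_value_le[OF m \<omega>(2), of z] c \<omega>(4) by (intro mult_mono) auto
  then show "AE z in lebesgue. norm (rough_operator \<Omega> F z) \<le> c * (circle_L1_norm \<Omega> * (sqrt m * ray_const))" by simp
qed

text \<open>Both norms may vanish while the argument divides by them, so the estimates are proved
  for strictly larger numbers. Powers with positive exponent are continuous up to 0, and both
  exponents are positive.\<close>

lemma le_powr_limit:
  fixes a b C L \<theta> :: real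
  assumes le: "\<And>x y. a < x \<Longrightarrow> b < y \<Longrightarrow> L \<le> C * x powr \<theta> * y powr (1 - \<theta>)"
    and ab: "0 \<le> a" "0 \<le> b" and \<theta>: "0 < \<theta>" "\<theta> < 1"
  shows "L \<le> C * a powr \<theta> * b powr (1 - \<theta>)"
proof -
  have lim: "(\<lambda>n. c + 1 / real (Suc n)) \<longlonglongrightarrow> c" for c :: real
    using tendsto_add[OF tendsto_const LIMSEQ_inverse_real_of_nat, of c] by (simp add: inverse_eq_divide)
  have p: "(\<lambda>n. (c + 1 / real (Suc n)) powr t) \<longlonglongrightarrow> c powr t" if "0 \<le> c" "0 < t" for c t :: real
    using that by (intro tendsto_powr'[OF lim tendsto_const]) auto
  have "(\<lambda>n. C * (a + 1 / real (Suc n)) powr \<theta> * (b + 1 / real (Suc n)) powr (1 - \<theta>)) \<longlonglongrightarrow> C * a powr \<theta> * b powr (1 - \<theta>)"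
    using ab \<theta> by (intro tendsto_mult tendsto_const p) auto
  moreover have "L \<le> C * (a + 1 / real (Suc n)) powr \<theta> * (b + 1 / real (Suc n)) powr (1 - \<theta>)" for n
    by (rule le) simp_all
  ultimately show ?thesis by (intro LIMSEQ_le_const) auto
qed

lemma sobolev_norm_nonneg: "0 \<le> sobolev_norm s p F"
  by (simp add: sobolev_norm_def Lp_norm_def)

theorem corollary1p5:
  fixes \<delta>\<^sub>0 p s \<delta> \<alpha> :: real
  assumes "0 < \<delta>\<^sub>0" and "\<delta>\<^sub>0 < 1 / 2"
    and "2 < p" and "2 / p < s"
    and "\<delta> = min (s - 2 / p) (1 / p)"
    and "0 < \<alpha>" and "\<alpha> \<le> \<delta> / (2 + \<delta>)"
  shows "\<exists>C::real. \<forall>F \<in> bmo \<delta>\<^sub>0 \<inter> sobolev_space s p.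
    (\<forall>v. norm v = 1 \<longrightarrow>
       (AE z in lebesgue. pv_exists (hilbert_integrand v F z)) \<and>
       hilbert v F \<in> bmo \<delta>\<^sub>0 \<and>
       bmo_norm \<delta>\<^sub>0 (hilbert v F)
         \<le> C * bmo_norm \<delta>\<^sub>0 F powr (\<alpha>\<^sup>2) * sobolev_norm s p F powr (1 - \<alpha>\<^sup>2)) \<and>
    (\<forall>\<Omega> \<in> circle_L1. circle_integral \<Omega> = 0 \<longrightarrow>
       (AE z in lebesgue. pv_exists (rough_integrand \<Omega> F z)) \<and>
       rough_operator \<Omega> F \<in> bmo \<delta>\<^sub>0 \<and>
       bmo_norm \<delta>\<^sub>0 (rough_operator \<Omega> F)
         \<le> C * circle_L1_norm \<Omega> * bmo_norm \<delta>\<^sub>0 F powr (\<alpha>\<^sup>2)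
             * sobolev_norm s p F powr (1 - \<alpha>\<^sup>2))"
proof -
  define \<theta> where "\<theta> = \<alpha>\<^sup>2"
  have p: "1 < p" using assms(3) by simp
  \<comment> \<open>Since \<open>p > 2\<close>, \<delta> is at most \<open>1 / 2\<close>. Squaring
    leads to \<open>\<theta> \<le> 1 / 4\<close>, the range of
    \<open>tame_interpolation\<close>.\<close>
  have "\<alpha> \<le> 1 / 2"
  proof -
    have "0 < \<delta>" using assms by (auto simp: min_def)
    moreover have "\<delta> \<le> 1 / p" using assms(5) by simp
    moreover have "1 / p \<le> 1 / 2" using assms(3) by (simp add: field_simps)
    ultimately have "\<delta> / (2 + \<delta>) \<le> 1 / 2" by (simp add: field_simps)
    then show ?thesis using assms(7) by linarith
  qed
  then have "\<theta> \<le> (1 / 2)\<^sup>2" unfolding \<theta>_def using assms(6) by (intro power_mono) auto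
  then have \<theta>: "0 < \<theta>" "\<theta> \<le> 1 / 4" "\<theta> < 1" using assms(6) by (auto simp: \<theta>_def power2_eq_square)
  obtain A \<kappa> where k: "0 < \<kappa>" "\<kappa> \<le> 1" and rep: "\<And>F N. F \<in> sobolev_space s p \<Longrightarrow> sobolev_norm s p F < N \<Longrightarrow>
      \<exists>g. tame A \<kappa> p g \<and> (AE z in lborel. F z = of_real (2 * N) * g z)"
    using sobolev_representation[OF p assms(4)] by blast
  obtain C where C: "0 \<le> C" "\<And>g e. tame A \<kappa> p g \<Longrightarrow> 0 < e \<Longrightarrow>
     (\<forall>I\<in>dyadic_intervals. \<forall>J\<in>dyadic_intervals.
        norm (haar_coeff g I J) \<le> e * sqrt (measure lebesgue I * measure lebesgue J)) \<Longrightarrow>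
     \<exists>m\<ge>0. (\<forall>z. norm (g z) \<le> m) \<and> sqrt m * tame_fun.ray_const A \<kappa> p \<le> C * e powr \<theta>"
    using tame_interpolation[OF k p \<theta>(1,2), of A] by blast
  show ?thesis
  \<comment> \<open>One factor 2 comes from \<open>F = 2 * N * g\<close> and one from the two
    opposite rays of the Hilbert transform.\<close>
  proof (rule exI[of _ "4 * C"], rule ballI)
    fix F assume "F \<in> bmo \<delta>\<^sub>0 \<inter> sobolev_space s p"
    then have F: "F \<in> bmo \<delta>\<^sub>0" "F \<in> sobolev_space s p" by auto
    have main: "\<exists>g m. tame A \<kappa> p g \<and> (AE z in lborel. F z = of_real (2 * N) * g z) \<and> (\<forall>z. norm (g z) \<le> m) \<and>
        2 * N * (sqrt m * tame_fun.ray_const A \<kappa> p) \<le> 2 * C * \<eta> powr \<theta> * N powr (1 - \<theta>)"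
      if \<eta>: "bmo_norm \<delta>\<^sub>0 F < \<eta>" and N: "sobolev_norm s p F < N" for \<eta> N
    proof -
      have N0: "0 < N" using N sobolev_norm_nonneg[of s p F] by linarith
      have \<eta>0: "0 < \<eta>" using \<eta> bmo_norm_nonneg[of \<delta>\<^sub>0 F] by linarith
      obtain g where g: "tame A \<kappa> p g" "AE z in lborel. F z = of_real (2 * N) * g z"
        using rep[OF F(2) N] by blast
      interpret tame_fun A \<kappa> p g using g(1) k p by unfold_locales
      \<comment> \<open>The normalised size of the Haar coefficients of \<open>g\<close> is a ratio
        of BMO norm to Sobolev norm; multiplying its power \<theta> by \<open>N\<close> yields the
        product of powers in the claim.\<close>
      have hc: "norm (haar_coeff g I J) \<le> \<eta> / N * sqrt (measure lebesgue I * measure lebesgue J)"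
        if IJ: "I \<in> dyadic_intervals" "J \<in> dyadic_intervals" for I J
      proof -
        let ?q = "sqrt (measure lebesgue I * measure lebesgue J)"
        have q: "0 \<le> ?q" by simp
        have "2 * N * norm (haar_coeff g I J) = norm (haar_coeff F I J)"
          unfolding haar_coeff_cong[OF g(2) IJ] norm_mult using N0 by simp
        also have "\<dots> \<le> bmo_norm \<delta>\<^sub>0 F * ?q" by (rule haar_coeff_le_bmo_norm[OF F(1) IJ])
        also have "\<dots> \<le> \<eta> * ?q" using \<eta> q by (intro mult_right_mono) auto
        finally have "2 * N * norm (haar_coeff g I J) \<le> \<eta> * ?q" .
        moreover have "N * norm (haar_coeff g I J) \<le> 2 * N * norm (haar_coeff g I J)" using N0 by simp
        ultimately have "N * norm (haar_coeff g I J) \<le> \<eta> * ?q" by linarith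
        then show ?thesis using N0 by (simp add: field_simps)
      qed
      obtain m where m: "\<And>z. norm (g z) \<le> m" "sqrt m * ray_const \<le> C * (\<eta> / N) powr \<theta>"
        using C(2)[OF g(1), of "\<eta> / N"] hc N0 \<eta>0 by auto
      have "2 * N * (sqrt m * ray_const) \<le> 2 * N * (C * (\<eta> / N) powr \<theta>)"
        using m(2) N0 by (intro mult_left_mono) auto
      also have "\<dots> = 2 * C * \<eta> powr \<theta> * N powr (1 - \<theta>)"
        using N0 \<eta>0 by (simp add: powr_divide powr_diff)
      finally show ?thesis using g m(1) by blast
    qed
    show "(\<forall>v. norm v = 1 \<longrightarrow>
       (AE z in lebesgue. pv_exists (hilbert_integrand v F z)) \<and>
       hilbert v F \<in> bmo \<delta>\<^sub>0 \<and>
       bmo_norm \<delta>\<^sub>0 (hilbert v F)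
         \<le> 4 * C * bmo_norm \<delta>\<^sub>0 F powr (\<alpha>\<^sup>2) * sobolev_norm s p F powr (1 - \<alpha>\<^sup>2)) \<and>
      (\<forall>\<Omega> \<in> circle_L1. circle_integral \<Omega> = 0 \<longrightarrow>
       (AE z in lebesgue. pv_exists (rough_integrand \<Omega> F z)) \<and>
       rough_operator \<Omega> F \<in> bmo \<delta>\<^sub>0 \<and>
       bmo_norm \<delta>\<^sub>0 (rough_operator \<Omega> F)
         \<le> 4 * C * circle_L1_norm \<Omega> * bmo_norm \<delta>\<^sub>0 F powr (\<alpha>\<^sup>2)
             * sobolev_norm s p F powr (1 - \<alpha>\<^sup>2))"
      unfolding \<theta>_def[symmetric]
    proof (intro conjI allI ballI impI)
      fix v :: "real \<times> real" assume v: "norm v = 1"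
      have H: "(AE z in lebesgue. pv_exists (hilbert_integrand v F z)) \<and> hilbert v F \<in> bmo \<delta>\<^sub>0 \<and>
          bmo_norm \<delta>\<^sub>0 (hilbert v F) \<le> 4 * C * \<eta> powr \<theta> * N powr (1 - \<theta>)"
        if \<eta>: "bmo_norm \<delta>\<^sub>0 F < \<eta>" and N: "sobolev_norm s p F < N" for \<eta> N
      proof -
        have N0: "0 \<le> 2 * N" using N sobolev_norm_nonneg[of s p F] by linarith
        obtain g m where g: "tame A \<kappa> p g" "AE z in lborel. F z = of_real (2 * N) * g z" "\<And>z. norm (g z) \<le> m"
          "2 * N * (sqrt m * tame_fun.ray_const A \<kappa> p) \<le> 2 * C * \<eta> powr \<theta> * N powr (1 - \<theta>)"
          using main[OF \<eta> N] by blast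
        interpret tame_fun A \<kappa> p g using g(1) k p by unfold_locales
        note hb = hilbert_bounded[OF g(2) N0 v g(3)]
        have "2 * N * (2 * (sqrt m * ray_const)) \<le> 4 * C * \<eta> powr \<theta> * N powr (1 - \<theta>)" using g(4) by linarith
        then have b: "AE z in lebesgue. norm (hilbert v F z) \<le> 4 * C * \<eta> powr \<theta> * N powr (1 - \<theta>)"
          using hb(3) by (auto elim!: eventually_mono)
        have "0 \<le> 4 * C * \<eta> powr \<theta> * N powr (1 - \<theta>)" using C(1) by simp
        then show ?thesis using bounded_in_bmo[OF hb(2) b] hb(1) by blast
      qed
      \<comment> \<open>Existence and membership follow from any one admissible pair; the norm bound
        uses all of them, through the limit.\<close>
      have H1: "bmo_norm \<delta>\<^sub>0 F < bmo_norm \<delta>\<^sub>0 F + 1" "sobolev_norm s p F < sobolev_norm s p F + 1" by auto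
      show "AE z in lebesgue. pv_exists (hilbert_integrand v F z)" "hilbert v F \<in> bmo \<delta>\<^sub>0" using H[OF H1] by blast+
      show "bmo_norm \<delta>\<^sub>0 (hilbert v F) \<le> 4 * C * bmo_norm \<delta>\<^sub>0 F powr \<theta> * sobolev_norm s p F powr (1 - \<theta>)"
        by (rule le_powr_limit) (use H bmo_norm_nonneg sobolev_norm_nonneg \<theta> in auto)
    next
      fix \<Omega> assume \<Omega>: "\<Omega> \<in> circle_L1" "circle_integral \<Omega> = 0"
      let ?L = "circle_L1_norm \<Omega>"
      have L: "0 \<le> ?L" unfolding circle_L1_norm_def set_lebesgue_integral_def by (intro integral_nonneg_AE) auto
      have H: "(AE z in lebesgue. pv_exists (rough_integrand \<Omega> F z)) \<and> rough_operator \<Omega> F \<in> bmo \<delta>\<^sub>0 \<and>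
          bmo_norm \<delta>\<^sub>0 (rough_operator \<Omega> F) \<le> 4 * C * ?L * \<eta> powr \<theta> * N powr (1 - \<theta>)"
        if \<eta>: "bmo_norm \<delta>\<^sub>0 F < \<eta>" and N: "sobolev_norm s p F < N" for \<eta> N
      proof -
        have N0: "0 \<le> 2 * N" using N sobolev_norm_nonneg[of s p F] by linarith
        obtain g m where g: "tame A \<kappa> p g" "AE z in lborel. F z = of_real (2 * N) * g z" "\<And>z. norm (g z) \<le> m"
          "2 * N * (sqrt m * tame_fun.ray_const A \<kappa> p) \<le> 2 * C * \<eta> powr \<theta> * N powr (1 - \<theta>)"
          using main[OF \<eta> N] by blast
        interpret tame_fun A \<kappa> p g using g(1) k p by unfold_locales
        note rb = rough_bounded[OF g(2) N0 \<Omega> g(3)]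
        have nn: "0 \<le> ?L * (C * \<eta> powr \<theta> * N powr (1 - \<theta>))" using C(1) L by simp
        have "2 * N * (?L * (sqrt m * ray_const)) = ?L * (2 * N * (sqrt m * ray_const))" by simp
        also have "\<dots> \<le> ?L * (2 * C * \<eta> powr \<theta> * N powr (1 - \<theta>))" using g(4) L by (rule mult_left_mono)
        also have "\<dots> \<le> 4 * C * ?L * \<eta> powr \<theta> * N powr (1 - \<theta>)" using nn by (simp add: mult_ac)
        finally have le: "2 * N * (?L * (sqrt m * ray_const)) \<le> 4 * C * ?L * \<eta> powr \<theta> * N powr (1 - \<theta>)" .
        then have b: "AE z in lebesgue. norm (rough_operator \<Omega> F z) \<le> 4 * C * ?L * \<eta> powr \<theta> * N powr (1 - \<theta>)"
          using rb(3) by (auto elim!: eventually_mono)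
        have "0 \<le> 4 * C * ?L * \<eta> powr \<theta> * N powr (1 - \<theta>)" using C(1) L by simp
        then show ?thesis using bounded_in_bmo[OF rb(2) b] rb(1) by blast
      qed
      have H1: "bmo_norm \<delta>\<^sub>0 F < bmo_norm \<delta>\<^sub>0 F + 1" "sobolev_norm s p F < sobolev_norm s p F + 1" by auto
      show "AE z in lebesgue. pv_exists (rough_integrand \<Omega> F z)" "rough_operator \<Omega> F \<in> bmo \<delta>\<^sub>0" using H[OF H1] by blast+
      show "bmo_norm \<delta>\<^sub>0 (rough_operator \<Omega> F) \<le> 4 * C * ?L * bmo_norm \<delta>\<^sub>0 F powr \<theta> * sobolev_norm s p F powr (1 - \<theta>)"
        by (rule le_powr_limit) (use H bmo_norm_nonneg sobolev_norm_nonneg \<theta> in auto)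
    qed
  qed
qed

end
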